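(* Let $(X_i)_{i\in\mathbb{Z}}$ be a stationary sequence (in the setting described in the context) of centered random variables. Consider the two conditions: (a) $\mathbb{E}(X_0^4)<\infty$ and $\sum_{j=1}^\infty j\,\theta_{p,q}(j)<\infty$ for any integers $p,q$ with $0\le p<q\le\min(3+p,4)$. (b) $X_0=(f_1-f_2)(\xi_0)$ for some real-valued $\mathcal{M}_0$-measurable random variable $\xi_0$ and nondecreasing functions $f_1,f_2$ such that $f_1(\xi_0),f_2(\xi_0)$ belong to $\mathbb{L}^3$ and, for $Q=\max(Q_{|f_1(\xi_0)|},Q_{|f_2(\xi_0)|})$, $$\sum_{j=1}^\infty j\int_0^{\alpha_{3,\boldsymbol{\xi}}(j)}Q^3(u)\,du<\infty .$$ If either (a) or (b) holds, then the series $\sigma^2=\mathbb{E}(X_0^2)+2\sum_{k=1}^\infty\mathbb{E}(X_0X_k)$ converges absolutely. Moreover, if $\sigma>0$, then there is a constant $C$ such that $d_1(S_n,\sqrt{n}\,\sigma Y)\le C$ for all $n\ge1$.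
   Context: Setting: $(\Omega,\mathcal{A},\mathbb{P})$ is a probability space and $T:\Omega\to\Omega$ is a bijective bimeasurable transformation preserving $\mathbb{P}$. $\mathcal{M}_0\subseteq\mathcal{A}$ is a sub-$\sigma$-algebra with $\mathcal{M}_0\subseteq T^{-1}(\mathcal{M}_0)$, and $\mathcal{M}_i=T^{-i}(\mathcal{M}_0)$, $i\in\mathbb{Z}$ (a nondecreasing filtration). $E_i$ denotes conditional expectation with respect to $\mathcal{M}_i$. $X_0$ is an $\mathcal{M}_0$-measurable centered real random variable, $X_i=X_0\circ T^i$, $S_n=X_1+\cdots+X_n$. $Y$ is $\mathcal{N}(0,1)$-distributed. $d_1(U,V)=\sup_f\mathbb{E}(f(U)-f(V))$ over all 1-Lipschitz $f:\mathbb{R}\to\mathbb{R}$. $\|\cdot\|_1$ is the $\mathbb{L}^1(\mathbb{P})$-norm. Coefficients $\theta$: for integers $0\le i<j$ and $p\ge0$, let $\Gamma_{i,j,p}$ be the set of integer tuples $(k_1,\dots,k_j)$ with $0\le k_1\le\cdots\le k_i$ and $k_i+p\le k_{i+1}\le\cdots\le k_j$ (when $i=0$, use the conventions $k_0=0$ and empty product $=1$), and $$\theta_{i,j}(p)=\sup_{(k_1,\dots,k_j)\in\Gamma_{i,j,p}}\big\|X_{k_1}\cdots X_{k_i}E_{k_i}\big(X_{k_{i+1}}\cdots X_{k_j}-\mathbb{E}(X_{k_{i+1}}\cdots X_{k_j})\big)\big\|_1 .$$ Coefficients $\alpha$: for a random vector $(\zeta_1,\dots,\zeta_k)$ in $\mathbb{R}^k$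 and a $\sigma$-algebra $\mathcal{M}$, put $g_{x,j}(t)=\mathbf{1}_{t\le x}-\mathbb{P}(\zeta_j\le x)$ and $$\alpha(\mathcal{M},(\zeta_1,\dots,\zeta_k))=\sup_{(x_1,\dots,x_k)\in\mathbb{R}^k}\Big\|\mathbb{E}\Big(\prod_{j=1}^kg_{x_j,j}(\zeta_j)\Big|\mathcal{M}\Big)-\mathbb{E}\Big(\prod_{j=1}^kg_{x_j,j}(\zeta_j)\Big)\Big\|_1 .$$ For $\boldsymbol{\xi}=(\xi_i)_{i\in\mathbb{Z}}$ with $\xi_i=\xi_0\circ T^i$, and $\xi_0$ real-valued and $\mathcal{M}_0$-measurable, $$\alpha_{k,\boldsymbol{\xi}}(n)=\max_{1\le l\le k}\ \sup_{i_l>\cdots>i_1\ge n}\alpha(\mathcal{M}_0,(\xi_{i_1},\dots,\xi_{i_l})).$$ Quantile: for a real random variable $X$, $Q_X$ is the generalized inverse of the tail function $x\mapsto\mathbb{P}(X>x)$, i.e. $Q_X(u)=\inf\{x\in\mathbb{R}:\mathbb{P}(X>x)\le u\}$ for $u\in\,]0,1[$. *)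

theory Defs
  imports "HOL-Probability.Probability"
begin

section \<open>The dynamical system, the filtration and the stationary sequence\<close>

definition mp_automorphism :: "'a measure \<Rightarrow> ('a \<Rightarrow> 'a) \<Rightarrow> bool" where
  "mp_automorphism M T \<longleftrightarrow>
     bij_betw T (space M) (space M) \<and>
     T \<in> measurable M M \<and>
     the_inv_into (space M) T \<in> measurable M M \<and>
     distr M M T = M"

definition int_iter :: "'a set \<Rightarrow> ('a \<Rightarrow> 'a) \<Rightarrow> int \<Rightarrow> 'a \<Rightarrow> 'a" where
  "int_iter \<Omega> T i = (if 0 \<le> i then T ^^ nat i else the_inv_into \<Omega> T ^^ nat (- i))"

definition shifted :: "'a measure \<Rightarrow> ('a \<Rightarrow> 'a) \<Rightarrow> ('a \<Rightarrow> real) \<Rightarrow> int \<Rightarrow> 'a \<Rightarrow> real" where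
  "shifted M T Z i = (\<lambda>\<omega>. Z (int_iter (space M) T i \<omega>))"

text \<open>The sigma-algebra \<open>T\<^sup>-\<^sup>i(\<M>\<^sub>0)\<close>. Only the sets of the resulting measure matter.\<close>

definition sigma_at :: "'a measure \<Rightarrow> ('a \<Rightarrow> 'a) \<Rightarrow> 'a measure \<Rightarrow> int \<Rightarrow> 'a measure" where
  "sigma_at M T M0 i = vimage_algebra (space M) (int_iter (space M) T i) M0"

definition partial_sum :: "'a measure \<Rightarrow> ('a \<Rightarrow> 'a) \<Rightarrow> ('a \<Rightarrow> real) \<Rightarrow> nat \<Rightarrow> 'a \<Rightarrow> real" where
  "partial_sum M T X0 n = (\<lambda>\<omega>. \<Sum>i=1..n. shifted M T X0 (int i) \<omega>)"

section \<open>The dependence coefficients\<close>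

definition L1_norm :: "'a measure \<Rightarrow> ('a \<Rightarrow> real) \<Rightarrow> ennreal" where
  "L1_norm M f = (\<integral>\<^sup>+\<omega>. ennreal \<bar>f \<omega>\<bar> \<partial>M)"

text \<open>A tuple \<open>(k\<^sub>1, \<dots>, k\<^sub>j)\<close> is encoded as a function on \<open>nat\<close>, whose values at indices
  greater than \<open>j\<close> play no role. The requirement \<open>k 0 = 0\<close> expresses both the constraint
  \<open>0 \<le> k\<^sub>1\<close> (when \<open>i \<ge> 1\<close>) and the convention \<open>k\<^sub>0 = 0\<close> (when \<open>i = 0\<close>).\<close>

definition Gamma_set :: "nat \<Rightarrow> nat \<Rightarrow> nat \<Rightarrow> (nat \<Rightarrow> int) set" where
  "Gamma_set i j p =
     {k. k 0 = 0 \<and> (\<forall>m<j. k m \<le> k (Suc m)) \<and> k i + int p \<le> k (Suc i)}"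

text \<open>This is the intended coefficient whenever products of \<open>j - i\<close> of the variables are
  integrable, so that the conditional expectation is meaningful.\<close>

definition theta_coeff ::
  "'a measure \<Rightarrow> ('a \<Rightarrow> 'a) \<Rightarrow> 'a measure \<Rightarrow> ('a \<Rightarrow> real) \<Rightarrow> nat \<Rightarrow> nat \<Rightarrow> nat \<Rightarrow> ennreal" where
  "theta_coeff M T M0 X0 i j p =
     (SUP k\<in>Gamma_set i j p.
        L1_norm M (\<lambda>\<omega>.
          (\<Prod>m=1..i. shifted M T X0 (k m) \<omega>) *
          real_cond_exp M (sigma_at M T M0 (k i))
            (\<lambda>\<omega>'. (\<Prod>m=Suc i..j. shifted M T X0 (k m) \<omega>')
                  - (\<integral>\<omega>''. (\<Prod>m=Suc i..j. shifted M T X0 (k m) \<omega>'') \<partial>M)) \<omega>))"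

definition centered_ind :: "'a measure \<Rightarrow> ('a \<Rightarrow> real) \<Rightarrow> real \<Rightarrow> real \<Rightarrow> real" where
  "centered_ind M Z x t = indicator {..x} t - measure M {\<omega>\<in>space M. Z \<omega> \<le> x}"

text \<open>The random vector is \<open>(\<zeta> 1, \<dots>, \<zeta> k)\<close>; other values of \<open>\<zeta>\<close> and \<open>x\<close> play no role.\<close>

definition alpha_alg ::
  "'a measure \<Rightarrow> 'a measure \<Rightarrow> nat \<Rightarrow> (nat \<Rightarrow> 'a \<Rightarrow> real) \<Rightarrow> ennreal" where
  "alpha_alg M F k \<zeta> =
     (SUP x :: nat \<Rightarrow> real.
        L1_norm M (\<lambda>\<omega>.
          real_cond_exp M F (\<lambda>\<omega>'. \<Prod>j=1..k. centered_ind M (\<zeta> j) (x j) (\<zeta> j \<omega>')) \<omega>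
          - (\<integral>\<omega>'. (\<Prod>j=1..k. centered_ind M (\<zeta> j) (x j) (\<zeta> j \<omega>')) \<partial>M)))"

definition alpha_coeff ::
  "'a measure \<Rightarrow> ('a \<Rightarrow> 'a) \<Rightarrow> 'a measure \<Rightarrow> ('a \<Rightarrow> real) \<Rightarrow> nat \<Rightarrow> nat \<Rightarrow> ennreal" where
  "alpha_coeff M T M0 \<xi>0 k n =
     (MAX l\<in>{1..k}.
        SUP i\<in>{i :: nat \<Rightarrow> int. strict_mono_on {1..l} i \<and> int n \<le> i 1}.
          alpha_alg M M0 l (\<lambda>j. shifted M T \<xi>0 (i j)))"

section \<open>The upper quantile function and the Wasserstein distance\<close>

text \<open>Meaningful for \<open>0 < u < 1\<close>.\<close>

definition tail_quantile :: "'a measure \<Rightarrow> ('a \<Rightarrow> real) \<Rightarrow> real \<Rightarrow> real" where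
  "tail_quantile M Z u = Inf {x. measure M {\<omega>\<in>space M. Z \<omega> > x} \<le> u}"

text \<open>The distance depends only on the laws of \<open>U\<close> and \<open>V\<close>, which may thus live on different
  probability spaces. Both variables are meant to be integrable.\<close>

definition wasserstein1 ::
  "'a measure \<Rightarrow> ('a \<Rightarrow> real) \<Rightarrow> 'b measure \<Rightarrow> ('b \<Rightarrow> real) \<Rightarrow> ereal" where
  "wasserstein1 M U N V =
     (SUP f\<in>{f :: real \<Rightarrow> real. 1-lipschitz_on UNIV f}.
        ereal ((\<integral>\<omega>. f (U \<omega>) \<partial>M) - (\<integral>\<omega>. f (V \<omega>) \<partial>N)))"

end

theory Submission
  imports Defs
begin

text \<open>The argument is a Lindeberg replacement along a moving Gaussian scale. For a 1-Lipschitz function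
\<open>f\<close> put \<open>H i = E (g_s (S i))\<close>, where \<open>g_s\<close> is \<open>f\<close> smoothed by a centred normal law of variance
\<open>s \<sigma>\<^sup>2\<close> and \<open>s = n - i + a\<close>. Moving from \<open>i\<close> to \<open>i + 1\<close> adds one summand and removes one
Gaussian increment, and \<open>H n - H 0\<close> is, up to a smoothing error of order \<open>sqrt a\<close>, the quantity to be
bounded. Smoothing gives the \<open>k\<close>-th derivative size \<open>s\<close> to the power \<open>(1 - k) / 2\<close>.

The summand is not independent of the past, so the first and second order Taylor terms do not match
those of the Gaussian increment at once. Unrolling the partial sum backwards over the last \<open>J\<close> times
(\<open>telescope_past\<close>) turns the first order term into covariances times second derivatives, which
together with the second order term form \<open>\<sigma>\<^sup>2 / 2\<close> times the mean of the second derivative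
(\<open>one_step\<close>); the rest consists of third order terms weighted by means of third derivatives at \<open>S l\<close> and of fourth
order terms.

Bounding the third derivative uniformly would give \<open>1 / s\<close> per step and a logarithm in the end. Instead
only its mean at \<open>S l\<close> enters, and the law of \<open>S l\<close> is by induction close to the normal law of variance
\<open>l \<sigma>\<^sup>2\<close>: this yields \<open>1 / n + K / (s * sqrt s)\<close>, where \<open>K\<close> is the constant of the induction
(\<open>third_derivative_bound\<close>). The sum over \<open>s \<ge> a\<close> of the second part is a small multiple of \<open>K\<close>
when \<open>a\<close> is large, so that the induction closes (\<open>replacement_bound\<close>).

The fourth order terms require truncation. At scale \<open>s\<close> the variables are truncated at a level \<open>M\<close> and
the past is unrolled over \<open>J\<close> steps with \<open>J M \<le> sqrt s\<close>. Written as integrals over a quantile level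
\<open>u\<close>, all errors of step \<open>s\<close> are dominated by one function \<open>\<Theta> s u\<close>, whose sum over \<open>s\<close> is at most a
multiple of \<open>A u\<^sup>2 Q u ^ 3\<close>, where \<open>A u\<close> is the number of \<open>j\<close> with \<open>\<alpha> j > u\<close>; the
integral of the latter is controlled by the series in the hypothesis (\<open>\<Theta>_total\<close>, \<open>profile_bound\<close>).

Both hypotheses produce such quantile bounds. Under finite fourth moments one takes \<open>Q = 1\<close> and no
truncation. For differences of monotone functions, the truncated variable is an integral of centred
indicators of half-lines; a product of such variables expands into an integral of products of indicators,
and each of these is bounded both by the dependence coefficient and by every one of the tail
probabilities involved. Integrating the minimum of these bounds gives exactly the quantile integral
(\<open>kernel_bound\<close>, \<open>mixing_bound\<close>).\<close>

abbreviation "gauss \<equiv> std_normal_distribution"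

abbreviation (in prob_space) "E \<equiv> expectation"

section \<open>Gaussian smoothing of Lipschitz functions\<close>

definition gsmooth :: "real => (real => real) => real => real" where
  "gsmooth h f x = (\<integral>y. f (x + h * y) \<partial>gauss)"

text \<open>The derivative of \<open>gsmooth h f\<close>, in the form obtained by differentiating the Gaussian density
instead of \<open>f\<close>.\<close>

definition gderiv :: "real => (real => real) => real => real" where
  "gderiv h f x = (\<integral>y. f (x + h * y) * y \<partial>gauss) / h"

lemma prob_space_std_normal: "prob_space gauss"
  by (rule prob_space_normal_density) simp

lemma lipschitz_UNIV_D:
  fixes f :: "real => real"
  shows "L-lipschitz_on UNIV f ==> \<bar>f x - f y\<bar> <= L * \<bar>x - y\<bar>"
  using lipschitz_onD[of L UNIV f x y] by (simp add: dist_real_def)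

lemma lipschitz_UNIV_I:
  fixes f :: "real => real"
  shows "0 <= L ==> (\<And>x y. \<bar>f x - f y\<bar> <= L * \<bar>x - y\<bar>) ==> L-lipschitz_on UNIV f"
  by (intro lipschitz_onI) (auto simp: dist_real_def)

lemma lipschitz_UNIV_measurable:
  fixes f :: "real => real"
  shows "L-lipschitz_on UNIV f ==> f \<in> borel_measurable borel"
  by (intro borel_measurable_continuous_onI lipschitz_on_continuous_on)

lemma std_normal_integrable_poly:
  fixes f :: "real => real"
  assumes "f \<in> borel_measurable borel" "\<And>y. \<bar>f y\<bar> <= A + B * \<bar>y\<bar>"
  shows "integrable gauss (%y. f y * y ^ k)"
proof -
  have "integrable gauss (%y. A * \<bar>y ^ k\<bar> + B * \<bar>y ^ Suc k\<bar>)"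
    by (intro Bochner_Integration.integrable_add integrable_mult_right integrable_abs
        integrable_std_normal_distribution_moment)
  then show ?thesis
  proof (rule Bochner_Integration.integrable_bound)
    show "(%y. f y * y ^ k) \<in> borel_measurable gauss" using assms(1) by simp
    show "AE y in gauss.
        norm (f y * y ^ k) <= norm (A * \<bar>y ^ k\<bar> + B * \<bar>y ^ Suc k\<bar>)"
    proof (rule AE_I2)
      fix y :: real
      have "\<bar>f y\<bar> * \<bar>y ^ k\<bar> <= (A + B * \<bar>y\<bar>) * \<bar>y ^ k\<bar>"
        by (intro mult_right_mono assms(2)) auto
      also have "... <= \<bar>A * \<bar>y ^ k\<bar> + B * \<bar>y ^ Suc k\<bar>\<bar>"
        by (rule order_trans[OF _ abs_ge_self]) (simp add: abs_mult algebra_simps)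
      finally show "norm (f y * y ^ k) <= norm (A * \<bar>y ^ k\<bar> + B * \<bar>y ^ Suc k\<bar>)"
        by (simp add: abs_mult)
    qed
  qed
qed

lemma std_normal_integrable_lipschitz:
  fixes f :: "real => real"
  assumes "L-lipschitz_on UNIV f"
  shows "integrable gauss (%y. f (x + h * y) * y ^ k)"
proof (rule std_normal_integrable_poly)
  show "(%y. f (x + h * y)) \<in> borel_measurable borel"
    using lipschitz_UNIV_measurable[OF assms] by simp
  fix y
  have "\<bar>f (x + h * y) - f x\<bar> <= L * \<bar>h * y\<bar>" using lipschitz_UNIV_D[OF assms, of "x + h * y" x] by simp
  then have "\<bar>f (x + h * y)\<bar> <= \<bar>f x\<bar> + L * \<bar>h * y\<bar>" by linarith
  then show "\<bar>f (x + h * y)\<bar> <= \<bar>f x\<bar> + (L * \<bar>h\<bar>) * \<bar>y\<bar>" by (simp add: abs_mult algebra_simps)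
qed

lemma std_normal_integrable_lipschitz0:
  fixes f :: "real => real"
  assumes "L-lipschitz_on UNIV f"
  shows "integrable gauss (%y. f (x + h * y))"
  using std_normal_integrable_lipschitz[OF assms, of x h 0] by simp

lemma std_normal_integrable_lipschitz1:
  fixes f :: "real => real"
  assumes "L-lipschitz_on UNIV f"
  shows "integrable gauss (%y. f (x + h * y) * y)"
  using std_normal_integrable_lipschitz[OF assms, of x h 1] by simp

lemma std_normal_moments:
  "(\<integral>y. y \<partial>gauss) = 0" "(\<integral>y. y ^ 2 \<partial>gauss) = 1"
  "(\<integral>y. y ^ 3 \<partial>gauss) = 0" "(\<integral>y. y ^ 4 \<partial>gauss) = 3"
  using integral_std_normal_distribution_moment_odd[of 1] std_normal_distribution_even_moments(1)[of 1]
    integral_std_normal_distribution_moment_odd[of 3] std_normal_distribution_even_moments(1)[of 2]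
  by (simp_all add: fact_numeral)

lemma std_normal_integrable_abs: "integrable gauss (%y. c * \<bar>y\<bar>)"
  using integrable_abs[OF integrable_std_normal_distribution_moment[of 1]]
  by (intro integrable_mult_right) simp

lemma std_normal_abs_moment: "(\<integral>y. \<bar>y\<bar> \<partial>gauss) <= 1"
proof -
  have i: "integrable gauss (%y. y ^ k)" for k
    by (rule integrable_std_normal_distribution_moment)
  interpret prob_space gauss by (rule prob_space_std_normal)
  have "(\<integral>y. \<bar>y\<bar> \<partial>gauss) <= (\<integral>y. (1 + y ^ 2) / 2 \<partial>gauss)"
  proof (rule integral_mono)
    show "integrable gauss (%y. \<bar>y\<bar>)" using i[of 1] by simp
    show "integrable gauss (%y. (1 + y ^ 2) / 2)" using i[of 2] by simp
    fix y :: real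
    have "0 <= (1 - \<bar>y\<bar>) ^ 2" by simp
    then show "\<bar>y\<bar> <= (1 + y ^ 2) / 2" by (simp add: power2_eq_square algebra_simps)
  qed
  also have "... = 1" using std_normal_moments(2) i[of 2] prob_space by simp
  finally show ?thesis .
qed

lemma std_normal_integral_abs_le:
  fixes f :: "real => real"
  assumes "f \<in> borel_measurable borel" "\<And>y. \<bar>f y\<bar> <= B"
  shows "\<bar>\<integral>y. f y \<partial>gauss\<bar> <= B"
proof -
  interpret prob_space gauss by (rule prob_space_std_normal)
  have "integrable gauss f"
    using assms by (intro integrable_const_bound[of _ B]) auto
  then have "\<bar>\<integral>y. f y \<partial>gauss\<bar> <= (\<integral>y. \<bar>f y\<bar> \<partial>gauss)"
    by simp
  also have "... <= (\<integral>y. B \<partial>gauss)"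
    using assms \<open>integrable gauss f\<close> by (intro integral_mono) auto
  finally show ?thesis using prob_space by simp
qed

lemma gsmooth_lipschitz:
  fixes f :: "real => real"
  assumes "L-lipschitz_on UNIV f"
  shows "L-lipschitz_on UNIV (gsmooth h f)"
proof (rule lipschitz_UNIV_I)
  show "0 <= L" using assms by (rule lipschitz_on_nonneg)
  fix x y
  have m: "f \<in> borel_measurable borel" by (rule lipschitz_UNIV_measurable[OF assms])
  have "gsmooth h f x - gsmooth h f y = (\<integral>z. f (x + h * z) - f (y + h * z) \<partial>gauss)"
    unfolding gsmooth_def using std_normal_integrable_lipschitz0[OF assms] by simp
  also have "\<bar>...\<bar> <= L * \<bar>x - y\<bar>"
  proof (rule std_normal_integral_abs_le)
    show "(%z. f (x + h * z) - f (y + h * z)) \<in> borel_measurable borel" using m by simp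
    show "\<bar>f (x + h * z) - f (y + h * z)\<bar> <= L * \<bar>x - y\<bar>" for z
      using lipschitz_UNIV_D[OF assms, of "x + h * z" "y + h * z"] by simp
  qed
  finally show "\<bar>gsmooth h f x - gsmooth h f y\<bar> <= L * \<bar>x - y\<bar>" .
qed

lemma gsmooth_close:
  assumes f: "L-lipschitz_on UNIV f" and "0 <= h"
  shows "\<bar>gsmooth h f x - f x\<bar> <= L * h"
proof -
  interpret prob_space gauss by (rule prob_space_std_normal)
  have L: "0 <= L" using f by (rule lipschitz_on_nonneg)
  have i: "integrable gauss (%y. f (x + h * y) - f x)"
    using std_normal_integrable_lipschitz0[OF f] by simp
  have "gsmooth h f x - f x = (\<integral>y. f (x + h * y) - f x \<partial>gauss)"
    unfolding gsmooth_def using std_normal_integrable_lipschitz0[OF f] prob_space by simp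
  also have "\<bar>...\<bar> <= (\<integral>y. \<bar>f (x + h * y) - f x\<bar> \<partial>gauss)"
    by (rule integral_abs_bound)
  also have "... <= (\<integral>y. (L * h) * \<bar>y\<bar> \<partial>gauss)"
  proof (rule integral_mono)
    show "integrable gauss (%y. \<bar>f (x + h * y) - f x\<bar>)" using i by simp
    show "integrable gauss (%y. (L * h) * \<bar>y\<bar>)"
      by (rule std_normal_integrable_abs)
    fix y show "\<bar>f (x + h * y) - f x\<bar> <= (L * h) * \<bar>y\<bar>"
      using lipschitz_UNIV_D[OF f, of "x + h * y" x] \<open>0 <= h\<close> by (simp add: abs_mult)
  qed
  also have "... = (L * h) * (\<integral>y. \<bar>y\<bar> \<partial>gauss)" by simp
  also have "... <= (L * h) * 1"
    by (intro mult_left_mono std_normal_abs_moment) (use L \<open>0 <= h\<close> in auto)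
  finally show ?thesis by simp
qed

lemma gsmooth_bound:
  assumes "f \<in> borel_measurable borel" "\<And>x. \<bar>f x\<bar> <= B"
  shows "\<bar>gsmooth h f x\<bar> <= B"
  unfolding gsmooth_def using assms by (intro std_normal_integral_abs_le) auto

lemma gderiv_lipschitz:
  assumes f: "L-lipschitz_on UNIV f" and h: "0 < h"
  shows "(L / h)-lipschitz_on UNIV (gderiv h f)"
proof (rule lipschitz_UNIV_I)
  have L: "0 <= L" using f by (rule lipschitz_on_nonneg)
  then show "0 <= L / h" using h by simp
  fix x y
  note i = std_normal_integrable_lipschitz1[OF f]
  have "gderiv h f x - gderiv h f y
      = (\<integral>z. (f (x + h * z) * z - f (y + h * z) * z) \<partial>gauss) / h"
    unfolding gderiv_def using i by (simp add: diff_divide_distrib)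
  then have "\<bar>gderiv h f x - gderiv h f y\<bar>
      = \<bar>\<integral>z. (f (x + h * z) * z - f (y + h * z) * z) \<partial>gauss\<bar> / h"
    by (simp only: abs_divide abs_of_pos[OF h])
  also have "... <= (\<integral>z. \<bar>f (x + h * z) * z - f (y + h * z) * z\<bar> \<partial>gauss) / h"
    by (rule divide_right_mono[OF integral_abs_bound less_imp_le[OF h]])
  also have "... <= (\<integral>z. (L * \<bar>x - y\<bar>) * \<bar>z\<bar> \<partial>gauss) / h"
  proof (intro divide_right_mono integral_mono)
    show "integrable gauss (%z. \<bar>f (x + h * z) * z - f (y + h * z) * z\<bar>)"
      using i by (intro integrable_abs Bochner_Integration.integrable_diff)
    show "integrable gauss (%z. (L * \<bar>x - y\<bar>) * \<bar>z\<bar>)"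
      by (rule std_normal_integrable_abs)
    show "0 <= h" using h by simp
    fix z
    have "\<bar>f (x + h * z) - f (y + h * z)\<bar> * \<bar>z\<bar> <= (L * \<bar>x - y\<bar>) * \<bar>z\<bar>"
      using lipschitz_UNIV_D[OF f, of "x + h * z" "y + h * z"] by (intro mult_right_mono) auto
    then show "\<bar>f (x + h * z) * z - f (y + h * z) * z\<bar> <= (L * \<bar>x - y\<bar>) * \<bar>z\<bar>"
      by (simp add: abs_mult[symmetric] left_diff_distrib)
  qed
  also have "... = (L * \<bar>x - y\<bar>) * (\<integral>y. \<bar>y\<bar> \<partial>gauss) / h" by simp
  also have "... <= (L * \<bar>x - y\<bar>) * 1 / h"
    by (intro divide_right_mono mult_left_mono std_normal_abs_moment) (use L h in auto)
  finally show "\<bar>gderiv h f x - gderiv h f y\<bar> <= L / h * \<bar>x - y\<bar>" by simp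
qed

lemma gderiv_bound:
  assumes f: "L-lipschitz_on UNIV f" and h: "0 < h"
  shows "\<bar>gderiv h f x\<bar> <= L"
proof -
  have L: "0 <= L" using f by (rule lipschitz_on_nonneg)
  note i = std_normal_integrable_lipschitz1[OF f]
  have i1: "integrable gauss (%y. y)" "integrable gauss (%y. y ^ 2)"
    using integrable_std_normal_distribution_moment[of 1] integrable_std_normal_distribution_moment[of 2] by auto
  \<comment> \<open>the Gaussian is centred, so \<open>f x\<close> may be subtracted\<close>
  have "(\<integral>y. f (x + h * y) * y \<partial>gauss)
      = (\<integral>y. f (x + h * y) * y - f x * y \<partial>gauss)"
    using i i1 by (simp add: std_normal_moments)
  also have "\<bar>...\<bar> <= (\<integral>y. \<bar>f (x + h * y) * y - f x * y\<bar> \<partial>gauss)"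
    by (rule integral_abs_bound)
  also have "... <= (\<integral>y. (L * h) * y ^ 2 \<partial>gauss)"
  proof (rule integral_mono)
    show "integrable gauss (%y. \<bar>f (x + h * y) * y - f x * y\<bar>)"
      using i i1 by (intro integrable_abs Bochner_Integration.integrable_diff integrable_mult_right)
    show "integrable gauss (%y. (L * h) * y ^ 2)"
      using i1 by (auto intro: integrable_mult_right)
    fix y
    have "\<bar>f (x + h * y) - f x\<bar> * \<bar>y\<bar> <= (L * \<bar>h * y\<bar>) * \<bar>y\<bar>"
      using lipschitz_UNIV_D[OF f, of "x + h * y" x] by (intro mult_right_mono) auto
    then show "\<bar>f (x + h * y) * y - f x * y\<bar> <= (L * h) * y ^ 2"
      using h by (simp add: abs_mult[symmetric] left_diff_distrib power2_eq_square)
        (simp add: abs_mult algebra_simps)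
  qed
  also have "... = L * h" by (simp add: std_normal_moments)
  finally have "\<bar>\<integral>y. f (x + h * y) * y \<partial>gauss\<bar> <= L * h" .
  then show ?thesis unfolding gderiv_def using h by (simp add: pos_divide_le_eq)
qed

lemma std_normal_integral_density:
  fixes f :: "real => real"
  assumes "f \<in> borel_measurable borel"
  shows "(\<integral>y. f y \<partial>gauss) = (\<integral>y. std_normal_density y * f y \<partial>lborel)"
  by (subst integral_density) (use assms in auto)

lemma gsmooth_eq_conv:
  assumes f: "f \<in> borel_measurable borel" and h: "0 < h"
  shows "gsmooth h f x = (\<integral>z. normal_density x h z * f z \<partial>lborel)"
proof -
  have "(\<integral>z. normal_density x h z * f z \<partial>lborel)
      = \<bar>h\<bar> * (\<integral>y. normal_density x h (x + h * y) * f (x + h * y) \<partial>lborel)"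
    using h lborel_integral_real_affine[of h "%z. normal_density x h z * f z" x] by simp
  also have "... = (\<integral>y. std_normal_density y * f (x + h * y) \<partial>lborel)"
    using h by (subst integral_mult_right_zero[symmetric], intro Bochner_Integration.integral_cong)
      (auto simp: normal_density_def power_mult_distrib real_sqrt_mult)
  also have "... = gsmooth h f x"
    unfolding gsmooth_def by (rule std_normal_integral_density[symmetric]) (use f in auto)
  finally show ?thesis ..
qed

lemma gderiv_eq_conv:
  assumes f: "f \<in> borel_measurable borel" and h: "0 < h"
  shows "gderiv h f x = (\<integral>z. normal_density x h z * ((z - x) / h\<^sup>2) * f z \<partial>lborel)"
proof -
  have "(\<integral>z. normal_density x h z * ((z - x) / h\<^sup>2) * f z \<partial>lborel)
      = \<bar>h\<bar> * (\<integral>y. normal_density x h (x + h * y) * ((x + h * y - x) / h\<^sup>2) * f (x + h * y) \<partial>lborel)"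
    using h lborel_integral_real_affine[of h "%z. normal_density x h z * ((z - x) / h\<^sup>2) * f z" x] by simp
  also have "... = (\<integral>y. (std_normal_density y * (f (x + h * y) * y)) / h \<partial>lborel)"
    using h by (subst integral_mult_right_zero[symmetric], intro Bochner_Integration.integral_cong)
      (auto simp: normal_density_def power_mult_distrib real_sqrt_mult power2_eq_square)
  also have "... = (\<integral>y. std_normal_density y * (f (x + h * y) * y) \<partial>lborel) / h"
    by simp
  also have "... = gderiv h f x"
    unfolding gderiv_def using f by (subst std_normal_integral_density) auto
  finally show ?thesis ..
qed

lemma normal_density_mean_deriv:
  assumes "0 < h"
  shows "((%x. normal_density x h z) has_real_derivative normal_density x h z * ((z - x) / h\<^sup>2)) (at x within S)"
proof -
  have "((%x. - (z - x)\<^sup>2 / (2 * h\<^sup>2)) has_real_derivative (z - x) / h\<^sup>2) (at x within S)"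
    using assms by (auto intro!: derivative_eq_intros simp: field_simps)
  from DERIV_cmult[OF DERIV_chain2[OF DERIV_exp this], of "1 / sqrt (2 * pi * h\<^sup>2)"] show ?thesis
    unfolding normal_density_def by (simp add: mult.assoc)
qed

lemma normal_density_integrable_lipschitz:
  assumes f: "L-lipschitz_on UNIV f" and h: "0 < h"
  shows "integrable lborel (%z. normal_density x h z * f z)"
proof -
  have m[measurable]: "f \<in> borel_measurable borel" by (rule lipschitz_UNIV_measurable[OF f])
  have "integrable gauss (%y. f (x + h * y))"
    by (rule std_normal_integrable_lipschitz0[OF f])
  then have "integrable lborel (%y. std_normal_density y * f (x + h * y))"
    by (subst (asm) integrable_density) auto
  then have "integrable lborel (%y. (std_normal_density y * f (x + h * y)) * (1 / h))"
    by (rule integrable_mult_left)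
  also have "(%y. (std_normal_density y * f (x + h * y)) * (1 / h))
      = (%y. normal_density x h (x + h * y) * f (x + h * y))"
    using h by (auto simp: fun_eq_iff normal_density_def power_mult_distrib real_sqrt_mult)
  finally show ?thesis
    using h lborel_integrable_real_affine_iff[of h "%z. normal_density x h z * f z" x] by simp
qed

text \<open>Fubini for the derivative of the density in its centre, which avoids differentiation under the
integral sign.\<close>

lemma gsmooth_increment:
  assumes f: "L-lipschitz_on UNIV f" and h: "0 < h" and ab: "a <= b"
  shows "gsmooth h f b - gsmooth h f a = integral {a..b} (gderiv h f)"
proof -
  have L: "0 <= L" using f by (rule lipschitz_on_nonneg)
  have m[measurable]: "f \<in> borel_measurable borel" by (rule lipschitz_UNIV_measurable[OF f])
  define F where "F x z = indicator {a..b} x * (normal_density x h z * ((z - x) / h\<^sup>2)) * f z" for x z :: real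
  have Fm[measurable]: "(%(x, z). F x z) \<in> borel_measurable (lborel \<Otimes>\<^sub>M lborel)"
    unfolding F_def normal_density_def by measurable
  define \<Phi> where "\<Phi> x = (\<integral>z. \<bar>f (x + h * z) * z\<bar> \<partial>gauss) / h" for x
  have absF: "(\<integral>z. norm (F x z) \<partial>lborel) = indicator {a..b} x * \<Phi> x" for x
  proof -
    have "(\<integral>z. norm (F x z) \<partial>lborel)
        = indicator {a..b} x * (\<integral>z. normal_density x h z * (\<bar>z - x\<bar> / h\<^sup>2) * \<bar>f z\<bar> \<partial>lborel)"
      by (subst integral_mult_right_zero[symmetric], intro Bochner_Integration.integral_cong)
        (auto simp: F_def abs_mult)
    also have "(\<integral>z. normal_density x h z * (\<bar>z - x\<bar> / h\<^sup>2) * \<bar>f z\<bar> \<partial>lborel)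
        = \<bar>h\<bar> * (\<integral>y. normal_density x h (x + h * y) * (\<bar>x + h * y - x\<bar> / h\<^sup>2) * \<bar>f (x + h * y)\<bar> \<partial>lborel)"
      using h lborel_integral_real_affine[of h "%z. normal_density x h z * (\<bar>z - x\<bar> / h\<^sup>2) * \<bar>f z\<bar>" x] by simp
    also have "... = (\<integral>y. (std_normal_density y * \<bar>f (x + h * y) * y\<bar>) / h \<partial>lborel)"
      using h by (subst integral_mult_right_zero[symmetric], intro Bochner_Integration.integral_cong)
        (auto simp: normal_density_def power_mult_distrib real_sqrt_mult power2_eq_square abs_mult)
    also have "... = (\<integral>y. std_normal_density y * \<bar>f (x + h * y) * y\<bar> \<partial>lborel) / h" by simp
    also have "... = \<Phi> x" unfolding \<Phi>_def by (subst std_normal_integral_density) auto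
    finally show ?thesis .
  qed
  have \<Phi>_le: "\<Phi> x <= (\<bar>f a\<bar> + L * \<bar>x - a\<bar> + L * h) / h" for x
  proof -
    have "(\<integral>z. \<bar>f (x + h * z) * z\<bar> \<partial>gauss)
        <= (\<integral>z. (\<bar>f a\<bar> + L * \<bar>x - a\<bar>) * \<bar>z\<bar> + (L * h) * z ^ 2 \<partial>gauss)"
    proof (rule integral_mono)
      show "integrable gauss (%z. \<bar>f (x + h * z) * z\<bar>)"
        using std_normal_integrable_lipschitz1[OF f] by (rule integrable_abs)
      show "integrable gauss (%z. (\<bar>f a\<bar> + L * \<bar>x - a\<bar>) * \<bar>z\<bar> + (L * h) * z ^ 2)"
        by (intro Bochner_Integration.integrable_add std_normal_integrable_abs integrable_mult_right
            integrable_std_normal_distribution_moment)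
      fix z
      have "\<bar>f (x + h * z) - f a\<bar> <= L * \<bar>x + h * z - a\<bar>" by (rule lipschitz_UNIV_D[OF f])
      also have "... <= L * (\<bar>x - a\<bar> + \<bar>h * z\<bar>)" by (rule mult_left_mono) (use L in auto)
      finally have "\<bar>f (x + h * z)\<bar> <= \<bar>f a\<bar> + L * \<bar>x - a\<bar> + L * h * \<bar>z\<bar>"
        using h by (simp add: abs_mult algebra_simps)
      then have "\<bar>f (x + h * z)\<bar> * \<bar>z\<bar> <= (\<bar>f a\<bar> + L * \<bar>x - a\<bar> + L * h * \<bar>z\<bar>) * \<bar>z\<bar>"
        by (rule mult_right_mono) auto
      also have "... = (\<bar>f a\<bar> + L * \<bar>x - a\<bar>) * \<bar>z\<bar> + (L * h) * (\<bar>z\<bar> * \<bar>z\<bar>)"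
        by (simp add: algebra_simps)
      finally show "\<bar>f (x + h * z) * z\<bar> <= (\<bar>f a\<bar> + L * \<bar>x - a\<bar>) * \<bar>z\<bar> + (L * h) * z ^ 2"
        by (simp add: abs_mult power2_eq_square)
    qed
    also have "... = (\<bar>f a\<bar> + L * \<bar>x - a\<bar>) * (\<integral>z. \<bar>z\<bar> \<partial>gauss)
        + (L * h) * (\<integral>z. z ^ 2 \<partial>gauss)"
      using std_normal_integrable_abs[of 1] integrable_std_normal_distribution_moment[of 2] by simp
    also have "... <= (\<bar>f a\<bar> + L * \<bar>x - a\<bar>) * 1 + (L * h) * 1"
      unfolding std_normal_moments
      by (intro add_mono mult_left_mono std_normal_abs_moment) (use L h in auto)
    finally show ?thesis unfolding \<Phi>_def using h by (simp add: divide_right_mono)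
  qed
  interpret lborel_pair: pair_sigma_finite lborel lborel ..
  have int2: "integrable (lborel \<Otimes>\<^sub>M lborel) (%(x, z). F x z)"
  proof (rule lborel_pair.Fubini_integrable)
    show "(%(x, z). F x z) \<in> borel_measurable (lborel \<Otimes>\<^sub>M lborel)" by (rule Fm)
    have "integrable lborel (%x. indicator {a..b} x * ((\<bar>f a\<bar> + L * (b - a) + L * h) / h))"
      by (intro integrable_mult_left integrable_real_indicator) (auto simp: emeasure_lborel_Icc_eq)
    then have "integrable lborel (%x. indicator {a..b} x * \<Phi> x)"
    proof (rule Bochner_Integration.integrable_bound)
      have "(%x. \<integral>z. norm (F x z) \<partial>lborel) \<in> borel_measurable lborel" by measurable
      then show "(%x. indicator {a..b} x * \<Phi> x) \<in> borel_measurable lborel" unfolding absF .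
      show "AE x in lborel. norm (indicator {a..b} x * \<Phi> x)
          <= norm (indicator {a..b} x * ((\<bar>f a\<bar> + L * (b - a) + L * h) / h))"
      proof (rule AE_I2)
        fix x
        have "0 <= \<Phi> x" unfolding \<Phi>_def using h by (intro divide_nonneg_pos integral_nonneg_AE) auto
        moreover have "\<Phi> x <= (\<bar>f a\<bar> + L * (b - a) + L * h) / h" if "x \<in> {a..b}"
          using that L h by (intro order_trans[OF \<Phi>_le]) (auto intro!: divide_right_mono mult_left_mono)
        ultimately have "x \<in> {a..b} ==> \<bar>\<Phi> x\<bar> <= \<bar>(\<bar>f a\<bar> + L * (b - a) + L * h) / h\<bar>" by linarith
        then show "norm (indicator {a..b} x * \<Phi> x)
          <= norm (indicator {a..b} x * ((\<bar>f a\<bar> + L * (b - a) + L * h) / h))"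
          by (cases "x \<in> {a..b}") simp_all
      qed
    qed
    then show "integrable lborel (%x. \<integral>y. norm (case (x, y) of (x, z) => F x z) \<partial>lborel)"
      using absF by simp
    show "AE x in lborel. integrable lborel (%y. case (x, y) of (x, z) => F x z)"
    proof (rule AE_I2)
      fix x
      have "integrable gauss (%y. f (x + h * y) * y)"
        by (rule std_normal_integrable_lipschitz1[OF f])
      then have "integrable lborel (%y. std_normal_density y * (f (x + h * y) * y))"
        by (subst (asm) integrable_density) auto
      then have "integrable lborel (%y. (std_normal_density y * (f (x + h * y) * y)) * (1 / h ^ 2))"
        by (rule integrable_mult_left)
      also have "(%y. (std_normal_density y * (f (x + h * y) * y)) * (1 / h ^ 2))
          = (%y. normal_density x h (x + h * y) * ((x + h * y - x) / h\<^sup>2) * f (x + h * y))"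
        using h by (auto simp: fun_eq_iff normal_density_def power_mult_distrib real_sqrt_mult power2_eq_square mult_ac)
      finally have "integrable lborel (%z. normal_density x h z * ((z - x) / h\<^sup>2) * f z)"
        using h lborel_integrable_real_affine_iff[of h "%z. normal_density x h z * ((z - x) / h\<^sup>2) * f z" x]
        by simp
      from integrable_mult_right[OF this, of "indicator {a..b} x"]
      show "integrable lborel (%y. case (x, y) of (x, z) => F x z)"
        by (simp add: F_def mult.assoc)
    qed
  qed
  have in1: "(\<integral>x. F x z \<partial>lborel) = (normal_density b h z - normal_density a h z) * f z" for z
  proof -
    have "(\<integral>x. (normal_density x h z * ((z - x) / h\<^sup>2)) * indicator {a..b} x \<partial>lborel)
        = normal_density b h z - normal_density a h z"
    proof (rule integral_FTC_Icc_real[OF ab])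
      fix x
      show "DERIV (%x. normal_density x h z) x :> normal_density x h z * ((z - x) / h\<^sup>2)"
        by (rule normal_density_mean_deriv[OF h])
      show "isCont (%x. normal_density x h z * ((z - x) / h\<^sup>2)) x"
        using h unfolding normal_density_def by (intro continuous_intros) auto
    qed
    then show ?thesis unfolding F_def by (subst integral_mult_left_zero) (simp add: mult.commute)
  qed
  have in2: "(\<integral>z. F x z \<partial>lborel) = indicator {a..b} x * gderiv h f x" for x
    unfolding F_def gderiv_eq_conv[OF m h] by (simp add: mult.assoc)
  note gi = normal_density_integrable_lipschitz[OF f h]
  have "gsmooth h f b - gsmooth h f a = (\<integral>z. \<integral>x. F x z \<partial>lborel \<partial>lborel)"
    unfolding in1 gsmooth_eq_conv[OF m h] using gi by (simp add: left_diff_distrib)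
  also have "... = (\<integral>x. \<integral>z. F x z \<partial>lborel \<partial>lborel)"
    by (rule lborel_pair.Fubini_integral[OF int2])
  also have "... = (LINT x:{a..b}|lborel. gderiv h f x)"
    unfolding in2 set_lebesgue_integral_def by simp
  also have "... = integral {a..b} (gderiv h f)"
  proof (rule set_borel_integral_eq_integral(2))
    have "continuous_on {a..b} (gderiv h f)"
      using lipschitz_on_continuous_on[OF gderiv_lipschitz[OF f h]] by (rule continuous_on_subset) auto
    then show "set_integrable lborel {a..b} (gderiv h f)"
      by (rule borel_integrable_atLeastAtMost')
  qed
  finally show ?thesis .
qed

lemma gsmooth_has_derivative:
  assumes f: "L-lipschitz_on UNIV f" and h: "0 < h"
  shows "(gsmooth h f has_real_derivative gderiv h f x) (at x)"
proof -
  have c: "continuous_on {x - 1..x + 1} (gderiv h f)"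
    using lipschitz_on_continuous_on[OF gderiv_lipschitz[OF f h]] by (rule continuous_on_subset) auto
  have "((%u. integral {x - 1..u} (gderiv h f)) has_real_derivative gderiv h f x) (at x within {x - 1..x + 1})"
    by (rule integral_has_real_derivative[OF c]) auto
  then have "((%u. gsmooth h f (x - 1) + integral {x - 1..u} (gderiv h f))
      has_real_derivative gderiv h f x) (at x within {x - 1..x + 1})"
    by (auto intro!: derivative_eq_intros)
  then have "(gsmooth h f has_real_derivative gderiv h f x) (at x within {x - 1..x + 1})"
  proof (rule has_field_derivative_transform_within)
    show "(0 :: real) < 1" "x \<in> {x - 1..x + 1}" by simp_all
    fix u assume "u \<in> {x - 1..x + 1}"
    then show "gsmooth h f (x - 1) + integral {x - 1..u} (gderiv h f) = gsmooth h f u"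
      using gsmooth_increment[OF f h, of "x - 1" u] by simp
  qed
  then show ?thesis
    by (subst (asm) at_within_interior) (auto simp: interior_atLeastAtMost_real)
qed

lemma pair_prob_std_normal: "pair_prob_space gauss gauss"
proof -
  interpret A: prob_space gauss by (rule prob_space_std_normal)
  show ?thesis ..
qed

lemma std_normal_pair_integrable:
  assumes f: "L-lipschitz_on UNIV f"
  shows "integrable (gauss \<Otimes>\<^sub>M gauss)
    (%(y, z). f (x + a * y + b * z) * y)"
proof -
  interpret A: prob_space gauss by (rule prob_space_std_normal)
  interpret pair_prob_space gauss gauss ..
  have L: "0 <= L" using f by (rule lipschitz_on_nonneg)
  have m[measurable]: "f \<in> borel_measurable borel" by (rule lipschitz_UNIV_measurable[OF f])
  show ?thesis
  proof (rule Fubini_integrable)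
    show "(%(y, z). f (x + a * y + b * z) * y)
      \<in> borel_measurable (gauss \<Otimes>\<^sub>M gauss)" by measurable
    have i: "integrable gauss (%z. f (x + a * y + b * z) * y)" for y
      by (intro integrable_mult_left std_normal_integrable_lipschitz0[OF f])
    show "AE y in gauss. integrable gauss
        (%z. case (y, z) of (y, z) => f (x + a * y + b * z) * y)"
      using i by simp
    have le: "(\<integral>z. \<bar>f (x + a * y + b * z) * y\<bar> \<partial>gauss)
        <= (\<bar>f x\<bar> + L * \<bar>b\<bar>) * \<bar>y\<bar> + L * \<bar>a\<bar> * y ^ 2" for y
    proof -
      have "(\<integral>z. \<bar>f (x + a * y + b * z) * y\<bar> \<partial>gauss)
          <= (\<integral>z. (\<bar>f x\<bar> + L * \<bar>a * y\<bar>) * \<bar>y\<bar> + (L * \<bar>b\<bar> * \<bar>y\<bar>) * \<bar>z\<bar> \<partial>gauss)"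
      proof (rule integral_mono)
        show "integrable gauss (%z. \<bar>f (x + a * y + b * z) * y\<bar>)"
          by (rule integrable_abs[OF i])
        show "integrable gauss
            (%z. (\<bar>f x\<bar> + L * \<bar>a * y\<bar>) * \<bar>y\<bar> + (L * \<bar>b\<bar> * \<bar>y\<bar>) * \<bar>z\<bar>)"
          by (intro Bochner_Integration.integrable_add std_normal_integrable_abs) auto
        fix z
        have "\<bar>f (x + a * y + b * z) - f x\<bar> <= L * \<bar>x + a * y + b * z - x\<bar>" by (rule lipschitz_UNIV_D[OF f])
        also have "... <= L * (\<bar>a * y\<bar> + \<bar>b * z\<bar>)" by (rule mult_left_mono) (use L in auto)
        also have "... = L * \<bar>a * y\<bar> + L * \<bar>b\<bar> * \<bar>z\<bar>" by (simp add: abs_mult algebra_simps)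
        finally have "\<bar>f (x + a * y + b * z)\<bar> <= \<bar>f x\<bar> + L * \<bar>a * y\<bar> + L * \<bar>b\<bar> * \<bar>z\<bar>"
          by linarith
        then have "\<bar>f (x + a * y + b * z)\<bar> * \<bar>y\<bar> <= (\<bar>f x\<bar> + L * \<bar>a * y\<bar> + L * \<bar>b\<bar> * \<bar>z\<bar>) * \<bar>y\<bar>"
          by (rule mult_right_mono) auto
        then show "\<bar>f (x + a * y + b * z) * y\<bar> <= (\<bar>f x\<bar> + L * \<bar>a * y\<bar>) * \<bar>y\<bar> + (L * \<bar>b\<bar> * \<bar>y\<bar>) * \<bar>z\<bar>"
          by (simp add: abs_mult algebra_simps)
      qed
      also have "... = (\<bar>f x\<bar> + L * \<bar>a * y\<bar>) * \<bar>y\<bar> + (L * \<bar>b\<bar> * \<bar>y\<bar>) * (\<integral>z. \<bar>z\<bar> \<partial>gauss)"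
        using std_normal_integrable_abs[of 1] A.prob_space by simp
      also have "... <= (\<bar>f x\<bar> + L * \<bar>a * y\<bar>) * \<bar>y\<bar> + (L * \<bar>b\<bar> * \<bar>y\<bar>) * 1"
        by (intro add_left_mono mult_left_mono std_normal_abs_moment) (use L in auto)
      also have "... = (\<bar>f x\<bar> + L * \<bar>b\<bar>) * \<bar>y\<bar> + L * \<bar>a\<bar> * (\<bar>y\<bar> * \<bar>y\<bar>)"
        by (simp add: abs_mult algebra_simps)
      finally show ?thesis by (simp add: power2_eq_square)
    qed
    have "integrable gauss (%y. (\<bar>f x\<bar> + L * \<bar>b\<bar>) * \<bar>y\<bar> + L * \<bar>a\<bar> * y ^ 2)"
      by (intro Bochner_Integration.integrable_add std_normal_integrable_abs integrable_mult_right
            integrable_std_normal_distribution_moment)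
    then have "integrable gauss
        (%y. \<integral>z. \<bar>f (x + a * y + b * z) * y\<bar> \<partial>gauss)"
    proof (rule Bochner_Integration.integrable_bound)
      show "(%y. \<integral>z. \<bar>f (x + a * y + b * z) * y\<bar> \<partial>gauss)
        \<in> borel_measurable gauss" by measurable
      show "AE y in gauss.
          norm (\<integral>z. \<bar>f (x + a * y + b * z) * y\<bar> \<partial>gauss)
          <= norm ((\<bar>f x\<bar> + L * \<bar>b\<bar>) * \<bar>y\<bar> + L * \<bar>a\<bar> * y ^ 2)"
        using le order_trans[OF le abs_ge_self] by (intro AE_I2) simp
    qed
    then show "integrable gauss (%y. \<integral>z. norm (case (y, z) of
        (y, z) => f (x + a * y + b * z) * y) \<partial>gauss)" by simp
  qed
qed

lemma gsmooth_gderiv_commute: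
  assumes f: "L-lipschitz_on UNIV f"
  shows "gsmooth k (gderiv h f) = gderiv h (gsmooth k f)"
proof
  fix x
  interpret pair_prob_space gauss gauss
    by (rule pair_prob_std_normal)
  have "gsmooth k (gderiv h f) x
      = (\<integral>z. \<integral>y. f (x + h * y + k * z) * y \<partial>gauss \<partial>gauss) / h"
    unfolding gsmooth_def gderiv_def by (simp add: add_ac)
  also have "... = (\<integral>y. \<integral>z. f (x + h * y + k * z) * y \<partial>gauss \<partial>gauss) / h"
    using Fubini_integral[OF std_normal_pair_integrable[OF f, of x h k]] by simp
  also have "... = gderiv h (gsmooth k f) x"
    unfolding gsmooth_def gderiv_def by simp
  finally show "gsmooth k (gderiv h f) x = gderiv h (gsmooth k f) x" .
qed

lemma normal_distributed_gsmooth: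
  assumes "distributed M lborel V (normal_density 0 c)" "0 < c" and f[measurable]: "f \<in> borel_measurable borel"
  shows "(\<integral>w. f (x + V w) \<partial>M) = gsmooth c f x"
proof -
  have "(\<integral>w. f (x + V w) \<partial>M) = (\<integral>v. normal_density 0 c v * f (x + v) \<partial>lborel)"
    by (rule distributed_integral[OF assms(1), symmetric]) auto
  also have "... = gsmooth c (%v. f (x + v)) 0"
    by (rule gsmooth_eq_conv[OF _ \<open>0 < c\<close>, symmetric]) measurable
  also have "... = gsmooth c f x" by (simp add: gsmooth_def)
  finally show ?thesis .
qed

text \<open>The sum of two independent centred normal variables is normal, with added variances.\<close>

lemma gsmooth_gsmooth:
  assumes f: "L-lipschitz_on UNIV f" and ab: "0 < a" "0 < b"
  shows "gsmooth a (gsmooth b f) = gsmooth (sqrt (a\<^sup>2 + b\<^sup>2)) f"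
proof
  fix x
  let ?N = gauss
  interpret A: prob_space ?N by (rule prob_space_std_normal)
  interpret P: pair_prob_space ?N ?N ..
  have m[measurable]: "f \<in> borel_measurable borel" by (rule lipschitz_UNIV_measurable[OF f])
  have m': "gsmooth b f \<in> borel_measurable borel"
    by (rule lipschitz_UNIV_measurable[OF gsmooth_lipschitz[OF f]])
  have d1: "distr (?N \<Otimes>\<^sub>M ?N) ?N fst = ?N" by (rule A.distr_pair_fst)
  have "distr (?N \<Otimes>\<^sub>M ?N) ?N snd = distr (distr (?N \<Otimes>\<^sub>M ?N) (?N \<Otimes>\<^sub>M ?N) (%(x, y). (y, x))) ?N snd"
    using P.distr_pair_swap by simp
  also have "... = distr (?N \<Otimes>\<^sub>M ?N) ?N fst"
    by (subst distr_distr) (auto simp: comp_def case_prod_beta)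
  finally have d2: "distr (?N \<Otimes>\<^sub>M ?N) ?N snd = ?N" using d1 by simp
  have dc: "distr (?N \<Otimes>\<^sub>M ?N) A f = distr (?N \<Otimes>\<^sub>M ?N) ?N f" if "sets A = sets ?N" for f A
    by (rule distr_cong) (use that in simp_all)
  have d1l: "distr (?N \<Otimes>\<^sub>M ?N) lborel fst = ?N" "distr (?N \<Otimes>\<^sub>M ?N) lborel snd = ?N"
    "distr (?N \<Otimes>\<^sub>M ?N) borel fst = ?N" "distr (?N \<Otimes>\<^sub>M ?N) borel snd = ?N"
    using dc[of lborel fst] dc[of lborel snd] dc[of borel fst] dc[of borel snd]
    unfolding d1 d2 by simp_all
  have df: "distributed (?N \<Otimes>\<^sub>M ?N) lborel fst std_normal_density"
    "distributed (?N \<Otimes>\<^sub>M ?N) lborel snd std_normal_density"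
    unfolding distributed_def using d1l by auto
  have dA: "distributed (?N \<Otimes>\<^sub>M ?N) lborel (%p. a * fst p) (normal_density 0 a)"
    using P.normal_density_affine[OF df(1), of a 0] ab by simp
  have dB: "distributed (?N \<Otimes>\<^sub>M ?N) lborel (%p. b * snd p) (normal_density 0 b)"
    using P.normal_density_affine[OF df(2), of b 0] ab by simp
  have "P.indep_var borel fst borel snd"
    unfolding P.indep_var_distribution_eq
  proof (intro conjI)
    have s: "sets (?N \<Otimes>\<^sub>M ?N) = sets (borel \<Otimes>\<^sub>M borel)" by (intro sets_pair_measure_cong) auto
    have "distr (?N \<Otimes>\<^sub>M ?N) (borel \<Otimes>\<^sub>M borel) (%x. (fst x, snd x)) = distr (?N \<Otimes>\<^sub>M ?N) (?N \<Otimes>\<^sub>M ?N) (%x. x)"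
      by (rule distr_cong) (auto simp: s)
    then show "distr (?N \<Otimes>\<^sub>M ?N) borel fst \<Otimes>\<^sub>M distr (?N \<Otimes>\<^sub>M ?N) borel snd
        = distr (?N \<Otimes>\<^sub>M ?N) (borel \<Otimes>\<^sub>M borel) (%x. (fst x, snd x))"
      unfolding d1l by (simp add: distr_id)
  qed auto
  then have "P.indep_var borel ((%y. a * y) \<circ> fst) borel ((%y. b * y) \<circ> snd)"
    by (rule P.indep_var_compose) auto
  then have ind: "P.indep_var borel (%p. a * fst p) borel (%p. b * snd p)"
    by (simp add: comp_def)
  have dS: "distributed (?N \<Otimes>\<^sub>M ?N) lborel (%p. a * fst p + b * snd p) (normal_density 0 (sqrt (a\<^sup>2 + b\<^sup>2)))"
    using P.add_indep_normal[OF ind ab dA dB] by simp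
  have "gsmooth (sqrt (a\<^sup>2 + b\<^sup>2)) f x = (\<integral>p. f (x + (a * fst p + b * snd p)) \<partial>(?N \<Otimes>\<^sub>M ?N))"
    by (rule normal_distributed_gsmooth[OF dS _ m, symmetric])
      (use ab in \<open>auto intro: add_pos_pos\<close>)
  also have "... = (\<integral>y. \<integral>z. f (x + a * y + b * z) \<partial>?N \<partial>?N)"
  proof -
    have "integrable (?N \<Otimes>\<^sub>M ?N) (%p. f (x + (a * fst p + b * snd p)))"
    proof -
      have "L-lipschitz_on UNIV (%v. f (x + v))"
        using lipschitz_UNIV_D[OF f, of "x + _" "x + _"] lipschitz_on_nonneg[OF f]
        by (intro lipschitz_UNIV_I) (auto simp: algebra_simps)
      from normal_density_integrable_lipschitz[OF this, of "sqrt (a\<^sup>2 + b\<^sup>2)" 0]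
      have "integrable lborel (%v. normal_density 0 (sqrt (a\<^sup>2 + b\<^sup>2)) v * f (x + v))"
        using ab by (simp add: add_pos_pos)
      then show ?thesis
        by (subst (asm) distributed_integrable[OF dS]) auto
    qed
    from P.integral_fst'[OF this] show ?thesis by (simp add: add_ac)
  qed
  also have "... = gsmooth a (gsmooth b f) x"
    unfolding gsmooth_def by simp
  finally show "gsmooth a (gsmooth b f) x = gsmooth (sqrt (a\<^sup>2 + b\<^sup>2)) f x" ..
qed

text \<open>The normal law of standard deviation \<open>2 h\<close> is split into four independent pieces of standard
deviation \<open>h\<close>. Each of up to four derivatives is taken on a piece of its own and costs one factor
\<open>1 / h\<close>; the first one costs nothing, by the Lipschitz property.\<close>

definition gsm :: "nat => real => (real => real) => real => real" where
  "gsm i h f = (gsmooth h ^^ (4 - i)) ((gderiv h ^^ i) f)"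

lemma gderiv_funpow_lipschitz:
  assumes f: "1-lipschitz_on UNIV f" and h: "0 < h"
  shows "(1 / h ^ i)-lipschitz_on UNIV ((gderiv h ^^ i) f)"
proof (induction i)
  case (Suc i)
  show ?case using gderiv_lipschitz[OF Suc h] by (simp add: mult.commute)
qed (use f in simp)

lemma gsmooth_funpow_lipschitz:
  "L-lipschitz_on UNIV f ==> L-lipschitz_on UNIV ((gsmooth h ^^ n) f)"
  by (induction n) (auto intro: gsmooth_lipschitz)

lemma gsmooth_funpow_bound:
  assumes "L-lipschitz_on UNIV f" "\<And>x. \<bar>f x\<bar> <= B"
  shows "\<bar>(gsmooth h ^^ n) f x\<bar> <= B"
proof (induction n arbitrary: x)
  case (Suc n)
  show ?case
    using gsmooth_bound[of "(gsmooth h ^^ n) f" B h x] Suc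
      lipschitz_UNIV_measurable[OF gsmooth_funpow_lipschitz[OF assms(1)]] by simp
qed (use assms in simp)

lemma gsm_lipschitz:
  assumes f: "1-lipschitz_on UNIV f" and h: "0 < h"
  shows "(1 / h ^ i)-lipschitz_on UNIV (gsm i h f)"
  unfolding gsm_def by (intro gsmooth_funpow_lipschitz gderiv_funpow_lipschitz assms)

lemma gsm_bound:
  assumes f: "1-lipschitz_on UNIV f" and h: "0 < h"
  shows "\<bar>gsm (Suc i) h f x\<bar> <= 1 / h ^ i"
  unfolding gsm_def
proof (rule gsmooth_funpow_bound[OF gderiv_funpow_lipschitz[OF assms]])
  show "\<bar>(gderiv h ^^ Suc i) f x\<bar> <= 1 / h ^ i" for x
    using gderiv_bound[OF gderiv_funpow_lipschitz[OF assms] h] by simp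
qed

lemma gsmooth_funpow_gderiv:
  assumes f: "L-lipschitz_on UNIV f"
  shows "gderiv h ((gsmooth k ^^ n) f) = (gsmooth k ^^ n) (gderiv h f)"
proof (induction n)
  case (Suc n)
  show ?case
    using gsmooth_gderiv_commute[OF gsmooth_funpow_lipschitz[OF f, of n k], of k h] Suc by simp
qed simp

lemma gsm_has_derivative:
  assumes f: "1-lipschitz_on UNIV f" and h: "0 < h" and i: "i < 4"
  shows "(gsm i h f has_real_derivative gsm (Suc i) h f x) (at x)"
proof -
  have e: "4 - i = Suc (4 - Suc i)" using i by simp
  note g = gderiv_funpow_lipschitz[OF f h, of i]
  have "(gsmooth h ((gsmooth h ^^ (4 - Suc i)) ((gderiv h ^^ i) f)) has_real_derivative
      gderiv h ((gsmooth h ^^ (4 - Suc i)) ((gderiv h ^^ i) f)) x) (at x)"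
    by (rule gsmooth_has_derivative[OF gsmooth_funpow_lipschitz[OF g] h])
  then show ?thesis
    unfolding gsmooth_funpow_gderiv[OF g] gsm_def e by simp
qed

lemma gsmooth_commute:
  assumes f: "L-lipschitz_on UNIV f" and "0 < a" "0 < b"
  shows "gsmooth a (gsmooth b f) = gsmooth b (gsmooth a f)"
  using gsmooth_gsmooth[OF f \<open>0 < a\<close> \<open>0 < b\<close>] gsmooth_gsmooth[OF f \<open>0 < b\<close> \<open>0 < a\<close>]
  by (simp add: add.commute)

lemma gsmooth_gsm:
  assumes f: "1-lipschitz_on UNIV f" and h: "0 < h" and k: "0 < k"
  shows "gsmooth k (gsm i h f) = gsm i h (gsmooth k f)"
proof -
  have 1: "gsmooth k ((gsmooth h ^^ n) g) = (gsmooth h ^^ n) (gsmooth k g)"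
    if g: "L-lipschitz_on UNIV g" for g L n
  proof (induction n)
    case (Suc n)
    show ?case using gsmooth_commute[OF gsmooth_funpow_lipschitz[OF g, of n h] k h] Suc by simp
  qed simp
  have 2: "gsmooth k ((gderiv h ^^ i) f) = (gderiv h ^^ i) (gsmooth k f)" for i
  proof (induction i)
    case (Suc i)
    show ?case
      using gsmooth_gderiv_commute[OF gderiv_funpow_lipschitz[OF f h, of i], of k h] Suc by simp
  qed simp
  show ?thesis unfolding gsm_def 1[OF gderiv_funpow_lipschitz[OF f h]] 2 ..
qed

lemma gsm_0:
  assumes f: "1-lipschitz_on UNIV f" and h: "0 < h"
  shows "gsm 0 h f = gsmooth (2 * h) f"
proof -
  have s: "sqrt ((sqrt (h\<^sup>2 + h\<^sup>2))\<^sup>2 + (sqrt (h\<^sup>2 + h\<^sup>2))\<^sup>2) = 2 * h"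
    by (rule real_sqrt_unique) (use h in \<open>auto simp: power_mult_distrib\<close>)
  have p: "0 < sqrt (h\<^sup>2 + h\<^sup>2)" using h by (auto intro: add_pos_pos)
  have "gsm 0 h f = gsmooth h (gsmooth h (gsmooth h (gsmooth h f)))"
    by (simp add: gsm_def numeral_eq_Suc)
  also have "... = gsmooth (sqrt (h\<^sup>2 + h\<^sup>2)) (gsmooth (sqrt (h\<^sup>2 + h\<^sup>2)) f)"
    using gsmooth_gsmooth[OF f h h] gsmooth_gsmooth[OF gsmooth_lipschitz[OF f, of "sqrt (h\<^sup>2 + h\<^sup>2)"] h h]
    by simp
  also have "... = gsmooth (2 * h) f"
    unfolding gsmooth_gsmooth[OF f p p] s ..
  finally show ?thesis .
qed

text \<open>Two Gaussian scales compose, at the level of derivatives as well: the derivatives on both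
  sides are those of one and the same function.\<close>

lemma gsmooth_gsm_scale:
  assumes f: "1-lipschitz_on UNIV f" and h: "0 < h" and k: "0 < k" and i: "i <= 4"
  shows "gsmooth k (gsm i h f) = gsm i (sqrt (h\<^sup>2 + (k / 2)\<^sup>2)) f"
proof -
  define h' where "h' = sqrt (h\<^sup>2 + (k / 2)\<^sup>2)"
  have h': "0 < h'" unfolding h'_def using h by (auto intro: add_pos_nonneg)
  note f' = gsmooth_lipschitz[OF f, of k]
  have "gsm i h (gsmooth k f) = gsm i h' f" if "i <= 4" for i
    using that
  proof (induction i)
    case 0
    have "sqrt ((2 * h)\<^sup>2 + k\<^sup>2) = 2 * h'"
      unfolding h'_def by (rule real_sqrt_unique) (use h in \<open>auto simp: power2_eq_square\<close>)
    then show ?case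
      using gsm_0[OF f' h] gsm_0[OF f h'] gsmooth_gsmooth[OF f _ k, of "2 * h"] h by simp
  next
    case (Suc i)
    then have "gsm i h (gsmooth k f) = gsm i h' f" "i < 4" by auto
    then show ?case
      using gsm_has_derivative[OF f' h, of i] gsm_has_derivative[OF f h', of i]
      by (metis DERIV_unique ext)
  qed
  then show ?thesis using gsmooth_gsm[OF f h k] i h'_def by simp
qed

lemma taylor_remainder_bound:
  fixes \<psi> :: "nat => real => real"
  assumes d: "\<And>i x. i < n ==> (\<psi> i has_real_derivative \<psi> (Suc i) x) (at x)"
    and b: "\<And>x. \<bar>\<psi> n x\<bar> <= B"
  shows "\<bar>\<psi> 0 (x + v) - (\<Sum>m<n. \<psi> m x / fact m * v ^ m)\<bar> <= B / fact n * \<bar>v\<bar> ^ n"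
proof -
  have "\<exists>t. \<bar>t\<bar> <= \<bar>v\<bar> \<and> \<psi> 0 (x + v)
      = (\<Sum>m<n. \<psi> m (x + 0) / fact m * v ^ m) + \<psi> n (x + t) / fact n * v ^ n"
  proof (rule Maclaurin_bi_le[of "%m v. \<psi> m (x + v)"], goal_cases)
    case 2
    have "((%v. \<psi> m (x + v)) has_real_derivative \<psi> (Suc m) (x + t)) (at t)" if "m < n" for m t
      using d[OF that, of "x + t"] by (simp add: DERIV_shift add.commute)
    then show ?case by blast
  qed simp
  then obtain t where "\<psi> 0 (x + v) = (\<Sum>m<n. \<psi> m (x + 0) / fact m * v ^ m) + \<psi> n (x + t) / fact n * v ^ n"
    by blast
  then have "\<psi> 0 (x + v) - (\<Sum>m<n. \<psi> m x / fact m * v ^ m) = \<psi> n (x + t) / fact n * v ^ n"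
    by simp
  moreover have "\<bar>\<psi> n (x + t) / fact n * v ^ n\<bar> <= B / fact n * \<bar>v\<bar> ^ n"
    using b by (simp add: abs_mult power_abs mult_right_mono divide_right_mono)
  ultimately show ?thesis by simp
qed

text \<open>The odd moments vanish, and the fourth moment \<open>3\<close> turns \<open>1 / 24\<close> into \<open>1 / 8\<close>.\<close>

lemma gsmooth_taylor:
  fixes \<psi> :: "nat => real => real"
  assumes l: "L-lipschitz_on UNIV (\<psi> 0)"
    and d: "\<And>i x. i < 4 ==> (\<psi> i has_real_derivative \<psi> (Suc i) x) (at x)"
    and b: "\<And>x. \<bar>\<psi> 4 x\<bar> <= B"
  shows "\<bar>gsmooth h (\<psi> 0) x - \<psi> 0 x - h\<^sup>2 / 2 * \<psi> 2 x\<bar> <= B * h ^ 4 / 8"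
proof -
  let ?N = gauss
  interpret prob_space ?N by (rule prob_space_std_normal)
  have mi: "integrable ?N (%y. c * y ^ k)" for c k
    by (intro integrable_mult_right integrable_std_normal_distribution_moment)
  define p where "p y = \<psi> 0 x + \<psi> 1 x * h * y ^ 1 + (\<psi> 2 x * h ^ 2 / 2) * y ^ 2 + (\<psi> 3 x * h ^ 3 / 6) * y ^ 3" for y
  have p: "integrable ?N p" unfolding p_def
    by (intro Bochner_Integration.integrable_add mi) simp
  have Ep: "(\<integral>y. p y \<partial>?N) = \<psi> 0 x + h\<^sup>2 / 2 * \<psi> 2 x"
    unfolding p_def using mi prob_space mi[of _ 1] by (simp add: std_normal_moments)
  have le: "\<bar>\<psi> 0 (x + h * y) - p y\<bar> <= (B / 24 * h ^ 4) * y ^ 4" for y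
    using taylor_remainder_bound[where \<psi>=\<psi> and n=4 and B=B and x=x and v="h * y", OF d b]
    by (simp add: p_def eval_nat_numeral algebra_simps abs_mult)
  have i: "integrable ?N (%y. \<psi> 0 (x + h * y))" by (rule std_normal_integrable_lipschitz0[OF l])
  have "\<bar>gsmooth h (\<psi> 0) x - (\<psi> 0 x + h\<^sup>2 / 2 * \<psi> 2 x)\<bar> = \<bar>\<integral>y. \<psi> 0 (x + h * y) - p y \<partial>?N\<bar>"
    unfolding gsmooth_def Ep[symmetric] using i p by simp
  also have "... <= (\<integral>y. \<bar>\<psi> 0 (x + h * y) - p y\<bar> \<partial>?N)" by (rule integral_abs_bound)
  also have "... <= (\<integral>y. (B / 24 * h ^ 4) * y ^ 4 \<partial>?N)"
    using i p mi le by (intro integral_mono) auto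
  also have "... = B * h ^ 4 / 8" by (simp add: std_normal_moments)
  finally show ?thesis by (simp add: algebra_simps)
qed

section \<open>Conditional mean bounds\<close>

text \<open>The conditional expectation of \<open>Z\<close> given \<open>F\<close> has norm at most \<open>e\<close> in \<open>L\<^sup>1\<close>,
expressed by duality: statements of this kind survive multiplication by bounded past factors without any
reference to versions of conditional expectations.\<close>

definition cond_le :: "'a measure => 'a measure => ('a => real) => real => bool" where
  "cond_le M F Z e \<longleftrightarrow>
     (\<forall>U\<in>borel_measurable F. (\<forall>w. \<bar>U w\<bar> <= 1) \<longrightarrow> \<bar>\<integral>w. U w * Z w \<partial>M\<bar> <= e)"

lemma cond_leI:
  "(\<And>U. U \<in> borel_measurable F ==> (\<And>w. \<bar>U w\<bar> <= 1) ==> \<bar>\<integral>w. U w * Z w \<partial>M\<bar> <= e) ==> cond_le M F Z e"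
  unfolding cond_le_def by blast

lemma cond_leD:
  "cond_le M F Z e ==> U \<in> borel_measurable F ==> (\<And>w. \<bar>U w\<bar> <= 1) ==> \<bar>\<integral>w. U w * Z w \<partial>M\<bar> <= e"
  unfolding cond_le_def by blast

lemma cond_le_integral: "cond_le M F Z e ==> \<bar>\<integral>w. Z w \<partial>M\<bar> <= e"
  using cond_leD[of M F Z e "%_. 1"] by simp

lemma cond_le_mono: "cond_le M F Z e ==> e <= e' ==> cond_le M F Z e'"
  unfolding cond_le_def by (meson order_trans)

lemma integrable_bounded_mult:
  fixes U Z :: "'a => real"
  assumes "integrable M Z" "U \<in> borel_measurable M" "\<And>w. \<bar>U w\<bar> <= c"
  shows "integrable M (%w. U w * Z w)"
proof (rule Bochner_Integration.integrable_bound[OF integrable_mult_right[OF assms(1), of c]])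
  show "(%w. U w * Z w) \<in> borel_measurable M" using assms by simp
  have "\<bar>U w\<bar> * \<bar>Z w\<bar> <= c * \<bar>Z w\<bar>" "0 <= c" for w
    using assms(3)[of w] by (auto intro: mult_right_mono)
  then show "AE w in M. norm (U w * Z w) <= norm (c * Z w)"
    by (intro AE_I2) (simp add: abs_mult)
qed

lemma cond_le_add:
  assumes "cond_le M F Z e" "cond_le M F Z' e'" "integrable M Z" "integrable M Z'" "subalgebra M F"
  shows "cond_le M F (%w. Z w + Z' w) (e + e')"
proof (rule cond_leI)
  fix U assume U: "U \<in> borel_measurable F" "\<And>w. \<bar>U w\<bar> <= (1 :: real)"
  have m: "U \<in> borel_measurable M" by (rule measurable_from_subalg[OF assms(5) U(1)])
  note i = integrable_bounded_mult[OF assms(3) m U(2)] integrable_bounded_mult[OF assms(4) m U(2)]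
  have "(\<integral>w. U w * (Z w + Z' w) \<partial>M) = (\<integral>w. U w * Z w \<partial>M) + (\<integral>w. U w * Z' w \<partial>M)"
    using i by (simp add: distrib_left)
  then show "\<bar>\<integral>w. U w * (Z w + Z' w) \<partial>M\<bar> <= e + e'"
    using cond_leD[OF assms(1) U] cond_leD[OF assms(2) U] by linarith
qed

lemma cond_le_cmult:
  assumes "cond_le M F Z e"
  shows "cond_le M F (%w. c * Z w) (\<bar>c\<bar> * e)"
proof (rule cond_leI)
  fix U assume U: "U \<in> borel_measurable F" "\<And>w. \<bar>U w\<bar> <= (1 :: real)"
  have "(\<integral>w. U w * (c * Z w) \<partial>M) = c * (\<integral>w. U w * Z w \<partial>M)"
    by (subst integral_mult_right_zero[symmetric]) (simp add: mult.left_commute)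
  then show "\<bar>\<integral>w. U w * (c * Z w) \<partial>M\<bar> <= \<bar>c\<bar> * e"
    using cond_leD[OF assms U] by (simp add: abs_mult mult_left_mono)
qed

lemma cond_le_abs:
  assumes "integrable M Z" "(\<integral>w. \<bar>Z w\<bar> \<partial>M) <= e" "subalgebra M F"
  shows "cond_le M F Z e"
proof (rule cond_leI)
  fix U assume U: "U \<in> borel_measurable F" "\<And>w. \<bar>U w\<bar> <= (1 :: real)"
  have m: "U \<in> borel_measurable M" by (rule measurable_from_subalg[OF assms(3) U(1)])
  have "\<bar>\<integral>w. U w * Z w \<partial>M\<bar> <= (\<integral>w. \<bar>U w * Z w\<bar> \<partial>M)" by (rule integral_abs_bound)
  also have "... <= (\<integral>w. \<bar>Z w\<bar> \<partial>M)"
    using assms(1) integrable_bounded_mult[OF assms(1) m U(2)] mult_left_le_one_le[OF abs_ge_zero abs_ge_zero U(2)]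
    by (intro integral_mono integrable_abs) (simp_all add: abs_mult)
  finally show "\<bar>\<integral>w. U w * Z w \<partial>M\<bar> <= e" using assms(2) by simp
qed

text \<open>The bounded quotient of \<open>B\<close> and \<open>c A\<close> is absorbed into the test function.\<close>

lemma cond_le_mult:
  fixes A B P :: "'a => real"
  assumes "cond_le M F (%w. A w * P w) e" and [measurable]: "A \<in> borel_measurable F" "B \<in> borel_measurable F"
    and "\<And>w. \<bar>B w\<bar> <= c * \<bar>A w\<bar>" "0 <= c"
  shows "cond_le M F (%w. B w * P w) (c * e)"
proof (rule cond_leI)
  fix U assume U[measurable]: "U \<in> borel_measurable F" and U1: "\<And>w. \<bar>U w\<bar> <= (1 :: real)"
  show "\<bar>\<integral>w. U w * (B w * P w) \<partial>M\<bar> <= c * e"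
  proof (cases "c = 0")
    case True
    then have "B w = 0" for w using assms(4)[of w] by simp
    then show ?thesis using True by simp
  next
    case False
    define V where "V w = U w * (B w / (c * A w))" for w
    have V: "V \<in> borel_measurable F" unfolding V_def by measurable
    have "\<bar>B w / (c * A w)\<bar> <= 1" for w
      using assms(4)[of w] assms(5) by (auto simp: abs_mult divide_le_eq_1 zero_less_mult_iff)
    then have V1: "\<bar>V w\<bar> <= 1" for w
      unfolding V_def abs_mult using U1[of w] by (intro mult_le_one) auto
    have "U w * (B w * P w) = c * (V w * (A w * P w))" for w
      using assms(4)[of w] False by (cases "A w = 0") (auto simp: V_def)
    then have "(\<integral>w. U w * (B w * P w) \<partial>M) = (\<integral>w. c * (V w * (A w * P w)) \<partial>M)"
      by (intro Bochner_Integration.integral_cong refl)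
    then have "(\<integral>w. U w * (B w * P w) \<partial>M) = c * (\<integral>w. V w * (A w * P w) \<partial>M)" by simp
    then show ?thesis
      using cond_leD[OF assms(1) V V1] assms(5) by (simp add: abs_mult mult_left_mono)
  qed
qed

lemma cond_le_bounded_mult:
  assumes "cond_le M F P e" "B \<in> borel_measurable F" "\<And>w. \<bar>B w\<bar> <= c"
  shows "\<bar>\<integral>w. B w * P w \<partial>M\<bar> <= c * e"
proof (rule cond_le_integral)
  have "0 <= c" using assms(3) abs_ge_zero order_trans by blast
  then show "cond_le M F (%w. B w * P w) (c * e)"
    using cond_le_mult[of M F "%_. 1" P e B c] assms by simp
qed

section \<open>Truncated mixing sequences\<close>

text \<open>Here \<open>W\<close> is a truncation of the stationary sequence \<open>X\<close> at level \<open>b\<close> with mean error \<open>\<rho>\<close>,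
unless it is \<open>X\<close> itself. A product of \<open>q\<close> truncated variables, of which the first \<open>p\<close> belong to the
past, depends on the past by at most \<open>D q j\<close> if the gap after the \<open>p\<close>-th one is \<open>j\<close>, whatever \<open>p\<close>.\<close>

locale mixing_seq = prob_space M for M :: "'a measure" +
  fixes F :: "nat => 'a measure" and X W :: "nat => 'a => real"
    and D :: "nat => nat => real" and \<rho> b :: real and \<gamma> :: "nat => real"
  assumes subalg: "\<And>i. subalgebra M (F i)"
    and filt: "\<And>i j. i <= j ==> sets (F i) \<subseteq> sets (F j)"
    and X_meas: "\<And>i. X i \<in> borel_measurable (F i)"
    and W_meas: "\<And>i. W i \<in> borel_measurable (F i)"
    and X_int: "\<And>i. integrable M (X i)"
    and W_int4: "\<And>i. integrable M (%w. W i w ^ 4)"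
    and W_mean: "\<And>i. E (W i) = 0"
    and trunc: "(\<forall>i w. X i w = W i w) \<or> (\<forall>i w. \<bar>W i w\<bar> <= b)"
    and b_nonneg: "0 <= b"
    and trunc_err: "\<And>i. E (%w. \<bar>X i w - W i w\<bar>) <= \<rho>"
    and D_nonneg: "\<And>q j. 0 <= D q j"
    and moment: "\<And>q i. 1 <= q ==> q <= 4 ==> E (%w. \<bar>W i w\<bar> ^ q) <= D q 0"
    and cov: "\<And>i r. E (%w. W i w * W (i + r) w) = \<gamma> r"
    and mix: "\<And>p q k j. p < q ==> q <= 4 ==> q <= p + 3 ==> (\<forall>m<q. k m <= k (Suc m)) ==>
        k p + j <= k (Suc p) ==> 1 <= j ==>
        cond_le M (F (k p)) (%w. (\<Prod>m=1..p. W (k m) w) *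
          ((\<Prod>m=Suc p..q. W (k m) w) - E (%w'. \<Prod>m=Suc p..q. W (k m) w'))) (D q j)"
begin

lemma F_mono: "f \<in> borel_measurable (F i) ==> i <= j ==> f \<in> borel_measurable (F j)"
  using measurable_from_subalg[of "F j" "F i" f borel] subalg[of i] subalg[of j] filt[of i j]
  by (simp add: subalgebra_def)

lemma F_M: "f \<in> borel_measurable (F i) ==> f \<in> borel_measurable M"
  using measurable_from_subalg[OF subalg] by blast

lemma W_M[measurable]: "W i \<in> borel_measurable M" by (rule F_M[OF W_meas])
lemma X_M[measurable]: "X i \<in> borel_measurable M" by (rule F_M[OF X_meas])

lemma cond_le_F_mono: "cond_le M (F j) Z e ==> i <= j ==> cond_le M (F i) Z e"
  unfolding cond_le_def using F_mono by blast

lemma integrable_prod4: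
  fixes f g h k :: "'a => real"
  assumes [measurable]: "f \<in> borel_measurable M" "g \<in> borel_measurable M" "h \<in> borel_measurable M" "k \<in> borel_measurable M"
    and i: "integrable M (%w. f w ^ 4)" "integrable M (%w. g w ^ 4)" "integrable M (%w. h w ^ 4)" "integrable M (%w. k w ^ 4)"
  shows "integrable M (%w. f w * g w * h w * k w)"
proof (rule Bochner_Integration.integrable_bound)
  show "integrable M (%w. f w ^ 4 + g w ^ 4 + h w ^ 4 + k w ^ 4)" using i by simp
  show "(%w. f w * g w * h w * k w) \<in> borel_measurable M" by measurable
  have s: "\<bar>x * y\<bar> <= (x\<^sup>2 + y\<^sup>2) / 2" for x y :: real
  proof -
    have "0 <= (\<bar>x\<bar> - \<bar>y\<bar>)\<^sup>2" by simp
    then show ?thesis by (simp add: power2_eq_square algebra_simps abs_mult)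
  qed
  have "\<bar>x * y * z * v\<bar> <= x ^ 4 + y ^ 4 + z ^ 4 + v ^ 4" for x y z v :: real
  proof -
    have "\<bar>x * y * z * v\<bar> <= ((x * y)\<^sup>2 + (z * v)\<^sup>2) / 2" using s[of "x * y" "z * v"] by (simp add: mult.assoc)
    also have "(x * y)\<^sup>2 <= ((x\<^sup>2)\<^sup>2 + (y\<^sup>2)\<^sup>2) / 2" using s[of "x\<^sup>2" "y\<^sup>2"] by (simp add: power_mult_distrib)
    also have "(z * v)\<^sup>2 <= ((z\<^sup>2)\<^sup>2 + (v\<^sup>2)\<^sup>2) / 2" using s[of "z\<^sup>2" "v\<^sup>2"] by (simp add: power_mult_distrib)
    also have "(((x\<^sup>2)\<^sup>2 + (y\<^sup>2)\<^sup>2) / 2 + ((z\<^sup>2)\<^sup>2 + (v\<^sup>2)\<^sup>2) / 2) / 2 = (x ^ 4 + y ^ 4 + z ^ 4 + v ^ 4) / 4"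
      by (simp add: power_mult[symmetric] add_divide_distrib)
    also have "... <= x ^ 4 + y ^ 4 + z ^ 4 + v ^ 4" by (simp add: zero_le_even_power)
    finally show ?thesis by simp
  qed
  from order_trans[OF this abs_ge_self]
  show "AE w in M. norm (f w * g w * h w * k w) <= norm (f w ^ 4 + g w ^ 4 + h w ^ 4 + k w ^ 4)"
    by (intro AE_I2) simp
qed

lemma W_integrable:
  "integrable M (W a)" "integrable M (%w. W a w * W c w)"
  "integrable M (%w. W a w * (W c w * W d w))" "integrable M (%w. W a w * (W c w * (W d w * W e w)))"
  using integrable_prod4[of "W a" "%_. 1" "%_. 1" "%_. 1"] integrable_prod4[of "W a" "W c" "%_. 1" "%_. 1"]
    integrable_prod4[of "W a" "W c" "W d" "%_. 1"] integrable_prod4[of "W a" "W c" "W d" "W e"] W_int4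
  by (simp_all add: mult.assoc)

lemma X_minus_W_integrable: "integrable M (%w. X i w - W i w)"
  using X_int W_integrable(1) by simp

lemma cov': "i <= k ==> E (%w. W i w * W k w) = \<gamma> (k - i)"
  using cov[of i "k - i"] by simp

lemma mix01: "l + j <= a ==> 1 <= j ==> cond_le M (F l) (W a) (D 1 j)"
  using mix[of 0 1 "%m. [l, a] ! m" j] W_mean by simp

lemma mix02:
  "l + j <= a ==> a <= c ==> 1 <= j ==> cond_le M (F l) (%w. W a w * W c w - \<gamma> (c - a)) (D 2 j)"
  using mix[of 0 2 "%m. [l, a, c] ! m" j] cov'[of a c]
  by (simp add: eval_nat_numeral All_less_Suc)

lemma mix03:
  "l + j <= a ==> a <= c ==> c <= d ==> 1 <= j ==>
    cond_le M (F l) (%w. W a w * (W c w * W d w) - E (%w. W a w * (W c w * W d w))) (D 3 j)"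
  using mix[of 0 3 "%m. [l, a, c, d] ! m" j]
  by (simp add: eval_nat_numeral All_less_Suc mult.assoc)

lemma mix12: "a + j <= c ==> 1 <= j ==> cond_le M (F a) (%w. W a w * W c w) (D 2 j)"
  using mix[of 1 2 "%m. [0, a, c] ! m" j] W_mean
  by (simp add: eval_nat_numeral All_less_Suc)

lemma mix13:
  "a + j <= c ==> c <= d ==> 1 <= j ==>
    cond_le M (F a) (%w. W a w * (W c w * W d w - \<gamma> (d - c))) (D 3 j)"
  using mix[of 1 3 "%m. [0, a, c, d] ! m" j] cov'[of c d]
  by (simp add: eval_nat_numeral All_less_Suc mult.assoc)

lemma mix14:
  "a + j <= c ==> c <= d ==> d <= e ==> 1 <= j ==>
    cond_le M (F a) (%w. W a w * (W c w * (W d w * W e w) - E (%w. W c w * (W d w * W e w)))) (D 4 j)"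
  using mix[of 1 4 "%m. [0, a, c, d, e] ! m" j]
  by (simp add: eval_nat_numeral All_less_Suc mult.assoc)

lemma mix23:
  "a <= c ==> c + j <= d ==> 1 <= j ==> cond_le M (F c) (%w. W a w * (W c w * W d w)) (D 3 j)"
  using mix[of 2 3 "%m. [0, a, c, d] ! m" j] W_mean
  by (simp add: eval_nat_numeral All_less_Suc mult.assoc)

lemma mix24:
  "a <= c ==> c + j <= d ==> d <= e ==> 1 <= j ==>
    cond_le M (F c) (%w. W a w * (W c w * (W d w * W e w - \<gamma> (e - d)))) (D 4 j)"
  using mix[of 2 4 "%m. [0, a, c, d, e] ! m" j] cov'[of d e]
  by (simp add: eval_nat_numeral All_less_Suc mult.assoc)

lemma mix34:
  "a <= c ==> c <= d ==> d + j <= e ==> 1 <= j ==>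
    cond_le M (F d) (%w. W a w * (W c w * (W d w * W e w))) (D 4 j)"
  using mix[of 3 4 "%m. [0, a, c, d, e] ! m" j] W_mean
  by (simp add: eval_nat_numeral All_less_Suc mult.assoc)

text \<open>Bound for fourth order products with several centred factors: subtracting a mean produces
products of bounds of lower order.\<close>

definition "E4 j = D 4 j + D 2 0 * D 2 j + D 1 0 * D 3 j"

lemma E4_ge: "D 4 j <= E4 j" "0 <= E4 j" "D 4 j + D 2 0 * D 2 j <= E4 j" "D 4 j + D 1 0 * D 3 j <= E4 j"
  unfolding E4_def using D_nonneg by (auto intro!: add_nonneg_nonneg)

lemma \<gamma>_le: "1 <= r ==> \<bar>\<gamma> r\<bar> <= D 2 r"
  using cond_le_integral[OF mix12[of 0 r r]] cov[of 0 r] by simp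

lemma \<gamma>0_le: "\<bar>\<gamma> 0\<bar> <= D 2 0"
  using moment[of 2 0] cov[of 0 0] by (simp add: power2_eq_square[symmetric] integral_nonneg_AE abs_of_nonneg flip: cov[of 0 0])

lemma abs_WW: "E (%w. \<bar>W a w * W c w\<bar>) <= D 2 0"
proof -
  have "E (%w. \<bar>W a w * W c w\<bar>) <= E (%w. (W a w * W a w + W c w * W c w) / 2)"
  proof (rule integral_mono)
    fix w
    have "0 <= (\<bar>W a w\<bar> - \<bar>W c w\<bar>)\<^sup>2" by simp
    then show "\<bar>W a w * W c w\<bar> <= (W a w * W a w + W c w * W c w) / 2"
      by (simp add: power2_eq_square algebra_simps abs_mult)
  qed (use W_integrable in auto)
  also have "... = (E (%w. \<bar>W a w\<bar> ^ 2) + E (%w. \<bar>W c w\<bar> ^ 2)) / 2"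
    using W_integrable(2) by (simp add: power2_eq_square)
  also have "... <= D 2 0" using moment[of 2 a] moment[of 2 c] by simp
  finally show ?thesis .
qed

text \<open>One factor may be the untruncated variable: where truncation is effective all other factors are
bounded, and the mean absolute truncation error suffices.\<close>

lemma cond_le_X:
  assumes c: "cond_le M (F m) (%w. W m w * Z w) e" and i: "integrable M (%w. W m w * Z w)"
    and [measurable]: "Z \<in> borel_measurable M"
    and B: "(\<And>i w. \<bar>W i w\<bar> <= b) ==> (\<And>w. \<bar>Z w\<bar> <= B)" and "0 <= B"
  shows "cond_le M (F m) (%w. X m w * Z w) (e + B * \<rho>)" "integrable M (%w. X m w * Z w)"
    "E (%w. \<bar>(X m w - W m w) * Z w\<bar>) <= B * \<rho>" "integrable M (%w. (X m w - W m w) * Z w)"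
proof -
  have \<rho>: "0 <= \<rho>" using trunc_err[of m] by (rule order_trans[rotated]) (simp add: integral_nonneg_AE)
  have R: "integrable M (%w. (X m w - W m w) * Z w) \<and> E (%w. \<bar>(X m w - W m w) * Z w\<bar>) <= B * \<rho>"
    using trunc
  proof
    assume "\<forall>i w. X i w = W i w"
    then show ?thesis using \<rho> \<open>0 <= B\<close> by simp
  next
    assume "\<forall>i w. \<bar>W i w\<bar> <= b"
    then have Z: "\<bar>Z w\<bar> <= B" for w using B by blast
    have 1: "integrable M (%w. Z w * (X m w - W m w))"
      by (rule integrable_bounded_mult[OF X_minus_W_integrable _ Z]) measurable
    have "E (%w. \<bar>(X m w - W m w) * Z w\<bar>) <= E (%w. B * \<bar>X m w - W m w\<bar>)"
    proof (rule integral_mono)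
      show "integrable M (%w. \<bar>(X m w - W m w) * Z w\<bar>)" using 1 by (simp add: mult.commute)
      show "integrable M (%w. B * \<bar>X m w - W m w\<bar>)" using X_minus_W_integrable by simp
      show "\<bar>(X m w - W m w) * Z w\<bar> <= B * \<bar>X m w - W m w\<bar>" for w
        using mult_left_mono[OF Z[of w], of "\<bar>X m w - W m w\<bar>"] by (simp add: abs_mult mult.commute)
    qed
    also have "... <= B * \<rho>" using trunc_err[of m] \<open>0 <= B\<close> by (simp add: mult_left_mono)
    finally show ?thesis using 1 by (simp add: mult.commute)
  qed
  then show "E (%w. \<bar>(X m w - W m w) * Z w\<bar>) <= B * \<rho>"
    "integrable M (%w. (X m w - W m w) * Z w)" by auto
  have eq: "(%w. X m w * Z w) = (%w. W m w * Z w + (X m w - W m w) * Z w)"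
    by (simp add: algebra_simps)
  show "integrable M (%w. X m w * Z w)" unfolding eq using i R by simp
  show "cond_le M (F m) (%w. X m w * Z w) (e + B * \<rho>)"
    unfolding eq using R by (intro cond_le_add[OF c] cond_le_abs i subalg) auto
qed

section \<open>Products along two and three gaps\<close>

lemma W_centred_integrable:
  "integrable M (%w. W a w * W c w - k)" "integrable M (%w. W a w * (W c w * W d w - k))"
  "integrable M (%w. W a w * (W c w * W d w) - k)"
  "integrable M (%w. W a w * (W c w * (W d w * W e w) - k))"
  "integrable M (%w. W a w * (W c w * (W d w * W e w - k)))"
  "integrable M (%w. W a w * (W c w * (W d w * W e w - k) - k'))"
  using W_integrable integrable_mult_left[OF W_integrable(2)[of a c], of k]
  by (simp_all add: right_diff_distrib mult.assoc)

lemma E_WW_centred: "E (%w. W l w * (W a w * W c w - k)) = E (%w. W l w * (W a w * W c w))"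
  using W_integrable W_mean by (simp add: right_diff_distrib)

text \<open>Either of the two gaps may serve to decouple the product, so the larger one counts.\<close>

lemma third_moment_gap:
  assumes "l < a" "a <= c"
  shows "\<bar>E (%w. W l w * (W a w * W c w - \<gamma> (c - a)))\<bar> <= D 3 (max (a - l) (c - a))"
proof (cases "c - a <= a - l")
  case True
  then show ?thesis using cond_le_integral[OF mix13[of l "a - l" a c]] assms by simp
next
  case False
  then show ?thesis
    using cond_le_integral[OF mix23[of l a "c - a" c]] assms E_WW_centred by simp
qed

lemma third_moment_square:
  assumes "a <= c"
  shows "\<bar>E (%w. W a w * (W a w * W c w))\<bar> <= D 3 (c - a)"
proof (cases "a = c")
  case True
  have "\<bar>E (%w. W a w * (W a w * W a w))\<bar> <= E (%w. \<bar>W a w * (W a w * W a w)\<bar>)"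
    by (rule integral_abs_bound)
  also have "... = E (%w. \<bar>W a w\<bar> ^ 3)" by (simp add: abs_mult power3_eq_cube mult_ac)
  finally show ?thesis using moment[of 3 a] True by simp
next
  case False
  then show ?thesis using cond_le_integral[OF mix23[of a a "c - a" c]] assms by simp
qed

lemma abs_W: "E (%w. \<bar>W a w\<bar>) <= D 1 0"
  using moment[of 1 a] by simp

lemma abs_W_cmult: "E (%w. \<bar>W a w * k\<bar>) <= D 1 0 * \<bar>k\<bar>"
  using abs_W[of a] by (simp add: abs_mult mult_right_mono)

lemma abs_WW_cmult: "E (%w. \<bar>W a w * (W c w * k)\<bar>) <= D 2 0 * \<bar>k\<bar>"
proof -
  have "E (%w. \<bar>W a w * (W c w * k)\<bar>) = E (%w. \<bar>W a w * W c w\<bar>) * \<bar>k\<bar>"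
    by (subst integral_mult_left_zero[symmetric]) (simp add: abs_mult mult.assoc)
  then show ?thesis using abs_WW[of a c] by (simp add: mult_right_mono)
qed

text \<open>A centred factor costs two terms when its own mean is the small quantity: the mean is
  subtracted and bounded separately.\<close>

lemma cond_le_minus:
  assumes "cond_le M (F m) Z e" "integrable M Z" "integrable M Z'" "E (%w. \<bar>Z' w\<bar>) <= e'"
  shows "cond_le M (F m) (%w. Z w - Z' w) (e + e')"
  using cond_le_add[OF assms(1) cond_le_abs[of M "%w. - Z' w" e' "F m"]] assms subalg by simp

lemma quad_square_pair:
  assumes "l < a" "a <= c"
  shows "cond_le M (F l) (%w. (W l w)\<^sup>2 * (W a w * W c w - \<gamma> (c - a))) (E4 (max (a - l) (c - a)))"
proof (cases "c - a <= a - l")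
  case True
  then show ?thesis using cond_le_mono[OF mix24[of l l "a - l" a c] E4_ge(1)] assms
    by (simp add: power2_eq_square mult.assoc)
next
  case False
  then have "cond_le M (F l) (%w. W l w * (W l w * (W a w * W c w))) (D 4 (c - a))"
    using cond_le_F_mono[OF mix34[of l l a "c - a" c], of l] assms by simp
  moreover have "E (%w. \<bar>W l w * (W l w * \<gamma> (c - a))\<bar>) <= D 2 0 * D 2 (c - a)"
    using False by (intro order_trans[OF abs_WW_cmult] mult_left_mono \<gamma>_le D_nonneg) auto
  ultimately have "cond_le M (F l) (%w. W l w * (W l w * (W a w * W c w)) - W l w * (W l w * \<gamma> (c - a)))
      (D 4 (c - a) + D 2 0 * D 2 (c - a))"
    using W_integrable(2)[of l l] by (intro cond_le_minus W_integrable) (auto simp: mult.assoc[symmetric])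
  from cond_le_mono[OF this E4_ge(3)] False show ?thesis
    by (simp add: power2_eq_square algebra_simps)
qed

lemma quad_X_square:
  assumes "m < a" "a <= c"
  defines "Z \<equiv> %w. W a w * (W a w * W c w) - E (%w. W a w * (W a w * W c w))"
  shows "cond_le M (F m) (%w. X m w * Z w) (E4 (max (a - m) (c - a)) + 2 * b ^ 3 * \<rho>)"
    "integrable M (%w. X m w * Z w)"
proof -
  have Zm: "Z \<in> borel_measurable M" unfolding Z_def by measurable
  have WZ: "integrable M (%w. W m w * Z w)" unfolding Z_def by (rule W_centred_integrable)
  have "cond_le M (F m) (%w. W m w * Z w) (E4 (max (a - m) (c - a)))"
  proof (cases "c - a <= a - m")
    case True
    then show ?thesis unfolding Z_def
      using cond_le_mono[OF mix14[of m "a - m" a a c] E4_ge(1)] assms by simp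
  next
    case False
    then have "cond_le M (F m) (%w. W m w * (W a w * (W a w * W c w))) (D 4 (c - a))"
      using cond_le_F_mono[OF mix34[of m a a "c - a" c], of m] assms by simp
    moreover have "E (%w. \<bar>W m w * E (%w. W a w * (W a w * W c w))\<bar>)
        <= D 1 0 * D 3 (c - a)"
      by (intro order_trans[OF abs_W_cmult] mult_left_mono third_moment_square D_nonneg assms)
    ultimately have "cond_le M (F m) (%w. W m w * (W a w * (W a w * W c w))
        - W m w * E (%w. W a w * (W a w * W c w))) (D 4 (c - a) + D 1 0 * D 3 (c - a))"
      using W_integrable by (intro cond_le_minus) auto
    from cond_le_mono[OF this E4_ge(4)] False show ?thesis
      by (simp add: Z_def right_diff_distrib)
  qed
  moreover have "\<bar>Z w\<bar> <= 2 * b ^ 3" if Wb: "\<And>i w. \<bar>W i w\<bar> <= b" for w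
  proof -
    have 1: "\<bar>W a w * (W a w * W c w)\<bar> <= b * (b * b)" for w
      unfolding abs_mult by (intro mult_mono Wb) (auto intro: b_nonneg)
    have "\<bar>E (%w. W a w * (W a w * W c w))\<bar> <= b * (b * b)"
      using cond_le_integral[OF cond_le_abs[OF W_integrable(3) _ subalg]]
        integral_le_const[OF integrable_abs[OF W_integrable(3)[of a a c]], of "b * (b * b)"] 1 by simp
    then show ?thesis using 1[of w] unfolding Z_def by (simp add: power3_eq_cube mult.assoc)
  qed
  ultimately show "cond_le M (F m) (%w. X m w * Z w) (E4 (max (a - m) (c - a)) + 2 * b ^ 3 * \<rho>)"
    "integrable M (%w. X m w * Z w)"
    using cond_le_X[of m Z "E4 (max (a - m) (c - a))" "2 * b ^ 3"] WZ Zm b_nonneg by simp_all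
qed

lemma pair_bounded:
  assumes Wb: "\<And>i w. \<bar>W i w\<bar> <= b"
  shows "\<bar>W a w * W c w - E (%w. W a w * W c w)\<bar> <= 2 * b ^ 2"
proof -
  have 1: "\<bar>W a w * W c w\<bar> <= b * b" for w
    unfolding abs_mult by (intro mult_mono Wb) (auto intro: b_nonneg)
  have "\<bar>E (%w. W a w * W c w)\<bar> <= b * b"
    using cond_le_integral[OF cond_le_abs[OF W_integrable(2) _ subalg]]
      integral_le_const[OF integrable_abs[OF W_integrable(2)[of a c]], of "b * b"] 1 by simp
  then show ?thesis using 1[of w] by (simp add: power2_eq_square)
qed

text \<open>Again the largest of the three gaps decouples; depending on its place, one, two or three factors
are on the side of the past.\<close>

lemma quad_X_triple:
  assumes "m < l" "l < a" "a <= c"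
  defines "Z \<equiv> %w. W l w * (W a w * W c w - \<gamma> (c - a)) - E (%w. W l w * (W a w * W c w - \<gamma> (c - a)))"
  shows "cond_le M (F m) (%w. X m w * Z w) (E4 (max (max (l - m) (a - l)) (c - a)) + 4 * b ^ 3 * \<rho>)"
    "integrable M (%w. X m w * Z w)"
proof -
  let ?g = "\<gamma> (c - a)" and ?e = "E (%w. W l w * (W a w * W c w))"
  have Z: "Z = (%w. W l w * (W a w * W c w - ?g) - ?e)" unfolding Z_def E_WW_centred ..
  have Zm: "Z \<in> borel_measurable M" unfolding Z_def by measurable
  have WZ: "integrable M (%w. W m w * Z w)" unfolding Z_def by (rule W_centred_integrable)
  have e: "\<bar>?e\<bar> <= D 3 (max (a - l) (c - a))" using third_moment_gap[OF assms(2,3)] by (simp add: E_WW_centred)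
  have We: "E (%w. \<bar>W m w * ?e\<bar>) <= D 1 0 * D 3 (max (a - l) (c - a))"
    by (intro order_trans[OF abs_W_cmult] mult_left_mono e D_nonneg)
  consider "max (max (l - m) (a - l)) (c - a) = l - m"
    | "max (max (l - m) (a - l)) (c - a) = a - l" "max (a - l) (c - a) = a - l"
    | "max (max (l - m) (a - l)) (c - a) = c - a" "max (a - l) (c - a) = c - a" "a < c"
  proof (cases "c - a <= max (l - m) (a - l)")
    case True
    then show ?thesis using that(1,2) by (cases "a - l <= l - m") (simp_all add: max_def split: if_splits)
  next
    case False
    moreover from this have "a < c" by simp
    ultimately show ?thesis using that(3) by (simp add: max_def split: if_splits)
  qed
  then have "cond_le M (F m) (%w. W m w * Z w) (E4 (max (max (l - m) (a - l)) (c - a)))"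
  proof cases
    case 1
    have "cond_le M (F m) (%w. W m w * (W l w * (W a w * W c w) - ?e)) (D 4 (l - m))"
      using mix14[of m "l - m" l a c] assms by simp
    moreover have "cond_le M (F m) (%w. (- ?g) * (W m w * W l w)) (\<bar>- ?g\<bar> * D 2 (l - m))"
      using mix12[of m "l - m" l] assms by (intro cond_le_cmult) simp
    ultimately have "cond_le M (F m) (%w. W m w * (W l w * (W a w * W c w) - ?e) + (- ?g) * (W m w * W l w))
        (D 4 (l - m) + \<bar>- ?g\<bar> * D 2 (l - m))"
      using W_integrable W_centred_integrable by (intro cond_le_add subalg integrable_mult_right) auto
    moreover have "D 4 (l - m) + \<bar>- ?g\<bar> * D 2 (l - m) <= E4 (l - m)"
    proof -
      have "\<bar>?g\<bar> <= D 2 0" using abs_WW[of a c] cov'[of a c] assms integral_abs_bound[of M "%w. W a w * W c w"] by simp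
      then have "\<bar>- ?g\<bar> * D 2 (l - m) <= D 2 0 * D 2 (l - m)" by (simp add: mult_right_mono D_nonneg)
      then show ?thesis using E4_ge(3)[of "l - m"] by simp
    qed
    ultimately show ?thesis unfolding Z 1 by (auto intro: cond_le_mono simp: algebra_simps)
  next
    case 2
    have "cond_le M (F m) (%w. W m w * (W l w * (W a w * W c w - ?g))) (D 4 (a - l))"
      using cond_le_F_mono[OF mix24[of m l "a - l" a c], of m] assms by simp
    from cond_le_minus[OF this W_centred_integrable(5) _ We]
    have "cond_le M (F m) (%w. W m w * (W l w * (W a w * W c w - ?g)) - W m w * ?e) (D 4 (a - l) + D 1 0 * D 3 (a - l))"
      using W_integrable 2 by simp
    from cond_le_mono[OF this E4_ge(4)] show ?thesis unfolding Z 2 by (simp add: right_diff_distrib)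
  next
    case 3
    have "cond_le M (F m) (%w. W m w * (W l w * (W a w * W c w))) (D 4 (c - a))"
      using cond_le_F_mono[OF mix34[of m l a "c - a" c], of m] assms 3 by simp
    from cond_le_minus[OF this W_integrable(4) _ We]
    have A: "cond_le M (F m) (%w. W m w * (W l w * (W a w * W c w)) - W m w * ?e) (D 4 (c - a) + D 1 0 * D 3 (c - a))"
      using W_integrable 3 by simp
    have B: "E (%w. \<bar>W m w * (W l w * ?g)\<bar>) <= D 2 0 * D 2 (c - a)"
      using 3 by (intro order_trans[OF abs_WW_cmult] mult_left_mono \<gamma>_le D_nonneg) auto
    have "cond_le M (F m) (%w. (W m w * (W l w * (W a w * W c w)) - W m w * ?e) - W m w * (W l w * ?g))
        (D 4 (c - a) + D 1 0 * D 3 (c - a) + D 2 0 * D 2 (c - a))"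
    proof (rule cond_le_minus[OF A _ _ B])
      show "integrable M (%w. W m w * (W l w * (W a w * W c w)) - W m w * ?e)"
        using W_integrable by simp
      show "integrable M (%w. W m w * (W l w * ?g))"
        using integrable_mult_left[OF W_integrable(2)[of m l], of ?g] by (simp add: mult.assoc)
    qed
    then show ?thesis unfolding Z 3 E4_def by (simp add: algebra_simps)
  qed
  moreover have "\<bar>Z w\<bar> <= 4 * b ^ 3" if Wb: "\<And>i w. \<bar>W i w\<bar> <= b" for w
  proof -
    have 1: "\<bar>W l w * (W a w * W c w - ?g)\<bar> <= b * (2 * b ^ 2)" for w
      unfolding abs_mult using pair_bounded[OF Wb, of a w c] cov'[of a c] assms
      by (intro mult_mono Wb) (auto intro: b_nonneg)
    have "\<bar>E (%w. W l w * (W a w * W c w - ?g))\<bar> <= b * (2 * b ^ 2)"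
      using cond_le_integral[OF cond_le_abs[OF W_centred_integrable(2) _ subalg]]
        integral_le_const[OF integrable_abs[OF W_centred_integrable(2)[of l a c ?g]], of "b * (2 * b ^ 2)"] 1 by simp
    then have "\<bar>Z w\<bar> <= b * (2 * b ^ 2) + b * (2 * b ^ 2)" using 1[of w] unfolding Z_def by linarith
    then show ?thesis by (simp add: power3_eq_cube power2_eq_square)
  qed
  ultimately show "cond_le M (F m) (%w. X m w * Z w) (E4 (max (max (l - m) (a - l)) (c - a)) + 4 * b ^ 3 * \<rho>)"
    "integrable M (%w. X m w * Z w)"
    using cond_le_X[of m Z "E4 (max (max (l - m) (a - l)) (c - a))" "4 * b ^ 3"] WZ Zm b_nonneg by simp_all
qed

lemma triple_base:
  assumes "n + J <= l" "1 <= J" "l < a" "a <= c"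
  shows "cond_le M (F n) (%w. W l w * (W a w * W c w - \<gamma> (c - a))
      - E (%w. W l w * (W a w * W c w - \<gamma> (c - a)))) (D 3 J + D 2 0 * D 1 J)"
proof -
  let ?g = "\<gamma> (c - a)"
  have g: "\<bar>?g\<bar> <= D 2 0" using abs_WW[of a c] cov'[of a c] assms integral_abs_bound[of M "%w. W a w * W c w"] by simp
  have "cond_le M (F n) (%w. (W l w * (W a w * W c w) - E (%w. W l w * (W a w * W c w))) + (- ?g) * W l w)
      (D 3 J + \<bar>- ?g\<bar> * D 1 J)"
    using W_integrable W_centred_integrable assms
    by (intro cond_le_add mix03 cond_le_cmult mix01 subalg integrable_mult_right) auto
  moreover have "\<bar>- ?g\<bar> * D 1 J <= D 2 0 * D 1 J" using g by (simp add: mult_right_mono D_nonneg)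
  ultimately show ?thesis unfolding E_WW_centred by (auto intro: cond_le_mono simp: algebra_simps)
qed

section \<open>Telescoping along the past\<close>

definition "S n w = (\<Sum>i=1..n. X i w)"

lemma S_0: "S 0 w = 0" and S_Suc: "S (Suc n) w = S n w + X (Suc n) w"
  by (simp_all add: S_def)

lemma S_meas_F: "S n \<in> borel_measurable (F n)"
  unfolding S_def by (intro borel_measurable_sum F_mono[OF X_meas]) auto

lemma S_M[measurable]: "S n \<in> borel_measurable M" by (rule F_M[OF S_meas_F])

lemma S_integrable: "integrable M (S n)"
  unfolding S_def using X_int by simp

text \<open>A function of the sum up to time \<open>i\<close> is its value at time \<open>i - J + 1\<close> plus the increments of the
last \<open>J - 1\<close> times. The former is weakly dependent on \<open>P\<close> by the gap, the latter are treated one by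
one, each with a principal part \<open>a p\<close>.\<close>

lemma telescope_past:
  assumes P: "integrable M P" "E P = 0" and J: "1 <= J"
    and \<psi>[measurable]: "\<psi> \<in> borel_measurable borel" and c: "\<And>x. \<bar>\<psi> x\<bar> <= c"
    and base: "J <= Suc i ==> cond_le M (F (Suc i - J)) P e0" and e0: "0 <= e0"
    and incr: "\<And>p. 1 <= p ==> p < J ==> p <= i ==>
      \<bar>E (%w. (\<psi> (S (Suc i - p) w) - \<psi> (S (i - p) w)) * P w) - a p\<bar> <= e p"
    and e: "\<And>p. 1 <= p ==> p < J ==> 0 <= e p"
  shows "\<bar>E (%w. \<psi> (S i w) * P w) - (\<Sum>p=1..<min J (Suc i). a p)\<bar> <= c * e0 + (\<Sum>p=1..<J. e p)"
proof -
  define i0 where "i0 = Suc i - J"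
  define H where "H n = E (%w. \<psi> (S n w) * P w)" for n
  have c0: "0 <= c" using c[of 0] by linarith
  have int: "integrable M (%w. \<psi> (S n w) * P w)" for n
    by (rule integrable_bounded_mult[OF P(1) _ c]) measurable
  have H0: "\<bar>H i0\<bar> <= c * e0"
  proof (cases "J <= Suc i")
    case True
    show ?thesis unfolding H_def i0_def
    proof (rule cond_le_bounded_mult[OF base[OF True] _ c])
      show "(%w. \<psi> (S (Suc i - J) w)) \<in> borel_measurable (F (Suc i - J))"
        using S_meas_F by measurable
    qed
  next
    case False
    then show ?thesis using P(2) c0 e0 by (simp add: H_def i0_def S_0)
  qed
  have Hd: "\<bar>H (Suc i - p) - H (i - p) - a p\<bar> <= e p" if "p \<in> {1..<min J (Suc i)}" for p
    using incr[of p] that int by (simp add: H_def left_diff_distrib)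
  have tel: "H i - H (Suc i - k) = (\<Sum>p=1..<k. H (Suc i - p) - H (i - p))" if "1 <= k" "k <= Suc i" for k
    using that
  proof (induction k rule: dec_induct)
    case (step n)
    then show ?case by (simp add: Suc_diff_le)
  qed simp
  have "Suc i - min J (Suc i) = i0" unfolding i0_def by simp
  then have "H i - H i0 = (\<Sum>p=1..<min J (Suc i). H (Suc i - p) - H (i - p))"
    using tel[of "min J (Suc i)"] J by simp
  then have "H i - H i0 - (\<Sum>p=1..<min J (Suc i). a p)
      = (\<Sum>p=1..<min J (Suc i). H (Suc i - p) - H (i - p) - a p)"
    by (simp add: sum_subtractf)
  also have "\<bar>(\<Sum>p=1..<min J (Suc i). H (Suc i - p) - H (i - p) - a p)\<bar> <= (\<Sum>p=1..<min J (Suc i). e p)"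
    by (intro order_trans[OF sum_abs] sum_mono Hd)
  finally have "\<bar>H i - H i0 - (\<Sum>p=1..<min J (Suc i). a p)\<bar> <= (\<Sum>p=1..<min J (Suc i). e p)" .
  also have "... <= (\<Sum>p=1..<J. e p)" by (rule sum_mono2) (use e in auto)
  finally show ?thesis using H0 unfolding H_def by linarith
qed

lemma lipschitz_increment:
  assumes \<psi>: "L-lipschitz_on UNIV \<psi>" and c: "cond_le M (F l) (%w. X l w * P w) e" and l: "1 <= l"
  shows "\<bar>E (%w. (\<psi> (S l w) - \<psi> (S (l - 1) w)) * P w)\<bar> <= L * e"
proof (rule cond_le_integral, rule cond_le_mult[OF c X_meas])
  have [measurable]: "\<psi> \<in> borel_measurable borel" by (rule lipschitz_UNIV_measurable[OF \<psi>])
  have [measurable]: "S l \<in> borel_measurable (F l)" "S (l - 1) \<in> borel_measurable (F l)"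
    using S_meas_F F_mono[OF S_meas_F, of "l - 1" l] by auto
  show "(%w. \<psi> (S l w) - \<psi> (S (l - 1) w)) \<in> borel_measurable (F l)" by measurable
  show "0 <= L" by (rule lipschitz_on_nonneg[OF \<psi>])
  show "\<bar>\<psi> (S l w) - \<psi> (S (l - 1) w)\<bar> <= L * \<bar>X l w\<bar>" for w
    using lipschitz_UNIV_D[OF \<psi>, of "S l w" "S (l - 1) w"] S_Suc[of "l - 1" w] l by simp
qed

lemma telescope_lipschitz:
  assumes P: "integrable M P" "E P = 0" and J: "1 <= J"
    and \<psi>: "L-lipschitz_on UNIV \<psi>" and c: "\<And>x. \<bar>\<psi> x\<bar> <= c"
    and base: "J <= Suc i ==> cond_le M (F (Suc i - J)) P e0" and e0: "0 <= e0"
    and incr: "\<And>p. 1 <= p ==> p < J ==> p <= i ==>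
      cond_le M (F (Suc i - p)) (%w. X (Suc i - p) w * P w) (e p)"
    and e: "\<And>p. 1 <= p ==> p < J ==> 0 <= e p"
  shows "\<bar>E (%w. \<psi> (S i w) * P w)\<bar> <= c * e0 + L * (\<Sum>p=1..<J. e p)"
proof -
  have "\<bar>E (%w. \<psi> (S i w) * P w) - (\<Sum>p=1..<min J (Suc i). 0)\<bar> <= c * e0 + (\<Sum>p=1..<J. L * e p)"
  proof (rule telescope_past[OF P J lipschitz_UNIV_measurable[OF \<psi>] c base e0])
    fix p assume p: "1 <= p" "p < J" "p <= i"
    have "Suc i - p - 1 = i - p" by simp
    then show "\<bar>E (%w. (\<psi> (S (Suc i - p) w) - \<psi> (S (i - p) w)) * P w) - 0\<bar> <= L * e p"
      using lipschitz_increment[OF \<psi> incr[OF p]] p by simp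
  qed (use e lipschitz_on_nonneg[OF \<psi>] in auto)
  then show ?thesis by (simp add: sum_distrib_left)
qed

end

locale smooth_chain =
  fixes \<psi> :: "nat => real => real" and c :: "nat => real"
  assumes deriv: "\<And>i x. i < 4 ==> (\<psi> i has_real_derivative \<psi> (Suc i) x) (at x)"
    and bound: "\<And>i x. 1 <= i ==> i <= 4 ==> \<bar>\<psi> i x\<bar> <= c i"
begin

lemma c_nonneg: "1 <= i ==> i <= 4 ==> 0 <= c i"
  using bound[of i 0] abs_ge_zero order_trans by blast

lemma increment: "i < 4 ==> \<bar>\<psi> i (x + v) - \<psi> i x\<bar> <= c (Suc i) * \<bar>v\<bar>"
  using taylor_remainder_bound[of 1 "%k. \<psi> (i + k)" "c (Suc i)" x v] deriv bound[of "Suc i"] by simp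

lemma taylor2: "i < 3 ==> \<bar>\<psi> i (x + v) - \<psi> i x - \<psi> (Suc i) x * v\<bar> <= c (i + 2) / 2 * v\<^sup>2"
  using taylor_remainder_bound[of 2 "%k. \<psi> (i + k)" "c (i + 2)" x v] deriv[of "i + _"] bound[of "i + 2"]
  by (simp add: eval_nat_numeral algebra_simps)

lemma taylor3:
  "i < 2 ==> \<bar>\<psi> i (x + v) - \<psi> i x - \<psi> (Suc i) x * v - \<psi> (i + 2) x * v\<^sup>2 / 2\<bar> <= c (i + 3) / 6 * \<bar>v\<bar> ^ 3"
  using taylor_remainder_bound[of 3 "%k. \<psi> (i + k)" "c (i + 3)" x v] deriv[of "i + _"] bound[of "i + 3"]
  by (simp add: eval_nat_numeral algebra_simps)

lemma taylor4:
  "\<bar>\<psi> 0 (x + v) - \<psi> 0 x - \<psi> 1 x * v - \<psi> 2 x * v\<^sup>2 / 2 - \<psi> 3 x * v ^ 3 / 6\<bar> <= c 4 / 24 * v ^ 4"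
  using taylor_remainder_bound[of 4 "\<psi>" "c 4" x v] deriv bound[of 4]
  by (simp add: eval_nat_numeral algebra_simps)

lemma lipschitz: "i < 4 ==> (c (Suc i))-lipschitz_on UNIV (\<psi> i)"
proof (rule lipschitz_UNIV_I)
  assume i: "i < 4"
  then show "0 <= c (Suc i)" by (intro c_nonneg) auto
  show "\<bar>\<psi> i x - \<psi> i y\<bar> <= c (Suc i) * \<bar>x - y\<bar>" for x y
    using increment[OF i, of y "x - y"] by simp
qed

lemma measurable: "i < 4 ==> \<psi> i \<in> borel_measurable borel"
  by (rule lipschitz_UNIV_measurable[OF lipschitz])

end

context mixing_seq
begin

lemma abs_expectation_le:
  fixes Z V :: "'a => real"
  assumes "integrable M Z" "integrable M V" "\<And>w. \<bar>V w\<bar> <= c * \<bar>Z w\<bar>" "E (%w. \<bar>Z w\<bar>) <= e" "0 <= c"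
  shows "\<bar>E V\<bar> <= c * e"
proof -
  have "\<bar>E V\<bar> <= E (%w. \<bar>V w\<bar>)" by (rule integral_abs_bound)
  also have "... <= E (%w. c * \<bar>Z w\<bar>)"
    using assms by (intro integral_mono) auto
  also have "... <= c * e" using assms(4,5) by (simp add: mult_left_mono)
  finally show ?thesis .
qed

lemma integrable_dominated:
  fixes Z V :: "'a => real"
  assumes "integrable M Z" "V \<in> borel_measurable M" "\<And>w. \<bar>V w\<bar> <= c * \<bar>Z w\<bar>" "0 <= c"
  shows "integrable M V"
  by (rule Bochner_Integration.integrable_bound[OF integrable_mult_right[OF assms(1), of c] assms(2)])
    (use assms(3,4) in \<open>auto simp: abs_mult\<close>)

text \<open>Increments of the second derivative are expanded once more. The term with the third derivative
is linear in \<open>W\<close>, hence is the mean of that derivative times a moment, up to a fluctuation for which a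
second telescoping is left.\<close>

lemma telescope_second_derivative:
  assumes sc: "smooth_chain \<psi> c"
    and P: "integrable M P" "E P = 0" and J: "1 <= J"
    and base: "J <= Suc i ==> cond_le M (F (Suc i - J)) P e0" and e0: "0 <= e0"
    and XP: "\<And>l. integrable M (%w. (X l w - W l w) * P w)"
    and WP: "\<And>l. integrable M (%w. W l w * P w)"
    and WWP: "\<And>l. integrable M (%w. (W l w)\<^sup>2 * P w)"
    and r: "\<And>l. E (%w. \<bar>(X l w - W l w) * P w\<bar>) <= r"
    and t: "\<And>p. 1 <= p ==> p < J ==> p <= i ==> \<bar>E (%w. W (Suc i - p) w * P w)\<bar> <= t p"
    and e2: "\<And>p. 1 <= p ==> p < J ==> p <= i ==>
        cond_le M (F (Suc i - p)) (%w. (W (Suc i - p) w)\<^sup>2 * P w) (e2 p)"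
    and v: "\<And>p. 1 <= p ==> p < J ==> p <= i ==>
        \<bar>E (%w. \<psi> 3 (S (i - p) w) * (W (Suc i - p) w * P w - E (%w. W (Suc i - p) w * P w)))\<bar> <= v p"
    and g: "\<And>p. 1 <= p ==> p < J ==> p <= i ==> \<bar>E (%w. \<psi> 3 (S (i - p) w))\<bar> <= g"
    and nonneg: "\<And>p. 0 <= t p" "\<And>p. 0 <= e2 p" "\<And>p. 0 <= v p" "0 <= r" "0 <= g"
  shows "\<bar>E (%w. \<psi> 2 (S i w) * P w)\<bar>
    <= c 2 * e0 + (\<Sum>p=1..<J. g * t p + c 3 * r + c 4 / 2 * e2 p + v p)"
proof -
  interpret smooth_chain \<psi> c by (rule sc)
  have m[measurable]: "\<psi> 2 \<in> borel_measurable borel" "\<psi> 3 \<in> borel_measurable borel" by (rule measurable; simp)+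
  have Pm[measurable]: "P \<in> borel_measurable M" using P(1) by auto
  have c34: "0 <= c 3" "0 <= c 4" using c_nonneg by auto
  have "\<bar>E (%w. \<psi> 2 (S i w) * P w) - (\<Sum>p=1..<min J (Suc i). 0)\<bar>
      <= c 2 * e0 + (\<Sum>p=1..<J. g * t p + c 3 * r + c 4 / 2 * e2 p + v p)"
  proof (rule telescope_past[OF P J m(1) _ base e0])
    show "\<bar>\<psi> 2 x\<bar> <= c 2" for x using bound[of 2 x] by simp
    fix p assume p: "1 <= p" "p < J"
    show "0 <= g * t p + c 3 * r + c 4 / 2 * e2 p + v p"
      using nonneg c34 by (intro add_nonneg_nonneg mult_nonneg_nonneg) auto
    assume pi: "p <= i"
    define l where "l = Suc i - p"
    have l: "i - p = l - 1" "1 <= l" using p pi unfolding l_def by auto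
    define V1 where "V1 w = \<psi> 2 (S (l - 1) w + X l w) - \<psi> 2 (S (l - 1) w + W l w)" for w
    define V2 where "V2 w = \<psi> 2 (S (l - 1) w + W l w) - \<psi> 2 (S (l - 1) w) - \<psi> 3 (S (l - 1) w) * W l w" for w
    have [measurable]: "S (l - 1) \<in> borel_measurable (F l)" "W l \<in> borel_measurable (F l)"
      using F_mono[OF S_meas_F, of "l - 1" l] W_meas by auto
    have V2m: "V2 \<in> borel_measurable (F l)" unfolding V2_def by measurable
    note V2M[measurable] = F_M[OF V2m]
    have V1M[measurable]: "V1 \<in> borel_measurable M" unfolding V1_def by measurable
    have V2: "\<bar>V2 w\<bar> <= c 4 / 2 * \<bar>(W l w)\<^sup>2\<bar>" for w
      using taylor2[of 2 "S (l - 1) w" "W l w"] unfolding V2_def by (simp add: eval_nat_numeral)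
    have V1: "\<bar>V1 w\<bar> <= c 3 * \<bar>X l w - W l w\<bar>" for w
      using increment[of 2 "S (l - 1) w + W l w" "X l w - W l w"] unfolding V1_def
      by (simp add: numeral_3_eq_3 algebra_simps)
    have V1P_le: "\<bar>V1 w * P w\<bar> <= c 3 * \<bar>(X l w - W l w) * P w\<bar>" for w
      using mult_right_mono[OF V1[of w], of "\<bar>P w\<bar>"] by (simp add: abs_mult mult.assoc)
    have V2P_le: "\<bar>V2 w * P w\<bar> <= c 4 / 2 * \<bar>(W l w)\<^sup>2 * P w\<bar>" for w
      using mult_right_mono[OF V2[of w], of "\<bar>P w\<bar>"] by (simp add: abs_mult mult.assoc)
    have V1P_int: "integrable M (%w. V1 w * P w)"
      by (rule integrable_dominated[OF XP[of l] _ V1P_le c34(1)]) measurable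
    have V2P_int: "integrable M (%w. V2 w * P w)"
      by (rule integrable_dominated[OF WWP[of l] _ V2P_le]) (use c34 in auto)
    have V1P: "\<bar>E (%w. V1 w * P w)\<bar> <= c 3 * r"
      by (rule abs_expectation_le[OF XP[of l] V1P_int V1P_le r c34(1)])
    have V2P: "\<bar>E (%w. V2 w * P w)\<bar> <= c 4 / 2 * e2 p"
    proof (rule cond_le_integral, rule cond_le_mult[OF _ _ V2m V2])
      show "cond_le M (F l) (%w. (W l w)\<^sup>2 * P w) (e2 p)" using e2[OF p pi] unfolding l_def .
    qed (use c34 in auto)
    define d where "d = E (%w. W l w * P w)"
    have \<psi>b: "\<bar>\<psi> 3 (S (l - 1) w)\<bar> <= c 3" for w using bound[of 3] by simp
    have i3: "integrable M (%w. \<psi> 3 (S (l - 1) w) * (W l w * P w - d))"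
      by (rule integrable_bounded_mult[OF _ _ \<psi>b]) (use WP[of l] in auto)
    have i4: "integrable M (%w. \<psi> 3 (S (l - 1) w) * 1)"
      by (rule integrable_bounded_mult[OF _ _ \<psi>b]) auto
    have "(\<psi> 2 (S l w) - \<psi> 2 (S (l - 1) w)) * P w
        = V1 w * P w + V2 w * P w + \<psi> 3 (S (l - 1) w) * (W l w * P w - d) + d * \<psi> 3 (S (l - 1) w)" for w
      using S_Suc[of "l - 1" w] l unfolding V1_def V2_def by (simp add: algebra_simps)
    then have "E (%w. (\<psi> 2 (S l w) - \<psi> 2 (S (l - 1) w)) * P w)
        = E (%w. V1 w * P w) + E (%w. V2 w * P w)
          + E (%w. \<psi> 3 (S (l - 1) w) * (W l w * P w - d)) + d * E (%w. \<psi> 3 (S (l - 1) w))"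
      using V1P_int V2P_int i3 i4 by simp
    moreover have "\<bar>d * E (%w. \<psi> 3 (S (l - 1) w))\<bar> <= g * t p"
      using t[OF p pi] g[OF p pi] nonneg unfolding l(1) l_def[symmetric] d_def[symmetric] abs_mult
      by (subst mult.commute) (intro mult_mono, auto)
    moreover have "\<bar>E (%w. \<psi> 3 (S (l - 1) w) * (W l w * P w - d))\<bar> <= v p"
      using v[OF p pi] unfolding l(1) l_def[symmetric] d_def[symmetric] .
    ultimately show "\<bar>E (%w. (\<psi> 2 (S (Suc i - p) w) - \<psi> 2 (S (i - p) w)) * P w) - 0\<bar>
        <= g * t p + c 3 * r + c 4 / 2 * e2 p + v p"
      using V1P V2P unfolding l(1) l_def[symmetric] by linarith
  qed
  then show ?thesis by simp
qed

lemma \<rho>_nonneg: "0 <= \<rho>"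
  using trunc_err[of 0] by (rule order_trans[rotated]) (simp add: integral_nonneg_AE)

text \<open>Bounds for the two expectations that remain in a Taylor expansion: the weight of a pair of later
variables at distance \<open>r\<close>, and that of a square times a later variable. The number \<open>g\<close> stands for the
mean of the third derivative.\<close>

definition "err_pair c g J r =
  c 2 * D 2 J + (\<Sum>p=1..<J. g * D 3 (max p r) + c 3 * (2 * b ^ 2 * \<rho>) + c 4 / 2 * E4 (max p r)
    + (c 3 * (D 3 J + D 2 0 * D 1 J) + c 4 * (\<Sum>p'=1..<J. E4 (max (max p' p) r) + 4 * b ^ 3 * \<rho>)))"
  for c :: "nat => real"

definition "err_square c g J r =
  g * D 3 r + (c 3 * D 3 J + c 4 * (\<Sum>p=1..<J. E4 (max p r) + 2 * b ^ 3 * \<rho>))"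
  for c :: "nat => real"

text \<open>Unrolling the past decouples the pair from it, and the centred part of the pair is small: only the
  covariance survives.\<close>

lemma pair_term:
  assumes sc: "smooth_chain \<psi> c" and J: "1 <= J" and rJ: "r < J"
    and g: "\<And>p. 1 <= p ==> p < J ==> p <= i ==> \<bar>E (%w. \<psi> 3 (S (i - p) w))\<bar> <= g" and g0: "0 <= g"
  shows "\<bar>E (%w. \<psi> 2 (S i w) * (W (Suc i) w * W (Suc i + r) w)) - E (%w. \<psi> 2 (S i w)) * \<gamma> r\<bar>
    <= err_pair c g J r"
proof -
  interpret smooth_chain \<psi> c by (rule sc)
  have [measurable]: "\<psi> 2 \<in> borel_measurable borel" "\<psi> 3 \<in> borel_measurable borel" by (rule measurable; simp)+
  define a d where "a = Suc i" and "d = Suc i + r"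
  have ad: "a <= d" "d - a = r" unfolding a_def d_def by auto
  define P where "P w = W a w * W d w - \<gamma> r" for w
  have Pi: "integrable M P" unfolding P_def by (rule W_centred_integrable)
  have P0: "E P = 0"
    unfolding P_def using W_integrable(2)[of a d] cov'[OF ad(1)] ad prob_space by simp
  have Pm[measurable]: "P \<in> borel_measurable M" unfolding P_def by measurable
  have c34: "0 <= c 3" "0 <= c 4" using c_nonneg by auto
  have WP: "integrable M (%w. W l w * P w)" for l unfolding P_def by (rule W_centred_integrable)
  have Pb: "(\<And>i w. \<bar>W i w\<bar> <= b) ==> \<bar>P w\<bar> <= 2 * b ^ 2" for w
    using pair_bounded[of a w d] cov'[OF ad(1)] ad unfolding P_def by simp
  have cX: "cond_le M (F l) (%w. W l w * P w) (E (%w. \<bar>W l w * P w\<bar>))" for l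
    by (rule cond_le_abs[OF WP _ subalg]) simp
  have WWP: "integrable M (%w. (W l w)\<^sup>2 * P w)" for l
    using W_centred_integrable(5)[of l l a d "\<gamma> r"] unfolding P_def by (simp add: power2_eq_square mult.assoc)
  have gap: "a - (Suc i - p) = p" "Suc i - p < a" if "1 <= p" "p <= i" for p
    using that unfolding a_def by auto
  have main: "\<bar>E (%w. \<psi> 2 (S i w) * P w)\<bar> <= err_pair c g J r"
    unfolding err_pair_def
  proof (rule telescope_second_derivative[OF sc Pi P0 J _ D_nonneg _ WP WWP])
    show "cond_le M (F (Suc i - J)) P (D 2 J)" if "J <= Suc i"
      using mix02[of "Suc i - J" J a d] that J ad unfolding P_def a_def by simp
    show "integrable M (%w. (X l w - W l w) * P w)"
      "E (%w. \<bar>(X l w - W l w) * P w\<bar>) <= 2 * b ^ 2 * \<rho>" for l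
      using cond_le_X(3,4)[OF cX WP Pm Pb] b_nonneg by auto
    fix p assume p: "1 <= p" "p < J" "p <= i"
    define l where "l = Suc i - p"
    have l: "l < a" "a - l = p" "Suc (i - p) = l" using p unfolding l_def a_def by auto
    show "\<bar>E (%w. W (Suc i - p) w * P w)\<bar> <= D 3 (max p r)"
      using third_moment_gap[OF l(1) ad(1)] unfolding P_def ad l l_def[symmetric] .
    show "cond_le M (F (Suc i - p)) (%w. (W (Suc i - p) w)\<^sup>2 * P w) (E4 (max p r))"
      using quad_square_pair[OF l(1) ad(1)] unfolding P_def ad l l_def[symmetric] .
    show "\<bar>E (%w. \<psi> 3 (S (i - p) w))\<bar> <= g" by (rule g[OF p])
    let ?Z = "%w. W (Suc i - p) w * P w - E (%w. W (Suc i - p) w * P w)"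
    show "\<bar>E (%w. \<psi> 3 (S (i - p) w) * ?Z w)\<bar>
      <= c 3 * (D 3 J + D 2 0 * D 1 J) + c 4 * (\<Sum>p'=1..<J. E4 (max (max p' p) r) + 4 * b ^ 3 * \<rho>)"
    proof (rule telescope_lipschitz[OF _ _ J])
      show "integrable M ?Z" using WP by simp
      show "E ?Z = 0" using WP prob_space by simp
      show "(c 4)-lipschitz_on UNIV (\<psi> 3)" using lipschitz[of 3] by simp
      show "\<bar>\<psi> 3 x\<bar> <= c 3" for x using bound[of 3] by simp
      show "0 <= D 3 J + D 2 0 * D 1 J" using D_nonneg by simp
      show "cond_le M (F (Suc (i - p) - J)) ?Z (D 3 J + D 2 0 * D 1 J)" if "J <= Suc (i - p)"
        using triple_base[of "l - J" J l a d] that J l ad unfolding P_def l_def[symmetric] by simp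
      fix p' assume p': "1 <= p'" "p' < J"
      show "0 <= E4 (max (max p' p) r) + 4 * b ^ 3 * \<rho>"
        using E4_ge(2) b_nonneg \<rho>_nonneg by simp
      assume pp: "p' <= i - p"
      have m: "Suc (i - p) - p' < l" "l - (Suc (i - p) - p') = p'" using p p' pp unfolding l_def by auto
      show "cond_le M (F (Suc (i - p) - p')) (%w. X (Suc (i - p) - p') w * ?Z w)
          (E4 (max (max p' p) r) + 4 * b ^ 3 * \<rho>)"
        using quad_X_triple(1)[OF m(1) l(1) ad(1)] unfolding m(2) l(2) ad(2) P_def l_def[symmetric] .
    qed
  next
    fix p
    show "0 <= c 3 * (D 3 J + D 2 0 * D 1 J) + c 4 * (\<Sum>p'=1..<J. E4 (max (max p' p) r) + 4 * b ^ 3 * \<rho>)"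
      using c34 D_nonneg E4_ge(2) b_nonneg \<rho>_nonneg
      by (intro add_nonneg_nonneg mult_nonneg_nonneg sum_nonneg) auto
  qed (use D_nonneg E4_ge(2) b_nonneg \<rho>_nonneg g0 in auto)
  have \<psi>b: "\<bar>\<psi> 2 (S i w)\<bar> <= c 2" for w using bound[of 2] by simp
  have i1: "integrable M (%w. \<psi> 2 (S i w) * (W a w * W d w))" "integrable M (%w. \<psi> 2 (S i w) * \<gamma> r)"
    by (rule integrable_bounded_mult[OF _ _ \<psi>b]; (use W_integrable in simp)?; measurable)+
  then have "E (%w. \<psi> 2 (S i w) * P w)
      = E (%w. \<psi> 2 (S i w) * (W a w * W d w)) - E (%w. \<psi> 2 (S i w)) * \<gamma> r"
    unfolding P_def by (simp add: right_diff_distrib)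
  with main show ?thesis unfolding a_def d_def by simp
qed

text \<open>The mean of the later factors is at most \<open>D 3 r\<close> and is weighted by \<open>g\<close>. For the centred product
a telescoping with the Lipschitz property of the third derivative suffices.\<close>

lemma square_term:
  assumes sc: "smooth_chain \<psi> c" and J: "1 <= J"
    and g: "\<bar>E (%w. \<psi> 3 (S i w))\<bar> <= g"
  shows "\<bar>E (%w. \<psi> 3 (S i w) * (W (Suc i) w * (W (Suc i) w * W (Suc i + r) w)))\<bar> <= err_square c g J r"
proof -
  interpret smooth_chain \<psi> c by (rule sc)
  have [measurable]: "\<psi> 3 \<in> borel_measurable borel" by (rule measurable) simp
  define a d where "a = Suc i" and "d = Suc i + r"
  have ad: "a <= d" "d - a = r" unfolding a_def d_def by auto
  define k where "k = E (%w. W a w * (W a w * W d w))"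
  define Z where "Z w = W a w * (W a w * W d w) - k" for w
  have Zi: "integrable M Z" unfolding Z_def by (rule W_centred_integrable)
  have main: "\<bar>E (%w. \<psi> 3 (S i w) * Z w)\<bar>
      <= c 3 * D 3 J + c 4 * (\<Sum>p=1..<J. E4 (max p r) + 2 * b ^ 3 * \<rho>)"
  proof (rule telescope_lipschitz[OF Zi _ J _ _ _ D_nonneg])
    show "E Z = 0" unfolding Z_def using W_integrable(3)[of a a d] prob_space by (simp add: k_def)
    show "(c 4)-lipschitz_on UNIV (\<psi> 3)" using lipschitz[of 3] by simp
    show "\<bar>\<psi> 3 x\<bar> <= c 3" for x using bound[of 3] by simp
    show "cond_le M (F (Suc i - J)) Z (D 3 J)" if "J <= Suc i"
      using mix03[of "Suc i - J" J a a d] that J ad unfolding Z_def k_def a_def by simp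
    fix p assume p: "1 <= p" "p < J"
    show "0 <= E4 (max p r) + 2 * b ^ 3 * \<rho>" using E4_ge(2) b_nonneg \<rho>_nonneg by simp
    assume pi: "p <= i"
    have l: "Suc i - p < a" "a - (Suc i - p) = p" using p pi unfolding a_def by auto
    show "cond_le M (F (Suc i - p)) (%w. X (Suc i - p) w * Z w) (E4 (max p r) + 2 * b ^ 3 * \<rho>)"
      using quad_X_square(1)[OF l(1) ad(1)] unfolding l(2) ad(2) Z_def k_def .
  qed
  have \<psi>b: "\<bar>\<psi> 3 (S i w)\<bar> <= c 3" for w using bound[of 3] by simp
  have i1: "integrable M (%w. \<psi> 3 (S i w) * Z w)" "integrable M (%w. \<psi> 3 (S i w) * 1)"
    by (rule integrable_bounded_mult[OF _ _ \<psi>b]; (use Zi in simp)?; measurable)+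
  have "E (%w. \<psi> 3 (S i w) * (W a w * (W a w * W d w)))
      = E (%w. \<psi> 3 (S i w) * Z w + k * \<psi> 3 (S i w))"
    unfolding Z_def by (simp add: algebra_simps)
  also have "... = E (%w. \<psi> 3 (S i w) * Z w) + k * E (%w. \<psi> 3 (S i w))"
    using i1 by simp
  finally have eq: "E (%w. \<psi> 3 (S i w) * (W a w * (W a w * W d w)))
      = E (%w. \<psi> 3 (S i w) * Z w) + k * E (%w. \<psi> 3 (S i w))" .
  have "\<bar>k\<bar> <= D 3 r" using third_moment_square[OF ad(1)] unfolding ad(2) k_def .
  then have "\<bar>k * E (%w. \<psi> 3 (S i w))\<bar> <= g * D 3 r"
    unfolding abs_mult using g by (subst mult.commute) (intro mult_mono, auto intro: order_trans[OF abs_ge_zero])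
  with main eq have "\<bar>E (%w. \<psi> 3 (S i w) * (W a w * (W a w * W d w)))\<bar> <= err_square c g J r"
    unfolding err_square_def by linarith
  then show ?thesis unfolding a_def d_def .
qed

text \<open>Unrolling produces second derivatives at earlier times, which have to be moved to the present: one
time step changes their mean by at most this.\<close>

definition "drift c J = c 3 * \<rho> + c 4 / 2 * D 2 0 + (c 3 * D 1 J + c 4 * (\<Sum>p=1..<J. D 2 p + b * \<rho>))"
  for c :: "nat => real"

definition "err_step c g J =
  c 1 * \<rho> + c 4 / 24 * D 4 0 + c 1 * D 1 J + (\<Sum>r=1..<J. c 2 * (b * \<rho>) + c 4 / 6 * D 4 r)
  + (\<Sum>r<J. err_pair c g J r + err_square c g J r) + (\<Sum>r=1..<J. D 2 r * (real r * drift c J))"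
  for c :: "nat => real"

lemma X_times_W: "m < a ==> cond_le M (F m) (%w. X m w * W a w) (D 2 (a - m) + b * \<rho>)"
  "integrable M (%w. (X m w - W m w) * W a w)"
  "E (%w. \<bar>(X m w - W m w) * W a w\<bar>) <= b * \<rho>"
proof -
  show "cond_le M (F m) (%w. X m w * W a w) (D 2 (a - m) + b * \<rho>)" if "m < a"
    using cond_le_X(1)[OF mix12[of m "a - m" a], of b] that W_integrable b_nonneg by simp
  have "cond_le M (F m) (%w. W m w * W a w) (E (%w. \<bar>W m w * W a w\<bar>))"
    by (rule cond_le_abs[OF W_integrable(2) _ subalg]) simp
  from cond_le_X(3,4)[OF this, of b]
  show "integrable M (%w. (X m w - W m w) * W a w)"
    "E (%w. \<bar>(X m w - W m w) * W a w\<bar>) <= b * \<rho>"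
    using W_integrable b_nonneg by auto
qed

lemma second_derivative_drift:
  assumes sc: "smooth_chain \<psi> c" and J: "1 <= J"
  shows "\<bar>E (%w. \<psi> 2 (S (Suc n) w)) - E (%w. \<psi> 2 (S n w))\<bar> <= drift c J"
proof -
  interpret smooth_chain \<psi> c by (rule sc)
  have [measurable]: "\<psi> 2 \<in> borel_measurable borel" "\<psi> 3 \<in> borel_measurable borel" by (rule measurable; simp)+
  define l where "l = Suc n"
  have c34: "0 <= c 3" "0 <= c 4" using c_nonneg by auto
  define V1 where "V1 w = \<psi> 2 (S n w + X l w) - \<psi> 2 (S n w + W l w)" for w
  define V2 where "V2 w = \<psi> 2 (S n w + W l w) - \<psi> 2 (S n w) - \<psi> 3 (S n w) * W l w" for w
  have m: "V1 \<in> borel_measurable M" "V2 \<in> borel_measurable M" unfolding V1_def V2_def by measurable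
  have V2: "\<bar>V2 w\<bar> <= c 4 / 2 * \<bar>W l w * W l w\<bar>" for w
    using taylor2[of 2 "S n w" "W l w"] unfolding V2_def by (simp add: eval_nat_numeral)
  have V1: "\<bar>V1 w\<bar> <= c 3 * \<bar>X l w - W l w\<bar>" for w
    using increment[of 2 "S n w + W l w" "X l w - W l w"] unfolding V1_def
    by (simp add: eval_nat_numeral algebra_simps)
  note i1 = integrable_dominated[OF X_minus_W_integrable m(1) V1 c34(1)]
  have i2: "integrable M V2" by (rule integrable_dominated[OF W_integrable(2) m(2) V2]) (use c34 in simp)
  have b1: "\<bar>E V1\<bar> <= c 3 * \<rho>"
    by (rule abs_expectation_le[OF X_minus_W_integrable i1 V1 trunc_err c34(1)])
  have b2: "\<bar>E V2\<bar> <= c 4 / 2 * D 2 0"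
    by (rule abs_expectation_le[OF W_integrable(2) i2 V2 abs_WW]) (use c34 in simp)
  have b3: "\<bar>E (%w. \<psi> 3 (S n w) * W l w)\<bar> <= c 3 * D 1 J + c 4 * (\<Sum>p=1..<J. D 2 p + b * \<rho>)"
  proof (rule telescope_lipschitz[OF W_integrable(1) W_mean J _ _ _ D_nonneg])
    show "(c 4)-lipschitz_on UNIV (\<psi> 3)" using lipschitz[of 3] by simp
    show "\<bar>\<psi> 3 x\<bar> <= c 3" for x using bound[of 3] by simp
    show "cond_le M (F (Suc n - J)) (W l) (D 1 J)" if "J <= Suc n"
      using mix01[of "Suc n - J" J l] that J unfolding l_def by simp
    fix p assume p: "1 <= p" "p < J"
    show "0 <= D 2 p + b * \<rho>" using D_nonneg b_nonneg \<rho>_nonneg by simp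
    assume "p <= n"
    then show "cond_le M (F (Suc n - p)) (%w. X (Suc n - p) w * W l w) (D 2 p + b * \<rho>)"
      using X_times_W(1)[of "Suc n - p" l] p unfolding l_def by simp
  qed
  have \<psi>b: "\<bar>\<psi> 3 (S n w)\<bar> <= c 3" for w using bound[of 3] by simp
  have i3: "integrable M (%w. \<psi> 3 (S n w) * W l w)"
    by (rule integrable_bounded_mult[OF W_integrable(1) _ \<psi>b]) measurable
  have i0: "integrable M (%w. \<psi> 2 (S k w))" for k
    by (rule integrable_const_bound[of _ "c 2"]) (use bound[of 2] in auto)
  have "E (%w. \<psi> 2 (S l w)) - E (%w. \<psi> 2 (S n w))
      = E (%w. \<psi> 2 (S l w) - \<psi> 2 (S n w))" using i0 by simp
  also have "... = E (%w. V1 w + V2 w + \<psi> 3 (S n w) * W l w)"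
    unfolding l_def S_Suc V1_def V2_def by simp
  also have "... = E V1 + E V2 + E (%w. \<psi> 3 (S n w) * W l w)"
    using i1 i2 i3 by simp
  finally show ?thesis using b1 b2 b3 unfolding drift_def l_def by linarith
qed

lemma second_derivative_drift_r:
  assumes sc: "smooth_chain \<psi> c" and J: "1 <= J"
  shows "\<bar>E (%w. \<psi> 2 (S (n + r) w)) - E (%w. \<psi> 2 (S n w))\<bar> <= real r * drift c J"
proof (induction r)
  case (Suc r)
  then show ?case using second_derivative_drift[OF sc J, of "n + r"] by (simp add: algebra_simps)
qed simp

text \<open>The first order term is where dependence enters: each of the recent increments of the first
derivative contributes one covariance times a mean second derivative.\<close>

lemma first_derivative_term:
  assumes sc: "smooth_chain \<psi> c" and J: "1 <= J"
    and g: "\<And>l. l <= i ==> i < l + 2 * J ==> \<bar>E (%w. \<psi> 3 (S l w))\<bar> <= g" and g0: "0 <= g"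
    and nonneg: "\<And>r. 0 <= err_pair c g J r" "\<And>r. 0 <= err_square c g J r"
  shows "\<bar>E (%w. \<psi> 1 (S i w) * W (Suc i) w)
      - (\<Sum>r=1..<min J (Suc i). E (%w. \<psi> 2 (S (i - r) w)) * \<gamma> r)\<bar>
    <= c 1 * D 1 J + (\<Sum>r=1..<J. (c 2 * (b * \<rho>) + c 4 / 6 * D 4 r) + (err_pair c g J r + err_square c g J r / 2))"
proof -
  interpret smooth_chain \<psi> c by (rule sc)
  have [measurable]: "\<psi> 1 \<in> borel_measurable borel" "\<psi> 2 \<in> borel_measurable borel" "\<psi> 3 \<in> borel_measurable borel"
    by (rule measurable; simp)+
  have c24: "0 <= c 2" "0 <= c 4" using c_nonneg by auto
  show ?thesis
  proof (rule telescope_past[OF W_integrable(1) W_mean J _ _ _ D_nonneg])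
    show "\<psi> 1 \<in> borel_measurable borel" by measurable
    show "\<bar>\<psi> 1 x\<bar> <= c 1" for x using bound[of 1] by simp
    show "cond_le M (F (Suc i - J)) (W (Suc i)) (D 1 J)" if "J <= Suc i"
      using mix01[of "Suc i - J" J "Suc i"] that J by simp
    fix r assume r: "1 <= r" "r < J"
    show "0 <= (c 2 * (b * \<rho>) + c 4 / 6 * D 4 r) + (err_pair c g J r + err_square c g J r / 2)"
      using c24 nonneg D_nonneg b_nonneg \<rho>_nonneg by simp
    assume ri: "r <= i"
    define n where "n = i - r"
    define l k where "l = Suc n" and "k = Suc i"
    have lk: "Suc i - r = l" "i - r = n" "k = l + r" "Suc n + r = k" "l < k" "l <= k" "k - l = r"
      using r ri unfolding l_def k_def n_def by auto
    define V1 where "V1 w = \<psi> 1 (S n w + X l w) - \<psi> 1 (S n w + W l w)" for w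
    define V3 where "V3 w = \<psi> 1 (S n w + W l w) - \<psi> 1 (S n w) - \<psi> 2 (S n w) * W l w
      - \<psi> 3 (S n w) * (W l w)\<^sup>2 / 2" for w
    have V1: "\<bar>V1 w\<bar> <= c 2 * \<bar>X l w - W l w\<bar>" for w
      using increment[of 1 "S n w + W l w" "X l w - W l w"] unfolding V1_def
      by (simp add: eval_nat_numeral algebra_simps)
    have V3: "\<bar>V3 w\<bar> <= c 4 / 6 * \<bar>W l w * (W l w * W l w)\<bar>" for w
      using taylor3[of 1 "S n w" "W l w"] unfolding V3_def by (simp add: eval_nat_numeral abs_mult)
    have [measurable]: "S n \<in> borel_measurable (F l)" "W l \<in> borel_measurable (F l)"
      using F_mono[OF S_meas_F, of n l] W_meas unfolding l_def by auto
    have V3m: "V3 \<in> borel_measurable (F l)" unfolding V3_def by measurable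
    note [measurable] = F_M[OF V3m]
    have V1M[measurable]: "V1 \<in> borel_measurable M" unfolding V1_def by measurable
    have V1W: "\<bar>V1 w * W k w\<bar> <= c 2 * \<bar>(X l w - W l w) * W k w\<bar>" for w
      using mult_right_mono[OF V1[of w], of "\<bar>W k w\<bar>"] by (simp add: abs_mult mult.assoc)
    have i1: "integrable M (%w. V1 w * W k w)"
      by (rule integrable_dominated[OF X_times_W(2) _ V1W c24(1)]) measurable
    have b1: "\<bar>E (%w. V1 w * W k w)\<bar> <= c 2 * (b * \<rho>)"
      by (rule abs_expectation_le[OF X_times_W(2) i1 V1W X_times_W(3) c24(1)])
    have V3W: "\<bar>V3 w * W k w\<bar> <= c 4 / 6 * \<bar>W l w * (W l w * (W l w * W k w))\<bar>" for w
      using mult_right_mono[OF V3[of w], of "\<bar>W k w\<bar>"] by (simp only: abs_mult mult.assoc abs_ge_zero)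
    have i3: "integrable M (%w. V3 w * W k w)"
      by (rule integrable_dominated[OF W_integrable(4)[of l l l k] _ V3W]) (use c24 in auto)
    have b3: "\<bar>E (%w. V3 w * W k w)\<bar> <= c 4 / 6 * D 4 r"
    proof (rule cond_le_integral, rule cond_le_mult[OF _ _ V3m V3])
      show "cond_le M (F l) (%w. W l w * (W l w * W l w) * W k w) (D 4 r)"
        using mix34[of l l l r k] lk r by (simp add: mult.assoc)
    qed (use c24 in auto)
    have b2: "\<bar>E (%w. \<psi> 2 (S n w) * (W l w * W k w)) - E (%w. \<psi> 2 (S n w)) * \<gamma> r\<bar> <= err_pair c g J r"
      unfolding lk(3) unfolding l_def
    proof (rule pair_term[OF sc J r(2) _ g0])
      fix p assume "1 <= p" "p < J" "p <= n"
      then show "\<bar>E (%w. \<psi> 3 (S (n - p) w))\<bar> <= g"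
        using r ri unfolding n_def by (intro g) auto
    qed
    have b4: "\<bar>E (%w. \<psi> 3 (S n w) * (W l w * (W l w * W k w)))\<bar> <= err_square c g J r"
      unfolding lk(3) unfolding l_def using g[of n] r ri unfolding n_def by (intro square_term[OF sc J]) auto
    have \<psi>b: "\<bar>\<psi> 3 (S n w)\<bar> <= c 3" "\<bar>\<psi> 2 (S n w)\<bar> <= c 2" for w using bound[of 3] bound[of 2] by auto
    have i2: "integrable M (%w. \<psi> 2 (S n w) * (W l w * W k w))"
      by (rule integrable_bounded_mult[OF W_integrable(2) _ \<psi>b(2)]) measurable
    have i4: "integrable M (%w. \<psi> 3 (S n w) * (W l w * (W l w * W k w)))"
      by (rule integrable_bounded_mult[OF W_integrable(3) _ \<psi>b(1)]) measurable
    have "E (%w. (\<psi> 1 (S l w) - \<psi> 1 (S n w)) * W k w)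
        = E (%w. V1 w * W k w + V3 w * W k w + \<psi> 2 (S n w) * (W l w * W k w)
          + \<psi> 3 (S n w) * (W l w * (W l w * W k w)) / 2)"
      unfolding V1_def V3_def l_def S_Suc by (intro Bochner_Integration.integral_cong refl)
        (simp add: algebra_simps power2_eq_square)
    also have "... = E (%w. V1 w * W k w) + E (%w. V3 w * W k w)
        + E (%w. \<psi> 2 (S n w) * (W l w * W k w))
        + E (%w. \<psi> 3 (S n w) * (W l w * (W l w * W k w))) / 2"
      using i1 i2 i3 i4 by simp
    finally show "\<bar>E (%w. (\<psi> 1 (S (Suc i - r) w) - \<psi> 1 (S (i - r) w)) * W (Suc i) w)
        - E (%w. \<psi> 2 (S (i - r) w)) * \<gamma> r\<bar>
        <= (c 2 * (b * \<rho>) + c 4 / 6 * D 4 r) + (err_pair c g J r + err_square c g J r / 2)"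
      using b1 b2 b3 b4 unfolding lk(1,2) unfolding k_def[symmetric] by linarith
  qed
qed

text \<open>One step of the replacement: the sum moves by one summand, and up to the error this has the
  effect of a Gaussian increment whose variance is the truncated series of covariances.\<close>

lemma one_step:
  assumes sc: "smooth_chain \<psi> c" and J: "1 <= J"
    and g: "\<And>l. l <= i ==> i < l + 2 * J ==> \<bar>E (%w. \<psi> 3 (S l w))\<bar> <= g" and g0: "0 <= g"
  shows "\<bar>E (%w. \<psi> 0 (S (Suc i) w)) - E (%w. \<psi> 0 (S i w))
      - (\<gamma> 0 + 2 * (\<Sum>r=1..<min J (Suc i). \<gamma> r)) / 2 * E (%w. \<psi> 2 (S i w))\<bar> <= err_step c g J"
proof -
  interpret smooth_chain \<psi> c by (rule sc)
  have [measurable]: "\<psi> 0 \<in> borel_measurable borel" "\<psi> 1 \<in> borel_measurable borel"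
    "\<psi> 2 \<in> borel_measurable borel" "\<psi> 3 \<in> borel_measurable borel"
    by (rule measurable; simp)+
  have c: "0 <= c 1" "0 <= c 2" "0 <= c 3" "0 <= c 4" using c_nonneg by auto
  note nn = c D_nonneg b_nonneg \<rho>_nonneg E4_ge(2) g0
  have ep: "0 <= err_pair c g J r" and es: "0 <= err_square c g J r" for r
    unfolding err_pair_def err_square_def using nn
    by (auto intro!: add_nonneg_nonneg mult_nonneg_nonneg sum_nonneg)
  define k where "k = Suc i"
  define V1 where "V1 w = \<psi> 0 (S i w + X k w) - \<psi> 0 (S i w + W k w)" for w
  define V4 where "V4 w = \<psi> 0 (S i w + W k w) - \<psi> 0 (S i w) - \<psi> 1 (S i w) * W k w
      - \<psi> 2 (S i w) * (W k w)\<^sup>2 / 2 - \<psi> 3 (S i w) * W k w ^ 3 / 6" for w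
  have V1: "\<bar>V1 w\<bar> <= c 1 * \<bar>X k w - W k w\<bar>" for w
    using increment[of 0 "S i w + W k w" "X k w - W k w"] unfolding V1_def by (simp add: algebra_simps)
  have V4: "\<bar>V4 w\<bar> <= c 4 / 24 * \<bar>W k w ^ 4\<bar>" for w
    using taylor4[of "S i w" "W k w"] unfolding V4_def by (simp add: abs_of_nonneg zero_le_even_power)
  have m: "V1 \<in> borel_measurable M" "V4 \<in> borel_measurable M" unfolding V1_def V4_def by measurable
  note i1 = integrable_dominated[OF X_minus_W_integrable m(1) V1 c(1)]
  have i4: "integrable M V4" by (rule integrable_dominated[OF W_int4 m(2) V4]) (use c in simp)
  have b1: "\<bar>E V1\<bar> <= c 1 * \<rho>"
    by (rule abs_expectation_le[OF X_minus_W_integrable i1 V1 trunc_err c(1)])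
  have b4: "\<bar>E V4\<bar> <= c 4 / 24 * D 4 0"
  proof (rule abs_expectation_le[OF W_int4 i4 V4])
    show "E (%w. \<bar>W k w ^ 4\<bar>) <= D 4 0" using moment[of 4 k] by (simp add: power_abs)
  qed (use c in simp)
  have b2: "\<bar>E (%w. \<psi> 2 (S i w) * (W k w * W k w)) - E (%w. \<psi> 2 (S i w)) * \<gamma> 0\<bar> <= err_pair c g J 0"
    using pair_term[OF sc J, of 0 i g] J g g0 unfolding k_def by simp
  have b3: "\<bar>E (%w. \<psi> 3 (S i w) * (W k w * (W k w * W k w)))\<bar> <= err_square c g J 0"
    using square_term[OF sc J, of i g 0] J g[of i] unfolding k_def by simp
  have \<psi>b: "\<bar>\<psi> 3 (S i w)\<bar> <= c 3" "\<bar>\<psi> 2 (S i w)\<bar> <= c 2" "\<bar>\<psi> 1 (S i w)\<bar> <= c 1" for w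
    using bound[of 3] bound[of 2] bound[of 1] by auto
  have j1: "integrable M (%w. \<psi> 1 (S i w) * W k w)"
    by (rule integrable_bounded_mult[OF W_integrable(1) _ \<psi>b(3)]) measurable
  have j2: "integrable M (%w. \<psi> 2 (S i w) * (W k w * W k w))"
    by (rule integrable_bounded_mult[OF W_integrable(2) _ \<psi>b(2)]) measurable
  have j3: "integrable M (%w. \<psi> 3 (S i w) * (W k w * (W k w * W k w)))"
    by (rule integrable_bounded_mult[OF W_integrable(3) _ \<psi>b(1)]) measurable
  have j0: "integrable M (%w. \<psi> 0 (S n w))" for n
  proof (rule Bochner_Integration.integrable_bound)
    show "integrable M (%w. \<bar>\<psi> 0 0\<bar> + c 1 * \<bar>S n w\<bar>)" using S_integrable[of n] by simp
    show "AE w in M. norm (\<psi> 0 (S n w)) <= norm (\<bar>\<psi> 0 0\<bar> + c 1 * \<bar>S n w\<bar>)"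
    proof (rule AE_I2)
      fix w
      show "norm (\<psi> 0 (S n w)) <= norm (\<bar>\<psi> 0 0\<bar> + c 1 * \<bar>S n w\<bar>)"
        using increment[of 0 0 "S n w"] abs_ge_self[of "\<bar>\<psi> 0 0\<bar> + c 1 * \<bar>S n w\<bar>"] by simp
    qed
  qed measurable
  have "E (%w. \<psi> 0 (S (Suc i) w)) - E (%w. \<psi> 0 (S i w))
      = E (%w. \<psi> 0 (S (Suc i) w) - \<psi> 0 (S i w))" using j0 by simp
  also have "... = E (%w. V1 w + V4 w + \<psi> 1 (S i w) * W k w + \<psi> 2 (S i w) * (W k w * W k w) / 2
      + \<psi> 3 (S i w) * (W k w * (W k w * W k w)) / 6)"
    unfolding V1_def V4_def k_def S_Suc
    by (intro Bochner_Integration.integral_cong refl) (simp add: algebra_simps power2_eq_square power3_eq_cube)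
  also have "... = E V1 + E V4 + E (%w. \<psi> 1 (S i w) * W k w)
      + E (%w. \<psi> 2 (S i w) * (W k w * W k w)) / 2
      + E (%w. \<psi> 3 (S i w) * (W k w * (W k w * W k w))) / 6"
    using i1 i4 j1 j2 j3 by simp
  finally have eq: "E (%w. \<psi> 0 (S (Suc i) w)) - E (%w. \<psi> 0 (S i w)) = ..." .
  let ?e2 = "%n. E (%w. \<psi> 2 (S n w))"
  let ?R = "{1..<min J (Suc i)}"
  have b5: "\<bar>(\<Sum>r\<in>?R. ?e2 (i - r) * \<gamma> r) - (\<Sum>r\<in>?R. \<gamma> r) * ?e2 i\<bar> <= (\<Sum>r=1..<J. D 2 r * (real r * drift c J))"
  proof -
    have "(\<Sum>r\<in>?R. \<gamma> r * (?e2 i - ?e2 (i - r))) = (\<Sum>r\<in>?R. \<gamma> r) * ?e2 i - (\<Sum>r\<in>?R. ?e2 (i - r) * \<gamma> r)"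
      by (simp add: right_diff_distrib sum_subtractf sum_distrib_right mult.commute)
    then have "\<bar>(\<Sum>r\<in>?R. ?e2 (i - r) * \<gamma> r) - (\<Sum>r\<in>?R. \<gamma> r) * ?e2 i\<bar> = \<bar>\<Sum>r\<in>?R. \<gamma> r * (?e2 i - ?e2 (i - r))\<bar>"
      by (simp only: abs_minus_commute)
    also have "... <= (\<Sum>r\<in>?R. \<bar>\<gamma> r * (?e2 i - ?e2 (i - r))\<bar>)" by (rule sum_abs)
    also have "... <= (\<Sum>r\<in>?R. D 2 r * (real r * drift c J))"
    proof (rule sum_mono)
      fix r assume "r \<in> ?R"
      then have r: "1 <= r" "i - r + r = i" by auto
      show "\<bar>\<gamma> r * (?e2 i - ?e2 (i - r))\<bar> <= D 2 r * (real r * drift c J)"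
        unfolding abs_mult using second_derivative_drift_r[OF sc J, of "i - r" r] r
        by (intro mult_mono \<gamma>_le D_nonneg) auto
    qed
    also have "... <= (\<Sum>r=1..<J. D 2 r * (real r * drift c J))"
    proof (rule sum_mono2)
      show "0 <= D 2 r * (real r * drift c J)" for r
        unfolding drift_def using nn by (auto intro!: add_nonneg_nonneg mult_nonneg_nonneg sum_nonneg)
    qed auto
    finally show ?thesis .
  qed
  have b6: "(\<Sum>r=1..<J. (c 2 * (b * \<rho>) + c 4 / 6 * D 4 r) + (err_pair c g J r + err_square c g J r / 2))
      + err_pair c g J 0 / 2 + err_square c g J 0 / 6
    <= (\<Sum>r=1..<J. c 2 * (b * \<rho>) + c 4 / 6 * D 4 r) + (\<Sum>r<J. err_pair c g J r + err_square c g J r)"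
  proof -
    have "(\<Sum>r<J. err_pair c g J r + err_square c g J r)
        = (err_pair c g J 0 + err_square c g J 0) + (\<Sum>r=1..<J. err_pair c g J r + err_square c g J r)"
      using J sum.atLeast_Suc_lessThan[of 0 J "%r. err_pair c g J r + err_square c g J r"]
      by (simp add: lessThan_atLeast0)
    moreover have "(\<Sum>r=1..<J. err_pair c g J r + err_square c g J r / 2) <= (\<Sum>r=1..<J. err_pair c g J r + err_square c g J r)"
      using es by (intro sum_mono) simp
    ultimately show ?thesis using ep[of 0] es[of 0] by (simp add: sum.distrib)
  qed
  have b0: "\<bar>E (%w. \<psi> 1 (S i w) * W k w) - (\<Sum>r\<in>?R. ?e2 (i - r) * \<gamma> r)\<bar>
    <= c 1 * D 1 J + (\<Sum>r=1..<J. (c 2 * (b * \<rho>) + c 4 / 6 * D 4 r) + (err_pair c g J r + err_square c g J r / 2))"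
    unfolding k_def by (rule first_derivative_term[OF sc J g g0 ep es])
  have e: "(\<gamma> 0 + 2 * (\<Sum>r\<in>?R. \<gamma> r)) / 2 * ?e2 i = ?e2 i * \<gamma> 0 / 2 + (\<Sum>r\<in>?R. \<gamma> r) * ?e2 i"
    by (simp add: field_simps)
  note bb = b0[unfolded abs_le_iff] b1[unfolded abs_le_iff] b2[unfolded abs_le_iff] b3[unfolded abs_le_iff]
    b4[unfolded abs_le_iff] b5[unfolded abs_le_iff] b6
  show ?thesis unfolding eq e err_step_def abs_le_iff
    by (intro conjI) (use bb in linarith)+
qed

end

section \<open>Summing over the gaps\<close>

text \<open>The sum is split according to the largest index; the others range below it.\<close>

lemma sum_max_two:
  fixes f :: "nat => real"
  assumes f: "\<And>j. 0 <= f j"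
  shows "(\<Sum>r<J. \<Sum>p=1..<J. f (max p r)) <= 2 * (\<Sum>j<J. real (Suc j) * f j)"
proof -
  have card: "(\<Sum>q<J. of_bool (q <= a) :: real) = real (Suc a)" if "a < J" for a
  proof -
    have "{..<J} \<inter> {q. q <= a} = {..a}" using that by auto
    then show ?thesis by (simp add: of_bool_def sum.If_cases)
  qed
  have "(\<Sum>r<J. \<Sum>p=1..<J. f (max p r)) <= (\<Sum>r<J. \<Sum>p<J. f (max p r))"
    by (intro sum_mono sum_mono2) (use f in auto)
  also have "... <= (\<Sum>r<J. \<Sum>p<J. of_bool (p <= r) * f r + of_bool (r <= p) * f p)"
    by (intro sum_mono) (use f in \<open>auto simp: max_def\<close>)
  also have "... = (\<Sum>r<J. (\<Sum>p<J. of_bool (p <= r)) * f r) + (\<Sum>p<J. (\<Sum>r<J. of_bool (r <= p)) * f p)"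
    unfolding sum.distrib sum_distrib_right by (subst (2) sum.swap) simp
  also have "... = 2 * (\<Sum>j<J. real (Suc j) * f j)"
    using card by simp
  finally show ?thesis .
qed

lemma sum_max_three:
  fixes f :: "nat => real"
  assumes f: "\<And>j. 0 <= f j"
  shows "(\<Sum>r<J. \<Sum>p=1..<J. \<Sum>p'=1..<J. f (max (max p' p) r)) <= 3 * (\<Sum>j<J. real (Suc j) ^ 2 * f j)"
proof -
  have card: "(\<Sum>q<J. of_bool (q <= a) :: real) = real (Suc a)" if "a < J" for a
  proof -
    have "{..<J} \<inter> {q. q <= a} = {..a}" using that by auto
    then show ?thesis by (simp add: of_bool_def sum.If_cases)
  qed
  have card2: "(\<Sum>p<J. \<Sum>q<J. of_bool (p <= a) * of_bool (q <= a) * f a) = real (Suc a) ^ 2 * f a" if "a < J" for a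
  proof -
    have "(\<Sum>p<J. \<Sum>q<J. of_bool (p <= a) * of_bool (q <= a) * f a)
        = (\<Sum>p<J. of_bool (p <= a)) * (\<Sum>q<J. of_bool (q <= a)) * f a"
      by (subst sum_product) (simp only: sum_distrib_right)
    then show ?thesis by (simp only: card[OF that] power2_eq_square)
  qed
  define h where "h a p q = of_bool (p <= a) * of_bool (q <= a) * f a" for a p q
  have "(\<Sum>r<J. \<Sum>p=1..<J. \<Sum>p'=1..<J. f (max (max p' p) r)) <= (\<Sum>r<J. \<Sum>p<J. \<Sum>p'=1..<J. f (max (max p' p) r))"
    by (intro sum_mono sum_mono2 sum_nonneg) (use f in auto)
  also have "... <= (\<Sum>r<J. \<Sum>p<J. \<Sum>p'<J. f (max (max p' p) r))"
    by (intro sum_mono sum_mono2) (use f in auto)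
  also have "... <= (\<Sum>r<J. \<Sum>p<J. \<Sum>p'<J. h r p p' + h p r p' + h p' r p)"
  proof (intro sum_mono)
    fix r p p' :: nat
    have h0: "0 <= h a b c" for a b c unfolding h_def using f by simp
    have h1: "h a b c = f a" if "b <= a" "c <= a" for a b c unfolding h_def using that by simp
    consider "p <= r" "p' <= r" | "r <= p" "p' <= p" | "r <= p'" "p <= p'" by linarith
    then show "f (max (max p' p) r) <= h r p p' + h p r p' + h p' r p"
    proof cases
      case 1
      then show ?thesis using h0[of p r p'] h0[of p' r p] h1[of p r p'] by (simp add: max_def)
    next
      case 2
      then have "max (max p' p) r = p" by simp
      then show ?thesis using 2 h0[of r p p'] h0[of p' r p] h1[of r p p'] by simp
    next
      case 3
      then have "max (max p' p) r = p'" by simp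
      then show ?thesis using 3 h0[of r p p'] h0[of p r p'] h1[of r p' p] by simp
    qed
  qed
  also have "... = (\<Sum>r<J. \<Sum>p<J. \<Sum>p'<J. h r p p') + (\<Sum>r<J. \<Sum>p<J. \<Sum>p'<J. h p r p')
      + (\<Sum>r<J. \<Sum>p<J. \<Sum>p'<J. h p' r p)"
    by (simp only: sum.distrib)
  also have "(\<Sum>r<J. \<Sum>p<J. \<Sum>p'<J. h p r p') = (\<Sum>p<J. \<Sum>r<J. \<Sum>p'<J. h p r p')"
    by (rule sum.swap)
  also have "(\<Sum>r<J. \<Sum>p<J. \<Sum>p'<J. h p' r p) = (\<Sum>p'<J. \<Sum>r<J. \<Sum>p<J. h p' r p)"
  proof -
    have "(\<Sum>r<J. \<Sum>p<J. \<Sum>p'<J. h p' r p) = (\<Sum>r<J. \<Sum>p'<J. \<Sum>p<J. h p' r p)"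
      by (intro sum.cong refl sum.swap)
    also have "... = (\<Sum>p'<J. \<Sum>r<J. \<Sum>p<J. h p' r p)" by (rule sum.swap)
    finally show ?thesis .
  qed
  also have "(\<Sum>r<J. \<Sum>p<J. \<Sum>p'<J. h r p p') + (\<Sum>p<J. \<Sum>r<J. \<Sum>p'<J. h p r p') + (\<Sum>p'<J. \<Sum>r<J. \<Sum>p<J. h p' r p)
      = 3 * (\<Sum>j<J. real (Suc j) ^ 2 * f j)"
    unfolding h_def using card2 by simp
  finally show ?thesis .
qed

context mixing_seq
begin

text \<open>With derivatives of size \<open>c i = \<kappa> q\<^sup>1\<^sup>-\<^sup>i\<close> at scale \<open>q = \<surd>s\<close>, all contributions to the error
  of one step collapse to a few quantities, provided that the blocks of length \<open>J\<close> of the truncated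
  variables stay below the scale, \<open>J b <= \<beta> q\<close>.\<close>

lemma err_step_scaled:
  fixes q \<kappa> \<beta> K2 K3 g :: real
  assumes c: "c 1 = \<kappa>" "c 2 = \<kappa> / q" "c 3 = \<kappa> / q ^ 2" "c 4 = \<kappa> / q ^ 3"
    and q: "1 <= q" and \<kappa>: "0 <= \<kappa>" and \<beta>: "0 <= \<beta>" and g: "0 <= g"
    and J: "1 <= J" "real J <= q" "real J * b <= \<beta> * q"
    and K2: "(\<Sum>j<J. real (Suc j) * D 2 j) <= K2" and K3: "(\<Sum>j<J. real (Suc j) * D 3 j) <= K3"
  shows "err_step c g J <= \<kappa> * ((1 + \<beta> + 2 * \<beta> ^ 2 + 6 * \<beta> ^ 3 + K2 * (1 + \<beta>)) * \<rho> + (1 + 2 * K2) * D 1 J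
      + real J / q * D 2 J + 2 * (real J / q) ^ 2 * D 3 J
      + 8 * (\<Sum>j<J. real (Suc j) ^ 2 * E4 j) / q ^ 3 + 2 * K2 ^ 2 / q ^ 3) + 3 * g * K3"
proof -
  define Q4 where "Q4 = (\<Sum>j<J. real (Suc j) ^ 2 * E4 j)"
  define x where "x = real J / q"
  have x: "0 <= x" "x <= 1" unfolding x_def using J q by auto
  have q0: "0 < q" using q by simp
  have xb: "0 <= x * b" "x * b <= \<beta>" using J(3) q0 x b_nonneg unfolding x_def by (auto simp: field_simps)
  have nn: "\<And>q j. 0 <= D q j" "\<And>j. 0 <= E4 j" "0 <= \<rho>" "0 <= b" by (fact D_nonneg E4_ge(2) \<rho>_nonneg b_nonneg)+
  have J0: "0 \<in> {..<J}" using J by auto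
  have D20: "D 2 0 <= K2" using member_le_sum[of 0 "{..<J}" "%j. real (Suc j) * D 2 j"] J nn K2 by simp
  have K20: "0 <= K2" using D20 nn(1)[of 2 0] by linarith
  have Q40: "0 <= Q4" unfolding Q4_def using nn by (intro sum_nonneg) auto
  have D40: "D 4 0 <= Q4"
    using member_le_sum[of 0 "{..<J}" "%j. real (Suc j) ^ 2 * E4 j"] J nn E4_ge(1)[of 0] unfolding Q4_def by simp
  have D4s: "(\<Sum>r=1..<J. D 4 r) <= Q4"
  proof -
    have "(\<Sum>r=1..<J. D 4 r) <= (\<Sum>r=1..<J. real (Suc r) ^ 2 * E4 r)"
    proof (rule sum_mono)
      fix r
      have "1 * D 4 r <= real (Suc r) ^ 2 * E4 r" using nn E4_ge(1) by (intro mult_mono) auto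
      then show "D 4 r <= real (Suc r) ^ 2 * E4 r" by simp
    qed
    also have "... <= Q4" unfolding Q4_def using nn by (intro sum_mono2) auto
    finally show ?thesis .
  qed
  have D2s: "(\<Sum>r=1..<J. D 2 r) <= K2"
  proof -
    have "(\<Sum>r=1..<J. D 2 r) <= (\<Sum>r=1..<J. real (Suc r) * D 2 r)"
      by (intro sum_mono) (use nn in \<open>auto simp: algebra_simps intro!: mult_nonneg_nonneg\<close>)
    also have "... <= (\<Sum>r<J. real (Suc r) * D 2 r)" using nn by (intro sum_mono2) auto
    finally show ?thesis using K2 by simp
  qed
  have D3s: "(\<Sum>r<J. D 3 r) <= K3"
  proof -
    have "(\<Sum>r<J. D 3 r) <= (\<Sum>r<J. real (Suc r) * D 3 r)"
      by (intro sum_mono) (use nn in \<open>auto simp: algebra_simps intro!: mult_nonneg_nonneg\<close>)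
    then show ?thesis using K3 by simp
  qed
  have E2s: "(\<Sum>r<J. \<Sum>p=1..<J. E4 (max p r)) <= 2 * Q4"
  proof (rule order_trans[OF sum_max_two[OF nn(2)]])
    have "real (Suc j) * E4 j <= real (Suc j) ^ 2 * E4 j" for j
      using nn by (intro mult_right_mono) (auto simp: power2_eq_square)
    then show "2 * (\<Sum>j<J. real (Suc j) * E4 j) <= 2 * Q4" unfolding Q4_def by (simp add: sum_mono)
  qed
  have E3s: "(\<Sum>r<J. \<Sum>p=1..<J. \<Sum>p'=1..<J. E4 (max (max p' p) r)) <= 3 * Q4"
    unfolding Q4_def by (rule sum_max_three[OF nn(2)])
  have D3m: "(\<Sum>r<J. \<Sum>p=1..<J. D 3 (max p r)) <= 2 * K3"
    using sum_max_two[of "D 3" J] nn(1) K3 by simp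
  have J1: "real (J - 1) <= real J" by simp
  define j where "j = real J"
  have j: "0 <= j" "j = x * q" unfolding j_def x_def using q0 by auto
  have c0: "0 <= c 3" "0 <= c 4" "0 <= c 2" unfolding c using \<kappa> q0 by simp_all
  have jJ: "0 <= real (J - 1)" "real (J - 1) <= j" unfolding j_def by simp_all
  have jj: "j * real (J - 1) <= j * j" "j * real (J - 1) * real (J - 1) <= j * j * j"
    using jJ j(1) by (simp_all add: mult_left_mono mult_mono)
  have kc1: "(\<Sum>r<J. k) = j * k" and kc3: "(\<Sum>r=1..<J. k) = real (J - 1) * k" for k :: real
    by (simp_all only: sum_constant card_lessThan card_atLeastLessThan j_def)
  have "(\<Sum>r<J. err_pair c g J r)
      = (\<Sum>r<J. c 2 * D 2 J) + (\<Sum>r<J. \<Sum>p=1..<J. g * D 3 (max p r)) + (\<Sum>r<J. \<Sum>p=1..<J. c 3 * (2 * b ^ 2 * \<rho>))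
        + (\<Sum>r<J. \<Sum>p=1..<J. c 4 / 2 * E4 (max p r)) + (\<Sum>r<J. \<Sum>p=1..<J. c 3 * (D 3 J + D 2 0 * D 1 J))
        + (\<Sum>r<J. \<Sum>p=1..<J. c 4 * (\<Sum>p'=1..<J. E4 (max (max p' p) r)))
        + (\<Sum>r<J. \<Sum>p=1..<J. c 4 * (\<Sum>p'=1..<J. 4 * b ^ 3 * \<rho>))"
    unfolding err_pair_def by (simp only: sum.distrib distrib_left add_ac)
  also have "... = j * c 2 * D 2 J + g * (\<Sum>r<J. \<Sum>p=1..<J. D 3 (max p r)) + j * real (J - 1) * (c 3 * (2 * b ^ 2 * \<rho>))
        + c 4 / 2 * (\<Sum>r<J. \<Sum>p=1..<J. E4 (max p r)) + j * real (J - 1) * (c 3 * (D 3 J + D 2 0 * D 1 J))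
        + c 4 * (\<Sum>r<J. \<Sum>p=1..<J. (\<Sum>p'=1..<J. E4 (max (max p' p) r)))
        + j * real (J - 1) * real (J - 1) * (c 4 * (4 * b ^ 3 * \<rho>))"
  proof -
    have a1: "(\<Sum>r<J. c 2 * D 2 J) = j * c 2 * D 2 J" by (simp only: kc1 mult.assoc)
    have a2: "(\<Sum>r<J. \<Sum>p=1..<J. e * f p r) = e * (\<Sum>r<J. \<Sum>p=1..<J. f p r)" for e :: real and f
      by (simp only: sum_distrib_left)
    have a3: "(\<Sum>r<J. \<Sum>p=1..<J. e) = j * real (J - 1) * e" for e
      by (simp only: kc1 kc3 mult.assoc)
    have a4: "(\<Sum>r<J. \<Sum>p=1..<J. c 4 * (\<Sum>p'=1..<J. 4 * b ^ 3 * \<rho>))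
        = j * real (J - 1) * real (J - 1) * (c 4 * (4 * b ^ 3 * \<rho>))"
      unfolding kc3 kc1 by (simp only: mult_ac)
    show ?thesis
      by (rule arg_cong2[where f = "(+)"] a1 a4 a3 a2)+
  qed
  also have "... <= j * c 2 * D 2 J + g * (2 * K3) + j * j * (c 3 * (2 * b ^ 2 * \<rho>))
        + c 4 / 2 * (2 * Q4) + j * j * (c 3 * (D 3 J + K2 * D 1 J))
        + c 4 * (3 * Q4) + j * j * j * (c 4 * (4 * b ^ 3 * \<rho>))"
  proof -
    have "j * real (J - 1) * (c 3 * (2 * b ^ 2 * \<rho>)) <= j * j * (c 3 * (2 * b ^ 2 * \<rho>))"
      by (intro mult_right_mono jj(1)) (use nn c0 in simp)
    moreover have "j * real (J - 1) * (c 3 * (D 3 J + D 2 0 * D 1 J)) <= j * j * (c 3 * (D 3 J + K2 * D 1 J))"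
    proof (rule mult_mono[OF jj(1)])
      have "D 2 0 * D 1 J <= K2 * D 1 J" by (rule mult_right_mono[OF D20 nn(1)])
      then show "c 3 * (D 3 J + D 2 0 * D 1 J) <= c 3 * (D 3 J + K2 * D 1 J)"
        by (intro mult_left_mono c0) simp
    qed (use nn c0 j(1) in simp_all)
    moreover have "j * real (J - 1) * real (J - 1) * (c 4 * (4 * b ^ 3 * \<rho>)) <= j * j * j * (c 4 * (4 * b ^ 3 * \<rho>))"
      by (intro mult_right_mono jj(2)) (use nn c0 in simp)
    moreover note mult_left_mono[OF D3m g] mult_left_mono[OF E3s c0(2)]
    moreover have "c 4 / 2 * (\<Sum>r<J. \<Sum>p=1..<J. E4 (max p r)) <= c 4 / 2 * (2 * Q4)"
      by (intro mult_left_mono E2s) (use c0 in simp)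
    ultimately show ?thesis by linarith
  qed
  also have "... = \<kappa> * x * D 2 J + 2 * g * K3 + 2 * \<kappa> * (x * b) ^ 2 * \<rho> + 4 * \<kappa> * (Q4 / q ^ 3)
        + \<kappa> * x ^ 2 * D 3 J + \<kappa> * x ^ 2 * (K2 * D 1 J) + 4 * \<kappa> * (x * b) ^ 3 * \<rho>"
    unfolding c j(2) using q0 by (simp add: field_simps power2_eq_square power3_eq_cube)
  also have "... <= \<kappa> * x * D 2 J + 2 * g * K3 + 2 * \<kappa> * \<beta> ^ 2 * \<rho> + 4 * \<kappa> * (Q4 / q ^ 3)
        + \<kappa> * x ^ 2 * D 3 J + \<kappa> * 1 * (K2 * D 1 J) + 4 * \<kappa> * \<beta> ^ 3 * \<rho>"
  proof -
    have "2 * \<kappa> * (x * b) ^ 2 * \<rho> <= 2 * \<kappa> * \<beta> ^ 2 * \<rho>"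
      by (intro mult_left_mono mult_right_mono power_mono xb nn) (use \<kappa> in simp)
    moreover have "4 * \<kappa> * (x * b) ^ 3 * \<rho> <= 4 * \<kappa> * \<beta> ^ 3 * \<rho>"
      by (intro mult_left_mono mult_right_mono power_mono xb nn) (use \<kappa> in simp)
    moreover have "\<kappa> * x ^ 2 * (K2 * D 1 J) <= \<kappa> * 1 * (K2 * D 1 J)"
      by (intro mult_left_mono mult_right_mono power_le_one x \<kappa>) (use K20 nn in simp)
    ultimately show ?thesis by linarith
  qed
  finally have pairs: "(\<Sum>r<J. err_pair c g J r) <= ..." .
  have "(\<Sum>r<J. err_square c g J r) = g * (\<Sum>r<J. D 3 r) + j * (c 3 * D 3 J)
      + c 4 * (\<Sum>r<J. \<Sum>p=1..<J. E4 (max p r)) + j * real (J - 1) * (c 4 * (2 * b ^ 3 * \<rho>))"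
    unfolding err_square_def j_def using J(1)
    by (simp add: sum.distrib distrib_left sum_distrib_left[symmetric] mult_ac of_nat_diff)
  also have "... <= g * K3 + j * j * (c 3 * D 3 J) + c 4 * (2 * Q4) + j * j * j * (c 4 * (2 * b ^ 3 * \<rho>))"
  proof -
    have j1: "1 <= j" using J unfolding j_def by simp
    then have "j <= j * j" by simp
    then have "j * (c 3 * D 3 J) <= j * j * (c 3 * D 3 J)"
      by (intro mult_right_mono) (use nn c0 in simp_all)
    moreover have "j * real (J - 1) <= j * j * j"
      using mult_left_mono[OF j1, of "j * j"] jj(1) j(1) by simp
    then have "j * real (J - 1) * (c 4 * (2 * b ^ 3 * \<rho>)) <= j * j * j * (c 4 * (2 * b ^ 3 * \<rho>))"
      by (intro mult_right_mono) (use nn c0 in simp_all)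
    moreover note mult_left_mono[OF D3s g] mult_left_mono[OF E2s c0(2)]
    ultimately show ?thesis by linarith
  qed
  also have "... = g * K3 + \<kappa> * x ^ 2 * D 3 J + 2 * \<kappa> * (Q4 / q ^ 3) + 2 * \<kappa> * (x * b) ^ 3 * \<rho>"
    unfolding c j(2) using q0 by (simp add: field_simps power2_eq_square power3_eq_cube)
  also have "... <= g * K3 + \<kappa> * x ^ 2 * D 3 J + 2 * \<kappa> * (Q4 / q ^ 3) + 2 * \<kappa> * \<beta> ^ 3 * \<rho>"
  proof -
    have "2 * \<kappa> * (x * b) ^ 3 * \<rho> <= 2 * \<kappa> * \<beta> ^ 3 * \<rho>"
      by (intro mult_left_mono mult_right_mono power_mono xb nn) (use \<kappa> in simp)
    then show ?thesis by linarith
  qed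
  finally have squares: "(\<Sum>r<J. err_square c g J r) <= ..." .
  have qp: "1 / q <= 1" "1 / q ^ 2 <= 1" "1 / q ^ 3 <= 1" using q by (auto intro: one_le_power)
  have "drift c J = \<kappa> * (\<rho> * (1 / q ^ 2)) + \<kappa> * (D 2 0 / 2 / q ^ 3) + \<kappa> * (D 1 J * (1 / q ^ 2))
      + \<kappa> * ((\<Sum>p=1..<J. D 2 p) / q ^ 3) + \<kappa> * (real (J - 1) * b * \<rho> / q ^ 3)"
    unfolding drift_def c by (simp add: sum.distrib algebra_simps add_divide_distrib)
  also have "... <= \<kappa> * (\<rho> * 1) + \<kappa> * (K2 / q ^ 3) + \<kappa> * (D 1 J * 1) + \<kappa> * (K2 / q ^ 3) + \<kappa> * (\<beta> * \<rho>)"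
  proof (intro add_mono mult_left_mono \<kappa> qp nn divide_right_mono D2s)
    show "D 2 0 / 2 <= K2" using D20 nn(1)[of 2 0] by linarith
    have "real (J - 1) * b <= real J * b" using nn by (intro mult_right_mono) auto
    also have "... <= \<beta> * q" by (rule J)
    also have "... <= \<beta> * q ^ 3" using \<beta> q power_increasing[of 1 3 q] by (intro mult_left_mono) auto
    finally have "real (J - 1) * b * \<rho> <= \<beta> * q ^ 3 * \<rho>" using nn by (intro mult_right_mono) auto
    then show "real (J - 1) * b * \<rho> / q ^ 3 <= \<beta> * \<rho>" using q0 by (simp add: field_simps)
  qed (use q0 in auto)
  finally have dr: "drift c J <= \<kappa> * ((1 + \<beta>) * \<rho> + D 1 J + 2 * K2 / q ^ 3)" by (simp add: field_simps)
  have dr0: "0 <= drift c J" unfolding drift_def c using nn \<kappa> q0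
    by (auto intro!: add_nonneg_nonneg mult_nonneg_nonneg sum_nonneg divide_nonneg_nonneg)
  have "(\<Sum>r=1..<J. D 2 r * (real r * drift c J)) = (\<Sum>r=1..<J. real r * D 2 r) * drift c J"
    by (simp add: sum_distrib_left sum_distrib_right mult_ac)
  also have "... <= K2 * drift c J"
  proof (rule mult_right_mono[OF _ dr0])
    have "(\<Sum>r=1..<J. real r * D 2 r) <= (\<Sum>r=1..<J. real (Suc r) * D 2 r)"
      by (intro sum_mono mult_right_mono nn) auto
    also have "... <= (\<Sum>r<J. real (Suc r) * D 2 r)" using nn by (intro sum_mono2) auto
    finally show "(\<Sum>r=1..<J. real r * D 2 r) <= K2" using K2 by simp
  qed
  also have "... <= K2 * (\<kappa> * ((1 + \<beta>) * \<rho> + D 1 J + 2 * K2 / q ^ 3))"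
    by (rule mult_left_mono[OF dr K20])
  finally have drifts: "(\<Sum>r=1..<J. D 2 r * (real r * drift c J)) <= ..." .
  have "(\<Sum>r=1..<J. c 2 * (b * \<rho>) + c 4 / 6 * D 4 r) = real (J - 1) * (c 2 * (b * \<rho>)) + c 4 / 6 * (\<Sum>r=1..<J. D 4 r)"
    by (simp add: sum.distrib sum_distrib_left)
  also have "... <= j * (c 2 * (b * \<rho>)) + c 4 / 6 * Q4"
  proof -
    have "real (J - 1) * (c 2 * (b * \<rho>)) <= j * (c 2 * (b * \<rho>))"
      by (intro mult_right_mono jJ(2)) (use nn c0 in simp)
    moreover have "c 4 / 6 * (\<Sum>r=1..<J. D 4 r) <= c 4 / 6 * Q4"
      by (intro mult_left_mono D4s) (use c0 in simp)
    ultimately show ?thesis by linarith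
  qed
  also have "... = \<kappa> * (x * b) * \<rho> + \<kappa> * (Q4 / q ^ 3) / 6"
    unfolding c j(2) using q0 by (simp add: field_simps)
  also have "... <= \<kappa> * \<beta> * \<rho> + \<kappa> * (Q4 / q ^ 3) / 6"
    by (intro add_right_mono mult_left_mono mult_right_mono xb nn \<kappa>)
  finally have singles: "(\<Sum>r=1..<J. c 2 * (b * \<rho>) + c 4 / 6 * D 4 r) <= ..." .
  have c4: "c 4 / 24 * D 4 0 <= \<kappa> * (Q4 / q ^ 3) / 24"
    unfolding c using mult_left_mono[OF D40 \<kappa>] q0 by (simp add: field_simps)
  have Qq: "0 <= \<kappa> * (Q4 / q ^ 3)" using \<kappa> Q40 q0 by simp
  have "err_step c g J <= \<kappa> * \<rho> + \<kappa> * (Q4 / q ^ 3) / 24 + \<kappa> * D 1 J + (\<kappa> * \<beta> * \<rho> + \<kappa> * (Q4 / q ^ 3) / 6)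
      + (\<kappa> * x * D 2 J + 2 * g * K3 + 2 * \<kappa> * \<beta> ^ 2 * \<rho> + 4 * \<kappa> * (Q4 / q ^ 3)
        + \<kappa> * x ^ 2 * D 3 J + \<kappa> * 1 * (K2 * D 1 J) + 4 * \<kappa> * \<beta> ^ 3 * \<rho>)
      + (g * K3 + \<kappa> * x ^ 2 * D 3 J + 2 * \<kappa> * (Q4 / q ^ 3) + 2 * \<kappa> * \<beta> ^ 3 * \<rho>)
      + K2 * (\<kappa> * ((1 + \<beta>) * \<rho> + D 1 J + 2 * K2 / q ^ 3))"
    unfolding err_step_def sum.distrib[of "err_pair c g J"] c(1)
    using c4 singles pairs squares drifts by linarith
  also have "... = \<kappa> * ((1 + \<beta> + 2 * \<beta> ^ 2 + 6 * \<beta> ^ 3 + K2 * (1 + \<beta>)) * \<rho> + (1 + 2 * K2) * D 1 J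
      + x * D 2 J + 2 * x ^ 2 * D 3 J + 2 * K2 ^ 2 / q ^ 3) + 3 * g * K3
      + (\<kappa> * (Q4 / q ^ 3) / 24 + \<kappa> * (Q4 / q ^ 3) / 6 + 6 * (\<kappa> * (Q4 / q ^ 3)))"
    by (simp add: algebra_simps power2_eq_square)
  also have "... <= \<kappa> * ((1 + \<beta> + 2 * \<beta> ^ 2 + 6 * \<beta> ^ 3 + K2 * (1 + \<beta>)) * \<rho> + (1 + 2 * K2) * D 1 J
      + x * D 2 J + 2 * x ^ 2 * D 3 J + 2 * K2 ^ 2 / q ^ 3) + 3 * g * K3 + 8 * (\<kappa> * (Q4 / q ^ 3))"
  proof (rule add_left_mono)
    have "y / 24 + y / 6 + 6 * y <= 8 * y" if "0 <= y" for y :: real using that by simp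
    from this[OF Qq] show "\<kappa> * (Q4 / q ^ 3) / 24 + \<kappa> * (Q4 / q ^ 3) / 6 + 6 * (\<kappa> * (Q4 / q ^ 3))
      <= 8 * (\<kappa> * (Q4 / q ^ 3))" .
  qed
  also have "... = \<kappa> * ((1 + \<beta> + 2 * \<beta> ^ 2 + 6 * \<beta> ^ 3 + K2 * (1 + \<beta>)) * \<rho> + (1 + 2 * K2) * D 1 J
      + x * D 2 J + 2 * x ^ 2 * D 3 J + 8 * Q4 / q ^ 3 + 2 * K2 ^ 2 / q ^ 3) + 3 * g * K3"
    by (simp add: algebra_simps)
  finally show ?thesis unfolding x_def Q4_def .
qed

end

section \<open>Replacement over all scales\<close>

text \<open>The index \<open>s\<close> is the remaining variance in units of \<open>\<sigma>\<^sup>2\<close>. At each scale there is a truncation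
\<open>W s\<close> of the same sequence \<open>X\<close> and a block length \<open>J s\<close>; \<open>e s\<close> collects the mixing and truncation
errors and the bias of the truncated covariances.\<close>

locale multiscale = prob_space M for M :: "'a measure" +
  fixes F :: "nat => 'a measure" and X :: "nat => 'a => real"
    and W :: "nat => nat => 'a => real" and D :: "nat => nat => nat => real" and \<rho> b :: "nat => real"
    and \<gamma> :: "nat => nat => real" and J :: "nat => nat" and g :: "nat => real"
    and \<sigma> \<beta> K2 K3 :: real and e :: "nat => real"
  assumes seq: "\<And>s. 1 <= s ==> mixing_seq M F X (W s) (D s) (\<rho> s) (b s) (\<gamma> s)"
    and J: "\<And>s. 1 <= s ==> 1 <= J s" "\<And>s. 1 <= s ==> real (J s) <= sqrt (real s)"
      "\<And>s. 1 <= s ==> real (J s) * b s <= \<beta> * sqrt (real s)"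
    and K2: "\<And>s. 1 <= s ==> (\<Sum>j<J s. real (Suc j) * D s 2 j) <= K2"
    and K3: "\<And>s. 1 <= s ==> (\<Sum>j<J s. real (Suc j) * D s 3 j) <= K3"
    and \<beta>: "0 <= \<beta>" and \<sigma>: "0 < \<sigma>"
    and g: "summable (%k. real (Suc k) * \<bar>g k\<bar>)" and \<sigma>_eq: "\<sigma>\<^sup>2 = g 0 + 2 * (\<Sum>k. g (Suc k))"
    and e_nonneg: "\<And>s. 0 <= e s" and e: "summable e"
    and e_mix: "\<And>s. 1 <= s ==> \<rho> s + D s 1 (J s) + real (J s) / sqrt (real s) * D s 2 (J s)
        + (real (J s) / sqrt (real s)) ^ 2 * D s 3 (J s)
        + (\<Sum>j<J s. real (Suc j) ^ 2 * (D s 4 j + D s 2 0 * D s 2 j + D s 1 0 * D s 3 j)) / sqrt (real s) ^ 3 <= e s"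
    and e_cov: "\<And>s. 1 <= s ==> (\<bar>\<gamma> s 0 - g 0\<bar> + 2 * (\<Sum>r=1..<J s. \<bar>\<gamma> s r - g r\<bar>) + 2 * (\<Sum>r. \<bar>g (r + J s)\<bar>)) / sqrt (real s) <= e s"
begin

text \<open>Smoothing with standard deviation \<open>sqrt s * \<sigma> / 2\<close> makes the derivatives exceed powers of
\<open>1 / sqrt s\<close> at most by \<open>\<kappa>\<close>; the next constant adds up the coefficients of the scaled error of one
step.\<close>

definition "\<kappa> = max 1 ((2 / \<sigma>) ^ 3)"

definition "A = 2 + \<beta> + 2 * \<beta> ^ 2 + 6 * \<beta> ^ 3 + K2 * (1 + \<beta>) + 2 * K2 + 8 + 2 * K2 ^ 2"

definition "wt s = 1 / sqrt (real s) ^ 3"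

definition "G m = (\<Sum>r. \<bar>g (r + m)\<bar>)"

definition "PS n w = (\<Sum>i=1..n. X i w)"

lemma \<kappa>: "1 <= \<kappa>" "1 <= i ==> i <= 4 ==> (2 / \<sigma>) ^ (i - 1) <= \<kappa>"
proof -
  show "1 <= \<kappa>" unfolding \<kappa>_def by simp
  assume i: "1 <= i" "i <= 4"
  show "(2 / \<sigma>) ^ (i - 1) <= \<kappa>"
  proof (cases "1 <= 2 / \<sigma>")
    case True
    then have "(2 / \<sigma>) ^ (i - 1) <= (2 / \<sigma>) ^ 3" using i by (intro power_increasing) auto
    then show ?thesis unfolding \<kappa>_def by simp
  next
    case False
    then have "(2 / \<sigma>) ^ (i - 1) <= 1" using \<sigma> by (intro power_le_one) auto
    then show ?thesis unfolding \<kappa>_def by simp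
  qed
qed

lemma wt_summable: "summable wt"
proof -
  have "wt s = real s powr (- (3/2))" for s
  proof (cases "s = 0")
    case False
    then have "sqrt (real s) ^ 3 = real s powr (3/2)"
      by (simp add: powr_half_sqrt[symmetric] powr_powr flip: powr_realpow)
    then show ?thesis unfolding wt_def powr_minus_divide by simp
  qed (simp add: wt_def)
  then have "wt = (%s. real s powr (- (3/2)))" by auto
  moreover have "summable (%s. real s powr (- (3/2)))" by (subst summable_real_powr_iff) simp
  ultimately show ?thesis by simp
qed

lemma wt_nonneg: "0 <= wt s" unfolding wt_def by simp

lemma g_abs_summable: "summable (%k. \<bar>g k\<bar>)"
  using g by (rule summable_comparison_test'[of _ 0]) (auto simp: algebra_simps mult_nonneg_nonneg)

lemma G_nonneg: "0 <= G m"
  unfolding G_def by (rule suminf_nonneg[OF summable_ignore_initial_segment[OF g_abs_summable]]) simp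

lemma G_sum: "(\<Sum>i<n. G (Suc i)) <= (\<Sum>k. real (Suc k) * \<bar>g k\<bar>)"
proof -
  have s: "summable (%r. \<bar>g (r + k)\<bar>)" for k using summable_ignore_initial_segment[OF g_abs_summable] .
  have G: "G m = (\<Sum>r. of_bool (m <= r) * \<bar>g r\<bar>)" for m
  proof -
    have "summable (%r. of_bool (m <= r) * \<bar>g r\<bar>)"
      by (rule summable_comparison_test'[OF g_abs_summable, of 0]) simp
    from suminf_split_initial_segment[OF this, of m] show ?thesis unfolding G_def by simp
  qed
  have sb: "summable (%r. of_bool (m <= r) * \<bar>g r\<bar>)" for m
    by (rule summable_comparison_test'[OF g_abs_summable, of 0]) simp
  have "(\<Sum>i<n. G (Suc i)) = (\<Sum>r. \<Sum>i<n. of_bool (Suc i <= r) * \<bar>g r\<bar>)"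
    unfolding G by (rule suminf_sum[symmetric]) (rule sb)
  also have "... <= (\<Sum>k. real (Suc k) * \<bar>g k\<bar>)"
  proof (rule suminf_le)
    fix r :: nat
    have "(\<Sum>i<n. of_bool (Suc i <= r)) = real (card ({..<n} \<inter> {i. Suc i <= r}))"
      by (simp add: of_bool_def sum.If_cases)
    also have "... <= real (card {..<r})" by (intro of_nat_mono card_mono) auto
    finally have "(\<Sum>i<n. of_bool (Suc i <= r)) * \<bar>g r\<bar> <= real (Suc r) * \<bar>g r\<bar>"
      by (intro mult_right_mono) auto
    then show "(\<Sum>i<n. of_bool (Suc i <= r) * \<bar>g r\<bar>) <= real (Suc r) * \<bar>g r\<bar>"
      by (simp only: sum_distrib_right)
    show "summable (%r. \<Sum>i<n. of_bool (Suc i <= r) * \<bar>g r\<bar>)" by (intro summable_sum sb)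
    show "summable (%k. real (Suc k) * \<bar>g k\<bar>)" by (rule g)
  qed
  finally show ?thesis .
qed

text \<open>The covariances that the replacement step sees are truncated, cut off at lag \<open>J\<close>, and also at lag
\<open>i\<close> because the sum has no terms before time \<open>1\<close>. The last defect is the tail \<open>G\<close>, and is summable in
\<open>i\<close> by the weighted summability of the covariances.\<close>

lemma variance_gap:
  assumes s: "1 <= s"
  shows "\<bar>(\<gamma> s 0 + 2 * (\<Sum>r=1..<min (J s) (Suc i). \<gamma> s r)) - \<sigma>\<^sup>2\<bar> / sqrt (real s) <= e s + 2 * G (Suc i)"
proof -
  define m where "m = min (J s) (Suc i)"
  have m: "1 <= m" "m <= J s" using J(1)[OF s] unfolding m_def by auto
  have sg: "summable (%k. g (Suc k))" "summable g"
    using summable_rabs_cancel[OF g_abs_summable] by (auto simp: summable_Suc_iff)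
  have "(\<Sum>k. g (Suc k)) = (\<Sum>k. g (k + m)) + (\<Sum>r=1..<m. g r)"
  proof -
    have "(\<Sum>k. g (Suc k)) = (\<Sum>k. g k) - g 0" using suminf_split_head[OF sg(2)] .
    moreover have "(\<Sum>k. g k) = (\<Sum>k. g (k + m)) + (\<Sum>k<m. g k)" by (rule suminf_split_initial_segment[OF sg(2)])
    moreover have "(\<Sum>k<m. g k) = g 0 + (\<Sum>r=1..<m. g r)"
      using m sum.atLeast_Suc_lessThan[of 0 m g] by (simp add: lessThan_atLeast0)
    ultimately show ?thesis by simp
  qed
  then have eq: "(\<gamma> s 0 + 2 * (\<Sum>r=1..<m. \<gamma> s r)) - \<sigma>\<^sup>2
      = (\<gamma> s 0 - g 0) + 2 * (\<Sum>r=1..<m. \<gamma> s r - g r) - 2 * (\<Sum>k. g (k + m))"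
    unfolding \<sigma>_eq by (simp add: sum_subtractf algebra_simps)
  have t: "\<bar>\<Sum>k. g (k + m)\<bar> <= G m"
    unfolding G_def using summable_ignore_initial_segment[OF g_abs_summable] by (rule summable_rabs)
  have u: "\<bar>\<Sum>r=1..<m. \<gamma> s r - g r\<bar> <= (\<Sum>r=1..<J s. \<bar>\<gamma> s r - g r\<bar>)"
    by (rule order_trans[OF sum_abs]) (use m in \<open>auto intro!: sum_mono2\<close>)
  have Gm: "G m <= G (J s) + G (Suc i)"
    unfolding m_def min_def using G_nonneg by simp
  have q: "1 <= sqrt (real s)" using s by simp
  have "\<bar>(\<gamma> s 0 + 2 * (\<Sum>r=1..<m. \<gamma> s r)) - \<sigma>\<^sup>2\<bar>
      <= (\<bar>\<gamma> s 0 - g 0\<bar> + 2 * (\<Sum>r=1..<J s. \<bar>\<gamma> s r - g r\<bar>) + 2 * (\<Sum>r. \<bar>g (r + J s)\<bar>)) + 2 * G (Suc i)"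
    unfolding eq using t u Gm unfolding G_def[of "J s"] by linarith
  then have "\<bar>(\<gamma> s 0 + 2 * (\<Sum>r=1..<m. \<gamma> s r)) - \<sigma>\<^sup>2\<bar> / sqrt (real s)
      <= (\<bar>\<gamma> s 0 - g 0\<bar> + 2 * (\<Sum>r=1..<J s. \<bar>\<gamma> s r - g r\<bar>) + 2 * (\<Sum>r. \<bar>g (r + J s)\<bar>)) / sqrt (real s)
        + 2 * G (Suc i) / sqrt (real s)"
    using q by (simp add: add_divide_distrib[symmetric] divide_right_mono)
  also have "2 * G (Suc i) / sqrt (real s) <= 2 * G (Suc i)"
    using q G_nonneg[of "Suc i"] by (simp add: divide_le_eq mult_le_cancel_left1)
  finally show ?thesis using e_cov[OF s] unfolding m_def by linarith
qed

text \<open>The replacement step for the dependent summand is compared with that for a Gaussian increment of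
variance \<open>\<sigma>\<^sup>2\<close>; both have the same second order term.\<close>

lemma step_bound:
  assumes s: "1 <= s" and f: "1-lipschitz_on UNIV f"
    and g3: "\<And>l. l <= i ==> i < l + 2 * J s ==>
      \<bar>E (%w. gsm 3 (sqrt (real s) * \<sigma> / 2) f (PS l w))\<bar> <= g3" and g30: "0 <= g3"
  shows "\<bar>E (%w. gsmooth (sqrt (real s) * \<sigma>) f (PS (Suc i) w))
      - E (%w. gsmooth (sqrt (real (Suc s)) * \<sigma>) f (PS i w))\<bar>
    <= \<kappa> * (A + 1) * e s + (\<kappa> * 2 * K2 ^ 2 + \<kappa> * \<sigma> ^ 4) * wt s + 3 * g3 * K3 + \<kappa> * G (Suc i)"
proof -
  interpret ms: mixing_seq M F X "W s" "D s" "\<rho> s" "b s" "\<gamma> s" by (rule seq[OF s])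
  have PS: "PS = ms.S" by (auto simp: fun_eq_iff PS_def ms.S_def)
  define q where "q = sqrt (real s)"
  define h where "h = q * \<sigma> / 2"
  have q: "1 <= q" unfolding q_def using s by simp
  have h: "0 < h" unfolding h_def using q \<sigma> by simp
  define \<psi> where "\<psi> i = gsm i h f" for i
  define c where "c i = \<kappa> / q ^ (i - 1)" for i :: nat
  have c1: "c 1 = \<kappa>" "c 2 = \<kappa> / q" "c 3 = \<kappa> / q ^ 2" "c 4 = \<kappa> / q ^ 3" unfolding c_def by simp_all
  have sc: "smooth_chain \<psi> c"
  proof
    show "i < 4 ==> (\<psi> i has_real_derivative \<psi> (Suc i) x) (at x)" for i x
      unfolding \<psi>_def by (rule gsm_has_derivative[OF f h])
    fix i :: nat and x assume i: "1 <= i" "i <= 4"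
    have "\<bar>\<psi> i x\<bar> <= 1 / h ^ (i - 1)"
      using gsm_bound[OF f h, of "i - 1" x] i unfolding \<psi>_def by simp
    also have "... = (2 / \<sigma>) ^ (i - 1) / q ^ (i - 1)"
      unfolding h_def using \<sigma> q by (simp add: power_divide power_mult_distrib)
    also have "... <= c i" unfolding c_def using \<kappa>(2)[OF i] q by (intro divide_right_mono) auto
    finally show "\<bar>\<psi> i x\<bar> <= c i" .
  qed
  interpret smooth_chain \<psi> c by (rule sc)
  have \<psi>0: "\<psi> 0 = gsmooth (q * \<sigma>) f" using gsm_0[OF f h] unfolding \<psi>_def h_def by simp
  have l0: "1-lipschitz_on UNIV (\<psi> 0)" unfolding \<psi>0 by (rule gsmooth_lipschitz[OF f])
  have next_scale: "gsmooth (sqrt (real (Suc s)) * \<sigma>) f = gsmooth \<sigma> (\<psi> 0)"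
  proof -
    have "sqrt (\<sigma>\<^sup>2 + (q * \<sigma>)\<^sup>2) = sqrt (real (Suc s)) * \<sigma>"
    proof (rule real_sqrt_unique)
      show "(sqrt (real (Suc s)) * \<sigma>)\<^sup>2 = \<sigma>\<^sup>2 + (q * \<sigma>)\<^sup>2"
        unfolding q_def by (simp add: power_mult_distrib algebra_simps)
    qed (use \<sigma> in simp)
    then show ?thesis unfolding \<psi>0 using gsmooth_gsmooth[OF f \<sigma>, of "q * \<sigma>"] q \<sigma> by simp
  qed
  have J0: "1 <= J s" "real (J s) <= q" "real (J s) * b s <= \<beta> * q" using J[OF s] unfolding q_def by auto
  have g3': "\<bar>E (%w. \<psi> 3 (ms.S l w))\<bar> <= g3" if "l <= i" "i < l + 2 * J s" for l
    using g3[OF that] unfolding \<psi>_def h_def q_def PS .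
  let ?v = "\<gamma> s 0 + 2 * (\<Sum>r=1..<min (J s) (Suc i). \<gamma> s r)"
  let ?e2 = "E (%w. \<psi> 2 (PS i w))"
  have K20: "0 <= K2"
    by (rule order_trans[OF sum_nonneg K2[OF s]]) (use ms.D_nonneg in auto)
  have k0: "0 <= \<kappa>" using \<kappa>(1) by simp
  have "\<bar>E (%w. \<psi> 0 (PS (Suc i) w)) - E (%w. \<psi> 0 (PS i w)) - ?v / 2 * ?e2\<bar>
      <= ms.err_step c g3 (J s)"
    using ms.one_step[OF sc J0(1) g3' g30] unfolding PS .
  also have "... <= \<kappa> * ((1 + \<beta> + 2 * \<beta> ^ 2 + 6 * \<beta> ^ 3 + K2 * (1 + \<beta>)) * \<rho> s + (1 + 2 * K2) * D s 1 (J s)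
      + real (J s) / q * D s 2 (J s) + 2 * (real (J s) / q) ^ 2 * D s 3 (J s)
      + 8 * (\<Sum>j<J s. real (Suc j) ^ 2 * ms.E4 j) / q ^ 3 + 2 * K2 ^ 2 / q ^ 3) + 3 * g3 * K3"
    by (rule ms.err_step_scaled[OF c1 q k0 \<beta> g30 J0 K2[OF s] K3[OF s]])
  also have "... <= \<kappa> * (A * e s + 2 * K2 ^ 2 / q ^ 3) + 3 * g3 * K3"
  proof -
    have A: "1 + \<beta> + 2 * \<beta> ^ 2 + 6 * \<beta> ^ 3 + K2 * (1 + \<beta>) <= A" "1 + 2 * K2 <= A" "1 <= A" "2 <= A" "8 <= A"
      unfolding A_def using \<beta> K20
      by (auto intro!: add_nonneg_nonneg mult_nonneg_nonneg)
    let ?Q = "(\<Sum>j<J s. real (Suc j) ^ 2 * ms.E4 j) / q ^ 3"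
    have Q: "0 <= ?Q" using q ms.E4_ge(2) by (intro divide_nonneg_nonneg sum_nonneg mult_nonneg_nonneg) auto
    have "(1 + \<beta> + 2 * \<beta> ^ 2 + 6 * \<beta> ^ 3 + K2 * (1 + \<beta>)) * \<rho> s + (1 + 2 * K2) * D s 1 (J s)
      + 1 * (real (J s) / q * D s 2 (J s)) + 2 * ((real (J s) / q) ^ 2 * D s 3 (J s)) + 8 * ?Q
      <= A * \<rho> s + A * D s 1 (J s) + A * (real (J s) / q * D s 2 (J s)) + A * ((real (J s) / q) ^ 2 * D s 3 (J s)) + A * ?Q"
      using ms.D_nonneg ms.\<rho>_nonneg q Q A by (intro add_mono mult_right_mono) auto
    also have "... = A * (\<rho> s + D s 1 (J s) + real (J s) / q * D s 2 (J s) + (real (J s) / q) ^ 2 * D s 3 (J s) + ?Q)"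
      by (simp only: distrib_left)
    also have "... <= A * e s"
      using e_mix[OF s] A(3) unfolding ms.E4_def q_def[symmetric] by (intro mult_left_mono) auto
    finally show ?thesis using k0 by (intro add_right_mono mult_left_mono) (simp_all add: mult.assoc)
  qed
  finally have 1: "\<bar>E (%w. \<psi> 0 (PS (Suc i) w)) - E (%w. \<psi> 0 (PS i w)) - ?v / 2 * ?e2\<bar>
      <= \<kappa> * (A * e s + 2 * K2 ^ 2 / q ^ 3) + 3 * g3 * K3" .
  have [measurable]: "PS n \<in> borel_measurable M" for n unfolding PS by measurable
  have [measurable]: "\<psi> 2 \<in> borel_measurable borel" "\<psi> 0 \<in> borel_measurable borel" by (rule measurable; simp)+
  have e2: "\<bar>?e2\<bar> <= \<kappa> / q"
  proof -
    have "integrable M (%w. \<psi> 2 (PS i w))"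
      by (rule integrable_const_bound[of _ "c 2"]) (use bound[of 2] in auto)
    then have "\<bar>?e2\<bar> <= c 2"
      using bound[of 2] by (intro order_trans[OF integral_abs_bound] integral_le_const) auto
    then show ?thesis unfolding c1 .
  qed
  have 2: "\<bar>?v / 2 * ?e2 - \<sigma>\<^sup>2 / 2 * ?e2\<bar> <= \<kappa> * e s + \<kappa> * G (Suc i)"
  proof -
    have "v / 2 * u - t / 2 * u = (v - t) / 2 * u" for v t u :: real by (simp add: field_simps)
    then have "\<bar>?v / 2 * ?e2 - \<sigma>\<^sup>2 / 2 * ?e2\<bar> = \<bar>?v - \<sigma>\<^sup>2\<bar> / 2 * \<bar>?e2\<bar>"
      by (simp only: abs_mult abs_divide abs_numeral)
    also have "... <= \<bar>?v - \<sigma>\<^sup>2\<bar> / 2 * (\<kappa> / q)" by (intro mult_left_mono e2) auto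
    also have "... = \<kappa> / 2 * (\<bar>?v - \<sigma>\<^sup>2\<bar> / q)" by simp
    also have "... <= \<kappa> / 2 * (e s + 2 * G (Suc i))"
      using variance_gap[OF s, of i] k0 unfolding q_def by (intro mult_left_mono) auto
    also have "... <= \<kappa> * e s + \<kappa> * G (Suc i)" using k0 e_nonneg[of s] by (simp add: algebra_simps)
    finally show ?thesis .
  qed
  have ig: "integrable M (%w. k (PS n w))" if k: "1-lipschitz_on UNIV k" for k :: "real => real" and n
  proof (rule Bochner_Integration.integrable_bound)
    show "integrable M (%w. \<bar>k 0\<bar> + \<bar>PS n w\<bar>)" using ms.S_integrable[of n] unfolding PS by simp
    show "(%w. k (PS n w)) \<in> borel_measurable M" using lipschitz_UNIV_measurable[OF k] by measurable
    show "AE w in M. norm (k (PS n w)) <= norm (\<bar>k 0\<bar> + \<bar>PS n w\<bar>)"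
    proof (rule AE_I2)
      fix w show "norm (k (PS n w)) <= norm (\<bar>k 0\<bar> + \<bar>PS n w\<bar>)"
        using lipschitz_UNIV_D[OF k, of "PS n w" 0] by simp
    qed
  qed
  have 3: "\<bar>E (%w. gsmooth \<sigma> (\<psi> 0) (PS i w)) - E (%w. \<psi> 0 (PS i w)) - \<sigma>\<^sup>2 / 2 * ?e2\<bar>
      <= \<kappa> / q ^ 3 * \<sigma> ^ 4"
  proof -
    have i2: "integrable M (%w. \<psi> 2 (PS i w))"
      by (rule integrable_const_bound[of _ "c 2"]) (use bound[of 2] in auto)
    note i0 = ig[OF l0, of i] ig[OF gsmooth_lipschitz[OF l0, of \<sigma>], of i]
    let ?r = "%w. gsmooth \<sigma> (\<psi> 0) (PS i w) - \<psi> 0 (PS i w) - \<sigma>\<^sup>2 / 2 * \<psi> 2 (PS i w)"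
    have "E (%w. gsmooth \<sigma> (\<psi> 0) (PS i w)) - E (%w. \<psi> 0 (PS i w)) - \<sigma>\<^sup>2 / 2 * ?e2
        = E ?r" using i0 i2 by simp
    moreover have "\<bar>E ?r\<bar> <= \<kappa> / q ^ 3 * \<sigma> ^ 4"
    proof (rule order_trans[OF integral_abs_bound], rule integral_le_const)
      show "integrable M (%w. \<bar>?r w\<bar>)" using i0 i2 by simp
      have "\<bar>?r w\<bar> <= c 4 * \<sigma> ^ 4 / 8" for w
        by (rule gsmooth_taylor[OF l0 deriv]) (use bound[of 4] in auto)
      also have "c 4 * \<sigma> ^ 4 / 8 <= \<kappa> / q ^ 3 * \<sigma> ^ 4" 
      proof -
        have "y / 8 <= y" if "0 <= y" for y :: real using that by simp
        moreover have "0 <= \<kappa> / q ^ 3 * \<sigma> ^ 4" using k0 q \<sigma> by simp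
        ultimately show ?thesis unfolding c1 by blast
      qed
      finally show "AE w in M. \<bar>?r w\<bar> <= \<kappa> / q ^ 3 * \<sigma> ^ 4" by simp
    qed
    ultimately show ?thesis by simp
  qed
  have "\<bar>E (%w. \<psi> 0 (PS (Suc i) w)) - E (%w. gsmooth \<sigma> (\<psi> 0) (PS i w))\<bar>
      <= (\<kappa> * (A * e s + 2 * K2 ^ 2 / q ^ 3) + 3 * g3 * K3) + (\<kappa> * e s + \<kappa> * G (Suc i)) + \<kappa> / q ^ 3 * \<sigma> ^ 4"
    using 1 2 3 by linarith
  also have "... = \<kappa> * (A + 1) * e s + (\<kappa> * 2 * K2 ^ 2 + \<kappa> * \<sigma> ^ 4) * wt s + 3 * g3 * K3 + \<kappa> * G (Suc i)"
    unfolding wt_def q_def[symmetric] by (simp add: algebra_simps add_divide_distrib)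
  finally show ?thesis unfolding next_scale \<psi>0 q_def .
qed

end

lemma gsmooth_cmult: "gsmooth k (%x. c * f x) x = c * gsmooth k f x"
  unfolding gsmooth_def by simp

lemma gsmooth_0: "gsmooth 0 f x = f x"
proof -
  interpret prob_space gauss by (rule prob_space_std_normal)
  show ?thesis unfolding gsmooth_def using prob_space by simp
qed

context multiscale
begin

lemma PS_0: "PS 0 w = 0" by (simp add: PS_def)

text \<open>Smoothed at scale \<open>s\<close>, the third derivative is Lipschitz with a constant of order
\<open>1 / (s * sqrt s)\<close>, and the assumed bound for the sum at time \<open>l\<close> applies with this factor. For the Gaussian in its place
the two scales add up, and the third derivative at scale \<open>s + l\<close> is of order \<open>1 / (s + l)\<close>.\<close>

lemma third_derivative_bound:
  assumes s: "1 <= s" and f: "1-lipschitz_on UNIV f"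
    and IH: "\<And>h. 1-lipschitz_on UNIV h ==> \<bar>E (%w. h (PS l w)) - gsmooth (sqrt (real l) * \<sigma>) h 0\<bar> <= K"
  shows "\<bar>E (%w. gsm 3 (sqrt (real s) * \<sigma> / 2) f (PS l w))\<bar> <= 4 / (\<sigma>\<^sup>2 * (real s + real l)) + \<kappa> * K * wt s"
proof -
  define h where "h = sqrt (real s) * \<sigma> / 2"
  have h: "0 < h" unfolding h_def using s \<sigma> by simp
  define u where "u = gsm 3 h f"
  have ul: "(1 / h ^ 3)-lipschitz_on UNIV u" unfolding u_def by (rule gsm_lipschitz[OF f h])
  have "1-lipschitz_on UNIV (%x. h ^ 3 * u x)"
  proof (rule lipschitz_UNIV_I)
    fix x y
    have "\<bar>h ^ 3 * u x - h ^ 3 * u y\<bar> = h ^ 3 * \<bar>u x - u y\<bar>"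
      using h by (simp add: abs_mult right_diff_distrib[symmetric])
    also have "... <= h ^ 3 * (1 / h ^ 3 * \<bar>x - y\<bar>)"
      using h lipschitz_UNIV_D[OF ul] by (intro mult_left_mono) auto
    finally show "\<bar>h ^ 3 * u x - h ^ 3 * u y\<bar> <= 1 * \<bar>x - y\<bar>" using h by simp
  qed simp
  from IH[OF this] have "h ^ 3 * \<bar>E (%w. u (PS l w)) - gsmooth (sqrt (real l) * \<sigma>) u 0\<bar> <= K"
    using h by (simp add: gsmooth_cmult right_diff_distrib[symmetric] abs_mult)
  then have 1: "\<bar>E (%w. u (PS l w)) - gsmooth (sqrt (real l) * \<sigma>) u 0\<bar> <= K * (1 / h ^ 3)"
    using h by (simp add: field_simps)
  have K: "0 <= K" using IH[OF f] by (rule order_trans[OF abs_ge_zero])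
  have "1 / h ^ 3 = (2 / \<sigma>) ^ 3 * wt s"
    unfolding h_def wt_def using \<sigma> by (simp add: power_divide power_mult_distrib)
  also have "... <= \<kappa> * wt s" using \<kappa>(2)[of 4] wt_nonneg by (intro mult_right_mono) auto
  finally have 2: "K * (1 / h ^ 3) <= \<kappa> * K * wt s" using K mult_left_mono[of "1 / h ^ 3" "\<kappa> * wt s" K] by (simp add: mult_ac)
  have 3: "\<bar>gsmooth (sqrt (real l) * \<sigma>) u 0\<bar> <= 4 / (\<sigma>\<^sup>2 * (real s + real l))"
  proof (cases "l = 0")
    case True
    have "\<bar>u 0\<bar> <= 1 / h ^ 2" unfolding u_def using gsm_bound[OF f h, of 2 0] by (simp add: eval_nat_numeral)
    also have "... = 4 / (\<sigma>\<^sup>2 * real s)" unfolding h_def using s by (simp add: power_divide power_mult_distrib)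
    finally show ?thesis using True by (simp add: gsmooth_0)
  next
    case False
    define h' where "h' = sqrt (h\<^sup>2 + (sqrt (real l) * \<sigma> / 2)\<^sup>2)"
    have h': "0 < h'" unfolding h'_def using h by (auto intro: add_pos_nonneg)
    have "h'\<^sup>2 = h\<^sup>2 + (sqrt (real l) * \<sigma> / 2)\<^sup>2" unfolding h'_def by (intro real_sqrt_pow2) simp
    also have "... = \<sigma>\<^sup>2 * (real s + real l) / 4" unfolding h_def by (simp add: power_divide power_mult_distrib algebra_simps add_divide_distrib)
    finally have h'2: "h'\<^sup>2 = \<sigma>\<^sup>2 * (real s + real l) / 4" .
    have "gsmooth (sqrt (real l) * \<sigma>) u = gsm 3 h' f"
      unfolding u_def h'_def using False \<sigma> by (intro gsmooth_gsm_scale[OF f h]) auto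
    moreover have "\<bar>gsm 3 h' f 0\<bar> <= 1 / h' ^ 2" using gsm_bound[OF f h', of 2 0] by (simp add: eval_nat_numeral)
    ultimately show ?thesis unfolding h'2 by simp
  qed
  show ?thesis using 1 2 3 unfolding u_def h_def by linarith
qed

text \<open>The bootstrap: the error at time \<open>n\<close> is at most a constant plus a quarter of the best
  constant for earlier times, once the smoothing \<open>a\<close> at the final time is large enough.\<close>

theorem replacement_bound:
  "\<exists>C. \<forall>n f. 1-lipschitz_on UNIV f \<longrightarrow> \<bar>E (%w. f (PS n w)) - gsmooth (sqrt (real n) * \<sigma>) f 0\<bar> <= C"
proof -
  interpret m1: mixing_seq M F X "W 1" "D 1" "\<rho> 1" "b 1" "\<gamma> 1" by (rule seq) simp
  have PS: "PS = m1.S" by (auto simp: fun_eq_iff PS_def m1.S_def)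
  have [measurable]: "PS n \<in> borel_measurable M" for n unfolding PS by measurable
  have K30: "0 <= K3" by (rule order_trans[OF sum_nonneg K3[of 1]]) (use m1.D_nonneg in auto)
  have K20: "0 <= K2" by (rule order_trans[OF sum_nonneg K2[of 1]]) (use m1.D_nonneg in auto)
  have k0: "0 <= \<kappa>" using \<kappa>(1) by simp
  have A0: "0 <= A" unfolding A_def using \<beta> K20 by (auto intro!: add_nonneg_nonneg mult_nonneg_nonneg)
  obtain a0 where a0: "\<And>n. a0 <= n ==> norm (\<Sum>t. wt (t + n)) < 1 / (12 * \<kappa> * K3 + 1)"
    using suminf_exist_split[OF _ wt_summable, of "1 / (12 * \<kappa> * K3 + 1)"] k0 K30
    by (metis add_nonneg_pos mult_nonneg_nonneg zero_less_divide_1_iff zero_less_one zero_le_numeral)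
  \<comment> \<open>The initial smoothing: it makes the series multiplying the induction constant at most a quarter, and makes blocks short compared with the total time.\<close>
  define a where "a = max 16 a0"
  have a: "16 <= a" unfolding a_def by simp
  have ws: "summable (%t. wt (t + k))" for k by (rule summable_ignore_initial_segment[OF wt_summable])
  have wa: "3 * \<kappa> * K3 * (\<Sum>t. wt (t + a)) <= 1 / 4"
  proof -
    have "(\<Sum>t. wt (t + a)) <= 1 / (12 * \<kappa> * K3 + 1)" using a0[of a] unfolding a_def by simp
    then have "3 * \<kappa> * K3 * (\<Sum>t. wt (t + a)) <= 3 * \<kappa> * K3 * (1 / (12 * \<kappa> * K3 + 1))"
      using k0 K30 by (intro mult_left_mono) auto
    also have "... <= 1 / 4"
    proof -
      have "z * (1 / (4 * z + 1)) <= 1 / 4" if "0 <= z" for z :: real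
      proof -
        have "0 < 4 * z + 1" using that by simp
        then show ?thesis by (simp add: pos_divide_le_eq)
      qed
      from this[of "3 * \<kappa> * K3"] show ?thesis using k0 K30 by (simp add: mult.assoc)
    qed
    finally show ?thesis .
  qed
  define B1 where "B1 = \<kappa> * (A + 1)"
  define B2 where "B2 = \<kappa> * 2 * K2 ^ 2 + \<kappa> * \<sigma> ^ 4"
  define C0 where "C0 = B1 * suminf e + B2 * suminf wt + 24 * K3 / \<sigma>\<^sup>2 + \<kappa> * (\<Sum>k. real (Suc k) * \<bar>g k\<bar>)
    + 2 * (sqrt (real a) * \<sigma>)"
  have B: "0 <= B1" "0 <= B2" unfolding B1_def B2_def using k0 A0 by auto
  \<comment> \<open>The error is at most \<open>C0 + K / 4\<close> when \<open>K\<close> works at earlier times.\<close>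
  define K where "K = 2 * C0"
  have C00: "0 <= C0" unfolding C0_def using B K30 k0 \<sigma> g e_nonneg wt_nonneg e wt_summable
    by (auto intro!: add_nonneg_nonneg mult_nonneg_nonneg suminf_nonneg)
  have K0: "0 <= K" unfolding K_def using C00 by simp
  have main: "\<bar>E (%w. f (PS n w)) - gsmooth (sqrt (real n) * \<sigma>) f 0\<bar> <= K"
    if "1-lipschitz_on UNIV f" for n f
    using that
  proof (induction n arbitrary: f rule: less_induct)
    case (less n f)
    note f = less.prems
    show ?case
    proof (cases "n = 0")
      case True
      then show ?thesis using K0 prob_space by (simp add: PS_0 gsmooth_0)
    next
      case False
      define s where "s i = n - Suc i + a" for i
      define H where "H i = E (%w. gsmooth (sqrt (real (n - i + a)) * \<sigma>) f (PS i w))" for i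
      define g3 where "g3 i = 8 / (\<sigma>\<^sup>2 * real n) + \<kappa> * K * wt (s i)" for i
      have step: "\<bar>H (Suc i) - H i\<bar> <= B1 * e (s i) + B2 * wt (s i) + 3 * g3 i * K3 + \<kappa> * G (Suc i)" if i: "i < n" for i
      proof -
        have s1: "1 <= s i" unfolding s_def using a by simp
        have s2: "n - i + a = Suc (s i)" unfolding s_def using i by simp
        have g0: "0 <= g3 i" unfolding g3_def using k0 K0 wt_nonneg by simp
        have g3: "\<bar>E (%w. gsm 3 (sqrt (real (s i)) * \<sigma> / 2) f (PS l w))\<bar> <= g3 i"
          if l: "l <= i" "i < l + 2 * J (s i)" for l
        proof -
          have 1: "\<bar>E (%w. gsm 3 (sqrt (real (s i)) * \<sigma> / 2) f (PS l w))\<bar>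
              <= 4 / (\<sigma>\<^sup>2 * (real (s i) + real l)) + \<kappa> * K * wt (s i)"
            using l i by (intro third_derivative_bound[OF s1 f] less.IH) auto
          define N where "N = real (s i) + real i"
          have N: "N = real n - 1 + real a" unfolding N_def s_def using i by simp
          have N16: "16 <= N" "real n <= N" unfolding N using a False by auto
          have "4 <= sqrt N" using N16 real_le_rsqrt[of 4 N] by simp
          then have "4 * sqrt N <= sqrt N * sqrt N" using N16 by (intro mult_right_mono) auto
          then have sqN: "4 * sqrt N <= N" using N16 by simp
          have "real (J (s i)) <= sqrt N" using J(2)[OF s1] unfolding N_def
            by (rule order_trans) simp
          moreover have "real i < real l + 2 * real (J (s i))"
            using l(2) of_nat_less_iff[of i "l + 2 * J (s i)", where 'a = real] by simp
          moreover have "real (s i) + real i = N" unfolding N_def ..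
          moreover have "N / 2 <= S + L" if "j <= q" "I < L + 2 * j" "S + I = N" "4 * q <= N" for S L I j q :: real
            using that by linarith
          ultimately have "N / 2 <= real (s i) + real l" using sqN by blast
          then have "real n / 2 <= real (s i) + real l" using N16 by simp
          then have "4 / (\<sigma>\<^sup>2 * (real (s i) + real l)) <= 4 / (\<sigma>\<^sup>2 * (real n / 2))"
            using False \<sigma> by (intro divide_left_mono mult_left_mono mult_pos_pos) auto
          also have "... = 8 / (\<sigma>\<^sup>2 * real n)" by simp
          finally show ?thesis using 1 unfolding g3_def by linarith
        qed
        have "n - Suc i + a = s i" unfolding s_def ..
        then show ?thesis
          using step_bound[OF s1 f g3 g0] unfolding H_def s2 B1_def B2_def by simp
      qed
      have tele: "H n - H 0 = (\<Sum>i<n. H (Suc i) - H i)" by (rule sum_lessThan_telescope[symmetric])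
      have re: "(\<Sum>i<n. k (s i)) <= (\<Sum>t. k (t + a))" if k: "summable k" "\<And>t. 0 <= k t" for k :: "nat => real"
      proof -
        have "(\<Sum>i<n. k (s i)) = (\<Sum>i<n. k (i + a))"
          unfolding s_def by (rule sum.nat_diff_reindex)
        also have "... <= (\<Sum>t. k (t + a))"
          using summable_ignore_initial_segment[OF k(1), of a] k(2) by (intro sum_le_suminf) auto
        finally show ?thesis .
      qed
      have full: "(\<Sum>t. k (t + a)) <= suminf k" if k: "summable k" "\<And>t. 0 <= k t" for k :: "nat => real"
        using suminf_split_initial_segment[OF k(1), of a] sum_nonneg[of "{..<a}" k] k(2) by simp
      have "\<bar>H n - H 0\<bar> <= (\<Sum>i<n. B1 * e (s i) + B2 * wt (s i) + 3 * g3 i * K3 + \<kappa> * G (Suc i))"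
        unfolding tele by (intro order_trans[OF sum_abs] sum_mono step) auto
      also have "... = B1 * (\<Sum>i<n. e (s i)) + B2 * (\<Sum>i<n. wt (s i)) + 24 * K3 / \<sigma>\<^sup>2
          + 3 * \<kappa> * K3 * K * (\<Sum>i<n. wt (s i)) + \<kappa> * (\<Sum>i<n. G (Suc i))"
        unfolding g3_def using False
        by (simp add: sum.distrib sum_distrib_left distrib_left distrib_right mult_ac)
      also have "... <= B1 * suminf e + B2 * suminf wt + 24 * K3 / \<sigma>\<^sup>2
          + K / 4 + \<kappa> * (\<Sum>k. real (Suc k) * \<bar>g k\<bar>)"
      proof -
        have "B1 * (\<Sum>i<n. e (s i)) <= B1 * suminf e"
          using re[OF e e_nonneg] full[OF e e_nonneg] B by (intro mult_left_mono) auto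
        moreover have "B2 * (\<Sum>i<n. wt (s i)) <= B2 * suminf wt"
          using re[OF wt_summable wt_nonneg] full[OF wt_summable wt_nonneg] B by (intro mult_left_mono) auto
        moreover have "3 * \<kappa> * K3 * K * (\<Sum>i<n. wt (s i)) <= K / 4"
        proof -
          have "3 * \<kappa> * K3 * (\<Sum>i<n. wt (s i)) <= 3 * \<kappa> * K3 * (\<Sum>t. wt (t + a))"
            using re[OF wt_summable wt_nonneg] k0 K30 by (intro mult_left_mono) auto
          also have "... <= 1 / 4" by (rule wa)
          finally have "K * (3 * \<kappa> * K3 * (\<Sum>i<n. wt (s i))) <= K * (1 / 4)" using K0 by (rule mult_left_mono)
          then show ?thesis by (simp add: mult_ac)
        qed
        moreover have "\<kappa> * (\<Sum>i<n. G (Suc i)) <= \<kappa> * (\<Sum>k. real (Suc k) * \<bar>g k\<bar>)"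
          by (intro mult_left_mono G_sum k0)
        ultimately show ?thesis by linarith
      qed
      finally have HH: "\<bar>H n - H 0\<bar> <= C0 - 2 * (sqrt (real a) * \<sigma>) + K / 4" unfolding C0_def by linarith
      have sa: "0 < sqrt (real a) * \<sigma>" using a \<sigma> by simp
      have ig: "integrable M (%w. k (PS n w))" if k: "1-lipschitz_on UNIV k" for k :: "real => real"
      proof (rule Bochner_Integration.integrable_bound)
        show "integrable M (%w. \<bar>k 0\<bar> + \<bar>PS n w\<bar>)" using m1.S_integrable[of n] unfolding PS by simp
        show "(%w. k (PS n w)) \<in> borel_measurable M" using lipschitz_UNIV_measurable[OF k] by measurable
        show "AE w in M. norm (k (PS n w)) <= norm (\<bar>k 0\<bar> + \<bar>PS n w\<bar>)"
        proof (rule AE_I2)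
          fix w show "norm (k (PS n w)) <= norm (\<bar>k 0\<bar> + \<bar>PS n w\<bar>)"
            using lipschitz_UNIV_D[OF k, of "PS n w" 0] by simp
        qed
      qed
      have E1: "\<bar>H n - E (%w. f (PS n w))\<bar> <= sqrt (real a) * \<sigma>"
      proof -
        note i = ig[OF gsmooth_lipschitz[OF f]] ig[OF f]
        have "H n - E (%w. f (PS n w)) = E (%w. gsmooth (sqrt (real a) * \<sigma>) f (PS n w) - f (PS n w))"
          unfolding H_def using i by simp
        moreover have "\<bar>E (%w. gsmooth (sqrt (real a) * \<sigma>) f (PS n w) - f (PS n w))\<bar> <= sqrt (real a) * \<sigma>"
          using i gsmooth_close[OF f, of "sqrt (real a) * \<sigma>"] sa
          by (intro order_trans[OF integral_abs_bound] integral_le_const) auto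
        ultimately show ?thesis by simp
      qed
      have E2: "\<bar>H 0 - gsmooth (sqrt (real n) * \<sigma>) f 0\<bar> <= sqrt (real a) * \<sigma>"
      proof -
        have "sqrt ((sqrt (real a) * \<sigma>)\<^sup>2 + (sqrt (real n) * \<sigma>)\<^sup>2) = sqrt (real (n + a)) * \<sigma>"
          by (rule real_sqrt_unique) (use \<sigma> in \<open>auto simp: power_mult_distrib algebra_simps\<close>)
        then have "gsmooth (sqrt (real a) * \<sigma>) (gsmooth (sqrt (real n) * \<sigma>) f) = gsmooth (sqrt (real (n + a)) * \<sigma>) f"
          using gsmooth_gsmooth[OF f sa, of "sqrt (real n) * \<sigma>"] False \<sigma> by simp
        moreover have "H 0 = gsmooth (sqrt (real (n + a)) * \<sigma>) f 0"
          unfolding H_def using prob_space by (simp add: PS_0)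
        ultimately show ?thesis
          using gsmooth_close[OF gsmooth_lipschitz[OF f, of "sqrt (real n) * \<sigma>"], of "sqrt (real a) * \<sigma>" 0] sa by simp
      qed
      show ?thesis using HH E1 E2 C00 unfolding K_def by linarith
    qed
  qed
  then show ?thesis by blast
qed

end

section \<open>Choice of block length and truncation level\<close>

lemma inverse_sqrt_step: "1 / sqrt (real (Suc n)) <= 2 * (sqrt (real (Suc n)) - sqrt (real n))"
proof -
  define a b where "a = sqrt (real (Suc n))" and "b = sqrt (real n)"
  have a: "0 < a" "b <= a" "0 <= b" unfolding a_def b_def by simp_all
  have "a\<^sup>2 = b\<^sup>2 + 1" unfolding a_def b_def by simp
  then have "(a - b) * (a + b) = 1" by (simp add: algebra_simps power2_eq_square)
  then have "1 <= (a - b) * (2 * a)" using mult_left_mono[of "a + b" "2 * a" "a - b"] a by simp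
  then have "1 / a <= ((a - b) * (2 * a)) / a" using a by (intro divide_right_mono) auto
  also have "... = 2 * (a - b)" using a by simp
  finally show ?thesis unfolding a_def b_def .
qed

lemma inverse_sqrt_cubed_step:
  "1 / sqrt (real (Suc n)) ^ 3 <= 4 * (1 / sqrt (real (Suc n)) - 1 / sqrt (real (Suc (Suc n))))"
proof -
  define a b where "a = sqrt (real (Suc n))" and "b = sqrt (real (Suc (Suc n)))"
  have a: "1 <= a" "a <= b" and b: "0 < b" unfolding a_def b_def by simp_all
  have sq: "b\<^sup>2 = a\<^sup>2 + 1" "1 <= a\<^sup>2" unfolding a_def b_def by simp_all
  have d: "(b - a) * (b + a) = 1" using sq by (simp add: algebra_simps power2_eq_square)
  have b2: "b <= 3 / 2 * a"
  proof (rule power2_le_imp_le)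
    show "b\<^sup>2 <= (3 / 2 * a)\<^sup>2" using sq by (simp add: power_mult_distrib power2_eq_square)
  qed (use a in simp)
  have "a * b * (b + a) <= a * (3 / 2 * a) * (3 / 2 * a + a)"
    using a b b2 by (intro mult_mono add_mono) auto
  also have "... <= 4 * a ^ 3" using a by (simp add: power3_eq_cube)
  finally have "a * b * (b + a) <= 4 * a ^ 3" .
  then have "4 / (4 * a ^ 3) <= 4 / (a * b * (b + a))" using a b by (intro divide_left_mono) auto
  then have "1 / a ^ 3 <= 4 * (1 / (a * b * (b + a)))" by simp
  also have "1 / (a * b * (b + a)) = 1 / a - 1 / b"
  proof -
    have "1 / a - 1 / b = (b - a) / (a * b)" using a b by (simp add: field_simps)
    also have "... = ((b - a) * (b + a)) / (a * b * (b + a))" using a b by simp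
    finally show ?thesis unfolding d by simp
  qed
  finally show ?thesis unfolding a_def b_def .
qed

lemma sum_scales_below:
  "(\<Sum>s<n. of_bool (sqrt (real (Suc s)) < y)) <= y\<^sup>2"
proof -
  have "(\<Sum>s<n. of_bool (sqrt (real (Suc s)) < y)) <= real n \<and> (\<Sum>s<n. of_bool (sqrt (real (Suc s)) < y)) <= y\<^sup>2"
  proof (induction n)
    case (Suc n)
    show ?case
    proof (cases "sqrt (real (Suc n)) < y")
      case True
      then have "(sqrt (real (Suc n)))\<^sup>2 <= y\<^sup>2" by (intro power_mono) auto
      then have "real n + 1 <= y\<^sup>2" by simp
      then show ?thesis using Suc True by simp
    qed (use Suc in simp)
  qed simp
  then show ?thesis by blast
qed

lemma sum_scales_below_weighted:
  assumes "0 <= y"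
  shows "(\<Sum>s<n. of_bool (sqrt (real (Suc s)) < y) * (y / sqrt (real (Suc s)))) <= 2 * y\<^sup>2"
proof -
  let ?s = "%n. \<Sum>s<n. of_bool (sqrt (real (Suc s)) < y) * (y / sqrt (real (Suc s)))"
  have "?s n <= 2 * y * sqrt (real n) \<and> ?s n <= 2 * y\<^sup>2"
  proof (induction n)
    case (Suc n)
    have st: "y / sqrt (real (Suc n)) <= 2 * y * sqrt (real (Suc n)) - 2 * y * sqrt (real n)"
      using mult_left_mono[OF inverse_sqrt_step[of n] assms] by (simp add: algebra_simps)
    have 1: "?s (Suc n) <= 2 * y * sqrt (real (Suc n))"
    proof (cases "sqrt (real (Suc n)) < y")
      case False
      have "2 * y * sqrt (real n) <= 2 * y * sqrt (real (Suc n))"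
        using assms by (intro mult_left_mono) auto
      then show ?thesis using Suc False by simp
    qed (use Suc st in simp)
    have "?s (Suc n) <= 2 * y\<^sup>2"
    proof (cases "sqrt (real (Suc n)) < y")
      case True
      then have "2 * y * sqrt (real (Suc n)) <= 2 * y * y" using assms by (intro mult_left_mono) auto
      then show ?thesis using 1 by (simp add: power2_eq_square)
    qed (use Suc in simp)
    then show ?case using 1 by blast
  qed simp
  then show ?thesis by blast
qed

lemma sum_scales_above:
  assumes "1 <= y"
  shows "(\<Sum>s<n. of_bool (y <= sqrt (real (Suc s))) * (y / sqrt (real (Suc s))) ^ 3) <= 4 * y\<^sup>2"
proof -
  let ?s = "%n. \<Sum>s<n. of_bool (y <= sqrt (real (Suc s))) * (y / sqrt (real (Suc s))) ^ 3"
  let ?b = "%n. max 0 (4 * y ^ 3 * (1 / y - 1 / sqrt (real (Suc n))))"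
  have "?s n <= ?b n"
  proof (induction n)
    case (Suc n)
    have dec: "1 / sqrt (real (Suc (Suc n))) <= 1 / sqrt (real (Suc n))" by (intro divide_left_mono) auto
    show ?case
    proof (cases "y <= sqrt (real (Suc n))")
      case True
      then have "1 / sqrt (real (Suc n)) <= 1 / y" using assms by (intro divide_left_mono) auto
      then have b: "?b n = 4 * y ^ 3 * (1 / y - 1 / sqrt (real (Suc n)))" using assms by simp
      have "(y / sqrt (real (Suc n))) ^ 3 = y ^ 3 * (1 / sqrt (real (Suc n)) ^ 3)" by (simp add: power_divide)
      also have "... <= y ^ 3 * (4 * (1 / sqrt (real (Suc n)) - 1 / sqrt (real (Suc (Suc n)))))"
        using assms by (intro mult_left_mono inverse_sqrt_cubed_step) simp
      finally have "?s (Suc n) <= 4 * y ^ 3 * (1 / y - 1 / sqrt (real (Suc (Suc n))))"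
        using Suc True unfolding b by (simp add: algebra_simps)
      then show ?thesis by simp
    next
      case False
      have "4 * y ^ 3 * (1 / y - 1 / sqrt (real (Suc n))) <= 4 * y ^ 3 * (1 / y - 1 / sqrt (real (Suc (Suc n))))"
        using assms dec by (intro mult_left_mono) auto
      then have "?b n <= ?b (Suc n)" by (intro max.mono order_refl)
      then show ?thesis using Suc False by simp
    qed
  qed simp
  also have "?b n <= 4 * y\<^sup>2"
  proof -
    have "4 * y ^ 3 * (1 / y - 1 / sqrt (real (Suc n))) <= 4 * y ^ 3 * (1 / y)"
      using assms by (intro mult_left_mono) auto
    also have "... = 4 * y\<^sup>2" using assms by (simp add: power3_eq_cube power2_eq_square)
    finally show ?thesis by simp
  qed
  finally show ?thesis .
qed

lemma sum_squares_le_cube: "(\<Sum>j<n. real (Suc j) ^ 2) <= real n ^ 3"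
proof (induction n)
  case (Suc n)
  have "real n ^ 3 + real (Suc n) ^ 2 <= real (Suc n) ^ 3"
    by (simp add: power2_eq_square power3_eq_cube algebra_simps)
  then show ?case using Suc by simp
qed simp

locale profile =
  fixes \<alpha> :: "nat => real" and Q :: "real => real"
  assumes \<alpha>_0: "\<alpha> 0 = 1" and \<alpha>_mono: "\<And>i j. i <= j ==> \<alpha> j <= \<alpha> i" and \<alpha>_nonneg: "\<And>j. 0 <= \<alpha> j"
    and Q_meas[measurable]: "Q \<in> borel_measurable borel"
    and Q_ge: "\<And>u. 0 < u ==> u < 1 ==> 1 <= Q u"
    and Q_mono: "\<And>u v. 0 < u ==> u <= v ==> v < 1 ==> Q v <= Q u"
    and finite_sum: "(\<Sum>j. of_nat (Suc j) * (\<integral>\<^sup>+u\<in>{0<..<\<alpha> j}. ennreal (Q u ^ 3) \<partial>lborel)) < \<infinity>"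
begin

lemma \<alpha>_le_1: "\<alpha> j <= 1" using \<alpha>_mono[of 0 j] \<alpha>_0 by simp

definition "K = enn2real (\<Sum>j. of_nat (Suc j) * (\<integral>\<^sup>+u\<in>{0<..<\<alpha> j}. ennreal (Q u ^ 3) \<partial>lborel))"

lemma K_eq: "ennreal K = (\<Sum>j. of_nat (Suc j) * (\<integral>\<^sup>+u\<in>{0<..<\<alpha> j}. ennreal (Q u ^ 3) \<partial>lborel))"
  unfolding K_def using finite_sum by (simp add: ennreal_enn2real_if)

lemma K_nonneg: "0 <= K" unfolding K_def by simp

lemma set_nn_mono:
  assumes "\<And>u. u \<in> S ==> f u <= g u"
  shows "(\<integral>\<^sup>+u\<in>S. ennreal (f u) \<partial>lborel) <= (\<integral>\<^sup>+u\<in>S. ennreal (g u) \<partial>lborel)"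
  using assms by (intro nn_integral_mono) (auto simp: indicator_def intro: ennreal_leI)

lemma \<alpha>_integral_ge: "ennreal (\<alpha> j) <= (\<integral>\<^sup>+u\<in>{0<..<\<alpha> j}. ennreal (Q u ^ 3) \<partial>lborel)"
proof -
  have "ennreal (\<alpha> j) = (\<integral>\<^sup>+u\<in>{0<..<\<alpha> j}. ennreal 1 \<partial>lborel)"
    using \<alpha>_nonneg[of j] by (simp add: emeasure_lborel_Ioo)
  also have "... <= (\<integral>\<^sup>+u\<in>{0<..<\<alpha> j}. ennreal (Q u ^ 3) \<partial>lborel)"
    using Q_ge \<alpha>_le_1[of j] by (intro set_nn_mono one_le_power) auto
  finally show ?thesis .
qed

lemma exists_\<alpha>_le:
  assumes "0 < u"
  shows "\<exists>j. \<alpha> j <= u"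
proof (rule ccontr)
  assume "\<nexists>j. \<alpha> j <= u"
  then have gt: "u < \<alpha> j" for j by (meson not_le)
  have "of_nat n * ennreal u <= ennreal K" for n
  proof -
    have "of_nat n * ennreal u = (\<Sum>j<n. ennreal u)" by simp
    also have "... <= (\<Sum>j<n. of_nat (Suc j) * (\<integral>\<^sup>+u\<in>{0<..<\<alpha> j}. ennreal (Q u ^ 3) \<partial>lborel))"
    proof (rule sum_mono)
      fix j
      have "1 * ennreal u <= of_nat (Suc j) * ennreal (\<alpha> j)"
        using gt[of j] of_nat_mono[of 1 "Suc j", where 'a = ennreal] by (intro mult_mono ennreal_leI) auto
      also have "... <= of_nat (Suc j) * (\<integral>\<^sup>+u\<in>{0<..<\<alpha> j}. ennreal (Q u ^ 3) \<partial>lborel)"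
        by (intro mult_left_mono \<alpha>_integral_ge) simp
      finally show "ennreal u <= of_nat (Suc j) * (\<integral>\<^sup>+u\<in>{0<..<\<alpha> j}. ennreal (Q u ^ 3) \<partial>lborel)" by simp
    qed
    also have "... <= ennreal K" unfolding K_eq by (intro sum_le_suminf) auto
    finally show ?thesis .
  qed
  then have "real n * u <= K" for n
    using assms K_nonneg by (simp add: ennreal_of_nat_eq_real_of_nat ennreal_mult[symmetric] del: of_nat_mult)
  moreover obtain n :: nat where "K / u < real n" using reals_Archimedean2 by blast
  ultimately show False using assms by (simp add: divide_less_eq) (meson not_le)
qed

text \<open>The inverse of \<open>\<alpha>\<close>: the number of indices with \<open>\<alpha> j > u\<close>.\<close>

definition A :: "real => nat" where "A u = (if 0 < u then LEAST j. \<alpha> j <= u else 0)"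

lemma less_A: "j < A u \<longleftrightarrow> 0 < u \<and> u < \<alpha> j"
proof (cases "0 < u")
  case u: True
  have "\<alpha> (A u) <= u" unfolding A_def using LeastI_ex[OF exists_\<alpha>_le[OF u]] u by simp
  moreover have "j < A u ==> u < \<alpha> j"
    unfolding A_def using not_less_Least[of j "%j. \<alpha> j <= u"] u by simp
  ultimately show ?thesis
    using \<alpha>_mono[of "A u" j] u by (meson le_less_trans not_le order_trans)
qed (simp add: A_def)

lemma A_ge_1: "0 < u ==> u < 1 ==> 1 <= A u"
  using less_A[of 0 u] \<alpha>_0 by simp

lemma A_mono: "0 < u ==> u <= v ==> A v <= A u"
proof (rule ccontr)
  assume u: "0 < u" "u <= v" and "\<not> A v <= A u"
  then have "A u < A v" by simp
  then have "v < \<alpha> (A u)" using less_A by blast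
  then have "A u < A u" using less_A[of "A u" u] u by simp
  then show False by simp
qed

lemma A_meas[measurable]: "(%u. real (A u)) \<in> borel_measurable borel"
proof (rule borel_measurableI_greater)
  fix y :: real
  show "{x \<in> space borel. y < real (A x)} \<in> sets borel"
  proof (cases "y < 0")
    case True
    then have "{x \<in> space borel. y < real (A x)} = UNIV" by auto
    then show ?thesis by simp
  next
    case False
    then have eq: "y < real (A x) \<longleftrightarrow> nat \<lfloor>y\<rfloor> < A x" for x by (simp add: nat_less_iff floor_less_iff)
    have "{x \<in> space borel. y < real (A x)} = {0<..<\<alpha> (nat \<lfloor>y\<rfloor>)}" unfolding eq less_A by auto
    then show ?thesis by simp
  qed
qed

text \<open>Error density at scale \<open>s\<close>. Levels with \<open>A u * Q u \<le> sqrt s\<close> are not affected by truncation and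
contribute through fourth order terms, the others through truncation and cut-off errors.\<close>

definition \<Theta> :: "nat => real => real" where
  "\<Theta> s u = (let y = real (A u) * Q u; q = sqrt (real s) in
     Q u * (of_bool (q < y) + of_bool (q < y) * (y / q) + of_bool (y <= q) * (y / q) ^ 3))"

lemma \<Theta>_nonneg: "0 < u ==> u < 1 ==> 0 <= \<Theta> s u"
  unfolding \<Theta>_def Let_def using Q_ge[of u] by (intro mult_nonneg_nonneg add_nonneg_nonneg) auto

lemma \<Theta>_meas[measurable]: "\<Theta> s \<in> borel_measurable borel"
  unfolding \<Theta>_def Let_def by measurable

definition "err s = enn2real (\<integral>\<^sup>+u\<in>{0<..<1}. ennreal (\<Theta> (Suc s) u) \<partial>lborel)"

lemma A_weight_integral: "(\<integral>\<^sup>+u\<in>{0<..<1}. ennreal (real (A u) ^ 2 * Q u ^ 3) \<partial>lborel) <= 2 * ennreal K"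
proof -
  have "(\<integral>\<^sup>+u\<in>{0<..<1}. ennreal (real (A u) ^ 2 * Q u ^ 3) \<partial>lborel)
      <= (\<integral>\<^sup>+u. (\<Sum>j. 2 * (of_nat (Suc j) * (ennreal (Q u ^ 3) * indicator {0<..<\<alpha> j} u))) \<partial>lborel)"
  proof (rule nn_integral_mono)
    fix u :: real
    show "ennreal (real (A u) ^ 2 * Q u ^ 3) * indicator {0<..<1} u
        <= (\<Sum>j. 2 * (of_nat (Suc j) * (ennreal (Q u ^ 3) * indicator {0<..<\<alpha> j} u)))"
    proof (cases "u \<in> {0<..<1}")
      case True
      have Q0: "0 <= Q u ^ 3" using Q_ge[of u] True by simp
      have "real n ^ 2 <= 2 * (\<Sum>j<n. real (Suc j))" for n
        by (induction n) (auto simp: power2_eq_square algebra_simps)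
      then have "real (A u) ^ 2 * Q u ^ 3 <= (\<Sum>j<A u. 2 * (real (Suc j) * Q u ^ 3))"
        using Q0 by (simp add: sum_distrib_left[symmetric] sum_distrib_right[symmetric] mult.assoc[symmetric] mult_right_mono del: of_nat_Suc)
      then have "ennreal (real (A u) ^ 2 * Q u ^ 3) <= ennreal (\<Sum>j<A u. 2 * (real (Suc j) * Q u ^ 3))"
        by (rule ennreal_leI)
      also have "... = (\<Sum>j<A u. ennreal (2 * (real (Suc j) * Q u ^ 3)))"
        using Q0 by (intro sum_ennreal[symmetric]) auto
      also have "... = (\<Sum>j<A u. 2 * (of_nat (Suc j) * (ennreal (Q u ^ 3) * indicator {0<..<\<alpha> j} u)))"
      proof (rule sum.cong[OF refl])
        fix j assume "j \<in> {..<A u}"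
        then have "indicator {0<..<\<alpha> j} u = (1 :: ennreal)" using less_A[of j u] by simp
        then show "ennreal (2 * (real (Suc j) * Q u ^ 3)) = 2 * (of_nat (Suc j) * (ennreal (Q u ^ 3) * indicator {0<..<\<alpha> j} u))"
          using Q0 by (simp add: ennreal_mult ennreal_of_nat_eq_real_of_nat del: of_nat_Suc)
      qed
      also have "... <= (\<Sum>j. 2 * (of_nat (Suc j) * (ennreal (Q u ^ 3) * indicator {0<..<\<alpha> j} u)))"
        by (intro sum_le_suminf) auto
      finally show ?thesis using True by simp
    qed simp
  qed
  also have "... = (\<Sum>j. \<integral>\<^sup>+u. 2 * (of_nat (Suc j) * (ennreal (Q u ^ 3) * indicator {0<..<\<alpha> j} u)) \<partial>lborel)"
    by (rule nn_integral_suminf) measurable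
  also have "... = (\<Sum>j. 2 * (of_nat (Suc j) * (\<integral>\<^sup>+u. (ennreal (Q u ^ 3) * indicator {0<..<\<alpha> j} u) \<partial>lborel)))"
    by (simp add: nn_integral_cmult)
  also have "... = 2 * ennreal K" unfolding K_eq by simp
  finally show ?thesis .
qed

text \<open>For a fixed level, summation over the scales below and above \<open>y\<^sup>2\<close> with \<open>y = A u * Q u\<close> gives
at most a multiple of \<open>y\<^sup>2\<close>.\<close>

lemma \<Theta>_total: "(\<Sum>s. \<integral>\<^sup>+u\<in>{0<..<1}. ennreal (\<Theta> (Suc s) u) \<partial>lborel) <= ennreal (14 * K)"
proof -
  have "(\<Sum>s. \<integral>\<^sup>+u\<in>{0<..<1}. ennreal (\<Theta> (Suc s) u) \<partial>lborel)
      = (\<integral>\<^sup>+u. (\<Sum>s. ennreal (\<Theta> (Suc s) u) * indicator {0<..<1} u) \<partial>lborel)"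
    by (rule nn_integral_suminf[symmetric]) measurable
  also have "... <= (\<integral>\<^sup>+u. 7 * (ennreal (real (A u) ^ 2 * Q u ^ 3) * indicator {0<..<1} u) \<partial>lborel)"
  proof (rule nn_integral_mono)
    fix u :: real
    show "(\<Sum>s. ennreal (\<Theta> (Suc s) u) * indicator {0<..<1} u) <= 7 * (ennreal (real (A u) ^ 2 * Q u ^ 3) * indicator {0<..<1} u)"
    proof (cases "u \<in> {0<..<1}")
      case True
      then have u: "0 < u" "u < 1" by auto
      define y where "y = real (A u) * Q u"
      have Qu: "1 <= Q u" by (rule Q_ge[OF u])
      have y: "1 <= y" unfolding y_def using A_ge_1[OF u] Qu mult_mono[of 1 "real (A u)" 1 "Q u"] by simp
      have "(\<Sum>s. ennreal (\<Theta> (Suc s) u)) <= ennreal (7 * (real (A u) ^ 2 * Q u ^ 3))"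
      proof (rule suminf_le_const[OF summableI])
        fix n
        have "(\<Sum>s<n. ennreal (\<Theta> (Suc s) u)) = ennreal (\<Sum>s<n. \<Theta> (Suc s) u)"
          using \<Theta>_nonneg[OF u] by (intro sum_ennreal) auto
        also have "... <= ennreal (7 * (real (A u) ^ 2 * Q u ^ 3))"
        proof (rule ennreal_leI)
          have "(\<Sum>s<n. \<Theta> (Suc s) u) = Q u * ((\<Sum>s<n. of_bool (sqrt (real (Suc s)) < y))
            + (\<Sum>s<n. of_bool (sqrt (real (Suc s)) < y) * (y / sqrt (real (Suc s))))
            + (\<Sum>s<n. of_bool (y <= sqrt (real (Suc s))) * (y / sqrt (real (Suc s))) ^ 3))"
            unfolding \<Theta>_def Let_def y_def[symmetric] sum_distrib_left[symmetric] by (simp only: sum.distrib)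
          also have "... <= Q u * (y\<^sup>2 + 2 * y\<^sup>2 + 4 * y\<^sup>2)"
            using Qu y by (intro mult_left_mono add_mono sum_scales_below sum_scales_below_weighted sum_scales_above) auto
          also have "... = 7 * (real (A u) ^ 2 * Q u ^ 3)"
            unfolding y_def by (simp add: power_mult_distrib power2_eq_square power3_eq_cube)
          finally show "(\<Sum>s<n. \<Theta> (Suc s) u) <= 7 * (real (A u) ^ 2 * Q u ^ 3)" .
        qed
        finally show "(\<Sum>s<n. ennreal (\<Theta> (Suc s) u)) <= ennreal (7 * (real (A u) ^ 2 * Q u ^ 3))" .
      qed
      then show ?thesis using True Qu by (simp add: ennreal_mult)
    qed simp
  qed
  also have "... = 7 * (\<integral>\<^sup>+u\<in>{0<..<1}. ennreal (real (A u) ^ 2 * Q u ^ 3) \<partial>lborel)"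
    by (rule nn_integral_cmult) measurable
  also have "... <= 7 * (2 * ennreal K)" by (intro mult_left_mono A_weight_integral) simp
  also have "... = ennreal (14 * K)" using K_nonneg by (simp add: ennreal_mult mult.assoc[symmetric])
  finally show ?thesis .
qed

lemma err_eq: "ennreal (err s) = (\<integral>\<^sup>+u\<in>{0<..<1}. ennreal (\<Theta> (Suc s) u) \<partial>lborel)"
proof -
  have "(\<integral>\<^sup>+u\<in>{0<..<1}. ennreal (\<Theta> (Suc s) u) \<partial>lborel) <= (\<Sum>s. \<integral>\<^sup>+u\<in>{0<..<1}. ennreal (\<Theta> (Suc s) u) \<partial>lborel)"
    using sum_le_suminf[of "%s. \<integral>\<^sup>+u\<in>{0<..<1}. ennreal (\<Theta> (Suc s) u) \<partial>lborel" "{s}"] by simp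
  also have "... < \<infinity>" using \<Theta>_total by (rule le_less_trans) simp
  finally show ?thesis unfolding err_def by (simp add: ennreal_enn2real_if)
qed

lemma err_nonneg: "0 <= err s" unfolding err_def by simp

lemma err_summable: "summable err"
proof (rule summableI_nonneg_bounded)
  fix n
  have "ennreal (\<Sum>s<n. err s) = (\<Sum>s<n. \<integral>\<^sup>+u\<in>{0<..<1}. ennreal (\<Theta> (Suc s) u) \<partial>lborel)"
    by (simp add: sum_ennreal[symmetric] err_nonneg err_eq)
  also have "... <= ennreal (14 * K)" by (rule order_trans[OF sum_le_suminf \<Theta>_total]) auto
  finally show "(\<Sum>s<n. err s) <= 14 * K" using K_nonneg by simp
qed (rule err_nonneg)

text \<open>Since \<open>A\<close> and \<open>Q\<close> both decrease in \<open>u\<close>, the condition \<open>A u * Q u \<le> sqrt s\<close> describes an upper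
interval of levels; block length and truncation level are the suprema of \<open>A\<close> and \<open>Q\<close> on it.\<close>

lemma exists_levels:
  assumes s: "1 <= s"
  shows "\<exists>J M. 1 <= J \<and> 1 <= M \<and> real J * M <= sqrt (real s) \<and>
    (\<forall>u. 0 < u \<and> u < 1 \<and> real (A u) * Q u <= sqrt (real s) \<longrightarrow> A u <= J \<and> Q u <= M) \<and>
    (\<forall>u. 0 < u \<and> u < 1 \<and> sqrt (real s) < real (A u) * Q u \<longrightarrow> J <= A u \<and> M <= Q u)"
proof -
  define good where "good = {u. 0 < u \<and> u < 1 \<and> real (A u) * Q u <= sqrt (real s)}"
  show ?thesis
  proof (cases "good = {}")
    case True
    then have "\<not> (real (A u) * Q u <= sqrt (real s))" if "0 < u" "u < 1" for u
      using that unfolding good_def by blast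
    then show ?thesis using s A_ge_1 Q_ge by (intro exI[of _ 1] exI[of _ "1 :: real"]) auto
  next
    case False
    have Ab: "real (A u) <= sqrt (real s)" "Q u <= sqrt (real s)" if "u \<in> good" for u
    proof -
      have u: "0 < u" "u < 1" "real (A u) * Q u <= sqrt (real s)" using that unfolding good_def by auto
      have "1 <= real (A u)" "1 <= Q u" using A_ge_1[OF u(1,2)] Q_ge[OF u(1,2)] by auto
      then have "real (A u) * 1 <= real (A u) * Q u" "1 * Q u <= real (A u) * Q u"
        by (intro mult_left_mono mult_right_mono; simp)+
      then show "real (A u) <= sqrt (real s)" "Q u <= sqrt (real s)" using u(3) by auto
    qed
    have fin: "finite (A ` good)"
      by (rule finite_subset[of _ "{.. nat \<lfloor>sqrt (real s)\<rfloor>}"]) (use Ab in \<open>auto simp: le_nat_floor\<close>)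
    have bdd: "bdd_above (Q ` good)" using Ab by (intro bdd_aboveI2) auto
    define J where "J = Max (A ` good)"
    define M where "M = Sup (Q ` good)"
    have "J \<in> A ` good" unfolding J_def using fin False by (intro Max_in) auto
    then obtain u1 where u1: "u1 \<in> good" "J = A u1" by auto
    have QM: "Q u <= M" if "u \<in> good" for u unfolding M_def using that bdd by (intro cSup_upper) auto
    have AJ: "A u <= J" if "u \<in> good" for u unfolding J_def using that fin by (intro Max_ge) auto
    have up: "v \<in> good" if "u \<in> good" "u <= v" "v < 1" for u v
    proof -
      have "real (A v) * Q v <= real (A u) * Q u"
        using that A_mono[of u v] Q_mono[of u v] Q_ge[of v] unfolding good_def by (intro mult_mono) auto
      then show ?thesis using that unfolding good_def by auto
    qed
    have J1: "1 <= J" using u1 A_ge_1[of u1] unfolding good_def by auto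
    have M1: "1 <= M" using QM[OF u1(1)] Q_ge[of u1] u1 unfolding good_def by auto
    have "M <= sqrt (real s) / real J"
      unfolding M_def
    proof (rule cSup_least)
      fix x assume "x \<in> Q ` good"
      then obtain u2 where u2: "u2 \<in> good" "x = Q u2" by auto
      define u where "u = min u1 u2"
      have u: "u \<in> good" unfolding u_def using u1 u2 by (simp add: min_def)
      have "J <= A u" unfolding u1(2) using u by (intro A_mono) (auto simp: u_def good_def)
      moreover have "x <= Q u" unfolding u2(2) using u u2 by (intro Q_mono) (auto simp: u_def good_def)
      ultimately have "real J * x <= real (A u) * Q u"
        using Q_ge[of u2] u2 unfolding good_def by (intro mult_mono) auto
      also have "... <= sqrt (real s)" using u unfolding good_def by auto
      finally show "x <= sqrt (real s) / real J" using J1 by (simp add: field_simps)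
    qed (use False in simp)
    then have JM: "real J * M <= sqrt (real s)" using J1 by (simp add: field_simps)
    have bad: "J <= A u \<and> M <= Q u" if u: "0 < u" "u < 1" "sqrt (real s) < real (A u) * Q u" for u
    proof -
      have less: "u < v" if "v \<in> good" for v
      proof (rule ccontr)
        assume "\<not> u < v"
        then have "u \<in> good" using up[OF that, of u] u by simp
        then show False using u unfolding good_def by simp
      qed
      have "J <= A u" unfolding u1(2) using less[OF u1(1)] u by (intro A_mono) auto
      moreover have "M <= Q u" unfolding M_def
      proof (rule cSup_least)
        fix x assume "x \<in> Q ` good"
        then obtain v where v: "v \<in> good" "x = Q v" by auto
        then show "x <= Q u" using less[OF v(1)] u unfolding good_def by (auto intro!: Q_mono)
      qed (use False in simp)
      ultimately show ?thesis by blast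
    qed
    show ?thesis
      using J1 M1 JM bad AJ QM unfolding good_def by (intro exI[of _ J] exI[of _ M]) auto
  qed
qed

text \<open>Quantile bounds for products of \<open>q\<close> variables truncated at \<open>M\<close> across a gap \<open>j\<close>, for covariances,
and for the first and second moments of the part cut off.\<close>

definition "H M q j = enn2real (\<integral>\<^sup>+u\<in>{0<..<\<alpha> j}. ennreal (min (Q u) M ^ q) \<partial>lborel)"
definition "H2 j = enn2real (\<integral>\<^sup>+u\<in>{0<..<\<alpha> j}. ennreal (Q u ^ 2) \<partial>lborel)"
definition "R1 M = enn2real (\<integral>\<^sup>+u\<in>{0<..<1}. ennreal (Q u - M) \<partial>lborel)"
definition "R2 M = enn2real (\<integral>\<^sup>+u\<in>{0<..<1}. ennreal (of_bool (M < Q u) * Q u ^ 2) \<partial>lborel)"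

lemma integral_Q3_finite: "(\<integral>\<^sup>+u\<in>{0<..<1}. ennreal (Q u ^ 3) \<partial>lborel) <= ennreal K"
  unfolding K_eq
  using sum_le_suminf[of "%j. of_nat (Suc j) * (\<integral>\<^sup>+u\<in>{0<..<\<alpha> j}. ennreal (Q u ^ 3) \<partial>lborel)" "{0}"] \<alpha>_0
  by simp

lemma set_nn_finite:
  assumes "\<And>u. 0 < u ==> u < 1 ==> u \<in> S ==> f u <= Q u ^ 3" "S \<subseteq> {0<..<1}"
  shows "ennreal (enn2real (\<integral>\<^sup>+u\<in>S. ennreal (f u) \<partial>lborel)) = (\<integral>\<^sup>+u\<in>S. ennreal (f u) \<partial>lborel)"
proof -
  have "(\<integral>\<^sup>+u\<in>S. ennreal (f u) \<partial>lborel) <= (\<integral>\<^sup>+u\<in>{0<..<1}. ennreal (Q u ^ 3) \<partial>lborel)"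
    using assms by (intro nn_integral_mono) (auto simp: indicator_def intro!: ennreal_leI)
  also have "... <= ennreal K" by (rule integral_Q3_finite)
  also have "... < \<infinity>" by simp
  finally show ?thesis by (simp add: ennreal_enn2real_if)
qed

lemma \<alpha>_sub: "{0<..<\<alpha> j} \<subseteq> {0<..<1}" using \<alpha>_le_1[of j] by auto

lemma Q_pow: "0 < u ==> u < 1 ==> q <= r ==> Q u ^ q <= Q u ^ r"
  using Q_ge[of u] by (intro power_increasing) auto

lemma min_pow: "0 < u ==> u < 1 ==> 0 <= M ==> min (Q u) M ^ q <= Q u ^ q"
  using Q_ge[of u] by (intro power_mono) auto

lemma H_eq: "0 <= M ==> ennreal (H M q j) = (\<integral>\<^sup>+u\<in>{0<..<\<alpha> j}. ennreal (min (Q u) M ^ q) \<partial>lborel)"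
proof -
  assume M: "0 <= M"
  have "(\<integral>\<^sup>+u\<in>{0<..<\<alpha> j}. ennreal (min (Q u) M ^ q) \<partial>lborel) <= (\<integral>\<^sup>+u\<in>{0<..<(1::real)}. ennreal (M ^ q) \<partial>lborel)"
  proof (rule nn_integral_mono)
    fix u
    show "ennreal (min (Q u) M ^ q) * indicator {0<..<\<alpha> j} u <= ennreal (M ^ q) * indicator {0<..<1} u"
    proof (cases "u \<in> {0<..<\<alpha> j}")
      case True
      then have "u \<in> {0<..<1}" using \<alpha>_sub[of j] by blast
      moreover from this have "min (Q u) M ^ q <= M ^ q" using Q_ge[of u] M by (intro power_mono) auto
      ultimately show ?thesis using True by (simp add: ennreal_leI)
    qed simp
  qed
  also have "... = ennreal (M ^ q) * emeasure lborel {0<..<(1::real)}" by (rule nn_integral_cmult_indicator) simp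
  also have "... < \<infinity>" by (simp add: emeasure_lborel_Ioo)
  finally show ?thesis unfolding H_def by (simp add: ennreal_enn2real_if)
qed

lemma H2_eq: "ennreal (H2 j) = (\<integral>\<^sup>+u\<in>{0<..<\<alpha> j}. ennreal (Q u ^ 2) \<partial>lborel)"
  unfolding H2_def by (intro set_nn_finite \<alpha>_sub Q_pow) auto

lemma nonneg: "0 <= H M q j" "0 <= H2 j" "0 <= R1 M" "0 <= R2 M"
  unfolding H_def H2_def R1_def R2_def by auto

lemma R2_eq: "ennreal (R2 M) = (\<integral>\<^sup>+u\<in>{0<..<1}. ennreal (of_bool (M < Q u) * Q u ^ 2) \<partial>lborel)"
  unfolding R2_def using Q_ge by (intro set_nn_finite order_trans[OF _ Q_pow[of _ 2 3]]) (auto simp: mult_le_cancel_right1)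

lemma R1_eq: "0 <= M ==> ennreal (R1 M) = (\<integral>\<^sup>+u\<in>{0<..<1}. ennreal (Q u - M) \<partial>lborel)"
  unfolding R1_def
proof (intro set_nn_finite)
  fix u :: real assume "0 <= M" "0 < u" "u < 1"
  then show "Q u - M <= Q u ^ 3" using Q_pow[of u 1 3] by simp
qed simp

lemma R1_le_R2: assumes "1 <= M" shows "M * R1 M <= R2 M"
proof -
  have "ennreal (M * R1 M) = ennreal M * (\<integral>\<^sup>+u\<in>{0<..<1}. ennreal (Q u - M) \<partial>lborel)"
    using assms nonneg by (simp add: ennreal_mult R1_eq)
  also have "... = (\<integral>\<^sup>+u. ennreal M * (ennreal (Q u - M) * indicator {0<..<1} u) \<partial>lborel)"
    by (rule nn_integral_cmult[symmetric]) measurable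
  also have "... <= (\<integral>\<^sup>+u\<in>{0<..<1}. ennreal (of_bool (M < Q u) * Q u ^ 2) \<partial>lborel)"
  proof (rule nn_integral_mono)
    fix u
    show "ennreal M * (ennreal (Q u - M) * indicator {0<..<1} u) <= ennreal (of_bool (M < Q u) * Q u ^ 2) * indicator {0<..<1} u"
    proof (cases "M < Q u")
      case True
      have "M * (Q u - M) <= Q u * Q u" using True assms by (intro mult_mono) auto
      then have "ennreal M * ennreal (Q u - M) <= ennreal (Q u ^ 2)"
        using assms True by (subst ennreal_mult[symmetric]) (auto simp: power2_eq_square intro: ennreal_leI)
      then show ?thesis using True by (auto simp: indicator_def)
    qed (simp add: ennreal_neg)
  qed
  also have "... = ennreal (R2 M)" by (rule R2_eq[symmetric])
  finally show ?thesis using nonneg by simp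
qed

text \<open>Everything is compared pointwise in the level \<open>u\<close> with the error density.\<close>

lemma sum_le_err:
  assumes T: "finite T" and c: "\<And>j. j \<in> T ==> 0 <= c j"
    and m: "\<And>j. f j \<in> borel_measurable borel" "\<And>j. S j \<in> sets borel"
    and f: "\<And>j u. 0 < u ==> u < 1 ==> 0 <= f j u"
    and S: "\<And>j. S j \<subseteq> {0<..<1}"
    and le: "\<And>u. 0 < u ==> u < 1 ==> (\<Sum>j\<in>T. c j * (of_bool (u \<in> S j) * f j u)) <= \<Theta> (Suc n) u"
  shows "(\<Sum>j\<in>T. c j * enn2real (\<integral>\<^sup>+u\<in>S j. ennreal (f j u) \<partial>lborel)) <= err n"
proof -
  note [measurable] = m
  have "ennreal (\<Sum>j\<in>T. c j * enn2real (\<integral>\<^sup>+u\<in>S j. ennreal (f j u) \<partial>lborel))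
      = (\<Sum>j\<in>T. ennreal (c j) * ennreal (enn2real (\<integral>\<^sup>+u\<in>S j. ennreal (f j u) \<partial>lborel)))"
    using c by (simp add: sum_ennreal[symmetric] ennreal_mult)
  also have "... <= (\<Sum>j\<in>T. ennreal (c j) * (\<integral>\<^sup>+u\<in>S j. ennreal (f j u) \<partial>lborel))"
    by (intro sum_mono mult_left_mono) (auto simp: ennreal_enn2real_if)
  also have "... = (\<Sum>j\<in>T. (\<integral>\<^sup>+u. ennreal (c j) * (ennreal (f j u) * indicator (S j) u) \<partial>lborel))"
    by (intro sum.cong refl nn_integral_cmult[symmetric]) measurable
  also have "... = (\<integral>\<^sup>+u. (\<Sum>j\<in>T. ennreal (c j) * (ennreal (f j u) * indicator (S j) u)) \<partial>lborel)"
    by (rule nn_integral_sum[symmetric]) measurable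
  also have "... <= (\<integral>\<^sup>+u\<in>{0<..<1}. ennreal (\<Theta> (Suc n) u) \<partial>lborel)"
  proof (rule nn_integral_mono)
    fix u :: real
    show "(\<Sum>j\<in>T. ennreal (c j) * (ennreal (f j u) * indicator (S j) u)) <= ennreal (\<Theta> (Suc n) u) * indicator {0<..<1} u"
    proof (cases "u \<in> {0<..<1}")
      case True
      then have "(\<Sum>j\<in>T. ennreal (c j) * (ennreal (f j u) * indicator (S j) u))
          = (\<Sum>j\<in>T. ennreal (c j * (of_bool (u \<in> S j) * f j u)))"
        using c f by (intro sum.cong refl) (auto simp: ennreal_mult indicator_def)
      also have "... = ennreal (\<Sum>j\<in>T. c j * (of_bool (u \<in> S j) * f j u))"
        using c f True by (intro sum_ennreal) auto
      also have "... <= ennreal (\<Theta> (Suc n) u)" using le[of u] True by (intro ennreal_leI) auto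
      finally show ?thesis using True by simp
    next
      case False
      then have "indicator (S j) u = (0 :: ennreal)" for j using S[of j] by (auto simp: indicator_def)
      then show ?thesis by simp
    qed
  qed
  also have "... = ennreal (err n)" by (rule err_eq[symmetric])
  finally show ?thesis using err_nonneg[of n] by simp
qed

definition "levels s J M \<longleftrightarrow> 1 <= J \<and> 1 <= M \<and> real J * M <= sqrt (real s) \<and>
    (\<forall>u. 0 < u \<and> u < 1 \<and> real (A u) * Q u <= sqrt (real s) \<longrightarrow> A u <= J \<and> Q u <= M) \<and>
    (\<forall>u. 0 < u \<and> u < 1 \<and> sqrt (real s) < real (A u) * Q u \<longrightarrow> J <= A u \<and> M <= Q u)"

context
  fixes n J :: nat and M :: real
  assumes lev: "levels (Suc n) J M"
begin

private lemma L: "1 <= J" "1 <= M" "real J * M <= sqrt (real (Suc n))"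
  "0 < u ==> u < 1 ==> real (A u) * Q u <= sqrt (real (Suc n)) ==> A u <= J \<and> Q u <= M"
  "0 < u ==> u < 1 ==> sqrt (real (Suc n)) < real (A u) * Q u ==> J <= A u \<and> M <= Q u"
  using lev unfolding levels_def by auto

private lemma \<Theta>_bad:
  assumes "0 < u" "u < 1" "sqrt (real (Suc n)) < real (A u) * Q u"
  shows "Q u <= \<Theta> (Suc n) u" "Q u * (real (A u) * Q u / sqrt (real (Suc n))) <= \<Theta> (Suc n) u"
  unfolding \<Theta>_def Let_def using assms(3) Q_ge[OF assms(1,2)] by (auto simp: distrib_left simp del: of_nat_Suc)

private lemma \<Theta>_good:
  assumes "0 < u" "u < 1" "\<not> sqrt (real (Suc n)) < real (A u) * Q u"
  shows "\<Theta> (Suc n) u = Q u * (real (A u) * Q u / sqrt (real (Suc n))) ^ 3"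
  unfolding \<Theta>_def Let_def using assms(3) by (simp del: of_nat_Suc)

private lemma below_J: "0 < u ==> u < \<alpha> J ==> sqrt (real (Suc n)) < real (A u) * Q u"
  using less_A[of J u] L(4)[of u] \<alpha>_le_1[of J] by fastforce

private lemma q0: "0 < sqrt (real (Suc n))" by simp

lemma R1_le_err: "R1 M <= err n"
proof -
  have "(\<Sum>j\<in>{0::nat}. 1 * enn2real (\<integral>\<^sup>+u\<in>{0<..<1}. ennreal (max 0 (Q u - M)) \<partial>lborel)) <= err n"
  proof (rule sum_le_err)
    fix u :: real assume u: "0 < u" "u < 1"
    have "max 0 (Q u - M) <= \<Theta> (Suc n) u"
    proof (cases "sqrt (real (Suc n)) < real (A u) * Q u")
      case True
      then show ?thesis using \<Theta>_bad(1)[OF u True] L(2) Q_ge[OF u] by simp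
    next
      case False
      then show ?thesis using L(4)[OF u] \<Theta>_nonneg[OF u, of "Suc n"] by simp
    qed
    then show "(\<Sum>j\<in>{0::nat}. 1 * (of_bool (u \<in> {0<..<1}) * max 0 (Q u - M))) <= \<Theta> (Suc n) u" using u by simp
  qed auto
  then show ?thesis unfolding R1_def by (simp add: ennreal_max_0)
qed

lemma R2_le_err: "real J / sqrt (real (Suc n)) * R2 M <= err n"
proof -
  have "(\<Sum>j\<in>{0::nat}. (real J / sqrt (real (Suc n))) * enn2real (\<integral>\<^sup>+u\<in>{0<..<1}. ennreal (of_bool (M < Q u) * Q u ^ 2) \<partial>lborel)) <= err n"
  proof (rule sum_le_err)
    fix u :: real assume u: "0 < u" "u < 1"
    have "real J / sqrt (real (Suc n)) * (of_bool (M < Q u) * Q u ^ 2) <= \<Theta> (Suc n) u"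
    proof (cases "sqrt (real (Suc n)) < real (A u) * Q u")
      case True
      have "real J / sqrt (real (Suc n)) * (of_bool (M < Q u) * Q u ^ 2) <= real (A u) / sqrt (real (Suc n)) * (1 * Q u ^ 2)"
        using L(5)[OF u True] Q_ge[OF u] by (intro mult_mono divide_right_mono) auto
      also have "... = Q u * (real (A u) * Q u / sqrt (real (Suc n)))" by (simp add: power2_eq_square)
      also have "... <= \<Theta> (Suc n) u" by (rule \<Theta>_bad(2)[OF u True])
      finally show ?thesis .
    next
      case False
      then show ?thesis using L(4)[OF u] \<Theta>_nonneg[OF u, of "Suc n"] by simp
    qed
    then show "(\<Sum>j\<in>{0::nat}. (real J / sqrt (real (Suc n))) * (of_bool (u \<in> {0<..<1}) * (of_bool (M < Q u) * Q u ^ 2))) <= \<Theta> (Suc n) u"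
      using u by simp
  qed auto
  then show ?thesis unfolding R2_def by simp
qed

lemma H_J_le_err:
  assumes q: "1 <= q"
  shows "(real J / sqrt (real (Suc n))) ^ (q - 1) * H M q J <= err n"
proof -
  have "(\<Sum>j\<in>{0::nat}. (real J / sqrt (real (Suc n))) ^ (q - 1) * enn2real (\<integral>\<^sup>+u\<in>{0<..<\<alpha> J}. ennreal (max 0 (min (Q u) M) ^ q) \<partial>lborel)) <= err n"
  proof (rule sum_le_err)
    fix u :: real assume u: "0 < u" "u < 1"
    have "(real J / sqrt (real (Suc n))) ^ (q - 1) * (of_bool (u \<in> {0<..<\<alpha> J}) * max 0 (min (Q u) M) ^ q) <= \<Theta> (Suc n) u"
    proof (cases "u < \<alpha> J")
      case True
      note bad = below_J[OF u(1) True]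
      have "(real J / sqrt (real (Suc n))) ^ (q - 1) * max 0 (min (Q u) M) ^ q <= (real J / sqrt (real (Suc n))) ^ (q - 1) * M ^ q"
        using Q_ge[OF u] L(2) by (intro mult_left_mono power_mono) auto
      also have "... = (real J * M / sqrt (real (Suc n))) ^ (q - 1) * M"
        using q power_add[of M "q - 1" 1] by (simp add: power_mult_distrib power_divide)
      also have "... <= 1 * M"
        using L(1-3) by (intro mult_right_mono power_le_one) (auto simp: divide_le_eq_1 simp del: of_nat_Suc)
      also have "... <= \<Theta> (Suc n) u" using L(5)[OF u bad] \<Theta>_bad(1)[OF u bad] by simp
      finally show ?thesis using u True by simp
    qed (use \<Theta>_nonneg[OF u, of "Suc n"] in simp)
    then show "(\<Sum>j\<in>{0::nat}. (real J / sqrt (real (Suc n))) ^ (q - 1) * (of_bool (u \<in> {0<..<\<alpha> J}) * max 0 (min (Q u) M) ^ q)) <= \<Theta> (Suc n) u"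
      by simp
  qed (use \<alpha>_le_1[of J] in auto)
  moreover have "(\<integral>\<^sup>+u\<in>{0<..<\<alpha> J}. ennreal (max 0 (min (Q u) M) ^ q) \<partial>lborel) = (\<integral>\<^sup>+u\<in>{0<..<\<alpha> J}. ennreal (min (Q u) M ^ q) \<partial>lborel)"
  proof (intro nn_integral_cong)
    fix u
    have "u \<in> {0<..<\<alpha> J} ==> max 0 (min (Q u) M) = min (Q u) M"
      using Q_ge[of u] L(2) \<alpha>_le_1[of J] by auto
    then show "ennreal (max 0 (min (Q u) M) ^ q) * indicator {0<..<\<alpha> J} u = ennreal (min (Q u) M ^ q) * indicator {0<..<\<alpha> J} u"
      by (auto simp: indicator_def)
  qed
  ultimately show ?thesis unfolding H_def by simp
qed

lemma H4_le_err: "(\<Sum>j<J. real (Suc j) ^ 2 * H M 4 j) / sqrt (real (Suc n)) ^ 3 <= err n"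
proof -
  let ?q = "sqrt (real (Suc n))"
  have "(\<Sum>j<J. (real (Suc j) ^ 2 / ?q ^ 3) * enn2real (\<integral>\<^sup>+u\<in>{0<..<\<alpha> j}. ennreal (min (Q u) M ^ 4) \<partial>lborel)) <= err n"
  proof (rule sum_le_err)
    fix u :: real assume u: "0 < u" "u < 1"
    have eq: "(\<Sum>j<J. (real (Suc j) ^ 2 / ?q ^ 3) * (of_bool (u \<in> {0<..<\<alpha> j}) * min (Q u) M ^ 4))
        = (\<Sum>j<J. of_bool (j < A u) * real (Suc j) ^ 2) * (min (Q u) M ^ 4 / ?q ^ 3)"
      unfolding sum_distrib_right using u by (intro sum.cong refl) (simp add: less_A)
    have mQ: "0 <= min (Q u) M" using Q_ge[OF u] L(2) by simp
    show "(\<Sum>j<J. (real (Suc j) ^ 2 / ?q ^ 3) * (of_bool (u \<in> {0<..<\<alpha> j}) * min (Q u) M ^ 4)) <= \<Theta> (Suc n) u"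
    proof (cases "?q < real (A u) * Q u")
      case True
      have "(\<Sum>j<J. of_bool (j < A u) * real (Suc j) ^ 2) <= (\<Sum>j<J. real (Suc j) ^ 2)"
        by (intro sum_mono) auto
      also have "... <= real J ^ 3" by (rule sum_squares_le_cube)
      finally have "(\<Sum>j<J. of_bool (j < A u) * real (Suc j) ^ 2) * (min (Q u) M ^ 4 / ?q ^ 3) <= real J ^ 3 * (M ^ 4 / ?q ^ 3)"
        using mQ by (intro mult_mono divide_right_mono power_mono sum_nonneg) auto
      also have "... = (real J * M / ?q) ^ 3 * M" by (simp add: power_mult_distrib power_divide eval_nat_numeral)
      also have "... <= 1 * M"
        using L(1-3) by (intro mult_right_mono power_le_one) (auto simp: divide_le_eq_1 simp del: of_nat_Suc)
      also have "... <= \<Theta> (Suc n) u" using L(5)[OF u True] \<Theta>_bad(1)[OF u True] by simp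
      finally show ?thesis unfolding eq .
    next
      case False
      have "(\<Sum>j<J. of_bool (j < A u) * real (Suc j) ^ 2) = (\<Sum>j\<in>{..<J} \<inter> {..<A u}. real (Suc j) ^ 2)"
        by (rule sum.mono_neutral_cong_right) auto
      also have "... <= (\<Sum>j<A u. real (Suc j) ^ 2)" by (intro sum_mono2) auto
      also have "... <= real (A u) ^ 3" by (rule sum_squares_le_cube)
      finally have "(\<Sum>j<J. of_bool (j < A u) * real (Suc j) ^ 2) * (min (Q u) M ^ 4 / ?q ^ 3) <= real (A u) ^ 3 * (Q u ^ 4 / ?q ^ 3)"
        using mQ by (intro mult_mono divide_right_mono power_mono sum_nonneg) auto
      also have "... = \<Theta> (Suc n) u" unfolding \<Theta>_good[OF u False]
        by (simp add: power_mult_distrib power_divide eval_nat_numeral)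
      finally show ?thesis unfolding eq .
    qed
  next
    fix j show "{0<..<\<alpha> j} \<subseteq> {0<..<1}" by (rule \<alpha>_sub)
  next
    fix u :: real and j :: nat assume "0 < u" "u < 1"
    then show "0 <= min (Q u) M ^ 4" using Q_ge[of u] L(2) by simp
  qed auto
  then show ?thesis unfolding H_def by (simp add: sum_divide_distrib)
qed

lemma H2_tail_le_err: "(\<Sum>r<m. H2 (r + J)) / sqrt (real (Suc n)) <= err n"
proof -
  let ?q = "sqrt (real (Suc n))"
  have "(\<Sum>r<m. (1 / ?q) * enn2real (\<integral>\<^sup>+u\<in>{0<..<\<alpha> (r + J)}. ennreal (Q u ^ 2) \<partial>lborel)) <= err n"
  proof (rule sum_le_err)
    fix u :: real assume u: "0 < u" "u < 1"
    have eq: "(\<Sum>r<m. (1 / ?q) * (of_bool (u \<in> {0<..<\<alpha> (r + J)}) * Q u ^ 2))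
        = (\<Sum>r<m. of_bool (r + J < A u)) * (Q u ^ 2 / ?q)"
      unfolding sum_distrib_right using u by (intro sum.cong refl) (simp add: less_A)
    have c: "(\<Sum>r<m. of_bool (r + J < A u)) = real (card ({..<m} \<inter> {r. r + J < A u}))"
      by (simp add: of_bool_def sum.If_cases)
    show "(\<Sum>r<m. (1 / ?q) * (of_bool (u \<in> {0<..<\<alpha> (r + J)}) * Q u ^ 2)) <= \<Theta> (Suc n) u"
    proof (cases "?q < real (A u) * Q u")
      case True
      have "card ({..<m} \<inter> {r. r + J < A u}) <= card {..<A u}" by (intro card_mono) auto
      then have "(\<Sum>r<m. of_bool (r + J < A u)) * (Q u ^ 2 / ?q) <= real (A u) * (Q u ^ 2 / ?q)"
        unfolding c by (intro mult_right_mono) auto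
      also have "... = Q u * (real (A u) * Q u / ?q)" by (simp add: power2_eq_square)
      also have "... <= \<Theta> (Suc n) u" by (rule \<Theta>_bad(2)[OF u True])
      finally show ?thesis unfolding eq .
    next
      case False
      then have "A u <= J" using L(4)[OF u] by simp
      then have "(\<Sum>r<m. of_bool (r + J < A u)) = (0 :: real)" by simp
      then show ?thesis unfolding eq using \<Theta>_nonneg[OF u, of "Suc n"] by simp
    qed
  next
    fix r show "{0<..<\<alpha> (r + J)} \<subseteq> {0<..<1}" by (rule \<alpha>_sub)
  qed auto
  then show ?thesis unfolding H2_def by (simp add: sum_divide_distrib)
qed

end

lemma weighted_sum_le_K:
  assumes h: "\<And>j. ennreal (h j) <= (\<integral>\<^sup>+u\<in>{0<..<\<alpha> j}. ennreal (Q u ^ 3) \<partial>lborel)" and h0: "\<And>j. 0 <= h j"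
  shows "(\<Sum>j<n. real (Suc j) * h j) <= K"
proof -
  have "ennreal (\<Sum>j<n. real (Suc j) * h j) = (\<Sum>j<n. of_nat (Suc j) * ennreal (h j))"
    using h0 by (simp add: sum_ennreal[symmetric] ennreal_mult ennreal_of_nat_eq_real_of_nat del: of_nat_Suc)
  also have "... <= (\<Sum>j<n. of_nat (Suc j) * (\<integral>\<^sup>+u\<in>{0<..<\<alpha> j}. ennreal (Q u ^ 3) \<partial>lborel))"
    by (intro sum_mono mult_left_mono h) simp
  also have "... <= ennreal K" unfolding K_eq by (intro sum_le_suminf) auto
  finally show ?thesis using K_nonneg by simp
qed

lemma H_sum_le_K: "0 <= M ==> q <= 3 ==> (\<Sum>j<n. real (Suc j) * H M q j) <= K"
proof (rule weighted_sum_le_K[OF _ nonneg(1)])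
  fix j assume M: "0 <= M" "q <= 3"
  show "ennreal (H M q j) <= (\<integral>\<^sup>+u\<in>{0<..<\<alpha> j}. ennreal (Q u ^ 3) \<partial>lborel)"
    unfolding H_eq[OF M(1)]
    using \<alpha>_sub[of j] M by (intro set_nn_mono order_trans[OF min_pow Q_pow]) auto
qed

lemma H2_sum_le_K: "(\<Sum>j<n. real (Suc j) * H2 j) <= K"
proof (rule weighted_sum_le_K[OF _ nonneg(2)])
  fix j
  show "ennreal (H2 j) <= (\<integral>\<^sup>+u\<in>{0<..<\<alpha> j}. ennreal (Q u ^ 3) \<partial>lborel)"
    unfolding H2_eq using \<alpha>_sub[of j] by (intro set_nn_mono Q_pow) auto
qed

lemma H2_summable: "summable (%j. real (Suc j) * H2 j)"
  by (rule summableI_nonneg_bounded[OF _ H2_sum_le_K]) (simp add: nonneg)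

lemma H_le_H4: assumes "1 <= M" "q <= 4" shows "H M q j <= H M 4 j"
proof -
  have "ennreal (H M q j) <= ennreal (H M 4 j)"
    using assms \<alpha>_sub[of j] Q_ge
    by (subst (1 2) H_eq) (auto intro!: set_nn_mono power_increasing)
  then show ?thesis using nonneg by simp
qed

lemma H_0_le_K: "0 <= M ==> q <= 3 ==> H M q 0 <= K"
  using H_sum_le_K[of M q 1] by simp

lemma profile_covariance_summable:
  assumes gb: "\<And>r. \<bar>g r\<bar> <= C * H2 r"
  shows "summable (%k. real (Suc k) * \<bar>g k\<bar>)"
proof (rule summable_comparison_test')
  show "summable (%k. C * (real (Suc k) * H2 k))" by (rule summable_mult[OF H2_summable])
  fix k :: nat
  have "real (Suc k) * \<bar>g k\<bar> <= real (Suc k) * (C * H2 k)" by (intro mult_left_mono gb) simp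
  then show "norm (real (Suc k) * \<bar>g k\<bar>) <= C * (real (Suc k) * H2 k)" by (simp add: mult_ac)
qed

text \<open>The criterion behind both sets of assumptions: mixing bounds of quantile form at every truncation
level suffice, because the level can be adapted to the scale.\<close>

theorem profile_bound:
  fixes N :: "'a measure" and F :: "nat => 'a measure"
  assumes fam: "\<And>M. 1 <= M ==> mixing_seq N F X (W M) (%q j. C * H M q j) (C * R1 M) (C * M) (\<gamma> M)"
    and cov: "\<And>M r. 1 <= M ==> \<bar>\<gamma> M r - g r\<bar> <= C * R2 M"
    and gb: "\<And>r. \<bar>g r\<bar> <= C * H2 r"
    and C: "0 <= C" and \<sigma>: "0 < \<sigma>" and \<sigma>_eq: "\<sigma>\<^sup>2 = g 0 + 2 * (\<Sum>k. g (Suc k))"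
  shows "\<exists>B. \<forall>n f. 1-lipschitz_on UNIV f \<longrightarrow>
    \<bar>(\<integral>w. f (\<Sum>i=1..n. X i w) \<partial>N) - gsmooth (sqrt (real n) * \<sigma>) f 0\<bar> <= B"
proof -
  have "\<forall>n. \<exists>J M. levels (Suc n) J M"
    unfolding levels_def by (intro allI, rule exists_levels) simp
  then obtain Jf Mf where lev: "\<And>n. levels (Suc n) (Jf n) (Mf n)" by metis
  define J where "J s = Jf (s - 1)" for s
  define m where "m s = Mf (s - 1)" for s
  define c where "c = 5 * C + 2 * C\<^sup>2 * K"
  have lv: "levels (Suc (s - 1)) (J s) (m s)" for s unfolding J_def m_def by (rule lev)
  have sc: "Suc (s - 1) = s" if "1 <= s" for s using that by simp
  have l: "1 <= J s" "1 <= m s" "real (J s) * m s <= sqrt (real s)" if "1 <= s" for s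
    using lv[of s] that unfolding levels_def by auto
  have Jq: "real (J s) <= sqrt (real s)" if "1 <= s" for s
  proof -
    have "real (J s) * 1 <= real (J s) * m s" using l[OF that] by (intro mult_left_mono) auto
    then show ?thesis using l(3)[OF that] by simp
  qed
  have c0: "0 <= c" "5 * C <= c" unfolding c_def using C K_nonneg by auto
  have gs: "summable (%k. real (Suc k) * \<bar>g k\<bar>)" by (rule profile_covariance_summable[OF gb])
  interpret m1: mixing_seq N F X "W 1" "%q j. C * H 1 q j" "C * R1 1" "C * 1" "\<gamma> 1" by (rule fam) simp
  have "multiscale N F X (%s. W (m s)) (%s q j. C * H (m s) q j) (%s. C * R1 (m s)) (%s. C * m s)
      (%s. \<gamma> (m s)) J g \<sigma> C (C * K) (C * K) (%s. c * err (s - 1))"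
  proof (intro multiscale.intro multiscale_axioms.intro)
    show "prob_space N" by (rule m1.prob_space_axioms)
    show "summable (%k. real (Suc k) * \<bar>g k\<bar>)" by (rule gs)
    show "0 <= C" "0 < \<sigma>" "\<sigma>\<^sup>2 = g 0 + 2 * (\<Sum>k. g (Suc k))" by fact+
    show "0 <= c * err (s - 1)" for s using c0 err_nonneg by simp
    have "summable (%s. err (s - 1))" by (subst summable_Suc_iff[symmetric]) (simp add: err_summable)
    then show "summable (%s. c * err (s - 1))" by (rule summable_mult)
    fix s :: nat assume s: "1 <= s"
    note lvs = lv[of s] and ls = l[OF s]
    have m0: "0 <= m s" using ls by simp
    let ?q = "sqrt (real s)"
    have q: "1 <= ?q" using s by simp
    show "mixing_seq N F X (W (m s)) (%q j. C * H (m s) q j) (C * R1 (m s)) (C * m s) (\<gamma> (m s))"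
      by (rule fam[OF ls(2)])
    show "1 <= J s" "real (J s) <= sqrt (real s)" by (rule ls Jq[OF s])+
    show "real (J s) * (C * m s) <= C * sqrt (real s)"
      using mult_left_mono[OF ls(3) C] by (simp add: mult_ac)
    show "(\<Sum>j<J s. real (Suc j) * (C * H (m s) 2 j)) <= C * K"
      using mult_left_mono[OF H_sum_le_K[OF m0, of 2 "J s"] C] by (simp add: sum_distrib_left mult_ac)
    show "(\<Sum>j<J s. real (Suc j) * (C * H (m s) 3 j)) <= C * K"
      using mult_left_mono[OF H_sum_le_K[OF m0, of 3 "J s"] C] by (simp add: sum_distrib_left mult_ac)
    show "C * R1 (m s) + C * H (m s) 1 (J s) + real (J s) / ?q * (C * H (m s) 2 (J s))
        + (real (J s) / ?q)\<^sup>2 * (C * H (m s) 3 (J s))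
        + (\<Sum>j<J s. (real (Suc j))\<^sup>2 * (C * H (m s) 4 j + C * H (m s) 2 0 * (C * H (m s) 2 j) + C * H (m s) 1 0 * (C * H (m s) 3 j)))
          / ?q ^ 3 <= c * err (s - 1)"
    proof -
      let ?e = "err (s - 1)"
      have 1: "C * R1 (m s) <= C * ?e" by (intro mult_left_mono C R1_le_err[OF lvs])
      have 2: "C * H (m s) 1 (J s) <= C * ?e"
        using H_J_le_err[OF lvs, of 1] C by (simp add: mult_left_mono)
      have 3: "real (J s) / ?q * (C * H (m s) 2 (J s)) <= C * ?e"
        using mult_left_mono[OF H_J_le_err[OF lvs, of 2] C] unfolding sc[OF s] by (simp add: mult_ac)
      have 4: "(real (J s) / ?q)\<^sup>2 * (C * H (m s) 3 (J s)) <= C * ?e"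
        using mult_left_mono[OF H_J_le_err[OF lvs, of 3] C] unfolding sc[OF s] by (simp add: mult_ac)
      have 5: "(\<Sum>j<J s. (real (Suc j))\<^sup>2 * (C * H (m s) 4 j + C * H (m s) 2 0 * (C * H (m s) 2 j) + C * H (m s) 1 0 * (C * H (m s) 3 j)))
          <= (C + 2 * C\<^sup>2 * K) * (\<Sum>j<J s. (real (Suc j))\<^sup>2 * H (m s) 4 j)"
        unfolding sum_distrib_left
      proof (rule sum_mono)
        fix j
        have "H (m s) 2 0 * H (m s) 2 j <= K * H (m s) 4 j" "H (m s) 1 0 * H (m s) 3 j <= K * H (m s) 4 j"
          using H_0_le_K[OF m0] H_le_H4[OF ls(2)] nonneg K_nonneg by (intro mult_mono; simp)+
        then have "C\<^sup>2 * (H (m s) 2 0 * H (m s) 2 j) + C\<^sup>2 * (H (m s) 1 0 * H (m s) 3 j) <= C\<^sup>2 * (K * H (m s) 4 j) + C\<^sup>2 * (K * H (m s) 4 j)"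
          by (intro add_mono mult_left_mono) auto
        then have "C * H (m s) 4 j + C * H (m s) 2 0 * (C * H (m s) 2 j) + C * H (m s) 1 0 * (C * H (m s) 3 j)
            <= (C + 2 * C\<^sup>2 * K) * H (m s) 4 j"
          by (simp add: power2_eq_square algebra_simps)
        then have "(real (Suc j))\<^sup>2 * (C * H (m s) 4 j + C * H (m s) 2 0 * (C * H (m s) 2 j) + C * H (m s) 1 0 * (C * H (m s) 3 j))
            <= (real (Suc j))\<^sup>2 * ((C + 2 * C\<^sup>2 * K) * H (m s) 4 j)" by (intro mult_left_mono) auto
        then show "(real (Suc j))\<^sup>2 * (C * H (m s) 4 j + C * H (m s) 2 0 * (C * H (m s) 2 j) + C * H (m s) 1 0 * (C * H (m s) 3 j))
            <= (C + 2 * C\<^sup>2 * K) * ((real (Suc j))\<^sup>2 * H (m s) 4 j)" by (simp only: mult_ac)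
      qed
      have "(C + 2 * C\<^sup>2 * K) * (\<Sum>j<J s. (real (Suc j))\<^sup>2 * H (m s) 4 j) / ?q ^ 3 <= (C + 2 * C\<^sup>2 * K) * ?e"
        using mult_left_mono[OF H4_le_err[OF lvs], of "C + 2 * C\<^sup>2 * K"] C K_nonneg unfolding sc[OF s] by simp
      then have 6: "(\<Sum>j<J s. (real (Suc j))\<^sup>2 * (C * H (m s) 4 j + C * H (m s) 2 0 * (C * H (m s) 2 j) + C * H (m s) 1 0 * (C * H (m s) 3 j))) / ?q ^ 3
          <= (C + 2 * C\<^sup>2 * K) * ?e"
        using divide_right_mono[OF 5, of "?q ^ 3"] by (meson order_trans real_sqrt_ge_zero of_nat_0_le_iff zero_le_power)
      have "c * ?e = C * ?e + C * ?e + C * ?e + C * ?e + (C + 2 * C\<^sup>2 * K) * ?e" unfolding c_def by (simp add: algebra_simps)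
      then show ?thesis using 1 2 3 4 6 by linarith
    qed
    show "(\<bar>\<gamma> (m s) 0 - g 0\<bar> + 2 * (\<Sum>r=1..<J s. \<bar>\<gamma> (m s) r - g r\<bar>) + 2 * (\<Sum>r. \<bar>g (r + J s)\<bar>)) / ?q <= c * err (s - 1)"
    proof -
      let ?e = "err (s - 1)"
      have "(\<Sum>r=1..<J s. \<bar>\<gamma> (m s) r - g r\<bar>) <= (\<Sum>r=1..<J s. C * R2 (m s))" by (intro sum_mono cov ls)
      also have "... <= real (J s) * (C * R2 (m s))"
        using C nonneg by (simp add: mult_right_mono)
      finally have "\<bar>\<gamma> (m s) 0 - g 0\<bar> + 2 * (\<Sum>r=1..<J s. \<bar>\<gamma> (m s) r - g r\<bar>) <= C * R2 (m s) + 2 * (real (J s) * (C * R2 (m s)))"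
        using cov[OF ls(2), of 0] by linarith
      also have "... <= 3 * C * (real (J s) * R2 (m s))"
      proof -
        have "1 * (C * R2 (m s)) <= real (J s) * (C * R2 (m s))" using ls(1) C nonneg by (intro mult_right_mono) auto
        then show ?thesis by (simp add: mult_ac)
      qed
      finally have a: "(\<bar>\<gamma> (m s) 0 - g 0\<bar> + 2 * (\<Sum>r=1..<J s. \<bar>\<gamma> (m s) r - g r\<bar>)) / ?q <= 3 * C * (real (J s) * R2 (m s)) / ?q"
        by (intro divide_right_mono) auto
      have b: "3 * C * (real (J s) * R2 (m s)) / ?q <= 3 * C * ?e"
        using mult_left_mono[OF R2_le_err[OF lvs], of "3 * C"] C unfolding sc[OF s] by simp
      have tail: "summable (%r. \<bar>g (r + J s)\<bar>)"
      proof (rule summable_ignore_initial_segment, rule summable_comparison_test'[OF gs, of 0])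
        show "norm \<bar>g k\<bar> <= real (Suc k) * \<bar>g k\<bar>" for k by (simp add: algebra_simps)
      qed
      have "(\<Sum>r. \<bar>g (r + J s)\<bar>) <= C * (?e * ?q)"
      proof (rule suminf_le_const[OF tail])
        fix n
        have "(\<Sum>r<n. \<bar>g (r + J s)\<bar>) <= (\<Sum>r<n. C * H2 (r + J s))" by (intro sum_mono gb)
        also have "... = C * (\<Sum>r<n. H2 (r + J s))" by (simp add: sum_distrib_left)
        also have "... <= C * (?e * ?q)"
          using H2_tail_le_err[OF lvs, of n] q C unfolding sc[OF s]
          by (intro mult_left_mono) (auto simp: pos_divide_le_eq)
        finally show "(\<Sum>r<n. \<bar>g (r + J s)\<bar>) <= C * (?e * ?q)" .
      qed
      then have d: "2 * (\<Sum>r. \<bar>g (r + J s)\<bar>) / ?q <= 2 * C * ?e" using q by (simp add: pos_divide_le_eq mult_ac)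
      have "5 * C * ?e <= c * ?e" by (intro mult_right_mono c0 err_nonneg)
      then show ?thesis using a b d unfolding add_divide_distrib by linarith
    qed
  qed
  then interpret ms: multiscale N F X "%s. W (m s)" "%s q j. C * H (m s) q j" "%s. C * R1 (m s)" "%s. C * m s"
      "%s. \<gamma> (m s)" J g \<sigma> C "C * K" "C * K" "%s. c * err (s - 1)" .
  show ?thesis using ms.replacement_bound unfolding ms.PS_def .
qed

end

section \<open>Stationary sequences generated by an automorphism\<close>

locale automorphism = prob_space M for M :: "'a measure" +
  fixes T :: "'a => 'a" and M0 :: "'a measure"
  assumes T: "mp_automorphism M T" and sub0: "subalgebra M M0"
    and filt0: "sets M0 \<subseteq> sets (sigma_at M T M0 1)"
begin

abbreviation "\<tau> \<equiv> int_iter (space M) T"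

lemma T_facts: "bij_betw T (space M) (space M)" "T \<in> measurable M M"
  "the_inv_into (space M) T \<in> measurable M M" "distr M M T = M"
  using T unfolding mp_automorphism_def by auto

lemma inv_T: "w \<in> space M ==> the_inv_into (space M) T (T w) = w"
  "w \<in> space M ==> T (the_inv_into (space M) T w) = w"
  using T_facts(1) by (auto simp: bij_betw_def the_inv_into_f_f f_the_inv_into_f)

lemma space_T: "w \<in> space M ==> T w \<in> space M" "w \<in> space M ==> the_inv_into (space M) T w \<in> space M"
  using T_facts(2,3) by (auto dest: measurable_space)

lemma \<tau>_0: "\<tau> 0 w = w" by (simp add: int_iter_def)

lemma \<tau>_space: "w \<in> space M ==> \<tau> i w \<in> space M"
proof -
  have 1: "(f ^^ n) w \<in> space M" if "\<And>w. w \<in> space M ==> f w \<in> space M" "w \<in> space M" for f n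
    using that by (induction n) auto
  show "w \<in> space M ==> \<tau> i w \<in> space M"
    unfolding int_iter_def using 1[of T] 1[of "the_inv_into (space M) T"] space_T by auto
qed

lemma \<tau>_succ: "w \<in> space M ==> \<tau> (i + 1) w = T (\<tau> i w)"
proof (cases "0 <= i")
  case True
  then have "nat (i + 1) = Suc (nat i)" by simp
  then show ?thesis using True by (simp add: int_iter_def)
next
  case False
  assume w: "w \<in> space M"
  from False have e: "nat (- i) = Suc (nat (- (i + 1)))" by simp
  have s: "\<tau> (i + 1) w \<in> space M" by (rule \<tau>_space[OF w])
  have "\<tau> i w = the_inv_into (space M) T (\<tau> (i + 1) w)"
  proof (cases "i = - 1")
    case True
    then show ?thesis by (simp add: int_iter_def)
  next
    case ni: False
    then show ?thesis using False e by (simp add: int_iter_def)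
  qed
  then show ?thesis using inv_T(2)[OF s] by simp
qed

lemma \<tau>_pred: "w \<in> space M ==> \<tau> (i - 1) w = the_inv_into (space M) T (\<tau> i w)"
  using \<tau>_succ[of w "i - 1"] inv_T(1)[OF \<tau>_space, of w "i - 1"] by simp

lemma \<tau>_add: assumes "w \<in> space M" shows "\<tau> (i + j) w = \<tau> i (\<tau> j w)"
proof (induction i rule: int_induct[of _ 0])
  case base
  then show ?case by (simp add: \<tau>_0)
next
  case (step1 i)
  have "\<tau> (i + 1 + j) w = T (\<tau> (i + j) w)" using \<tau>_succ[OF assms, of "i + j"] by (simp add: add_ac)
  then show ?case using step1 \<tau>_succ[OF \<tau>_space[OF assms], of i j] by simp
next
  case (step2 i)
  have "\<tau> (i - 1 + j) w = the_inv_into (space M) T (\<tau> (i + j) w)"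
    using \<tau>_pred[OF assms, of "i + j"] by (simp add: algebra_simps)
  then show ?case using step2 \<tau>_pred[OF \<tau>_space[OF assms], of i j] by simp
qed

lemma \<tau>_measurable[measurable]: "\<tau> i \<in> measurable M M"
proof -
  have 1: "(f ^^ n) \<in> measurable M M" if "f \<in> measurable M M" for f n
    using that by (induction n) (auto intro: measurable_comp)
  show ?thesis unfolding int_iter_def using 1 T_facts by auto
qed

lemma distr_\<tau>: "distr M M (\<tau> i) = M"
proof (induction i rule: int_induct[of _ 0])
  case base
  show ?case by (rule trans[OF distr_cong distr_id]) (simp_all add: \<tau>_0)
next
  case (step1 i)
  have "distr M M (\<tau> (i + 1)) = distr M M (T \<circ> \<tau> i)" by (rule distr_cong) (simp_all add: \<tau>_succ)
  also have "... = distr (distr M M (\<tau> i)) M T" using T_facts by (subst distr_distr) auto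
  finally show ?case using step1 T_facts by simp
next
  case (step2 i)
  have "distr M M (\<tau> (i - 1)) = distr M M (the_inv_into (space M) T \<circ> \<tau> i)" by (rule distr_cong) (simp_all add: \<tau>_pred)
  also have "... = distr (distr M M (\<tau> i)) M (the_inv_into (space M) T)" using T_facts by (subst distr_distr) auto
  also have "... = distr (distr M M T) M (the_inv_into (space M) T)" using step2 T_facts by simp
  also have "... = distr M M (the_inv_into (space M) T \<circ> T)" using T_facts by (subst distr_distr) auto
  also have "... = distr M M (%w. w)" by (rule distr_cong) (simp_all add: inv_T)
  finally show ?case by (simp add: distr_id)
qed

lemma expectation_\<tau>:
  fixes f :: "'a => real"
  assumes "f \<in> borel_measurable M"
  shows "E (%w. f (\<tau> i w)) = E f"
  using integral_distr[OF \<tau>_measurable assms, of i] by (simp add: distr_\<tau>)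

lemma integrable_\<tau>:
  fixes f :: "'a => real"
  assumes "integrable M f"
  shows "integrable M (%w. f (\<tau> i w))"
  using integrable_distr[OF \<tau>_measurable, of i f] assms by (simp add: distr_\<tau>)

lemma space_M0: "space M0 = space M" using sub0 by (simp add: subalgebra_def)

lemma space_sigma[simp]: "space (sigma_at M T M0 i) = space M" by (simp add: sigma_at_def)

lemma M0_M: "f \<in> borel_measurable M0 ==> f \<in> borel_measurable M"
  using measurable_from_subalg[OF sub0] .

lemma \<tau>_M0: "\<tau> i \<in> space M \<rightarrow> space M0" using \<tau>_space space_M0 by auto

lemma sets_sigma: "sets (sigma_at M T M0 i) = {\<tau> i -` B \<inter> space M | B. B \<in> sets M0}"
  unfolding sigma_at_def by (rule sets_vimage_algebra2[OF \<tau>_M0])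

lemma sigma_at_sub: "subalgebra M (sigma_at M T M0 i)"
proof -
  have "\<tau> i -` B \<inter> space M \<in> sets M" if "B \<in> sets M0" for B
    using that sub0 by (intro measurable_sets[OF \<tau>_measurable]) (auto simp: subalgebra_def)
  then show ?thesis unfolding subalgebra_def sets_sigma by auto
qed

lemma sigma_at_step: "sets (sigma_at M T M0 i) \<subseteq> sets (sigma_at M T M0 (i + 1))"
proof
  fix A assume "A \<in> sets (sigma_at M T M0 i)"
  then obtain B where B: "B \<in> sets M0" "A = \<tau> i -` B \<inter> space M" unfolding sets_sigma by auto
  then obtain B' where B': "B' \<in> sets M0" "B = \<tau> 1 -` B' \<inter> space M" using filt0 unfolding sets_sigma by auto
  have "A = \<tau> (i + 1) -` B' \<inter> space M"
    unfolding B(2) B'(2) using \<tau>_space \<tau>_add[of _ 1 i] by (auto simp: add.commute)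
  then show "A \<in> sets (sigma_at M T M0 (i + 1))" unfolding sets_sigma using B' by auto
qed

lemma sigma_at_mono: "(i :: nat) <= j ==> sets (sigma_at M T M0 (int i)) \<subseteq> sets (sigma_at M T M0 (int j))"
proof (induction j rule: dec_induct)
  case (step n)
  then show ?case using sigma_at_step[of "int n"] by (auto simp: add.commute)
qed simp

lemma shifted_meas: "Z \<in> borel_measurable M0 ==> shifted M T Z i \<in> borel_measurable (sigma_at M T M0 i)"
  unfolding shifted_def sigma_at_def
  by (rule measurable_compose[OF measurable_vimage_algebra1[OF \<tau>_M0]])

lemma shifted_M: "Z \<in> borel_measurable M ==> shifted M T Z i \<in> borel_measurable M"
  unfolding shifted_def by (rule measurable_compose[OF \<tau>_measurable])

lemma shifted_0: "shifted M T Z 0 = Z" by (simp add: shifted_def \<tau>_0)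

lemma shifted_\<tau>: "w \<in> space M ==> shifted M T Z i (\<tau> j w) = shifted M T Z (i + j) w"
  unfolding shifted_def by (simp add: \<tau>_add)

lemma \<tau>_back: "w \<in> space M ==> \<tau> i (\<tau> (- i) w) = w"
  using \<tau>_add[of w i "- i"] by (simp add: \<tau>_0)

lemma back_measurable: "\<tau> (- i) \<in> measurable M0 (sigma_at M T M0 i)"
  unfolding sigma_at_def
proof (rule measurable_vimage_algebra2)
  show "\<tau> (- i) \<in> space M0 \<rightarrow> space M" using \<tau>_space space_M0 by auto
  show "(%x. \<tau> i (\<tau> (- i) x)) \<in> measurable M0 M0"
    by (subst measurable_cong[where g = "%x. x"]) (simp_all add: \<tau>_back space_M0)
qed

text \<open>Invariance of the measure reduces all times to time \<open>0\<close>, where the coefficients are defined.\<close>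

lemma cond_le_shift:
  assumes c: "cond_le M M0 (%w. P (\<tau> (- i) w)) e" and P: "P \<in> borel_measurable M"
  shows "cond_le M (sigma_at M T M0 i) P e"
proof (rule cond_leI)
  fix U assume U: "U \<in> borel_measurable (sigma_at M T M0 i)" and U1: "\<And>w. \<bar>U w\<bar> <= (1 :: real)"
  have UM: "U \<in> borel_measurable M" by (rule measurable_from_subalg[OF sigma_at_sub U])
  have "(%w. U (\<tau> (- i) w)) \<in> borel_measurable M0"
    by (rule measurable_compose[OF back_measurable U])
  from cond_leD[OF c this U1] show "\<bar>\<integral>w. U w * P w \<partial>M\<bar> <= e"
    using expectation_\<tau>[of "%w. U w * P w" "- i"] UM P by simp
qed

lemma cond_le_cong:
  assumes "\<And>w. w \<in> space N ==> Z w = Z' w"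
  shows "cond_le N F Z e \<longleftrightarrow> cond_le N F Z' e"
proof -
  have "(\<integral>w. U w * Z w \<partial>N) = (\<integral>w. U w * Z' w \<partial>N)" for U
    using assms by (intro Bochner_Integration.integral_cong) auto
  then show ?thesis unfolding cond_le_def by simp
qed

text \<open>The dependence coefficients are norms of conditional expectations, which dominate the dual form.\<close>

lemma cond_le_of_L1_norm:
  assumes F: "subalgebra M F" and A: "A \<in> borel_measurable F" and B: "integrable M B"
    and AB: "integrable M (%w. A w * B w)"
    and n: "L1_norm M (%w. A w * real_cond_exp M F B w) <= ennreal e" and e: "0 <= e"
  shows "cond_le M F (%w. A w * B w) e"
proof (rule cond_leI)
  interpret f: finite_measure_subalgebra M F by standard (rule F)
  note [measurable] = A borel_measurable_integrable[OF B]
  fix U assume U[measurable]: "U \<in> borel_measurable F" and U1: "\<And>w. \<bar>U w\<bar> <= (1 :: real)"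
  have UM: "U \<in> borel_measurable M" by (rule measurable_from_subalg[OF F U])
  let ?C = "real_cond_exp M F B"
  have i: "integrable M (%w. U w * A w * B w)"
    using integrable_bounded_mult[OF AB UM U1] by (simp add: mult.assoc)
  have "(\<integral>w. U w * (A w * B w) \<partial>M) = (\<integral>w. U w * A w * ?C w \<partial>M)"
    using f.real_cond_exp_intg(2)[OF i] by (simp add: mult.assoc)
  also have "\<bar>\<integral>w. U w * A w * ?C w \<partial>M\<bar> <= (\<integral>w. \<bar>A w * ?C w\<bar> \<partial>M)"
  proof (rule order_trans[OF integral_abs_bound integral_mono])
    show "integrable M (%w. \<bar>U w * A w * ?C w\<bar>)" using f.real_cond_exp_intg(1)[OF i] by simp
    show "integrable M (%w. \<bar>A w * ?C w\<bar>)" using f.real_cond_exp_intg(1)[OF AB] by simp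
    fix w
    show "\<bar>U w * A w * ?C w\<bar> <= \<bar>A w * ?C w\<bar>"
      using mult_right_mono[OF U1[of w], of "\<bar>A w * ?C w\<bar>"] by (simp add: abs_mult mult.assoc)
  qed
  also have "... <= e"
  proof -
    have "ennreal (\<integral>w. \<bar>A w * ?C w\<bar> \<partial>M) = L1_norm M (%w. A w * ?C w)"
      unfolding L1_norm_def using f.real_cond_exp_intg(1)[OF AB] by (intro nn_integral_eq_integral[symmetric]) auto
    then have "ennreal (\<integral>w. \<bar>A w * ?C w\<bar> \<partial>M) <= ennreal e" using n by simp
    then show ?thesis using e by simp
  qed
  finally show "\<bar>\<integral>w. U w * (A w * B w) \<partial>M\<bar> <= e" .
qed

end

section \<open>Fourth moments and projective conditions\<close>

lemma (in prob_space) integrable_power_prod: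
  fixes f :: "nat => 'a => real"
  assumes m: "\<And>i. i \<in> I ==> f i \<in> borel_measurable M" and i4: "\<And>i. i \<in> I ==> integrable M (%w. f i w ^ 4)"
    and I: "finite I" "card I <= 4"
  shows "integrable M (%w. \<Prod>i\<in>I. f i w)"
proof (rule Bochner_Integration.integrable_bound)
  show "integrable M (%w. 1 + (\<Sum>i\<in>I. f i w ^ 4))" using i4 by simp
  show "(%w. \<Prod>i\<in>I. f i w) \<in> borel_measurable M" using m by measurable
  show "AE w in M. norm (\<Prod>i\<in>I. f i w) <= norm (1 + (\<Sum>i\<in>I. f i w ^ 4))"
  proof (rule AE_I2)
    fix w
    \<comment> \<open>compare with the largest factor\<close>
    define x where "x = Max (insert 1 ((%i. \<bar>f i w\<bar>) ` I))"
    have x1: "1 <= x" unfolding x_def using I by simp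
    have xi: "\<bar>f i w\<bar> <= x" if "i \<in> I" for i unfolding x_def using I that by simp
    have "\<bar>\<Prod>i\<in>I. f i w\<bar> = (\<Prod>i\<in>I. \<bar>f i w\<bar>)" by (rule abs_prod)
    also have "... <= (\<Prod>i\<in>I. x)" using xi by (intro prod_mono) auto
    also have "... = x ^ card I" by simp
    also have "... <= x ^ 4" using x1 I by (intro power_increasing) auto
    also have "... <= 1 + (\<Sum>i\<in>I. f i w ^ 4)"
    proof -
      have s0: "0 <= (\<Sum>i\<in>I. f i w ^ 4)" by (intro sum_nonneg) (simp add: zero_le_even_power)
      have "x \<in> insert 1 ((%i. \<bar>f i w\<bar>) ` I)" unfolding x_def using I by (intro Max_in) auto
      then consider "x = 1" | i where "i \<in> I" "x = \<bar>f i w\<bar>" by auto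
      then show ?thesis
      proof cases
        case 2
        have "f i w ^ 4 <= (\<Sum>i\<in>I. f i w ^ 4)"
          using I 2 by (intro member_le_sum) (auto simp: zero_le_even_power)
        then show ?thesis using 2 by (simp add: power_abs)
      qed (use s0 in simp)
    qed
    finally show "norm (\<Prod>i\<in>I. f i w) <= norm (1 + (\<Sum>i\<in>I. f i w ^ 4))" by simp
  qed
qed

locale fourth_moment = automorphism M T M0 for M :: "'a measure" and T M0 +
  fixes X0 :: "'a => real"
  assumes X0: "X0 \<in> borel_measurable M0" and X0_mean: "E X0 = 0"
    and X0_4: "integrable M (%w. X0 w ^ 4)"
    and \<theta>: "\<And>p q. p < q ==> q <= min (3 + p) 4 ==>
      (\<Sum>j. of_nat (Suc j) * theta_coeff M T M0 X0 p q (Suc j)) < \<infinity>"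
begin

abbreviation "Xs \<equiv> shifted M T X0"

definition "pairs = {(p :: nat, q :: nat). p < q \<and> q <= min (3 + p) 4}"

lemma finite_pairs: "finite pairs"
  by (rule finite_subset[of _ "{..4} \<times> {..4}"]) (auto simp: pairs_def)

definition "\<theta>s j = (\<Sum>(p, q)\<in>pairs. theta_coeff M T M0 X0 p q j)"

lemma theta_antimono: "j <= j' ==> theta_coeff M T M0 X0 p q j' <= theta_coeff M T M0 X0 p q j"
  unfolding theta_coeff_def by (rule SUP_subset_mono) (auto simp: Gamma_set_def)

lemma \<theta>s_antimono: "j <= j' ==> \<theta>s j' <= \<theta>s j"
  unfolding \<theta>s_def by (intro sum_mono) (auto intro: theta_antimono)

lemma \<theta>_le_\<theta>s: "p < q ==> q <= min (3 + p) 4 ==> theta_coeff M T M0 X0 p q j <= \<theta>s j"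
  unfolding \<theta>s_def using member_le_sum[of "(p, q)" pairs "%(p, q). theta_coeff M T M0 X0 p q j"] finite_pairs
  by (auto simp: pairs_def)

lemma \<theta>s_sum: "(\<Sum>j. of_nat (Suc j) * \<theta>s (Suc j)) < \<infinity>"
proof -
  have "(\<Sum>j. of_nat (Suc j) * \<theta>s (Suc j)) = (\<Sum>j. \<Sum>(p, q)\<in>pairs. of_nat (Suc j) * theta_coeff M T M0 X0 p q (Suc j))"
    unfolding \<theta>s_def by (simp only: sum_distrib_left case_prod_unfold)
  also have "... = (\<Sum>(p, q)\<in>pairs. \<Sum>j. of_nat (Suc j) * theta_coeff M T M0 X0 p q (Suc j))"
    unfolding case_prod_unfold by (rule suminf_sum) simp
  also have "... < \<infinity>"
    using \<theta> unfolding infinity_ennreal_def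
    by (subst ennreal_sum_less_top[OF finite_pairs]) (auto simp: pairs_def)
  finally show ?thesis .
qed

lemma \<theta>s_finite: "\<theta>s (Suc j) < \<infinity>"
proof -
  have "1 * \<theta>s (Suc j) <= of_nat (Suc j) * \<theta>s (Suc j)"
    using of_nat_mono[of 1 "Suc j", where 'a = ennreal] by (intro mult_right_mono) auto
  also have "... <= (\<Sum>j. of_nat (Suc j) * \<theta>s (Suc j))"
    using sum_le_suminf[of "%j. of_nat (Suc j) * \<theta>s (Suc j)" "{j}"] by simp
  finally show ?thesis using \<theta>s_sum by (simp add: le_less_trans)
qed

lemma X_M: "Xs i \<in> borel_measurable M" by (rule shifted_M[OF M0_M[OF X0]])

lemma X4: "integrable M (%w. Xs i w ^ 4)"
  using integrable_\<tau>[OF X0_4, of i] unfolding shifted_def .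

lemma X_prod: "card (I :: nat set) <= 4 ==> finite I ==> integrable M (%w. \<Prod>m\<in>I. Xs (k m) w)"
  using integrable_power_prod[of I "%m. Xs (k m)"] X_M X4 by blast

text \<open>The coefficient \<open>\<theta>\<close> is exactly a conditional bound of this kind; for \<open>p = 0\<close> the time of the
  conditioning is moved to the origin by stationarity.\<close>

lemma theta_mixing:
  fixes k :: "nat => nat"
  assumes pq: "p < q" "q <= 4" "q <= p + 3" and k: "\<forall>m<q. k m <= k (Suc m)" and gap: "k p + Suc j <= k (Suc p)"
  shows "cond_le M (sigma_at M T M0 (int (k p)))
    (%w. (\<Prod>m=1..p. Xs (int (k m)) w) *
      ((\<Prod>m=Suc p..q. Xs (int (k m)) w) - E (%w'. \<Prod>m=Suc p..q. Xs (int (k m)) w'))) (enn2real (\<theta>s (Suc j)))"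
proof (cases "p = 0")
  case False
  define k' where "k' m = (if m = 0 then 0 else int (k m))" for m
  have e: "(\<Prod>m=1..p. Xs (int (k m)) w) = (\<Prod>m=1..p. Xs (k' m) w)"
    "(\<Prod>m=Suc p..q. Xs (int (k m)) w) = (\<Prod>m=Suc p..q. Xs (k' m) w)" for w
    unfolding k'_def by (auto intro!: prod.cong)
  have kp: "int (k p) = k' p" using False unfolding k'_def by simp
  have G: "k' \<in> Gamma_set p q (Suc j)"
    unfolding Gamma_set_def mem_Collect_eq
  proof (intro conjI allI impI)
    show "k' m <= k' (Suc m)" if "m < q" for m
      using k[rule_format, OF that] unfolding k'_def by simp
    show "k' p + int (Suc j) <= k' (Suc p)" using gap False unfolding k'_def by simp
  qed (simp add: k'_def)
  let ?B = "%w. (\<Prod>m=Suc p..q. Xs (k' m) w) - E (%w'. \<Prod>m=Suc p..q. Xs (k' m) w')"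
  let ?A = "%w. \<Prod>m=1..p. Xs (k' m) w"
  show ?thesis unfolding e kp
  proof (rule cond_le_of_L1_norm[OF sigma_at_sub])
    have "Xs (k' m) \<in> borel_measurable (sigma_at M T M0 (k' p))" if "m \<in> {1..p}" for m
    proof -
      have "k a <= k n" if "a <= n" "n <= q" for a n
        using that
      proof (induction n rule: dec_induct)
        case (step n)
        then show ?case using k[rule_format, of n] by simp
      qed simp
      then have mp: "k m <= k p" using that pq by simp
      have "Xs (k' m) \<in> borel_measurable (sigma_at M T M0 (int (k m)))"
        using shifted_meas[OF X0, of "k' m"] that unfolding k'_def by simp
      then show ?thesis
        using sigma_at_mono[OF mp] unfolding kp[symmetric]
        by (auto simp: measurable_def)
    qed
    then show "?A \<in> borel_measurable (sigma_at M T M0 (k' p))" by (rule borel_measurable_prod)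
    show "integrable M ?B" using X_prod[of "{Suc p..q}" k'] pq by simp
    have "{1..q} = {1..p} \<union> {Suc p..q}" "{1..p} \<inter> {Suc p..q} = {}" using pq by auto
    then have "(\<Prod>m=1..q. Xs (k' m) w) = ?A w * (\<Prod>m=Suc p..q. Xs (k' m) w)" for w
      by (simp add: prod.union_disjoint)
    then show "integrable M (%w. ?A w * ?B w)"
      using X_prod[of "{1..q}" k'] X_prod[of "{1..p}" k'] pq by (simp add: right_diff_distrib)
    have "L1_norm M (%w. ?A w * real_cond_exp M (sigma_at M T M0 (k' p)) ?B w) <= theta_coeff M T M0 X0 p q (Suc j)"
      unfolding theta_coeff_def using G by (intro SUP_upper)
    also have "... <= \<theta>s (Suc j)" using pq by (intro \<theta>_le_\<theta>s) auto
    also have "... = ennreal (enn2real (\<theta>s (Suc j)))" using \<theta>s_finite by (simp add: ennreal_enn2real_if less_top[symmetric])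
    finally show "L1_norm M (%w. ?A w * real_cond_exp M (sigma_at M T M0 (k' p)) ?B w) <= ennreal (enn2real (\<theta>s (Suc j)))" .
  qed simp
next
  case True
  define l where "l = int (k 0)"
  define k' where "k' m = int (k m) - l" for m
  have G: "k' \<in> Gamma_set 0 q (Suc j)"
    unfolding Gamma_set_def mem_Collect_eq
  proof (intro conjI allI impI)
    show "k' m <= k' (Suc m)" if "m < q" for m
      using k[rule_format, OF that] unfolding k'_def by simp
    show "k' 0 + int (Suc j) <= k' (Suc 0)" using gap True unfolding k'_def by simp
  qed (simp add: k'_def l_def)
  let ?P = "%w. (\<Prod>m=1..q. Xs (int (k m)) w) - E (%w'. \<Prod>m=1..q. Xs (int (k m)) w')"
  let ?B = "%w. (\<Prod>m=1..q. Xs (k' m) w) - E (%w'. \<Prod>m=1..q. Xs (k' m) w')"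
  have Xm[measurable]: "Xs i \<in> borel_measurable M" for i by (rule X_M)
  have pr: "(\<Prod>m=1..q. Xs (int (k m)) (\<tau> (- l) w)) = (\<Prod>m=1..q. Xs (k' m) w)" if "w \<in> space M" for w
    using shifted_\<tau>[OF that] unfolding k'_def by simp
  have ex: "E (%w'. \<Prod>m=1..q. Xs (int (k m)) w') = E (%w'. \<Prod>m=1..q. Xs (k' m) w')"
    using expectation_\<tau>[of "%w. \<Prod>m=1..q. Xs (int (k m)) w" "- l"]
    by (subst Bochner_Integration.integral_cong[OF refl pr[symmetric]]) auto
  have c1: "cond_le M (sigma_at M T M0 0) (%w. 1 * ?B w) (enn2real (\<theta>s (Suc j)))"
  proof (rule cond_le_of_L1_norm[OF sigma_at_sub])
    show "integrable M ?B" "integrable M (%w. 1 * ?B w)" using X_prod[of "{1..q}" k'] pq by simp_all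
    have "L1_norm M (%w. 1 * real_cond_exp M (sigma_at M T M0 0) ?B w) <= theta_coeff M T M0 X0 0 q (Suc j)"
      unfolding theta_coeff_def using G by (intro SUP_upper2[OF G]) (simp add: k'_def l_def)
    also have "... <= \<theta>s (Suc j)" using pq True by (intro \<theta>_le_\<theta>s) auto
    also have "... = ennreal (enn2real (\<theta>s (Suc j)))" using \<theta>s_finite by (simp add: ennreal_enn2real_if less_top[symmetric])
    finally show "L1_norm M (%w. 1 * real_cond_exp M (sigma_at M T M0 0) ?B w) <= ennreal (enn2real (\<theta>s (Suc j)))" .
  qed simp_all
  have "cond_le M M0 ?B (enn2real (\<theta>s (Suc j)))"
  proof (rule cond_leI)
    fix U assume U: "U \<in> borel_measurable M0" and U1: "\<And>w. \<bar>U w\<bar> <= (1 :: real)"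
    have "U \<in> borel_measurable (sigma_at M T M0 0)" using shifted_meas[OF U, of 0] unfolding shifted_0 .
    from cond_leD[OF c1 this U1] show "\<bar>\<integral>w. U w * ?B w \<partial>M\<bar> <= enn2real (\<theta>s (Suc j))" by simp
  qed
  moreover have "?P (\<tau> (- l) w) = ?B w" if "w \<in> space M" for w using pr[OF that] ex by simp
  ultimately have "cond_le M M0 (%w. ?P (\<tau> (- l) w)) (enn2real (\<theta>s (Suc j)))"
    using cond_le_cong[of M "%w. ?P (\<tau> (- l) w)" ?B M0] by blast
  then have "cond_le M (sigma_at M T M0 l) ?P (enn2real (\<theta>s (Suc j)))" by (rule cond_le_shift) measurable
  then show ?thesis using True unfolding l_def by simp
qed

definition "g k = E (%w. X0 w * Xs (int k) w)"

text \<open>The coefficients are divided by \<open>C\<close> so that the profile starts at \<open>1\<close> and decreases, while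
\<open>C * \<alpha>\<close> still bounds the coefficients and the moments.\<close>

definition "C = 1 + enn2real (\<theta>s 1) + E (%w. X0 w ^ 4)"

definition "\<alpha> j = (if j = 0 then 1 else enn2real (\<theta>s j) / C)"

lemma C_ge: "1 <= C" "enn2real (\<theta>s 1) <= C" "1 + E (%w. X0 w ^ 4) <= C"
  unfolding C_def by (auto simp: integral_nonneg_AE zero_le_even_power)

lemma profile_\<alpha>: "profile \<alpha> (%_. 1)"
proof
  show "\<alpha> 0 = 1" by (simp add: \<alpha>_def)
  have \<theta>1: "enn2real (\<theta>s j) <= enn2real (\<theta>s i)" if "i <= j" "i \<noteq> 0" for i j
  proof (rule enn2real_mono)
    show "\<theta>s j <= \<theta>s i" by (rule \<theta>s_antimono[OF that(1)])
    show "\<theta>s i < top" using \<theta>s_finite[of "i - 1"] that by simp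
  qed
  show "\<alpha> j <= \<alpha> i" if "i <= j" for i j
  proof (cases "i = 0")
    case True
    have "enn2real (\<theta>s j) <= C" if "j \<noteq> 0" using \<theta>1[of 1 j] that C_ge by simp
    then show ?thesis using True C_ge by (auto simp: \<alpha>_def divide_le_eq_1)
  next
    case False
    then show ?thesis using \<theta>1[OF that False] that C_ge by (auto simp: \<alpha>_def intro!: divide_right_mono)
  qed
  show nn: "0 <= \<alpha> j" for j using C_ge by (simp add: \<alpha>_def)
  have i: "(\<integral>\<^sup>+u\<in>{0<..<\<alpha> j}. ennreal (1 ^ 3) \<partial>lborel) = ennreal (\<alpha> j)" for j
    using nn[of j] by (simp add: emeasure_lborel_Ioo)
  have "ennreal (real (Suc j) * enn2real (\<theta>s (Suc j))) = of_nat (Suc j) * \<theta>s (Suc j)" for j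
    using \<theta>s_finite[of j] by (simp add: ennreal_mult ennreal_of_nat_eq_real_of_nat ennreal_enn2real_if del: of_nat_Suc)
  then have "summable (%j. real (Suc j) * enn2real (\<theta>s (Suc j)))"
    using \<theta>s_sum by (intro summable_suminf_not_top) auto
  then have "summable (%j. 2 / C * (real (Suc j) * enn2real (\<theta>s (Suc j))))" by (rule summable_mult)
  then have "summable (%j. real (Suc (Suc j)) * \<alpha> (Suc j))"
  proof (rule summable_comparison_test'[of _ 0])
    fix j :: nat
    have "real (Suc (Suc j)) * (enn2real (\<theta>s (Suc j)) / C) <= (2 * real (Suc j)) * (enn2real (\<theta>s (Suc j)) / C)"
      using C_ge by (intro mult_right_mono) auto
    also have "... = 2 / C * (real (Suc j) * enn2real (\<theta>s (Suc j)))" by simp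
    finally have "real (Suc (Suc j)) * \<alpha> (Suc j) <= 2 / C * (real (Suc j) * enn2real (\<theta>s (Suc j)))"
      by (simp add: \<alpha>_def)
    moreover have "norm (real (Suc (Suc j)) * \<alpha> (Suc j)) = real (Suc (Suc j)) * \<alpha> (Suc j)"
      using nn[of "Suc j"] by (simp add: abs_mult del: of_nat_Suc)
    ultimately show "norm (real (Suc (Suc j)) * \<alpha> (Suc j)) <= 2 / C * (real (Suc j) * enn2real (\<theta>s (Suc j)))"
      by simp
  qed
  then have "summable (%j. real (Suc j) * \<alpha> j)" by (subst summable_Suc_iff[symmetric])
  then have "(\<Sum>j. ennreal (real (Suc j) * \<alpha> j)) \<noteq> top" using nn by (intro ennreal_suminf_neq_top) auto
  then show "(\<Sum>j. of_nat (Suc j) * (\<integral>\<^sup>+u\<in>{0<..<\<alpha> j}. ennreal (1 ^ 3) \<partial>lborel)) < \<infinity>"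
    unfolding i using nn by (simp add: ennreal_mult ennreal_of_nat_eq_real_of_nat less_top del: of_nat_Suc)
qed simp_all

sublocale pr: profile \<alpha> "%_. 1" by (rule profile_\<alpha>)

lemma H_value: "1 <= N ==> pr.H N q j = \<alpha> j"
  using pr.\<alpha>_nonneg[of j] unfolding pr.H_def by (simp add: emeasure_lborel_Ioo min_def)

lemma H2_value: "pr.H2 j = \<alpha> j"
  using pr.\<alpha>_nonneg[of j] unfolding pr.H2_def by (simp add: emeasure_lborel_Ioo)

lemma R_value: assumes "1 <= N" shows "pr.R1 N = 0" "pr.R2 N = 0"
  using assms unfolding pr.R1_def pr.R2_def by (simp_all add: ennreal_neg)

lemma X_int: "integrable M (Xs i)"
  using X_prod[of "{0}" "%_. i"] by simp

lemma sequence: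
  assumes N: "1 <= N"
  shows "mixing_seq M (%i. sigma_at M T M0 (int i)) (%i. Xs (int i)) (%i. Xs (int i))
    (%q j. C * pr.H N q j) (C * pr.R1 N) (C * N) g"
  unfolding H_value[OF N] R_value[OF N]
proof (intro mixing_seq.intro mixing_seq_axioms.intro)
  show "prob_space M" by (rule prob_space_axioms)
  show "subalgebra M (sigma_at M T M0 (int i))" for i by (rule sigma_at_sub)
  show "sets (sigma_at M T M0 (int i)) \<subseteq> sets (sigma_at M T M0 (int j))" if "i <= j" for i j
    by (rule sigma_at_mono[OF that])
  show "Xs (int i) \<in> borel_measurable (sigma_at M T M0 (int i))" for i by (rule shifted_meas[OF X0])
  then show "Xs (int i) \<in> borel_measurable (sigma_at M T M0 (int i))" for i .
  show "integrable M (Xs (int i))" for i by (rule X_int)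
  show "integrable M (%w. Xs (int i) w ^ 4)" for i by (rule X4)
  show "E (Xs (int i)) = 0" for i
    using expectation_\<tau>[OF M0_M[OF X0], of "int i"] X0_mean unfolding shifted_def by simp
  show "(\<forall>i w. Xs (int i) w = Xs (int i) w) \<or> (\<forall>i w. \<bar>Xs (int i) w\<bar> <= C * N)" by simp
  show "0 <= C * N" using C_ge N by simp
  show "E (%w. \<bar>Xs (int i) w - Xs (int i) w\<bar>) <= C * 0" for i by simp
  show "0 <= C * \<alpha> j" for j using C_ge pr.\<alpha>_nonneg[of j] by simp
  show "E (%w. \<bar>Xs (int i) w\<bar> ^ q) <= C * \<alpha> 0" if q: "1 <= q" "q <= 4" for q i
  proof -
    have le: "\<bar>x\<bar> ^ q <= 1 + x ^ 4" for x :: real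
    proof (cases "\<bar>x\<bar> <= 1")
      case True
      then have "\<bar>x\<bar> ^ q <= 1" by (intro power_le_one) auto
      then show ?thesis by (simp add: zero_le_even_power add_increasing2)
    next
      case False
      then have "\<bar>x\<bar> ^ q <= \<bar>x\<bar> ^ 4" using q by (intro power_increasing) auto
      then show ?thesis by (simp add: power_abs)
    qed
    have i4: "integrable M (%w. 1 + Xs (int i) w ^ 4)" using X4 by simp
    have "integrable M (%w. \<bar>Xs (int i) w\<bar> ^ q)"
    proof (rule Bochner_Integration.integrable_bound[OF i4])
      show "(%w. \<bar>Xs (int i) w\<bar> ^ q) \<in> borel_measurable M" using X_M by measurable
      show "AE w in M. norm (\<bar>Xs (int i) w\<bar> ^ q) <= norm (1 + Xs (int i) w ^ 4)"
        using order_trans[OF le abs_ge_self] by (intro AE_I2) simp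
    qed
    then have "E (%w. \<bar>Xs (int i) w\<bar> ^ q) <= E (%w. 1 + Xs (int i) w ^ 4)"
      using i4 le by (intro integral_mono) auto
    also have "... = 1 + E (%w. Xs (int i) w ^ 4)" using X4 prob_space by simp
    also have "E (%w. Xs (int i) w ^ 4) = E (%w. X0 w ^ 4)"
      using expectation_\<tau>[of "%w. X0 w ^ 4" "int i"] M0_M[OF X0] unfolding shifted_def by simp
    finally show ?thesis using C_ge by (simp add: \<alpha>_def)
  qed
  show "E (%w. Xs (int i) w * Xs (int (i + r)) w) = g r" for i r
  proof -
    have "E (%w. X0 (\<tau> (int i) w) * Xs (int r) (\<tau> (int i) w)) = g r"
      unfolding g_def using M0_M[OF X0] X_M[of "int r"] by (intro expectation_\<tau>) measurable
    moreover have "E (%w. X0 (\<tau> (int i) w) * Xs (int r) (\<tau> (int i) w)) = E (%w. Xs (int i) w * Xs (int (i + r)) w)"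
      by (intro Bochner_Integration.integral_cong refl) (simp add: shifted_\<tau> add.commute, simp add: shifted_def)
    ultimately show ?thesis by simp
  qed
  show "cond_le M (sigma_at M T M0 (int (k p))) (%w. (\<Prod>m=1..p. Xs (int (k m)) w) *
      ((\<Prod>m=Suc p..q. Xs (int (k m)) w) - E (%w'. \<Prod>m=Suc p..q. Xs (int (k m)) w'))) (C * \<alpha> j)"
    if "p < q" "q <= 4" "q <= p + 3" "\<forall>m<q. k m <= k (Suc m)" "k p + j <= k (Suc p)" "1 <= j" for p q k j
  proof -
    have "C * \<alpha> j = enn2real (\<theta>s (Suc (j - 1)))" using that C_ge by (simp add: \<alpha>_def)
    then show ?thesis using theta_mixing[of p q k "j - 1"] that by simp
  qed
qed

lemma g_bound: "\<bar>g r\<bar> <= C * pr.H2 r"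
proof -
  interpret s: mixing_seq M "%i. sigma_at M T M0 (int i)" "%i. Xs (int i)" "%i. Xs (int i)"
    "%q j. C * pr.H 1 q j" "C * pr.R1 1" "C * 1" g by (rule sequence) simp
  show ?thesis using s.\<gamma>_le[of r] s.\<gamma>0_le by (cases "r = 0") (simp_all add: H_value H2_value)
qed

lemma covariances_summable: "summable (%k. real (Suc k) * \<bar>g k\<bar>)"
  by (rule pr.profile_covariance_summable[OF g_bound])

lemma replacement:
  assumes "0 < \<sigma>" "\<sigma>\<^sup>2 = g 0 + 2 * (\<Sum>k. g (Suc k))"
  shows "\<exists>B. \<forall>n f. 1-lipschitz_on UNIV f \<longrightarrow>
    \<bar>E (%w. f (\<Sum>i=1..n. Xs (int i) w)) - gsmooth (sqrt (real n) * \<sigma>) f 0\<bar> <= B"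
  by (rule pr.profile_bound[where C = C and g = g, OF sequence _ g_bound _ assms])
    (use C_ge in \<open>simp_all add: R_value\<close>)

end

section \<open>Tail quantiles\<close>

context prob_space
begin

lemma tail_quantile_set:
  fixes Z :: "'a => real"
  assumes [measurable]: "Z \<in> borel_measurable M" and Z0: "\<And>w. 0 <= Z w" and u: "0 < u" "u < 1"
  defines "S \<equiv> {x. measure M {w\<in>space M. Z w > x} <= u}"
  shows "S \<noteq> {}" "\<And>x. x \<in> S ==> 0 <= x"
proof -
  show "0 <= x" if "x \<in> S" for x
  proof (rule ccontr)
    assume "\<not> 0 <= x"
    then have "x < Z w" for w using Z0[of w] by linarith
    then have "{w\<in>space M. Z w > x} = space M" by auto
    then show False using that u prob_space unfolding S_def by simp
  qed
  have "(%n. measure M {w\<in>space M. Z w > real n}) \<longlonglongrightarrow> measure M (\<Inter>n. {w\<in>space M. Z w > real n})"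
    by (intro finite_Lim_measure_decseq) (auto simp: decseq_def intro: le_less_trans)
  moreover have "(\<Inter>n. {w\<in>space M. Z w > real n}) = {}"
  proof -
    have "\<exists>n. \<not> real n < Z w" for w using reals_Archimedean2[of "Z w"] by (meson less_asym)
    then show ?thesis by auto
  qed
  ultimately have "(%n. measure M {w\<in>space M. Z w > real n}) \<longlonglongrightarrow> 0" by simp
  then have "eventually (%n. measure M {w\<in>space M. Z w > real n} < u) sequentially"
    using u by (auto dest: order_tendstoD(2))
  then obtain n where "measure M {w\<in>space M. Z w > real n} < u" by (auto simp: eventually_sequentially)
  then show "S \<noteq> {}" unfolding S_def by (auto intro!: exI[of _ "real n"])
qed

lemma tail_quantile_nonneg:
  fixes Z :: "'a => real"
  assumes "Z \<in> borel_measurable M" "\<And>w. 0 <= Z w" "0 < u" "u < 1"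
  shows "0 <= tail_quantile M Z u"
  unfolding tail_quantile_def using tail_quantile_set[OF assms] by (intro cInf_greatest) auto

text \<open>The weak inequality in the event matters: levels strictly below the probability of \<open>y \<le> Z\<close> have
quantile at least \<open>y\<close>.\<close>

lemma tail_quantile_ge:
  fixes Z :: "'a => real"
  assumes Z[measurable]: "Z \<in> borel_measurable M" and Z0: "\<And>w. 0 <= Z w" and u: "0 < u" "u < 1"
    and y: "u < measure M {w\<in>space M. y <= Z w}"
  shows "y <= tail_quantile M Z u"
  unfolding tail_quantile_def
proof (rule cInf_greatest)
  fix x assume x: "x \<in> {x. measure M {w\<in>space M. Z w > x} <= u}"
  show "y <= x"
  proof (rule ccontr)
    assume "\<not> y <= x"
    then have "measure M {w\<in>space M. y <= Z w} <= measure M {w\<in>space M. Z w > x}"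
      by (intro finite_measure_mono) auto
    then show False using x y by simp
  qed
qed (use tail_quantile_set(1)[OF Z Z0 u] in simp)

lemma less_tail_quantileD:
  fixes Z :: "'a => real"
  assumes Z: "Z \<in> borel_measurable M" and Z0: "\<And>w. 0 <= Z w" and u: "0 < u" "u < 1"
    and y: "y < tail_quantile M Z u"
  shows "u < measure M {w\<in>space M. y < Z w}"
proof (rule ccontr)
  assume "\<not> u < measure M {w\<in>space M. y < Z w}"
  then have "tail_quantile M Z u <= y"
    unfolding tail_quantile_def using tail_quantile_set(2)[OF Z Z0 u]
    by (intro cInf_lower) (auto intro!: bdd_belowI[of _ 0])
  then show False using y by simp
qed

lemma tail_quantile_antimono:
  fixes Z :: "'a => real"
  assumes Z: "Z \<in> borel_measurable M" and Z0: "\<And>w. 0 <= Z w" and u: "0 < u" "u <= v" "v < 1"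
  shows "tail_quantile M Z v <= tail_quantile M Z u"
  unfolding tail_quantile_def
proof (rule cInf_superset_mono)
  show "{x. measure M {w\<in>space M. Z w > x} <= u} \<noteq> {}" using tail_quantile_set(1)[OF Z Z0, of u] u by simp
  show "bdd_below {x. measure M {w\<in>space M. Z w > x} <= v}"
    using tail_quantile_set(2)[OF Z Z0, of v] u by (auto intro!: bdd_belowI[of _ 0])
qed (use u in auto)

text \<open>Layer cake: integrals of increasing functions of \<open>Z\<close> and of its tail quantile are compared
  through the super-level sets.\<close>

lemma layer_cake_le:
  fixes v :: "real => ennreal" and Z :: "'a => real" and q :: "real => real"
  assumes Z[measurable]: "Z \<in> borel_measurable M" and v[measurable]: "v \<in> borel_measurable borel"
    and q[measurable]: "q \<in> borel_measurable borel"
    and ge: "\<And>u x. 0 < u ==> u < 1 ==> 0 <= x ==> u < measure M {w\<in>space M. x <= Z w} ==> x <= q u"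
  shows "(\<integral>\<^sup>+w. (\<integral>\<^sup>+x. v x * indicator {0..Z w} x \<partial>lborel) \<partial>M)
    <= (\<integral>\<^sup>+u\<in>{0<..<1}. (\<integral>\<^sup>+x. v x * indicator {0..q u} x \<partial>lborel) \<partial>lborel)"
proof -
  interpret P: pair_sigma_finite M lborel ..
  have "(\<integral>\<^sup>+w. (\<integral>\<^sup>+x. v x * indicator {0..Z w} x \<partial>lborel) \<partial>M)
      = (\<integral>\<^sup>+w. (\<integral>\<^sup>+x. v x * of_bool (0 <= x) * of_bool (x <= Z w) \<partial>lborel) \<partial>M)"
    by (intro nn_integral_cong) (auto simp: indicator_def)
  also have "... = (\<integral>\<^sup>+x. (\<integral>\<^sup>+w. v x * of_bool (0 <= x) * of_bool (x <= Z w) \<partial>M) \<partial>lborel)"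
    by (rule P.Fubini'[symmetric]) measurable
  also have "... <= (\<integral>\<^sup>+x. (\<integral>\<^sup>+u. v x * of_bool (0 <= x) * (of_bool (x <= q u) * indicator {0<..<1} u) \<partial>lborel) \<partial>lborel)"
  proof (rule nn_integral_mono)
    fix x :: real
    have "(\<integral>\<^sup>+w. v x * of_bool (0 <= x) * of_bool (x <= Z w) \<partial>M) = v x * of_bool (0 <= x) * emeasure M {w\<in>space M. x <= Z w}"
    proof -
      have "(\<integral>\<^sup>+w. v x * of_bool (0 <= x) * of_bool (x <= Z w) \<partial>M)
          = (\<integral>\<^sup>+w. (v x * of_bool (0 <= x)) * indicator {w\<in>space M. x <= Z w} w \<partial>M)"
        by (intro nn_integral_cong) (auto simp: indicator_def)
      then show ?thesis by (simp add: nn_integral_cmult_indicator)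
    qed
    also have "... <= v x * of_bool (0 <= x) * (\<integral>\<^sup>+u. of_bool (x <= q u) * indicator {0<..<1} u \<partial>lborel)"
    proof (cases "0 <= x")
      case True
      let ?p = "measure M {w\<in>space M. x <= Z w}"
      have "emeasure M {w\<in>space M. x <= Z w} = ennreal ?p" by (rule emeasure_eq_measure)
      also have "... = (\<integral>\<^sup>+u. indicator {0<..<?p} u \<partial>lborel)" by (simp add: emeasure_lborel_Ioo)
      also have "... <= (\<integral>\<^sup>+u. of_bool (x <= q u) * indicator {0<..<1} u \<partial>lborel)"
      proof (rule nn_integral_mono)
        fix u
        have "u < ?p ==> u < 1" using prob_le_1[of "{w\<in>space M. x <= Z w}"] by linarith
        then show "(indicator {0<..<?p} u :: ennreal) <= of_bool (x <= q u) * indicator {0<..<1} u"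
          using ge[of u x] True by (auto simp: indicator_def)
      qed
      finally show ?thesis by (intro mult_left_mono) auto
    qed simp
    also have "... = (\<integral>\<^sup>+u. v x * of_bool (0 <= x) * (of_bool (x <= q u) * indicator {0<..<1} u) \<partial>lborel)"
      by (rule nn_integral_cmult[symmetric]) measurable
    finally show "(\<integral>\<^sup>+w. v x * of_bool (0 <= x) * of_bool (x <= Z w) \<partial>M)
        <= (\<integral>\<^sup>+u. v x * of_bool (0 <= x) * (of_bool (x <= q u) * indicator {0<..<1} u) \<partial>lborel)" .
  qed
  also have "... = (\<integral>\<^sup>+u. (\<integral>\<^sup>+x. v x * of_bool (0 <= x) * (of_bool (x <= q u) * indicator {0<..<1} u) \<partial>lborel) \<partial>lborel)"
    by (rule lborel_pair.Fubini') measurable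
  also have "... = (\<integral>\<^sup>+u\<in>{0<..<1}. (\<integral>\<^sup>+x. v x * indicator {0..q u} x \<partial>lborel) \<partial>lborel)"
    by (intro nn_integral_cong) (auto simp: indicator_def intro!: nn_integral_cong)
  finally show ?thesis .
qed

lemma layer_cake_ge:
  fixes v :: "real => ennreal" and Z :: "'a => real" and q :: "real => real"
  assumes Z[measurable]: "Z \<in> borel_measurable M" and v[measurable]: "v \<in> borel_measurable borel"
    and q[measurable]: "q \<in> borel_measurable borel"
    and less: "\<And>u x. 0 < u ==> u < 1 ==> 0 <= x ==> x < q u ==> u < measure M {w\<in>space M. x < Z w}"
  shows "(\<integral>\<^sup>+u\<in>{0<..<1}. (\<integral>\<^sup>+x. v x * indicator {0..<q u} x \<partial>lborel) \<partial>lborel)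
    <= (\<integral>\<^sup>+w. (\<integral>\<^sup>+x. v x * indicator {0..<Z w} x \<partial>lborel) \<partial>M)"
proof -
  interpret P: pair_sigma_finite M lborel ..
  have "(\<integral>\<^sup>+u\<in>{0<..<1}. (\<integral>\<^sup>+x. v x * indicator {0..<q u} x \<partial>lborel) \<partial>lborel)
      = (\<integral>\<^sup>+u. (\<integral>\<^sup>+x. v x * of_bool (0 <= x) * (of_bool (x < q u) * indicator {0<..<1} u) \<partial>lborel) \<partial>lborel)"
    by (intro nn_integral_cong) (auto simp: indicator_def intro!: nn_integral_cong)
  also have "... = (\<integral>\<^sup>+x. (\<integral>\<^sup>+u. v x * of_bool (0 <= x) * (of_bool (x < q u) * indicator {0<..<1} u) \<partial>lborel) \<partial>lborel)"
    by (rule lborel_pair.Fubini'[symmetric]) measurable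
  also have "... <= (\<integral>\<^sup>+x. (\<integral>\<^sup>+w. v x * of_bool (0 <= x) * of_bool (x < Z w) \<partial>M) \<partial>lborel)"
  proof (rule nn_integral_mono)
    fix x :: real
    have "(\<integral>\<^sup>+u. v x * of_bool (0 <= x) * (of_bool (x < q u) * indicator {0<..<1} u) \<partial>lborel)
        = v x * of_bool (0 <= x) * (\<integral>\<^sup>+u. of_bool (x < q u) * indicator {0<..<1} u \<partial>lborel)"
      by (rule nn_integral_cmult) measurable
    also have "... <= v x * of_bool (0 <= x) * emeasure M {w\<in>space M. x < Z w}"
    proof (cases "0 <= x")
      case True
      let ?p = "measure M {w\<in>space M. x < Z w}"
      have "(\<integral>\<^sup>+u. of_bool (x < q u) * indicator {0<..<1} u \<partial>lborel) <= (\<integral>\<^sup>+u. indicator {0<..<?p} u \<partial>lborel)"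
        using less[of _ x] True by (intro nn_integral_mono) (auto simp: indicator_def)
      also have "... = ennreal ?p" by (simp add: emeasure_lborel_Ioo)
      also have "... = emeasure M {w\<in>space M. x < Z w}" by (rule emeasure_eq_measure[symmetric])
      finally show ?thesis by (intro mult_left_mono) auto
    qed simp
    also have "... = (\<integral>\<^sup>+w. (v x * of_bool (0 <= x)) * indicator {w\<in>space M. x < Z w} w \<partial>M)"
      by (simp add: nn_integral_cmult_indicator)
    also have "... = (\<integral>\<^sup>+w. v x * of_bool (0 <= x) * of_bool (x < Z w) \<partial>M)"
      by (intro nn_integral_cong) (auto simp: indicator_def)
    finally show "(\<integral>\<^sup>+u. v x * of_bool (0 <= x) * (of_bool (x < q u) * indicator {0<..<1} u) \<partial>lborel)
        <= (\<integral>\<^sup>+w. v x * of_bool (0 <= x) * of_bool (x < Z w) \<partial>M)" .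
  qed
  also have "... = (\<integral>\<^sup>+w. (\<integral>\<^sup>+x. v x * of_bool (0 <= x) * of_bool (x < Z w) \<partial>lborel) \<partial>M)"
    by (rule P.Fubini') measurable
  also have "... = (\<integral>\<^sup>+w. (\<integral>\<^sup>+x. v x * indicator {0..<Z w} x \<partial>lborel) \<partial>M)"
    by (intro nn_integral_cong) (auto simp: indicator_def)
  finally show ?thesis .
qed

end

lemma nn_integral_half_open:
  assumes [measurable]: "v \<in> borel_measurable borel"
  shows "(\<integral>\<^sup>+x. v x * indicator {0..<z :: real} x \<partial>lborel) = (\<integral>\<^sup>+x. v x * indicator {0..z} x \<partial>lborel)"
proof (rule nn_integral_cong_AE)
  have "AE x in lborel. x \<noteq> z" by (rule AE_lborel_singleton)
  then show "AE x in lborel. v x * indicator {0..<z} x = v x * indicator {0..z} x"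
    by eventually_elim (auto simp: indicator_def)
qed

lemma nn_integral_cube: "(\<integral>\<^sup>+x. ennreal (3 * x ^ 2) * indicator {0..z} x \<partial>lborel) = ennreal (max 0 z ^ 3)"
proof (cases "0 <= z")
  case True
  have "(\<integral>\<^sup>+x. ennreal (3 * x ^ 2) * indicator {0..z} x \<partial>lborel) = ennreal (z ^ 3 - 0 ^ 3)"
    by (rule nn_integral_FTC_Icc) (use True in \<open>auto intro!: derivative_eq_intros\<close>)
  then show ?thesis using True by simp
qed simp

lemma nn_integral_excess:
  assumes "0 <= c"
  shows "(\<integral>\<^sup>+x. indicator {c..} x * indicator {0..z} x \<partial>lborel) = ennreal (z - c)"
proof -
  have "(\<integral>\<^sup>+x. indicator {c..} x * indicator {0..z} x \<partial>lborel) = (\<integral>\<^sup>+x. indicator {c..z} x \<partial>lborel)"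
    using assms by (intro nn_integral_cong) (auto simp: indicator_def)
  then show ?thesis by (simp add: emeasure_lborel_Icc_eq ennreal_neg)
qed

lemma nn_integral_excess_square:
  assumes "0 <= c"
  shows "(\<integral>\<^sup>+x. (ennreal (2 * (x - c)) * indicator {c..} x) * indicator {0..z} x \<partial>lborel) = ennreal (max 0 (z - c) ^ 2)"
proof (cases "c <= z")
  case True
  have "(\<integral>\<^sup>+x. (ennreal (2 * (x - c)) * indicator {c..} x) * indicator {0..z} x \<partial>lborel)
      = (\<integral>\<^sup>+x. ennreal (2 * (x - c)) * indicator {c..z} x \<partial>lborel)"
    using assms by (intro nn_integral_cong) (auto simp: indicator_def)
  also have "... = ennreal ((z - c) ^ 2 - (c - c) ^ 2)"
    by (rule nn_integral_FTC_Icc[where F = "%x. (x - c) ^ 2"]) (use True in \<open>auto intro!: derivative_eq_intros\<close>)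
  finally show ?thesis using True by simp
next
  case False
  then have "(\<integral>\<^sup>+x. (ennreal (2 * (x - c)) * indicator {c..} x) * indicator {0..z} x \<partial>lborel) = (\<integral>\<^sup>+x. 0 \<partial>(lborel :: real measure))"
    by (intro nn_integral_cong) (auto simp: indicator_def)
  then show ?thesis using False by simp
qed

section \<open>Products of centred indicators\<close>

locale alpha_sequence = automorphism M T M0 for M :: "'a measure" and T M0 +
  fixes \<xi> :: "'a => real"
  assumes \<xi>: "\<xi> \<in> borel_measurable M0"
begin

abbreviation "\<xi>s \<equiv> shifted M T \<xi>"

lemma \<xi>_M[measurable]: "\<xi>s i \<in> borel_measurable M" by (rule shifted_M[OF M0_M[OF \<xi>]])

definition "gi i x w = centered_ind M (\<xi>s i) x (\<xi>s i w)"

definition "Fd i x = measure M {w\<in>space M. \<xi>s i w <= x}"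

lemma gi_eq: "gi i x w = of_bool (\<xi>s i w <= x) - Fd i x"
  unfolding gi_def centered_ind_def Fd_def by (auto simp: indicator_def)

lemma Fd_bounds: "0 <= Fd i x" "Fd i x <= 1" unfolding Fd_def by auto

lemma gi_abs: "\<bar>gi i x w\<bar> <= 1" unfolding gi_eq using Fd_bounds[of i x] by auto

lemma gi_M[measurable]: "gi i x \<in> borel_measurable M" unfolding gi_eq[abs_def] by measurable

lemma gi_square:
  "gi i x w * gi i y w = gi i (min x y) w + (- Fd i y) * gi i x w + (- Fd i x) * gi i y w + (Fd i (min x y) - Fd i x * Fd i y)"
  unfolding gi_eq by (auto simp: min_def algebra_simps)

text \<open>Dependence of \<open>P\<close> on \<open>M0\<close> in units of the coefficient \<open>a\<close>. Uniform boundedness is included because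
it makes the notion stable under pointwise limits with a common bound.\<close>

definition "dep P c a \<longleftrightarrow> P \<in> borel_measurable M \<and> (\<exists>B. \<forall>w. \<bar>P w\<bar> <= B) \<and>
  cond_le M M0 (%w. P w - E P) (c * a)"

lemma bounded_integrable: "P \<in> borel_measurable M ==> \<forall>w. \<bar>P w\<bar> <= B ==> integrable M (P :: 'a => real)"
  by (rule integrable_const_bound[of _ B]) auto

lemma dep_integrable: "dep P c a ==> integrable M P"
  unfolding dep_def using bounded_integrable by blast

lemma dep_add:
  assumes "dep P c a" "dep R d a"
  shows "dep (%w. P w + R w) (c + d) a"
proof -
  note i = dep_integrable[OF assms(1)] dep_integrable[OF assms(2)]
  obtain B B' where "\<forall>w. \<bar>P w\<bar> <= B" "\<forall>w. \<bar>R w\<bar> <= B'" using assms unfolding dep_def by blast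
  then have "\<bar>P w + R w\<bar> <= B + B'" for w by (meson abs_triangle_ineq add_mono order_trans)
  moreover have "cond_le M M0 (%w. (P w - E P) + (R w - E R)) (c * a + d * a)"
    using assms i unfolding dep_def by (intro cond_le_add sub0) auto
  then have "cond_le M M0 (%w. P w + R w - E (%w. P w + R w)) ((c + d) * a)"
    using i by (simp add: algebra_simps)
  ultimately show ?thesis
    using assms borel_measurable_add[of P M R] unfolding dep_def by blast
qed

lemma dep_cmult:
  assumes "dep P c a" "\<bar>k\<bar> <= 1" "0 <= c * a"
  shows "dep (%w. k * P w) c a"
proof -
  obtain B where B: "\<forall>w. \<bar>P w\<bar> <= B" using assms unfolding dep_def by blast
  have "\<bar>k * P w\<bar> <= 1 * B" for w unfolding abs_mult using B assms(2) by (intro mult_mono) auto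
  moreover have "cond_le M M0 (%w. k * (P w - E P)) (\<bar>k\<bar> * (c * a))"
    using assms unfolding dep_def by (intro cond_le_cmult) auto
  then have "cond_le M M0 (%w. k * P w - E (%w. k * P w)) (\<bar>k\<bar> * (c * a))"
    by (simp add: right_diff_distrib)
  then have "cond_le M M0 (%w. k * P w - E (%w. k * P w)) (c * a)"
    by (rule cond_le_mono) (use assms in \<open>simp add: mult_left_le_one_le\<close>)
  ultimately show ?thesis using assms unfolding dep_def by fastforce
qed

lemma dep_const: "0 <= c * a ==> dep (%w. k) c a"
  unfolding dep_def using prob_space by (auto simp: cond_le_def)

lemma dep_mono: "dep P c a ==> c <= d ==> 0 <= a ==> dep P d a"
  unfolding dep_def by (meson cond_le_mono mult_right_mono)

lemma dep_limit:
  assumes P: "\<And>n. dep (P n) c a" and b: "\<And>n w. \<bar>P n w\<bar> <= B" and R[measurable]: "R \<in> borel_measurable M"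
    and lim: "\<And>w. (%n. P n w) \<longlonglongrightarrow> R w"
  shows "dep R c a"
proof -
  have PM[measurable]: "P n \<in> borel_measurable M" for n using P unfolding dep_def by blast
  have Rb: "\<bar>R w\<bar> <= B" for w
  proof (rule LIMSEQ_le_const2[OF tendsto_rabs[OF lim]])
    show "\<exists>N. \<forall>n\<ge>N. \<bar>P n w\<bar> <= B" using b by blast
  qed
  have lE: "(%n. E (%w. V w * P n w)) \<longlonglongrightarrow> E (%w. V w * R w)"
    if V[measurable]: "V \<in> borel_measurable M" and V1: "\<And>w. \<bar>V w\<bar> <= 1" for V
  proof (rule integral_dominated_convergence[where w = "%_. B"])
    show "AE x in M. (%n. V x * P n x) \<longlonglongrightarrow> V x * R x" using lim by (intro AE_I2 tendsto_mult_left)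
    show "AE x in M. norm (V x * P n x) <= B" for n
    proof (rule AE_I2)
      fix x
      have "\<bar>V x\<bar> * \<bar>P n x\<bar> <= 1 * B" using V1 b by (intro mult_mono) auto
      then show "norm (V x * P n x) <= B" by (simp add: abs_mult)
    qed
  qed measurable
  have "cond_le M M0 (%w. R w - E R) (c * a)"
  proof (rule cond_leI)
    fix U assume U: "U \<in> borel_measurable M0" and U1: "\<And>w. \<bar>U w\<bar> <= (1 :: real)"
    note UM[measurable] = M0_M[OF U]
    have eq: "(\<integral>w. U w * (Y w - E Y) \<partial>M) = E (%w. U w * Y w) - E U * E (%w. 1 * Y w)"
      if "integrable M Y" for Y :: "'a => real"
    proof -
      have "integrable M U" using bounded_integrable[OF UM, of 1] U1 by blast
      then show ?thesis using integrable_bounded_mult[OF that UM U1] by (simp add: right_diff_distrib)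
    qed
    have "(%n. E (%w. U w * P n w) - E U * E (%w. 1 * P n w))
        \<longlonglongrightarrow> E (%w. U w * R w) - E U * E (%w. 1 * R w)"
      using lE[OF UM U1] lE[of "%_. 1"] by (intro tendsto_diff tendsto_mult tendsto_const) auto
    then have "(%n. \<integral>w. U w * (P n w - E (P n)) \<partial>M) \<longlonglongrightarrow> (\<integral>w. U w * (R w - E R) \<partial>M)"
      using eq[OF bounded_integrable[OF R, of B]] eq[OF dep_integrable[OF P]] Rb by simp
    then show "\<bar>\<integral>w. U w * (R w - E R) \<partial>M\<bar> <= c * a"
    proof (rule LIMSEQ_le_const2[OF tendsto_rabs])
      have "\<bar>\<integral>w. U w * (P n w - E (P n)) \<partial>M\<bar> <= c * a" for n
        using cond_leD[OF _ U U1] P unfolding dep_def by blast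
      then show "\<exists>N. \<forall>n\<ge>N. \<bar>\<integral>w. U w * (P n w - E (P n)) \<partial>M\<bar> <= c * a" by blast
    qed
  qed
  then show ?thesis unfolding dep_def using Rb by auto
qed

lemma dep_strict:
  fixes r :: nat
  assumes r: "1 <= r" "r <= 3" and i: "strict_mono_on {1..r} i" "int n <= i 1"
    and a: "alpha_coeff M T M0 \<xi> 3 n <= ennreal a" "0 <= a"
  shows "dep (%w. \<Prod>j=1..r. gi (i j) (x j) w) 1 a"
proof -
  let ?P = "%w. \<Prod>j=1..r. gi (i j) (x j) w"
  have Pm[measurable]: "?P \<in> borel_measurable M" by measurable
  have Pb: "\<bar>?P w\<bar> <= 1" for w unfolding abs_prod by (rule prod_le_1) (use gi_abs in auto)
  have Pi: "integrable M ?P" by (rule bounded_integrable[OF Pm]) (use Pb in blast)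
  have Pci: "integrable M (%w. ?P w - E ?P)" using Pi by simp
  interpret f: finite_measure_subalgebra M M0 by standard (rule sub0)
  have "cond_le M M0 (%w. 1 * (?P w - E ?P)) (1 * a)"
  proof (rule cond_le_of_L1_norm[OF sub0 _ Pci])
    have "AE w in M. real_cond_exp M M0 (%w. ?P w - E ?P) w
        = real_cond_exp M M0 ?P w - real_cond_exp M M0 (%_. E ?P) w"
      by (rule f.real_cond_exp_diff[OF Pi]) simp
    moreover have "AE w in M. real_cond_exp M M0 (%_. E ?P) w = E ?P"
      by (rule f.real_cond_exp_F_meas) simp_all
    ultimately have "AE w in M. real_cond_exp M M0 (%w. ?P w - E ?P) w
        = real_cond_exp M M0 ?P w - E ?P" by eventually_elim simp
    then have "L1_norm M (%w. 1 * real_cond_exp M M0 (%w. ?P w - E ?P) w)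
        = L1_norm M (%w. real_cond_exp M M0 ?P w - E ?P)"
      unfolding L1_norm_def by (intro nn_integral_cong_AE) (auto elim: eventually_mono)
    also have "... <= alpha_alg M M0 r (%j. \<xi>s (i j))"
      unfolding alpha_alg_def gi_def by (rule SUP_upper2[of x]) simp_all
    also have "... <= (SUP i\<in>{i :: nat => int. strict_mono_on {1..r} i \<and> int n <= i 1}. alpha_alg M M0 r (%j. \<xi>s (i j)))"
      using i by (intro SUP_upper) auto
    also have "... <= alpha_coeff M T M0 \<xi> 3 n"
      unfolding alpha_coeff_def using r by (intro Max_ge) auto
    also have "... <= ennreal (1 * a)" using a by simp
    finally show "L1_norm M (%w. 1 * real_cond_exp M M0 (%w. ?P w - E ?P) w) <= ennreal (1 * a)" .
  qed (use Pci a in simp_all)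
  then show ?thesis unfolding dep_def using Pm Pb by auto
qed

context
  fixes n :: nat and a :: real
  assumes a: "alpha_coeff M T M0 \<xi> 3 n <= ennreal a" "0 <= a"
begin

lemma dep1: "int n <= i ==> dep (gi i x) 1 a"
  using dep_strict[of 1 "%_. i" n a "%_. x"] a by (simp add: strict_mono_on_def)

lemma dep2_strict:
  assumes "int n <= i" "i < j"
  shows "dep (%w. gi i x w * gi j y w) 1 a"
proof -
  have e: "{1..2} = {1, 2 :: nat}" by auto
  have "strict_mono_on {1..2 :: nat} (%m. if m = 1 then i else j)"
    using assms by (intro strict_mono_onI) auto
  from dep_strict[OF _ _ this _ a, of "%m. if m = 1 then x else y"]
  show ?thesis using assms unfolding e by simp
qed

lemma dep3_strict:
  assumes "int n <= i" "i < j" "j < k"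
  shows "dep (%w. gi i x w * gi j y w * gi k z w) 1 a"
proof -
  have e: "{1..3} = {1, 2, 3 :: nat}" by auto
  have "strict_mono_on {1..3 :: nat} (%m. if m = 1 then i else if m = 2 then j else k)"
    using assms by (intro strict_mono_onI) auto
  from dep_strict[OF _ _ this _ a, of "%m. if m = 1 then x else if m = 2 then y else z"]
  show ?thesis using assms unfolding e by (simp add: mult.assoc)
qed

lemma Fd_diff: "\<bar>Fd i (min x y) - Fd i x * Fd i y\<bar> <= 1"
proof -
  have "Fd i x * Fd i y <= 1 * 1" by (intro mult_mono Fd_bounds) auto
  then show ?thesis using Fd_bounds[of i "min x y"] mult_nonneg_nonneg[OF Fd_bounds(1)[of i x] Fd_bounds(1)[of i y]] by linarith
qed

text \<open>Coinciding times are resolved by expanding the product of two centred indicators.\<close>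

lemma dep_expand:
  assumes "dep (%w. gi i (min x y) w * V w) c a" "dep (%w. gi i x w * V w) c a" "dep (%w. gi i y w * V w) c a"
    and "dep V d a" "0 <= c" "0 <= d"
  shows "dep (%w. gi i x w * gi i y w * V w) (3 * c + d) a"
proof -
  have ca: "0 <= c * a" "0 <= d * a" using assms a by simp_all
  have "dep (%w. gi i (min x y) w * V w + (- Fd i y) * (gi i x w * V w) + (- Fd i x) * (gi i y w * V w)
      + (Fd i (min x y) - Fd i x * Fd i y) * V w) (c + c + c + d) a"
    using Fd_bounds[of i x] Fd_bounds[of i y] Fd_diff[of i x y] ca
    by (intro dep_add dep_cmult assms) auto
  moreover have "gi i (min x y) w * V w + (- Fd i y) * (gi i x w * V w) + (- Fd i x) * (gi i y w * V w)
      + (Fd i (min x y) - Fd i x * Fd i y) * V w = gi i x w * gi i y w * V w" for w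
    unfolding gi_square by (simp only: distrib_right mult.assoc)
  moreover have "c + c + c + d = 3 * c + d" by simp
  ultimately show ?thesis by simp
qed

lemma dep2: "int n <= i ==> i <= j ==> dep (%w. gi i x w * gi j y w) 3 a"
proof (cases "i = j")
  case True
  assume i: "int n <= i"
  have "dep (%w. gi i x w * gi i y w * 1) (3 * 1 + 0) a"
    by (rule dep_expand) (use dep1[OF i] dep_const[of 0 a 1] in simp_all)
  then show ?thesis using True by simp
next
  case False
  assume "int n <= i" "i <= j"
  then show ?thesis using dep_mono[OF dep2_strict[of i j x y], of 3] False a by simp
qed

lemma dep3: "int n <= i ==> i <= j ==> j <= k ==> dep (%w. gi i x w * gi j y w * gi k z w) 10 a"
proof -
  assume i: "int n <= i" "i <= j" "j <= k"
  show ?thesis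
  proof (cases "i = j")
    case True
    have "dep (%w. gi i x w * gi i y w * gi k z w) (3 * 3 + 1) a"
      by (rule dep_expand) (use dep2[of i k] dep1[of k] i True in simp_all)
    then show ?thesis using True by simp
  next
    case ij: False
    show ?thesis
    proof (cases "j = k")
      case True
      have s: "dep (%w. gi j u w * gi i x w) 1 a" for u
        using dep2_strict[of i j x u] i ij by (simp add: mult.commute)
      have "dep (%w. gi j y w * gi j z w * gi i x w) (3 * 1 + 1) a"
        by (rule dep_expand) (use s dep1[of i] i in simp_all)
      from dep_mono[OF this, of 10] show ?thesis using True a by (simp add: mult_ac)
    next
      case False
      then show ?thesis using dep_mono[OF dep3_strict[of i j k x y z], of 10] i ij a by simp
    qed
  qed
qed

lemma dep_product:
  fixes r :: nat
  assumes r: "1 <= r" "r <= 3" and i: "int n <= i 1" "\<And>m. 1 <= m ==> m < r ==> i m <= i (Suc m)"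
  shows "dep (%w. \<Prod>m=1..r. gi (i m) (x m) w) 10 a"
proof -
  consider "r = 1" | "r = 2" | "r = 3" using r by linarith
  then show ?thesis
  proof cases
    case 1
    then show ?thesis using dep_mono[OF dep1[of "i 1" "x 1"], of 10] i a by simp
  next
    case 2
    then show ?thesis using dep_mono[OF dep2[of "i 1" "i 2" "x 1" "x 2"], of 10] i(1) i(2)[of 1] a by (simp add: numeral_2_eq_2)
  next
    case 3
    then show ?thesis using dep3[of "i 1" "i 2" "i 3" "x 1" "x 2" "x 3"] i(1) i(2)[of 1] i(2)[of 2] a
      by (simp add: numeral_2_eq_2 numeral_3_eq_3)
  qed
qed

end

definition "downset D \<longleftrightarrow> (\<forall>s t. t \<in> D \<longrightarrow> s <= t \<longrightarrow> s \<in> (D :: real set))"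

text \<open>A half-line of any kind is a limit of closed half-lines.\<close>

lemma downset_limit:
  assumes D: "downset D"
  shows "\<exists>c :: nat => real. \<forall>t. (%n. of_bool (t <= c n) :: real) \<longlonglongrightarrow> of_bool (t \<in> D)"
proof -
  have ev: "(%n. of_bool (t <= c n) :: real) \<longlonglongrightarrow> of_bool (t \<in> D)"
    if "eventually (%n. t <= c n \<longleftrightarrow> t \<in> D) sequentially" for t and c :: "nat => real"
    by (rule tendsto_eventually) (use that in \<open>auto elim: eventually_mono\<close>)
  consider "D = {}" | "D = UNIV" | "D \<noteq> {}" "D \<noteq> UNIV" by blast
  then show ?thesis
  proof cases
    case 1
    have "eventually (%n. t <= - real n \<longleftrightarrow> t \<in> D) sequentially" for t
    proof -
      obtain N :: nat where "- t < real N" using reals_Archimedean2 by blast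
      then show ?thesis using 1 by (intro eventually_sequentiallyI[of N]) auto
    qed
    then show ?thesis by (intro exI[of _ "%n. - real n"] allI ev)
  next
    case 2
    have "eventually (%n. t <= real n \<longleftrightarrow> t \<in> D) sequentially" for t
    proof -
      obtain N :: nat where "t < real N" using reals_Archimedean2 by blast
      then show ?thesis using 2 by (intro eventually_sequentiallyI[of N]) auto
    qed
    then show ?thesis by (intro exI[of _ "%n. real n"] allI ev)
  next
    case 3
    define s where "s = Sup D"
    obtain z where z: "z \<notin> D" using 3 by blast
    have ub: "t < z" if "t \<in> D" for t using D z that unfolding downset_def by (meson not_le)
    then have bdd: "bdd_above D" by (intro bdd_aboveI[of _ z]) (auto intro: less_imp_le)
    have le: "t <= s" if "t \<in> D" for t unfolding s_def using that bdd by (rule cSup_upper)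
    have lt: "t \<in> D" if "t < s" for t
      using that D 3(1) bdd unfolding s_def downset_def by (meson less_cSup_iff less_imp_le)
    show ?thesis
    proof (cases "s \<in> D")
      case True
      have "t <= s \<longleftrightarrow> t \<in> D" for t using le True D unfolding downset_def by blast
      then show ?thesis by (intro exI[of _ "%_. s"]) simp
    next
      case False
      have "eventually (%n. t <= s - 1 / real (Suc n) \<longleftrightarrow> t \<in> D) sequentially" for t
      proof (cases "t < s")
        case True
        then obtain N :: nat where N: "1 / real (Suc N) < s - t" using nat_approx_posE[of "s - t"] by auto
        have "t <= s - 1 / real (Suc n)" if "N <= n" for n
        proof -
          have "1 / real (Suc n) <= 1 / real (Suc N)" using that by (intro divide_left_mono) auto
          then show ?thesis using N by simp
        qed
        then show ?thesis using lt[OF True] by (intro eventually_sequentiallyI[of N]) auto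
      next
        case ns: False
        then have "t \<notin> D" using le[of t] False by force
        moreover have "\<not> t <= s - 1 / real (Suc n)" for n
          using ns by (smt (verit) divide_pos_pos of_nat_0_less_iff zero_less_Suc)
        ultimately show ?thesis by simp
      qed
      then show ?thesis by (intro exI[of _ "%n. s - 1 / real (Suc n)"] allI ev)
    qed
  qed
qed

definition "gd i D w = of_bool (\<xi>s i w \<in> D) - measure M {w\<in>space M. \<xi>s i w \<in> D}"

text \<open>Half-lines may be open or closed and times may coincide, whereas the coefficient concerns closed
half-lines at distinct times; the factor \<open>10\<close> is the price of the expansion for coinciding times.\<close>

lemma dep_downsets:
  fixes r :: nat
  assumes a: "alpha_coeff M T M0 \<xi> 3 n <= ennreal a" "0 <= a"
    and r: "1 <= r" "r <= 3" and i: "int n <= i 1" "\<And>m. 1 <= m ==> m < r ==> i m <= i (Suc m)"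
    and D: "\<And>m. downset (D m)"
  shows "dep (%w. \<Prod>m=1..r. gd (i m) (D m) w) 10 a"
proof -
  have "\<forall>m. \<exists>c :: nat => real. \<forall>t. (%n. of_bool (t <= c n) :: real) \<longlonglongrightarrow> of_bool (t \<in> D m)"
    using downset_limit[OF D] by blast
  then obtain c :: "nat => nat => real" where c: "\<And>m t. (%n. of_bool (t <= c m n) :: real) \<longlonglongrightarrow> of_bool (t \<in> D m)"
    by metis
  have bm: "(%w. of_bool (\<xi>s j w \<in> D m) :: real) \<in> borel_measurable M" for j m
    by (rule borel_measurable_LIMSEQ_metric[where f = "%n w. of_bool (\<xi>s j w <= c m n)"])
      (use c in simp_all)
  have Sm: "{w\<in>space M. \<xi>s j w \<in> D m} \<in> sets M" for j m
  proof -
    have "{w\<in>space M. \<xi>s j w \<in> D m} = {w\<in>space M. 1 / 2 < (of_bool (\<xi>s j w \<in> D m) :: real)}" by auto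
    then show ?thesis using borel_measurable_less[OF borel_measurable_const bm[of j m], of "1 / 2"] by simp
  qed
  have F: "(%n. Fd j (c m n)) \<longlonglongrightarrow> measure M {w\<in>space M. \<xi>s j w \<in> D m}" for j m
  proof -
    have e: "E (%w. of_bool (\<xi>s j w \<in> A) :: real) = measure M {w\<in>space M. \<xi>s j w \<in> A}"
      if "{w\<in>space M. \<xi>s j w \<in> A} \<in> sets M" for A
    proof -
      have "E (%w. of_bool (\<xi>s j w \<in> A) :: real) = E (indicator {w\<in>space M. \<xi>s j w \<in> A})"
        by (intro Bochner_Integration.integral_cong) (auto simp: indicator_def)
      also have "... = measure M ({w\<in>space M. \<xi>s j w \<in> A} \<inter> space M)"
        by (rule Bochner_Integration.integral_indicator)
      also have "{w\<in>space M. \<xi>s j w \<in> A} \<inter> space M = {w\<in>space M. \<xi>s j w \<in> A}" by auto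
      finally show ?thesis .
    qed
    have "(%n. E (%w. of_bool (\<xi>s j w <= c m n) :: real)) \<longlonglongrightarrow> E (%w. of_bool (\<xi>s j w \<in> D m) :: real)"
    proof (rule integral_dominated_convergence[where w = "%_. 1"])
      show "(%w. of_bool (\<xi>s j w \<in> D m) :: real) \<in> borel_measurable M" by (rule bm)
      show "(%w. of_bool (\<xi>s j w <= c m k) :: real) \<in> borel_measurable M" for k by measurable
    qed (use c in auto)
    moreover have "E (%w. of_bool (\<xi>s j w <= c m k) :: real) = Fd j (c m k)" for k
      using e[of "{..c m k}"] unfolding Fd_def by simp
    ultimately show ?thesis using e[OF Sm] by simp
  qed
  show ?thesis
  proof (rule dep_limit[where P = "%k w. \<Prod>m=1..r. gi (i m) (c m k) w"])
    show "dep (%w. \<Prod>m=1..r. gi (i m) (c m k) w) 10 a" for k by (rule dep_product[OF a r i])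
    show "\<bar>\<Prod>m=1..r. gi (i m) (c m k) w\<bar> <= 1" for k w
      unfolding abs_prod by (rule prod_le_1) (use gi_abs in auto)
    show "(%w. \<Prod>m=1..r. gd (i m) (D m) w) \<in> borel_measurable M"
      unfolding gd_def using bm by (intro borel_measurable_prod borel_measurable_diff) auto
    show "(%k. \<Prod>m=1..r. gi (i m) (c m k) w) \<longlonglongrightarrow> (\<Prod>m=1..r. gd (i m) (D m) w)" for w
      unfolding gi_eq gd_def by (intro tendsto_prod tendsto_diff c F)
  qed
qed

end

section \<open>Multilinear expansion of products of integrals\<close>

lemma finite_measure_PiM:
  assumes I: "finite I" and V: "finite_measure V"
  shows "finite_measure (PiM I (%_. V))"
proof (rule finite_measureI)
  interpret V: finite_measure V by fact
  interpret P: product_sigma_finite "%_. V" ..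
  have "emeasure (PiM I (%_. V)) (\<Pi>\<^sub>E i\<in>I. space V) = (\<Prod>i\<in>I. emeasure V (space V))"
    by (rule P.emeasure_PiM[OF I]) simp
  then show "emeasure (PiM I (%_. V)) (space (PiM I (%_. V))) \<noteq> \<infinity>"
    unfolding space_PiM using V.emeasure_finite by (simp add: power_eq_top_ennreal)
qed

text \<open>A product of integrals over \<open>V\<close> is an integral over a power of \<open>V\<close>, and Fubini moves the remaining
integration inside.\<close>

lemma integral_prod_of_integrals:
  fixes G :: "'i => 'z => 'a => real" and U :: "'a => real"
  assumes N: "finite_measure N" and V: "finite_measure V" and I: "finite I"
    and U[measurable]: "U \<in> borel_measurable N" and U1: "\<And>w. \<bar>U w\<bar> <= 1"
    and G: "\<And>m. m \<in> I ==> (%x. G m (fst x) (snd x)) \<in> borel_measurable (V \<Otimes>\<^sub>M N)"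
    and G1: "\<And>m z w. m \<in> I ==> \<bar>G m z w\<bar> <= 1"
  shows "(\<integral>w. U w * (\<Prod>m\<in>I. \<integral>z. G m z w \<partial>V) \<partial>N)
      = (\<integral>z. (\<integral>w. U w * (\<Prod>m\<in>I. G m (z m) w) \<partial>N) \<partial>PiM I (%_. V))" (is ?eq)
    and "(%z. \<integral>w. U w * (\<Prod>m\<in>I. G m (z m) w) \<partial>N) \<in> borel_measurable (PiM I (%_. V))" (is ?meas)
proof -
  interpret N: finite_measure N by fact
  interpret V: finite_measure V by fact
  interpret P: product_sigma_finite "%_. V" by standard
  let ?P = "PiM I (%_. V)"
  interpret PF: finite_measure ?P by (rule finite_measure_PiM[OF I V])
  interpret pn: pair_sigma_finite ?P N ..
  interpret fin: finite_measure "?P \<Otimes>\<^sub>M N"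
    by (rule finite_measure_pair_measure) (rule N PF.finite_measure_axioms)+
  have Gm: "(%z. G m z w) \<in> borel_measurable V" if "m \<in> I" "w \<in> space N" for m w
    using measurable_compose[OF measurable_Pair2'[OF that(2)] G[OF that(1)]] by simp
  have Gi: "integrable V (%z. G m z w)" if "m \<in> I" "w \<in> space N" for m w
    using Gm[OF that] G1[OF that(1)] by (intro V.integrable_const_bound[of _ 1]) auto
  have pt: "U w * (\<Prod>m\<in>I. \<integral>z. G m z w \<partial>V) = (\<integral>z. U w * (\<Prod>m\<in>I. G m (z m) w) \<partial>?P)"
    if "w \<in> space N" for w
    using P.product_integral_prod[OF I Gi[OF _ that]] by simp
  have m1: "(%x. G m (fst x m) (snd x)) \<in> borel_measurable (?P \<Otimes>\<^sub>M N)" if "m \<in> I" for m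
  proof -
    have "(%x. (fst x m, snd x)) \<in> measurable (?P \<Otimes>\<^sub>M N) (V \<Otimes>\<^sub>M N)"
      using that by (intro measurable_Pair measurable_compose[OF measurable_fst measurable_component_singleton] measurable_snd)
    from measurable_compose[OF this G[OF that]] show ?thesis by simp
  qed
  have m2: "(%x. U (snd x) * (\<Prod>m\<in>I. G m (fst x m) (snd x))) \<in> borel_measurable (?P \<Otimes>\<^sub>M N)"
    using m1 by (intro borel_measurable_times borel_measurable_prod measurable_compose[OF measurable_snd U])
  have b: "\<bar>U w * (\<Prod>m\<in>I. G m (z m) w)\<bar> <= 1" for z w
  proof -
    have "\<bar>\<Prod>m\<in>I. G m (z m) w\<bar> <= 1" unfolding abs_prod by (rule prod_le_1) (use G1 in auto)
    then show ?thesis unfolding abs_mult using U1 by (intro mult_le_one) auto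
  qed
  have i: "integrable (?P \<Otimes>\<^sub>M N) (%(z, w). U w * (\<Prod>m\<in>I. G m (z m) w))"
    using m2 b by (intro fin.integrable_const_bound[of _ 1]) (auto simp: case_prod_beta')
  have "(\<integral>w. U w * (\<Prod>m\<in>I. \<integral>z. G m z w \<partial>V) \<partial>N) = (\<integral>w. (\<integral>z. U w * (\<Prod>m\<in>I. G m (z m) w) \<partial>?P) \<partial>N)"
    by (rule Bochner_Integration.integral_cong[OF refl pt])
  also have "... = (\<integral>z. (\<integral>w. U w * (\<Prod>m\<in>I. G m (z m) w) \<partial>N) \<partial>?P)" by (rule pn.Fubini_integral[OF i])
  finally show ?eq .
  show ?meas using m2 by (intro N.borel_measurable_lebesgue_integral) (simp add: case_prod_beta')
qed

section \<open>Truncation as an integral of indicators\<close>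

definition cut :: "real => real measure" where
  "cut N = density lborel (%x. ennreal (indicator {- N..N} x))"

text \<open>The boolean tells which of the two monotone functions is concerned, and the real number is the
threshold of the indicator.\<close>

definition signed_cut :: "real => (bool \<times> real) measure" where
  "signed_cut N = count_space UNIV \<Otimes>\<^sub>M cut N"

definition clamp :: "real => real => real" where "clamp N y = max (- N) (min N y)"

lemma sets_cut[measurable_cong, simp]: "sets (cut N) = sets borel" by (simp add: cut_def)

lemma space_cut[simp]: "space (cut N) = UNIV" by (simp add: cut_def)

lemma sets_signed_cut[measurable_cong]: "sets (signed_cut N) = sets (count_space UNIV \<Otimes>\<^sub>M borel)"
  unfolding signed_cut_def by (rule sets_pair_measure_cong) simp_all

lemma emeasure_cut: "A \<in> sets borel ==> emeasure (cut N) A = emeasure lborel (A \<inter> {- N..N})"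
  unfolding cut_def by (subst emeasure_density) (auto simp: nn_integral_indicator[symmetric] indicator_def intro!: nn_integral_cong)

lemma finite_cut: "finite_measure (cut N)"
  by (rule finite_measureI) (auto simp: emeasure_cut emeasure_lborel_Icc_eq)

lemma finite_signed_cut: "finite_measure (signed_cut N)"
  unfolding signed_cut_def by (intro finite_measure_pair_measure finite_cut finite_measure_count_space) simp

lemma integral_signed_cut:
  assumes h: "(%z. h (fst z) (snd z)) \<in> borel_measurable (signed_cut N)" and b: "\<And>b x. \<bar>h b x\<bar> <= (1 :: real)"
  shows "(\<integral>z. h (fst z) (snd z) \<partial>signed_cut N) = (\<integral>x. h True x \<partial>cut N) + (\<integral>x. h False x \<partial>cut N)"
proof -
  interpret c: finite_measure "cut N" by (rule finite_cut)
  interpret f: finite_measure "signed_cut N" by (rule finite_signed_cut)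
  interpret s: sigma_finite_measure "count_space (UNIV :: bool set)"
    by (rule sigma_finite_measure_count_space_finite) simp
  interpret p: pair_sigma_finite "count_space (UNIV :: bool set)" "cut N" ..
  have "integrable (signed_cut N) (%z. h (fst z) (snd z))"
    using h b by (intro f.integrable_const_bound[of _ 1]) auto
  then have "integrable (count_space UNIV \<Otimes>\<^sub>M cut N) (%(b, x). h b x)"
    unfolding signed_cut_def by (simp add: case_prod_beta')
  from p.integral_fst[OF this] show ?thesis
    unfolding signed_cut_def by (simp add: lebesgue_integral_count_space_finite UNIV_bool case_prod_beta')
qed

lemma signed_cut_strip:
  assumes "0 <= c" "0 <= N"
  shows "(\<integral>\<^sup>+z. of_bool (\<bar>snd z\<bar> <= c) \<partial>signed_cut N) = ennreal (4 * min c N)"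
proof -
  interpret c: finite_measure "cut N" by (rule finite_cut)
  have "(\<integral>\<^sup>+z. of_bool (\<bar>snd z\<bar> <= c) \<partial>signed_cut N) = (\<integral>\<^sup>+z. indicator (UNIV \<times> {- c..c}) z \<partial>signed_cut N)"
    by (intro nn_integral_cong) (auto simp: indicator_def)
  also have "... = emeasure (signed_cut N) (UNIV \<times> {- c..c})"
    by (rule nn_integral_indicator) (simp add: sets_signed_cut)
  also have "... = emeasure (count_space (UNIV :: bool set)) UNIV * emeasure (cut N) {- c..c}"
    unfolding signed_cut_def by (rule c.emeasure_pair_measure_Times) simp_all
  also have "... = 2 * ennreal (2 * min c N)"
    using assms by (simp add: emeasure_count_space emeasure_cut Int_atLeastAtMost emeasure_lborel_Icc_eq max_def min_def)
  also have "... = ennreal (4 * min c N)"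
    using assms by (simp add: ennreal_mult'[symmetric] ennreal_numeral[symmetric] del: ennreal_numeral)
  finally show ?thesis .
qed

lemma integral_cut_above:
  assumes "0 <= N"
  shows "(\<integral>x. of_bool (y <= x) \<partial>cut N) = N - clamp N y"
proof -
  have "(\<integral>x. of_bool (y <= x) \<partial>cut N) = (\<integral>x. indicator {y..} x \<partial>cut N)"
    by (intro Bochner_Integration.integral_cong) (auto simp: indicator_def)
  also have "... = measure (cut N) {y..}"
    by (subst Bochner_Integration.integral_indicator) simp
  also have "... = enn2real (emeasure lborel {max y (- N)..N})"
  proof -
    have "{y..} \<inter> {- N..N} = {max y (- N)..N}" by auto
    then show ?thesis by (simp add: measure_def emeasure_cut)
  qed
  also have "... = N - clamp N y"
    using assms by (simp add: emeasure_lborel_Icc_eq clamp_def max_def min_def)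
  finally show ?thesis .
qed

lemma clamp_bound: "0 <= N ==> \<bar>clamp N y\<bar> <= N" unfolding clamp_def by linarith

lemma clamp_diff: "0 <= N ==> \<bar>y - clamp N y\<bar> = max 0 (\<bar>y\<bar> - N)" unfolding clamp_def by linarith

section \<open>Differences of monotone functions\<close>

text \<open>The last assumption excludes the case of two almost surely vanishing functions, in which the quantiles
say nothing about the coefficients. Otherwise \<open>Q\<close> is bounded below near \<open>0\<close>, and the series controls
the coefficients as well.\<close>

locale monotone_difference = alpha_sequence M T M0 \<xi>
  for M :: "'a measure" and T M0 \<xi> +
  fixes h :: "bool => real => real" and X0 :: "'a => real"
  assumes h_mono: "\<And>b. mono (h b)"
    and h_cube: "\<And>b. integrable M (%w. \<bar>h b (\<xi> w)\<bar> ^ 3)"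
    and X0: "X0 \<in> borel_measurable M0" and X0_int: "integrable M X0" and X0_mean: "E X0 = 0"
    and X0_eq: "AE w in M. X0 w = h True (\<xi> w) - h False (\<xi> w)"
    and tails: "(\<Sum>j. of_nat (Suc j) * (\<integral>\<^sup>+u\<in>{u. 0 < u \<and> ennreal u < alpha_coeff M T M0 \<xi> 3 (Suc j)}.
        ennreal (max (tail_quantile M (%w. \<bar>h True (\<xi> w)\<bar>) u) (tail_quantile M (%w. \<bar>h False (\<xi> w)\<bar>) u) ^ 3) \<partial>lborel)) < \<infinity>"
    and nondegenerate: "\<exists>u>0. u < 1 \<and>
        0 < max (tail_quantile M (%w. \<bar>h True (\<xi> w)\<bar>) u) (tail_quantile M (%w. \<bar>h False (\<xi> w)\<bar>) u)"
begin

abbreviation "tq b \<equiv> tail_quantile M (%w. \<bar>h b (\<xi> w)\<bar>)"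

lemma h_meas[measurable]: "h b \<in> borel_measurable borel" by (rule borel_measurable_mono[OF h_mono])

lemma \<xi>_0[measurable]: "\<xi> \<in> borel_measurable M" by (rule M0_M[OF \<xi>])

definition "\<alpha> j = (if j = 0 then 1 else enn2real (min 1 (alpha_coeff M T M0 \<xi> 3 j)))"

text \<open>The quantile is set to \<open>0\<close> outside the unit interval, where its values are arbitrary, and then raised
to at least \<open>1\<close>. Raising changes the quantile integrals at most by a multiple of \<open>\<alpha> j\<close>, which they
dominate.\<close>

definition "qr u = indicator {0<..<1} u * max (tq True u) (tq False u)" for u :: real

definition "Q u = max 1 (qr u)"

lemma alpha_coeff_antimono:
  assumes "m <= n" shows "alpha_coeff M T M0 \<xi> 3 n <= alpha_coeff M T M0 \<xi> 3 m"
  unfolding alpha_coeff_def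
proof (rule Max.boundedI)
  fix a assume "a \<in> (%l. SUP i\<in>{i :: nat => int. strict_mono_on {1..l} i \<and> int n <= i 1}. alpha_alg M M0 l (%j. \<xi>s (i j))) ` {1..3}"
  then obtain l where l: "l \<in> {1..3}"
    and a: "a = (SUP i\<in>{i :: nat => int. strict_mono_on {1..l} i \<and> int n <= i 1}. alpha_alg M M0 l (%j. \<xi>s (i j)))" by blast
  have "a <= (SUP i\<in>{i :: nat => int. strict_mono_on {1..l} i \<and> int m <= i 1}. alpha_alg M M0 l (%j. \<xi>s (i j)))"
    unfolding a by (rule SUP_subset_mono) (use assms in auto)
  also have "... <= (MAX l\<in>{1..3}. SUP i\<in>{i :: nat => int. strict_mono_on {1..l} i \<and> int m <= i 1}. alpha_alg M M0 l (%j. \<xi>s (i j)))"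
    using l by (intro Max_ge) auto
  finally show "a <= (MAX l\<in>{1..3}. SUP i\<in>{i :: nat => int. strict_mono_on {1..l} i \<and> int m <= i 1}. alpha_alg M M0 l (%j. \<xi>s (i j)))" .
qed auto

lemma \<alpha>_nonneg: "0 <= \<alpha> j" by (simp add: \<alpha>_def)

lemma \<alpha>_eq: "1 <= j ==> ennreal (\<alpha> j) = min 1 (alpha_coeff M T M0 \<xi> 3 j)"
proof -
  assume "1 <= j"
  have "min 1 (alpha_coeff M T M0 \<xi> 3 j) <= 1" by simp
  then have "min 1 (alpha_coeff M T M0 \<xi> 3 j) < top" by (rule le_less_trans) simp
  then show ?thesis using \<open>1 <= j\<close> by (simp add: \<alpha>_def)
qed

lemma \<alpha>_le_1: "\<alpha> j <= 1"
proof (cases "j = 0")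
  case False
  then have "ennreal (\<alpha> j) <= ennreal 1" using \<alpha>_eq[of j] by simp
  then show ?thesis by (simp add: ennreal_le_iff del: ennreal_1)
qed (simp add: \<alpha>_def)

lemma \<alpha>_antimono: assumes "i <= j" shows "\<alpha> j <= \<alpha> i"
proof (cases "i = 0")
  case True
  then show ?thesis using \<alpha>_le_1[of j] by (simp add: \<alpha>_def)
next
  case False
  then have "ennreal (\<alpha> j) <= ennreal (\<alpha> i)"
    using assms alpha_coeff_antimono[OF assms] \<alpha>_eq[of i] \<alpha>_eq[of j] by (simp add: min.coboundedI2)
  then show ?thesis using \<alpha>_nonneg by (simp add: ennreal_le_iff)
qed

lemma tq_nonneg: "0 < u ==> u < 1 ==> 0 <= tq b u" by (rule tail_quantile_nonneg) auto

lemma tq_antimono: "0 < u ==> u <= v ==> v < 1 ==> tq b v <= tq b u" by (rule tail_quantile_antimono) auto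

lemma qr_nonneg: "0 <= qr u" unfolding qr_def using tq_nonneg[of u True] by (auto simp: indicator_def le_max_iff_disj)

lemma qr_meas[measurable]: "qr \<in> borel_measurable borel"
proof -
  have "mono_on {0<..<1} (%u. - max (tq True u) (tq False u))"
  proof (rule mono_onI)
    fix u v :: real assume uv: "u \<in> {0<..<1}" "v \<in> {0<..<1}" "u <= v"
    then show "- max (tq True u) (tq False u) <= - max (tq True v) (tq False v)"
      using tq_antimono[of u v True] tq_antimono[of u v False] by auto
  qed
  then have "(%u. - max (tq True u) (tq False u)) \<in> borel_measurable (restrict_space borel {0<..<1})"
    by (rule borel_measurable_mono_on_fnc)
  then have "(%u :: real. indicator {0<..<1} u *\<^sub>R - max (tq True u) (tq False u)) \<in> borel_measurable borel"
    by (subst (asm) borel_measurable_restrict_space_iff) auto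
  then have "(%u :: real. - (indicator {0<..<1} u *\<^sub>R - max (tq True u) (tq False u))) \<in> borel_measurable borel"
    by measurable
  then show ?thesis unfolding qr_def[abs_def] by simp
qed

lemma cube_integral: "(\<integral>\<^sup>+u\<in>{0<..<1}. ennreal (qr u ^ 3) \<partial>lborel) < \<infinity>"
proof -
  let ?Z = "%w. max \<bar>h True (\<xi> w)\<bar> \<bar>h False (\<xi> w)\<bar>"
  have "(\<integral>\<^sup>+u\<in>{0<..<1}. ennreal (qr u ^ 3) \<partial>lborel)
      = (\<integral>\<^sup>+u\<in>{0<..<1}. (\<integral>\<^sup>+x. ennreal (3 * x ^ 2) * indicator {0..<qr u} x \<partial>lborel) \<partial>lborel)"
    by (subst nn_integral_half_open) (simp_all add: nn_integral_cube qr_nonneg max_absorb2)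
  also have "... <= (\<integral>\<^sup>+w. (\<integral>\<^sup>+x. ennreal (3 * x ^ 2) * indicator {0..<?Z w} x \<partial>lborel) \<partial>M)"
  proof (rule layer_cake_ge)
    fix u x :: real assume u: "0 < u" "u < 1" "0 <= x" "x < qr u"
    then obtain b where b: "x < tq b u" unfolding qr_def by (auto simp: less_max_iff_disj)
    have "u < measure M {w\<in>space M. x < \<bar>h b (\<xi> w)\<bar>}" by (rule less_tail_quantileD[OF _ _ u(1,2) b]) auto
    also have "... <= measure M {w\<in>space M. x < ?Z w}"
      by (intro finite_measure_mono) (cases b, auto)
    finally show "u < measure M {w\<in>space M. x < ?Z w}" .
  qed measurable
  also have "... = (\<integral>\<^sup>+w. ennreal (?Z w ^ 3) \<partial>M)"
    by (subst nn_integral_half_open) (simp_all add: nn_integral_cube max_absorb2 le_max_iff_disj)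
  also have "... <= (\<integral>\<^sup>+w. ennreal (\<bar>h True (\<xi> w)\<bar> ^ 3 + \<bar>h False (\<xi> w)\<bar> ^ 3) \<partial>M)"
    by (intro nn_integral_mono ennreal_leI) (auto simp: max_def)
  also have "... = ennreal (E (%w. \<bar>h True (\<xi> w)\<bar> ^ 3 + \<bar>h False (\<xi> w)\<bar> ^ 3))"
    using h_cube by (intro nn_integral_eq_integral) auto
  finally show ?thesis by (rule le_less_trans) simp
qed

lemma qr_alpha_bound: "\<exists>c\<ge>0. \<forall>j. ennreal (\<alpha> j) <= ennreal c * (\<integral>\<^sup>+u\<in>{0<..<\<alpha> j}. ennreal (qr u ^ 3) \<partial>lborel)"
proof -
  obtain u0 where u0: "0 < u0" "u0 < 1" and q0: "0 < qr u0"
    using nondegenerate unfolding qr_def by (auto simp: indicator_def)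
  have le: "qr u0 <= qr u" if "0 < u" "u <= u0" for u
    using that u0 tq_antimono[of u u0 True] tq_antimono[of u u0 False] unfolding qr_def by (auto simp: indicator_def)
  define e where "e = u0 * qr u0 ^ 3"
  have e: "0 < e" unfolding e_def using u0 q0 by simp
  have "ennreal (\<alpha> j) <= ennreal (1 / e) * (\<integral>\<^sup>+u\<in>{0<..<\<alpha> j}. ennreal (qr u ^ 3) \<partial>lborel)" for j
  proof -
    have s: "\<alpha> j * u0 <= \<alpha> j" "\<alpha> j * u0 <= u0"
      using \<alpha>_le_1[of j] \<alpha>_nonneg[of j] u0 by (simp_all add: mult_left_le mult_left_le_one_le)
    have "ennreal (\<alpha> j * e) = ennreal (qr u0 ^ 3) * emeasure lborel {0<..<\<alpha> j * u0}"
      using \<alpha>_nonneg[of j] u0 q0 unfolding e_def by (simp add: emeasure_lborel_Ioo ennreal_mult[symmetric] mult_ac)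
    also have "... = (\<integral>\<^sup>+u\<in>{0<..<\<alpha> j * u0}. ennreal (qr u0 ^ 3) \<partial>lborel)"
      by (rule nn_integral_cmult_indicator[symmetric]) simp
    also have "... <= (\<integral>\<^sup>+u\<in>{0<..<\<alpha> j}. ennreal (qr u ^ 3) \<partial>lborel)"
      using s le q0 by (intro nn_integral_mono) (auto simp: indicator_def intro!: ennreal_leI power_mono)
    finally have "ennreal (1 / e) * ennreal (\<alpha> j * e) <= ennreal (1 / e) * (\<integral>\<^sup>+u\<in>{0<..<\<alpha> j}. ennreal (qr u ^ 3) \<partial>lborel)"
      by (rule mult_left_mono) simp
    moreover have "ennreal (1 / e) * ennreal (\<alpha> j * e) = ennreal (\<alpha> j)"
      using e \<alpha>_nonneg[of j] by (simp add: ennreal_mult[symmetric])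
    ultimately show ?thesis by simp
  qed
  then show ?thesis using e by (intro exI[of _ "1 / e"]) simp
qed

lemma Q_cube_integral:
  assumes "0 <= a"
  shows "(\<integral>\<^sup>+u\<in>{0<..<a}. ennreal (Q u ^ 3) \<partial>lborel) <= ennreal a + (\<integral>\<^sup>+u\<in>{0<..<a}. ennreal (qr u ^ 3) \<partial>lborel)"
proof -
  have "(\<integral>\<^sup>+u\<in>{0<..<a}. ennreal (Q u ^ 3) \<partial>lborel)
      <= (\<integral>\<^sup>+u. indicator {0<..<a} u + ennreal (qr u ^ 3) * indicator {0<..<a} u \<partial>lborel)"
  proof (rule nn_integral_mono)
    fix u
    have "Q u ^ 3 <= 1 + qr u ^ 3" unfolding Q_def using qr_nonneg[of u] by (auto simp: max_def)
    then have "ennreal (Q u ^ 3) <= ennreal (1 + qr u ^ 3)" by (rule ennreal_leI)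
    also have "... = 1 + ennreal (qr u ^ 3)" using qr_nonneg[of u] by (simp add: ennreal_plus)
    finally show "ennreal (Q u ^ 3) * indicator {0<..<a} u <= indicator {0<..<a} u + ennreal (qr u ^ 3) * indicator {0<..<a} u"
      by (auto simp: indicator_def)
  qed
  also have "... = (\<integral>\<^sup>+u. indicator {0<..<a} u \<partial>lborel) + (\<integral>\<^sup>+u\<in>{0<..<a}. ennreal (qr u ^ 3) \<partial>lborel)"
    by (rule nn_integral_add) measurable
  also have "(\<integral>\<^sup>+u. indicator {0<..<a} u \<partial>lborel) = ennreal a" using assms by (simp add: emeasure_lborel_Ioo)
  finally show ?thesis .
qed

lemma profile_\<alpha>Q: "profile \<alpha> Q"
proof
  show "\<alpha> 0 = 1" by (simp add: \<alpha>_def)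
  show "\<alpha> j <= \<alpha> i" if "i <= j" for i j by (rule \<alpha>_antimono[OF that])
  show "0 <= \<alpha> j" for j by (rule \<alpha>_nonneg)
  show "Q \<in> borel_measurable borel" unfolding Q_def[abs_def] by measurable
  show "1 <= Q u" for u by (simp add: Q_def)
  show "Q v <= Q u" if "0 < u" "u <= v" "v < 1" for u v
    using that tq_antimono[of u v True] tq_antimono[of u v False] unfolding Q_def qr_def by (auto simp: indicator_def max_def)
  let ?J = "%j. \<integral>\<^sup>+u\<in>{0<..<\<alpha> j}. ennreal (Q u ^ 3) \<partial>lborel"
  let ?j = "%j. \<integral>\<^sup>+u\<in>{0<..<\<alpha> j}. ennreal (qr u ^ 3) \<partial>lborel"
  obtain c where c: "0 <= c" "\<And>j. ennreal (\<alpha> j) <= ennreal c * ?j j" using qr_alpha_bound by blast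
  have le: "?j (Suc j) <= (\<integral>\<^sup>+u\<in>{u. 0 < u \<and> ennreal u < alpha_coeff M T M0 \<xi> 3 (Suc j)}.
        ennreal (max (tq True u) (tq False u) ^ 3) \<partial>lborel)" for j
  proof (rule nn_integral_mono)
    fix u :: real
    have "ennreal u < alpha_coeff M T M0 \<xi> 3 (Suc j)" "u < 1" if "0 < u" "u < \<alpha> (Suc j)"
    proof -
      have "ennreal u < ennreal (\<alpha> (Suc j))" using that by (intro ennreal_lessI) auto
      then show "ennreal u < alpha_coeff M T M0 \<xi> 3 (Suc j)" using \<alpha>_eq[of "Suc j"] by simp
      show "u < 1" using that \<alpha>_le_1[of "Suc j"] by simp
    qed
    then show "ennreal (qr u ^ 3) * indicator {0<..<\<alpha> (Suc j)} u
        <= ennreal (max (tq True u) (tq False u) ^ 3) * indicator {u. 0 < u \<and> ennreal u < alpha_coeff M T M0 \<xi> 3 (Suc j)} u"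
      unfolding qr_def by (auto simp: indicator_def)
  qed
  have t: "of_nat (Suc (Suc j)) * ?J (Suc j) <= (2 * (ennreal c + 1)) * (of_nat (Suc j) *
      (\<integral>\<^sup>+u\<in>{u. 0 < u \<and> ennreal u < alpha_coeff M T M0 \<xi> 3 (Suc j)}. ennreal (max (tq True u) (tq False u) ^ 3) \<partial>lborel))"
    (is "_ <= _ * (_ * ?L)") for j
  proof -
    have "?J (Suc j) <= ennreal (\<alpha> (Suc j)) + ?j (Suc j)" by (rule Q_cube_integral[OF \<alpha>_nonneg])
    also have "... <= ennreal c * ?j (Suc j) + ?j (Suc j)" by (rule add_right_mono[OF c(2)])
    also have "... = (ennreal c + 1) * ?j (Suc j)" by (simp add: distrib_right)
    also have "... <= (ennreal c + 1) * ?L" by (rule mult_left_mono[OF le]) simp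
    finally have J: "?J (Suc j) <= (ennreal c + 1) * ?L" .
    have "(of_nat (Suc (Suc j)) :: ennreal) <= of_nat (2 * Suc j)" by (rule of_nat_mono) simp
    also have "... = 2 * of_nat (Suc j)" by (simp only: of_nat_mult of_nat_numeral)
    finally have n: "(of_nat (Suc (Suc j)) :: ennreal) <= 2 * of_nat (Suc j)" .
    have "of_nat (Suc (Suc j)) * ?J (Suc j) <= (2 * of_nat (Suc j)) * ((ennreal c + 1) * ?L)"
      by (rule mult_mono[OF n J]) simp_all
    also have "... = (2 * (ennreal c + 1)) * (of_nat (Suc j) * ?L)" by (simp only: mult_ac)
    finally show ?thesis .
  qed
  have "(\<Sum>j. of_nat (Suc j) * ?J j) = (\<Sum>j. of_nat (Suc (j + 1)) * ?J (j + 1)) + (\<Sum>j<1. of_nat (Suc j) * ?J j)"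
    by (rule suminf_offset) simp
  also have "... = (\<Sum>j. of_nat (Suc (Suc j)) * ?J (Suc j)) + ?J 0" by simp
  also have "... < \<infinity>"
  proof -
    have "(\<Sum>j. of_nat (Suc (Suc j)) * ?J (Suc j)) <= (\<Sum>j. (2 * (ennreal c + 1)) * (of_nat (Suc j) *
      (\<integral>\<^sup>+u\<in>{u. 0 < u \<and> ennreal u < alpha_coeff M T M0 \<xi> 3 (Suc j)}. ennreal (max (tq True u) (tq False u) ^ 3) \<partial>lborel)))"
      by (rule suminf_le[OF t]) simp_all
    also have "... = (2 * (ennreal c + 1)) * (\<Sum>j. of_nat (Suc j) *
      (\<integral>\<^sup>+u\<in>{u. 0 < u \<and> ennreal u < alpha_coeff M T M0 \<xi> 3 (Suc j)}. ennreal (max (tq True u) (tq False u) ^ 3) \<partial>lborel))"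
      by (rule ennreal_suminf_cmult)
    also have "... < \<infinity>" using tails by (simp add: ennreal_mult_less_top)
    finally have a: "(\<Sum>j. of_nat (Suc (Suc j)) * ?J (Suc j)) < \<infinity>" .
    have "?J 0 <= ennreal 1 + (\<integral>\<^sup>+u\<in>{0<..<1}. ennreal (qr u ^ 3) \<partial>lborel)"
      using Q_cube_integral[of 1] by (simp add: \<alpha>_def)
    also have "... < \<infinity>" using cube_integral by simp
    finally show ?thesis using a by simp
  qed
  finally show "(\<Sum>j. of_nat (Suc j) * ?J j) < \<infinity>" .
qed

sublocale pr: profile \<alpha> Q by (rule profile_\<alpha>Q)

definition "tail b y = measure M {w\<in>space M. y <= \<bar>h b (\<xi> w)\<bar>}"

text \<open>A number that is at most \<open>\<alpha> j\<close> and at most each tail probability is an integral over those levels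
\<open>u < \<alpha> j\<close> at which all thresholds are below the quantile. After exchanging the integrals, the
thresholds below \<open>Q u\<close> in the truncation window have measure \<open>4 min (Q u) N\<close> for each variable.\<close>

lemma kernel_bound:
  fixes I :: "nat set"
  assumes I: "finite I" and N: "1 <= N"
    and \<Lambda>: "\<Lambda> \<in> borel_measurable (PiM I (%_. signed_cut N))"
    and b1: "\<And>z. \<bar>\<Lambda> z\<bar> <= 10 * \<alpha> j"
    and b2: "\<And>z m. m \<in> I ==> \<bar>\<Lambda> z\<bar> <= 10 * tail (fst (z m)) \<bar>snd (z m)\<bar>"
  shows "\<bar>\<integral>z. \<Lambda> z \<partial>PiM I (%_. signed_cut N)\<bar> <= 10 * 4 ^ card I * pr.H N (card I) j"
proof -
  let ?P = "PiM I (%_. signed_cut N)"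
  interpret V: finite_measure "signed_cut N" by (rule finite_signed_cut)
  interpret P: product_sigma_finite "%_. signed_cut N" by standard
  interpret PF: finite_measure ?P by (rule finite_measure_PiM[OF I finite_signed_cut])
  interpret pl: pair_sigma_finite ?P lborel ..
  have sm: "(%x. snd (fst x m)) \<in> borel_measurable (?P \<Otimes>\<^sub>M lborel)" if "m \<in> I" for m
  proof -
    have "(%x. fst x m) \<in> measurable (?P \<Otimes>\<^sub>M lborel) (signed_cut N)"
      using that by (intro measurable_compose[OF measurable_fst measurable_component_singleton])
    moreover have "snd \<in> measurable (signed_cut N) borel"
      unfolding measurable_cong_sets[OF sets_signed_cut refl] by (rule measurable_snd)
    ultimately show ?thesis by (rule measurable_compose)
  qed
  have jm: "(%x. (\<Prod>m\<in>I. of_bool (\<bar>snd (fst x m)\<bar> <= Q (snd x)) :: ennreal)) \<in> borel_measurable (?P \<Otimes>\<^sub>M lborel)"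
  proof (rule borel_measurable_prod_ennreal)
    fix m assume "m \<in> I"
    note sm[OF this, measurable]
    show "(%x. of_bool (\<bar>snd (fst x m)\<bar> <= Q (snd x)) :: ennreal) \<in> borel_measurable (?P \<Otimes>\<^sub>M lborel)" by measurable
  qed
  have pt: "ennreal \<bar>\<Lambda> z\<bar> <= 10 * (\<integral>\<^sup>+u. (\<Prod>m\<in>I. of_bool (\<bar>snd (z m)\<bar> <= Q u)) * indicator {0<..<\<alpha> j} u \<partial>lborel)" for z
  proof -
    define a where "a = \<bar>\<Lambda> z\<bar> / 10"
    have "ennreal a = (\<integral>\<^sup>+u. indicator {0<..<a} u \<partial>lborel)" by (simp add: emeasure_lborel_Ioo a_def)
    also have "... <= (\<integral>\<^sup>+u. (\<Prod>m\<in>I. of_bool (\<bar>snd (z m)\<bar> <= Q u)) * indicator {0<..<\<alpha> j} u \<partial>lborel)"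
    proof (rule nn_integral_mono)
      fix u
      show "(indicator {0<..<a} u :: ennreal) <= (\<Prod>m\<in>I. of_bool (\<bar>snd (z m)\<bar> <= Q u)) * indicator {0<..<\<alpha> j} u"
      proof (cases "u \<in> {0<..<a}")
        case True
        then have u: "0 < u" "u < \<alpha> j" using b1[of z] by (auto simp: a_def)
        then have u1: "u < 1" using \<alpha>_le_1[of j] by simp
        have "\<bar>snd (z m)\<bar> <= Q u" if "m \<in> I" for m
        proof -
          have "u < tail (fst (z m)) \<bar>snd (z m)\<bar>" using True b2[OF that, of z] by (auto simp: a_def)
          then have "\<bar>snd (z m)\<bar> <= tq (fst (z m)) u"
            unfolding tail_def by (intro tail_quantile_ge u u1) auto
          also have "... <= qr u" using u u1 unfolding qr_def by (cases "fst (z m)") (auto simp: indicator_def)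
          also have "... <= Q u" by (simp add: Q_def)
          finally show ?thesis .
        qed
        then have "(\<Prod>m\<in>I. of_bool (\<bar>snd (z m)\<bar> <= Q u) :: ennreal) = 1" by (intro prod.neutral) auto
        then show ?thesis using True u by simp
      qed simp
    qed
    finally have "ennreal 10 * ennreal a <= 10 * (\<integral>\<^sup>+u. (\<Prod>m\<in>I. of_bool (\<bar>snd (z m)\<bar> <= Q u)) * indicator {0<..<\<alpha> j} u \<partial>lborel)"
      by (simp add: mult_left_mono)
    then show ?thesis by (simp add: a_def ennreal_mult[symmetric] del: ennreal_numeral)
  qed
  have "ennreal \<bar>\<integral>z. \<Lambda> z \<partial>?P\<bar> <= (\<integral>\<^sup>+z. ennreal \<bar>\<Lambda> z\<bar> \<partial>?P)"
    using integral_norm_bound_ennreal[of ?P \<Lambda>] PF.integrable_const_bound[of \<Lambda> "10 * \<alpha> j"] \<Lambda> b1 by simp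
  also have "... <= (\<integral>\<^sup>+z. 10 * (\<integral>\<^sup>+u. (\<Prod>m\<in>I. of_bool (\<bar>snd (z m)\<bar> <= Q u)) * indicator {0<..<\<alpha> j} u \<partial>lborel) \<partial>?P)"
    by (rule nn_integral_mono[OF pt])
  also have "... = 10 * (\<integral>\<^sup>+z. (\<integral>\<^sup>+u. (\<Prod>m\<in>I. of_bool (\<bar>snd (z m)\<bar> <= Q u)) * indicator {0<..<\<alpha> j} u \<partial>lborel) \<partial>?P)"
    using jm by (intro nn_integral_cmult lborel.borel_measurable_nn_integral) (auto simp: case_prod_beta' intro!: borel_measurable_times_ennreal)
  also have "(\<integral>\<^sup>+z. (\<integral>\<^sup>+u. (\<Prod>m\<in>I. of_bool (\<bar>snd (z m)\<bar> <= Q u)) * indicator {0<..<\<alpha> j} u \<partial>lborel) \<partial>?P)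
      = (\<integral>\<^sup>+u. (\<integral>\<^sup>+z. (\<Prod>m\<in>I. of_bool (\<bar>snd (z m)\<bar> <= Q u)) * indicator {0<..<\<alpha> j} u \<partial>?P) \<partial>lborel)"
    using jm by (intro pl.Fubini'[symmetric]) (auto simp: case_prod_beta' intro!: borel_measurable_times_ennreal)
  also have "... = (\<integral>\<^sup>+u. ennreal (4 ^ card I) * (ennreal (min (Q u) N ^ card I) * indicator {0<..<\<alpha> j} u) \<partial>lborel)"
  proof (rule nn_integral_cong)
    fix u
    have Q0: "0 <= Q u" by (simp add: Q_def)
    have mo: "(%z. of_bool (\<bar>snd z\<bar> <= Q u) :: ennreal) \<in> borel_measurable (signed_cut N)"
      unfolding measurable_cong_sets[OF sets_signed_cut refl] by measurable
    have "(\<integral>\<^sup>+z. (\<Prod>m\<in>I. of_bool (\<bar>snd (z m)\<bar> <= Q u)) * indicator {0<..<\<alpha> j} u \<partial>?P)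
        = (\<integral>\<^sup>+z. (\<Prod>m\<in>I. of_bool (\<bar>snd (z m)\<bar> <= Q u)) \<partial>?P) * indicator {0<..<\<alpha> j} u"
      by (cases "u \<in> {0<..<\<alpha> j}") simp_all
    also have "(\<integral>\<^sup>+z. (\<Prod>m\<in>I. of_bool (\<bar>snd (z m)\<bar> <= Q u)) \<partial>?P) = (\<Prod>m\<in>I. ennreal (4 * min (Q u) N))"
      using Q0 N by (subst P.product_nn_integral_prod[OF I mo]) (simp add: signed_cut_strip)
    also have "... = ennreal (4 ^ card I) * ennreal (min (Q u) N ^ card I)"
      using Q0 N by (simp add: ennreal_power power_mult_distrib ennreal_mult[symmetric])
    finally show "(\<integral>\<^sup>+z. (\<Prod>m\<in>I. of_bool (\<bar>snd (z m)\<bar> <= Q u)) * indicator {0<..<\<alpha> j} u \<partial>?P)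
        = ennreal (4 ^ card I) * (ennreal (min (Q u) N ^ card I) * indicator {0<..<\<alpha> j} u)" by (simp add: mult.assoc)
  qed
  also have "... = ennreal (4 ^ card I) * (\<integral>\<^sup>+u\<in>{0<..<\<alpha> j}. ennreal (min (Q u) N ^ card I) \<partial>lborel)"
    by (rule nn_integral_cmult) measurable
  also have "... = ennreal (4 ^ card I) * ennreal (pr.H N (card I) j)" using N by (simp add: pr.H_eq)
  also have "10 * (ennreal (4 ^ card I) * ennreal (pr.H N (card I) j)) = ennreal (10 * 4 ^ card I * pr.H N (card I) j)"
    using pr.nonneg by (simp add: ennreal_mult mult.assoc)
  finally show ?thesis using pr.nonneg by (simp add: ennreal_le_iff)
qed

definition "df b x = measure M {w\<in>space M. h b (\<xi> w) <= x}"

text \<open>The centred indicators at time \<open>i\<close>, signed so that their integral over all thresholds in the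
window is the truncated variable.\<close>

definition "Ker i z w = (if fst z then 1 else - 1) * (df (fst z) (snd z) - of_bool (h (fst z) (\<xi>s i w) <= snd z))"

definition "Wt N i w = (\<integral>z. Ker i z w \<partial>signed_cut N)"

lemma df_bounds: "0 <= df b x" "df b x <= 1" by (auto simp: df_def)

lemma df_meas[measurable]: "df b \<in> borel_measurable borel"
proof (rule borel_measurable_mono, rule monoI)
  show "df b x <= df b y" if "x <= y" for x y
    unfolding df_def using that by (intro finite_measure_mono) auto
qed

lemma Ker_abs: "\<bar>Ker i z w\<bar> <= 1"
  unfolding Ker_def using df_bounds[of "fst z" "snd z"] by (auto simp: of_bool_def)

lemma Ker_pair:
  assumes Z: "\<And>b. (%w. h b (\<xi>s i w)) \<in> borel_measurable F"
  shows "(%x. Ker i (fst x) (snd x)) \<in> borel_measurable (signed_cut N \<Otimes>\<^sub>M F)"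
proof -
  note Z[measurable]
  have "(%x. Ker i (fst x) (snd x)) = (%x. if fst (fst x)
      then df True (snd (fst x)) - of_bool (h True (\<xi>s i (snd x)) <= snd (fst x))
      else of_bool (h False (\<xi>s i (snd x)) <= snd (fst x)) - df False (snd (fst x)))"
    unfolding Ker_def by auto
  also have "... \<in> borel_measurable ((count_space UNIV \<Otimes>\<^sub>M borel) \<Otimes>\<^sub>M F)" by measurable
  also have "borel_measurable ((count_space UNIV \<Otimes>\<^sub>M borel) \<Otimes>\<^sub>M F) = borel_measurable (signed_cut N \<Otimes>\<^sub>M F)"
    by (intro measurable_cong_sets sets_pair_measure_cong sets_signed_cut[symmetric] refl)
  finally show ?thesis .
qed

lemma Ker_F:
  assumes Z: "\<And>b. (%w. h b (\<xi>s i w)) \<in> borel_measurable F"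
  shows "Ker i z \<in> borel_measurable F"
  unfolding Ker_def[abs_def] using Z[of "fst z"] by measurable

lemma h\<xi>_M: "(%w. h b (\<xi>s i w)) \<in> borel_measurable M" by measurable

lemma h\<xi>_F: "(%w. h b (\<xi>s i w)) \<in> borel_measurable (sigma_at M T M0 i)"
  by (rule measurable_compose[OF shifted_meas[OF \<xi>] h_meas])

lemmas Ker_M[measurable] = Ker_F[OF h\<xi>_M]

lemma measure_shift:
  assumes "A \<in> sets borel"
  shows "measure M {w\<in>space M. \<xi>s i w \<in> A} = measure M {w\<in>space M. \<xi> w \<in> A}"
proof -
  have S: "{w\<in>space M. \<xi> w \<in> A} \<in> sets M"
    using measurable_sets[OF \<xi>_0 assms] by (simp add: vimage_def Int_def conj_commute)
  have "measure M {w\<in>space M. \<xi> w \<in> A} = measure (distr M M (\<tau> i)) {w\<in>space M. \<xi> w \<in> A}" by (simp add: distr_\<tau>)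
  also have "... = measure M (\<tau> i -` {w\<in>space M. \<xi> w \<in> A} \<inter> space M)" by (rule measure_distr) (use S in simp_all)
  also have "\<tau> i -` {w\<in>space M. \<xi> w \<in> A} \<inter> space M = {w\<in>space M. \<xi>s i w \<in> A}"
    using \<tau>_space by (auto simp: shifted_def)
  finally show ?thesis by simp
qed

lemma Ker_gd: "Ker i z w = (if fst z then - 1 else 1) * gd i {t. h (fst z) t <= snd z} w"
proof -
  have "{t. h (fst z) t <= snd z} \<in> sets borel" by measurable
  from measure_shift[OF this, of i] show ?thesis unfolding Ker_def gd_def df_def by simp
qed

lemma downset_h: "downset {t. h b t <= x}"
  unfolding downset_def using monoD[OF h_mono] by (auto intro: order_trans)

lemma Ker_mean: "E (Ker i z) = 0"
proof -
  have S: "{w\<in>space M. h (fst z) (\<xi>s i w) <= snd z} \<in> sets M" by measurable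
  have "E (%w. of_bool (h (fst z) (\<xi>s i w) <= snd z) :: real) = E (indicator {w\<in>space M. h (fst z) (\<xi>s i w) <= snd z})"
    by (intro Bochner_Integration.integral_cong) (auto simp: indicator_def)
  also have "... = measure M ({w\<in>space M. h (fst z) (\<xi>s i w) <= snd z} \<inter> space M)" by (rule Bochner_Integration.integral_indicator)
  also have "{w\<in>space M. h (fst z) (\<xi>s i w) <= snd z} \<inter> space M = {w\<in>space M. h (fst z) (\<xi>s i w) <= snd z}" by auto
  also have "measure M ... = df (fst z) (snd z)"
    using measure_shift[of "{t. h (fst z) t <= snd z}" i] unfolding df_def by simp
  finally have e: "E (%w. of_bool (h (fst z) (\<xi>s i w) <= snd z) :: real) = df (fst z) (snd z)" .
  have "integrable M (%w. of_bool (h (fst z) (\<xi>s i w) <= snd z) :: real)" by (rule bounded_integrable[of _ 1]) auto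
  then show ?thesis unfolding Ker_def[abs_def] using e prob_space by simp
qed

lemma Ker_int: "integrable M (Ker i z)" by (rule bounded_integrable[of _ 1]) (use Ker_abs in auto)

text \<open>A centred indicator has mean absolute value \<open>2 p (1 - p)\<close>; the smaller of the two probabilities is a
tail of the absolute value, the sign of the threshold deciding which.\<close>

lemma Ker_tail: "E (%w. \<bar>Ker i z w\<bar>) <= 2 * tail (fst z) \<bar>snd z\<bar>"
proof -
  let ?b = "fst z" and ?x = "snd z"
  let ?i = "%w. of_bool (h ?b (\<xi>s i w) <= ?x) :: real"
  have ii: "integrable M ?i" by (rule bounded_integrable[of _ 1]) auto
  have m: "E ?i = df ?b ?x"
  proof -
    have "0 = (if ?b then 1 else - 1) * (df ?b ?x - E ?i)"
      using Ker_mean[of i z] ii prob_space unfolding Ker_def[abs_def] by simp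
    then show ?thesis by (simp split: if_splits)
  qed
  have "E (%w. \<bar>Ker i z w\<bar>) <= E (%w. ?i w + df ?b ?x)"
    using Ker_int ii df_bounds[of ?b ?x] by (intro integral_mono) (auto simp: Ker_def abs_mult of_bool_def)
  then have 1: "E (%w. \<bar>Ker i z w\<bar>) <= 2 * df ?b ?x" using ii m prob_space by simp
  have "E (%w. \<bar>Ker i z w\<bar>) <= E (%w. (1 - ?i w) + (1 - df ?b ?x))"
    using Ker_int ii df_bounds[of ?b ?x] by (intro integral_mono) (auto simp: Ker_def abs_mult of_bool_def)
  then have 2: "E (%w. \<bar>Ker i z w\<bar>) <= 2 * (1 - df ?b ?x)" using ii m prob_space by simp
  show ?thesis
  proof (cases "0 <= ?x")
    case True
    have S: "{w\<in>space M. h ?b (\<xi> w) <= ?x} \<in> sets M" by measurable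
    have "1 - df ?b ?x = measure M (space M - {w\<in>space M. h ?b (\<xi> w) <= ?x})"
      unfolding df_def by (rule prob_compl[OF S, symmetric])
    also have "... <= tail ?b \<bar>?x\<bar>"
      unfolding tail_def using True by (intro finite_measure_mono) auto
    finally show ?thesis using 2 by simp
  next
    case False
    have "df ?b ?x <= tail ?b \<bar>?x\<bar>"
      unfolding tail_def df_def using False by (intro finite_measure_mono) auto
    then show ?thesis using 1 by simp
  qed
qed

lemma prod_Ker_abs: "\<bar>\<Prod>m\<in>I. Ker (i m) (z m) w\<bar> <= 1"
  unfolding abs_prod by (rule prod_le_1) (use Ker_abs in auto)

lemma prod_Ker_tail:
  assumes "finite I" "m \<in> I"
  shows "E (%w. \<bar>\<Prod>m\<in>I. Ker (i m) (z m) w\<bar>) <= 2 * tail (fst (z m)) \<bar>snd (z m)\<bar>"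
proof -
  have "\<bar>\<Prod>m\<in>I. Ker (i m) (z m) w\<bar> <= \<bar>Ker (i m) (z m) w\<bar>" for w
  proof -
    have "(\<Prod>m\<in>I. Ker (i m) (z m) w) = Ker (i m) (z m) w * (\<Prod>m\<in>I - {m}. Ker (i m) (z m) w)"
      by (rule prod.remove[OF assms])
    then show ?thesis using prod_Ker_abs[of i z w "I - {m}"] by (simp add: abs_mult mult_left_le)
  qed
  moreover have "integrable M (%w. \<bar>\<Prod>m\<in>I. Ker (i m) (z m) w\<bar>)"
    by (rule bounded_integrable[of _ 1]) (use prod_Ker_abs in auto)
  ultimately have "E (%w. \<bar>\<Prod>m\<in>I. Ker (i m) (z m) w\<bar>) <= E (%w. \<bar>Ker (i m) (z m) w\<bar>)"
    using Ker_int by (intro integral_mono) auto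
  then show ?thesis using Ker_tail[of "i m" "z m"] by simp
qed

lemma tail_nonneg: "0 <= tail b y" by (simp add: tail_def)

lemma Wt_abs: assumes "0 <= N" shows "\<bar>Wt N i w\<bar> <= (\<integral>z. \<bar>Ker i z w\<bar> \<partial>signed_cut N)"
  unfolding Wt_def by (rule integral_abs_bound)

lemma moment_bound:
  assumes N: "1 <= N" and q: "1 <= q"
  shows "E (%w. \<bar>Wt N i w\<bar> ^ q) <= 10 * 4 ^ q * pr.H N q 0"
proof -
  let ?P = "PiM {1..q} (%_. signed_cut N)"
  let ?\<Lambda> = "%z. E (%w. 1 * (\<Prod>m\<in>{1..q}. \<bar>Ker i (z m) w\<bar>))"
  have G: "(%x. \<bar>Ker i (fst x) (snd x)\<bar>) \<in> borel_measurable (signed_cut N \<Otimes>\<^sub>M M)" by (rule borel_measurable_abs[OF Ker_pair[OF h\<xi>_M]])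
  note exp = integral_prod_of_integrals[where G = "%m z w. \<bar>Ker i z w\<bar>" and I = "{1..q}" and N = M and V = "signed_cut N" and U = "%_. 1",
      OF finite_measure_axioms finite_signed_cut _ _ _ G]
  have bm: "(%w. \<integral>z. \<bar>Ker i z w\<bar> \<partial>signed_cut N) \<in> borel_measurable M"
  proof -
    interpret V: finite_measure "signed_cut N" by (rule finite_signed_cut)
    interpret p: pair_sigma_finite "signed_cut N" M ..
    have "(%x. \<bar>Ker i (snd x) (fst x)\<bar>) \<in> borel_measurable (M \<Otimes>\<^sub>M signed_cut N)"
      using measurable_compose[OF measurable_pair_swap' G] by (simp add: case_prod_beta')
    then show ?thesis by (intro V.borel_measurable_lebesgue_integral) (simp add: case_prod_beta')
  qed
  have bb: "(\<integral>z. \<bar>Ker i z w\<bar> \<partial>signed_cut N) <= measure (signed_cut N) (space (signed_cut N))" for w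
  proof -
    interpret V: finite_measure "signed_cut N" by (rule finite_signed_cut)
    show ?thesis
    proof (cases "integrable (signed_cut N) (%z. \<bar>Ker i z w\<bar>)")
      case True
      have "(\<integral>z. \<bar>Ker i z w\<bar> \<partial>signed_cut N) <= (\<integral>z. 1 \<partial>signed_cut N)" by (rule integral_mono[OF True]) (use Ker_abs in auto)
      then show ?thesis by simp
    qed (simp add: not_integrable_integral_eq)
  qed
  have nn: "0 <= (\<integral>z. \<bar>Ker i z w\<bar> \<partial>signed_cut N)" for w by (rule integral_nonneg_AE) auto
  have le: "\<bar>Wt N i w\<bar> ^ q <= (\<integral>z. \<bar>Ker i z w\<bar> \<partial>signed_cut N) ^ q" for w
    using Wt_abs[of N i w] N by (intro power_mono) auto
  have int: "integrable M (%w. (\<integral>z. \<bar>Ker i z w\<bar> \<partial>signed_cut N) ^ q)"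
    using bm nn bb by (intro bounded_integrable[of _ "measure (signed_cut N) (space (signed_cut N)) ^ q"]) (auto intro!: power_mono simp: power_abs)
  have "E (%w. \<bar>Wt N i w\<bar> ^ q) <= E (%w. (\<integral>z. \<bar>Ker i z w\<bar> \<partial>signed_cut N) ^ q)"
    by (rule integral_mono_AE'[OF int]) (use le nn in \<open>auto\<close>)
  also have "... = E (%w. 1 * (\<Prod>m\<in>{1..q}. \<integral>z. \<bar>Ker i z w\<bar> \<partial>signed_cut N))" by simp
  also have "... = (\<integral>z. ?\<Lambda> z \<partial>?P)" by (rule exp(1)) (use Ker_abs in auto)
  also have "... <= \<bar>\<integral>z. ?\<Lambda> z \<partial>?P\<bar>" by simp
  also have "... <= 10 * 4 ^ card {1..q} * pr.H N (card {1..q}) 0"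
  proof (rule kernel_bound[OF _ N])
    show "?\<Lambda> \<in> borel_measurable ?P" by (rule exp(2)) (use Ker_abs in auto)
    have e: "?\<Lambda> z = E (%w. \<bar>\<Prod>m\<in>{1..q}. Ker i (z m) w\<bar>)" for z by (simp add: abs_prod)
    have n: "0 <= ?\<Lambda> z" for z unfolding e by (rule integral_nonneg_AE) auto
    have pi: "integrable M (%w. \<bar>\<Prod>m\<in>{1..q}. Ker i (z m) w\<bar>)" for z
      by (rule bounded_integrable[of _ 1]) (use prod_Ker_abs[of "%_. i" z _ "{1..q}"] in auto)
    have "?\<Lambda> z <= E (%w. 1)" for z
      unfolding e using pi prod_Ker_abs[of "%_. i" z _ "{1..q}"] by (intro integral_mono) auto
    then show "\<bar>?\<Lambda> z\<bar> <= 10 * \<alpha> 0" for z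
      using n[of z] prob_space order_trans[of "?\<Lambda> z" 1 10] by (simp add: \<alpha>_def)
    show "\<bar>?\<Lambda> z\<bar> <= 10 * tail (fst (z m)) \<bar>snd (z m)\<bar>" if "m \<in> {1..q}" for z m
    proof -
      have "?\<Lambda> z <= 2 * tail (fst (z m)) \<bar>snd (z m)\<bar>"
        unfolding e by (rule prod_Ker_tail[of "{1..q}" m "%_. i" z]) (use that in auto)
      then show ?thesis using n[of z] tail_nonneg[of "fst (z m)" "\<bar>snd (z m)\<bar>"] by linarith
    qed
  qed simp
  finally show ?thesis by simp
qed

lemma kernel_mixing:
  fixes i :: "nat => int"
  assumes pq: "p < q" "q <= p + 3" and i: "l + int j <= i (Suc p)" "\<And>m. p < m ==> m < q ==> i m <= i (Suc m)"
    and j: "1 <= j"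
  shows "cond_le M (sigma_at M T M0 l)
    (%w. (\<Prod>m=Suc p..q. Ker (i m) (z m) w) - E (%w. \<Prod>m=Suc p..q. Ker (i m) (z m) w)) (10 * \<alpha> j)"
proof -
  let ?P = "%w. \<Prod>m=Suc p..q. Ker (i m) (z m) w"
  have Pm[measurable]: "?P \<in> borel_measurable M" by measurable
  have Pi: "integrable M ?P" by (rule bounded_integrable[of _ 1]) (use prod_Ker_abs in auto)
  show ?thesis
  proof (cases "alpha_coeff M T M0 \<xi> 3 j <= 1")
    case True
    have a: "alpha_coeff M T M0 \<xi> 3 j <= ennreal (\<alpha> j)" using \<alpha>_eq[OF j] True by (simp add: min_absorb2)
    define r where "r = q - p"
    define D where "D m = {t. h (fst (z (p + m))) t <= snd (z (p + m))}" for m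
    define s where "s = (\<Prod>m=1..r. if fst (z (p + m)) then - 1 else 1 :: real)"
    let ?R = "%w. \<Prod>m=1..r. gd (i (p + m) - l) (D m) w"
    have "dep ?R 10 (\<alpha> j)"
    proof (rule dep_downsets[OF a \<alpha>_nonneg])
      show "1 <= r" "r <= 3" using pq by (auto simp: r_def)
      show "int j <= i (p + 1) - l" using i(1) by simp
      show "i (p + m) - l <= i (p + Suc m) - l" if "1 <= m" "m < r" for m
        using i(2)[of "p + m"] that by (simp add: r_def)
      show "downset (D m)" for m unfolding D_def by (rule downset_h)
    qed
    then have R: "cond_le M M0 (%w. ?R w - E ?R) (10 * \<alpha> j)" by (simp add: dep_def)
    have s1: "\<bar>s\<bar> = 1" unfolding s_def abs_prod by (intro prod.neutral) auto
    have PR: "?P (\<tau> (- l) w) = s * ?R w" if "w \<in> space M" for w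
    proof -
      have "?P (\<tau> (- l) w) = (\<Prod>m=Suc p..q. Ker (i m - l) (z m) w)"
        using shifted_\<tau>[OF that, of \<xi>] unfolding Ker_def by simp
      also have "... = (\<Prod>m=1..r. Ker (i (p + m) - l) (z (p + m)) w)"
        by (rule prod.reindex_bij_witness[where i = "%m. p + m" and j = "%m. m - p"]) (auto simp: r_def)
      also have "... = s * ?R w" unfolding Ker_gd s_def D_def by (rule prod.distrib)
      finally show ?thesis .
    qed
    have ER: "E ?P = s * E ?R"
    proof -
      have "E ?P = E (%w. ?P (\<tau> (- l) w))" by (rule expectation_\<tau>[OF Pm, symmetric])
      also have "... = E (%w. s * ?R w)" by (rule Bochner_Integration.integral_cong[OF refl PR])
      finally show ?thesis by simp
    qed
    have "cond_le M M0 (%w. s * (?R w - E ?R)) (\<bar>s\<bar> * (10 * \<alpha> j))" by (rule cond_le_cmult[OF R])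
    then have "cond_le M M0 (%w. ?P (\<tau> (- l) w) - E ?P) (10 * \<alpha> j)"
      using cond_le_cong[of M "%w. ?P (\<tau> (- l) w) - E ?P" "%w. s * (?R w - E ?R)"] PR ER s1
      by (simp add: right_diff_distrib)
    then show ?thesis by (rule cond_le_shift) measurable
  next
    case False
    then have "ennreal (\<alpha> j) = ennreal 1" using \<alpha>_eq[OF j] by (simp add: min_def)
    then have \<alpha>1: "\<alpha> j = 1" using \<alpha>_nonneg[of j] by (simp add: ennreal_eq_1 flip: ennreal_1)
    have E1: "\<bar>E ?P\<bar> <= 1"
    proof -
      have "\<bar>E ?P\<bar> <= E (%w. \<bar>?P w\<bar>)" by (rule integral_abs_bound)
      also have "... <= E (%w. 1)" using Pi prod_Ker_abs by (intro integral_mono) auto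
      finally show ?thesis using prob_space by simp
    qed
    have "\<bar>?P w - E ?P\<bar> <= 2" for w using E1 prod_Ker_abs[of i z w "{Suc p..q}"] by linarith
    then have "E (%w. \<bar>?P w - E ?P\<bar>) <= E (%w. 2)"
      using Pi by (intro integral_mono) auto
    then have "E (%w. \<bar>?P w - E ?P\<bar>) <= 10 * \<alpha> j" using prob_space \<alpha>1 by simp
    then show ?thesis using Pi by (intro cond_le_abs sigma_at_sub) auto
  qed
qed

lemma integral_pair_mult:
  fixes f g :: "'a => real"
  assumes f[measurable]: "f \<in> borel_measurable M" and g[measurable]: "g \<in> borel_measurable M"
    and b: "\<And>w. \<bar>f w\<bar> <= a" "\<And>w. \<bar>g w\<bar> <= b"
  shows "(\<integral>x. f (fst x) * g (snd x) \<partial>(M \<Otimes>\<^sub>M M)) = E f * E g"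
proof -
  interpret p: pair_sigma_finite M M ..
  interpret fp: finite_measure "M \<Otimes>\<^sub>M M" by (rule finite_measure_pair_measure) (rule finite_measure_axioms)+
  have "0 <= a" using b(1) abs_ge_zero order_trans by blast
  then have ab: "\<bar>f x * g y\<bar> <= a * b" for x y unfolding abs_mult using b by (intro mult_mono) auto
  have "integrable (M \<Otimes>\<^sub>M M) (%(x, y). f x * g y)"
    using ab by (intro fp.integrable_const_bound[of _ "a * b"]) auto
  from p.integral_fst[OF this] show ?thesis by (simp add: case_prod_beta')
qed

lemma Wt_shift: "Wt N i w = Wt N 0 (\<tau> i w)"
  unfolding Wt_def Ker_def shifted_def by (simp add: \<tau>_0)

lemma Wt_F_of:
  assumes "\<And>b. (%w. h b (\<xi>s i w)) \<in> borel_measurable F"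
  shows "Wt N i \<in> borel_measurable F"
proof -
  interpret V: finite_measure "signed_cut N" by (rule finite_signed_cut)
  have "(%x. Ker i (snd x) (fst x)) \<in> borel_measurable (F \<Otimes>\<^sub>M signed_cut N)"
    using measurable_compose[OF measurable_pair_swap' Ker_pair[OF assms]] by (simp add: case_prod_beta')
  then show ?thesis unfolding Wt_def[abs_def]
    by (intro V.borel_measurable_lebesgue_integral) (simp add: case_prod_beta')
qed

lemmas Wt_M[measurable] = Wt_F_of[OF h\<xi>_M]

definition "wb N = measure (signed_cut N) (space (signed_cut N))"

lemma Wt_bounded: "\<bar>Wt N i w\<bar> <= wb N"
proof -
  interpret V: finite_measure "signed_cut N" by (rule finite_signed_cut)
  have "(\<integral>z. \<bar>Ker i z w\<bar> \<partial>signed_cut N) <= wb N"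
  proof (cases "integrable (signed_cut N) (%z. \<bar>Ker i z w\<bar>)")
    case True
    have "(\<integral>z. \<bar>Ker i z w\<bar> \<partial>signed_cut N) <= (\<integral>z. 1 \<partial>signed_cut N)" by (rule integral_mono[OF True]) (use Ker_abs in auto)
    then show ?thesis by (simp add: wb_def)
  qed (simp add: not_integrable_integral_eq wb_def)
  then show ?thesis unfolding Wt_def by (rule order_trans[OF integral_abs_bound])
qed

lemma prod_Wt_bounded: "\<bar>\<Prod>m\<in>I. Wt N (i m) w\<bar> <= (\<Prod>m\<in>I. wb N)"
  unfolding abs_prod by (rule prod_mono) (use Wt_bounded in auto)

text \<open>Both the expectation of the product and the product of the expectations are expanded over the same
thresholds, the latter by means of an independent second copy of the probability space, so that their
difference is the integral of the differences for indicators.\<close>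

lemma mixing_bound:
  fixes k :: "nat => nat"
  assumes N: "1 <= N" and pq: "p < q" "q <= p + 3" and k: "\<forall>m<q. k m <= k (Suc m)"
    and gap: "k p + j <= k (Suc p)" and j: "1 <= j"
  shows "cond_le M (sigma_at M T M0 (int (k p))) (%w. (\<Prod>m=1..p. Wt N (int (k m)) w) *
      ((\<Prod>m=Suc p..q. Wt N (int (k m)) w) - E (%w'. \<Prod>m=Suc p..q. Wt N (int (k m)) w')))
    (10 * 4 ^ q * pr.H N q j)"
proof (rule cond_leI)
  fix U assume U: "U \<in> borel_measurable (sigma_at M T M0 (int (k p)))" and U1: "\<And>w. \<bar>U w\<bar> <= (1 :: real)"
  have UM[measurable]: "U \<in> borel_measurable M" by (rule measurable_from_subalg[OF sigma_at_sub U])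
  define i where "i m = int (k m)" for m
  let ?V = "PiM {1..q} (%_. signed_cut N)"
  interpret PF: finite_measure ?V by (rule finite_measure_PiM[OF _ finite_signed_cut]) simp
  have split: "{1..q} = {1..p} \<union> {Suc p..q}" "{1..p} \<inter> {Suc p..q} = {}" using pq by auto
  have sp: "(\<Prod>m\<in>{1..q}. f m) = (\<Prod>m=1..p. f m) * (\<Prod>m=Suc p..q. f m)" for f :: "nat => real"
    unfolding split(1) by (rule prod.union_disjoint) (use split(2) in auto)
  let ?A = "%w. \<Prod>m=1..p. Wt N (i m) w" and ?B = "%w. \<Prod>m=Suc p..q. Wt N (i m) w"
  let ?a = "%z w. \<Prod>m=1..p. Ker (i m) (z m) w" and ?b = "%z w. \<Prod>m=Suc p..q. Ker (i m) (z m) w"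
  have UA: "\<bar>U w * ?A w\<bar> <= (\<Prod>m=1..p. wb N)" for w
    using mult_mono[OF U1[of w] prod_Wt_bounded[of N i w "{1..p}"]] by (simp add: abs_mult)
  have Ua: "\<bar>U w * ?a z w\<bar> <= 1" for z w
    using mult_mono[OF U1[of w] prod_Ker_abs[of i z w "{1..p}"]] by (simp add: abs_mult)
  note exp1 = integral_prod_of_integrals[where G = "%m. Ker (i m)" and I = "{1..q}" and N = M and V = "signed_cut N" and U = U,
      OF finite_measure_axioms finite_signed_cut _ UM U1 Ker_pair[OF h\<xi>_M] Ker_abs]
  \<comment> \<open>The past factors live on the first copy, the future ones on the second.\<close>
  define G where "G m z x = Ker (i m) z (if m <= p then fst x else snd x)" for m z and x :: "'a \<times> 'a"
  have Gm: "(%x. G m (fst x) (snd x)) \<in> borel_measurable (signed_cut N \<Otimes>\<^sub>M (M \<Otimes>\<^sub>M M))" for m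
  proof -
    have "(%x. (fst x, if m <= p then fst (snd x) else snd (snd x))) \<in> measurable (signed_cut N \<Otimes>\<^sub>M (M \<Otimes>\<^sub>M M)) (signed_cut N \<Otimes>\<^sub>M M)"
      by (cases "m <= p") simp_all
    from measurable_compose[OF this Ker_pair[OF h\<xi>_M]] show ?thesis unfolding G_def by simp
  qed
  have fin2: "finite_measure (M \<Otimes>\<^sub>M M)" by (rule finite_measure_pair_measure) (rule finite_measure_axioms)+
  have Uf: "(%x. U (fst x)) \<in> borel_measurable (M \<Otimes>\<^sub>M M)" by measurable
  have G1: "\<bar>G m z x\<bar> <= 1" for m z x unfolding G_def by (rule Ker_abs)
  note exp2 = integral_prod_of_integrals[where G = G and I = "{1..q}" and N = "M \<Otimes>\<^sub>M M" and V = "signed_cut N" and U = "%x. U (fst x)",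
      OF fin2 finite_signed_cut _ Uf U1 Gm G1]
  let ?\<Lambda>1 = "%z. E (%w. U w * (\<Prod>m\<in>{1..q}. Ker (i m) (z m) w))"
  let ?\<Lambda>2 = "%z. E (%w. U w * ?a z w) * E (?b z)"
  have e1: "E (%w. U w * (?A w * ?B w)) = (\<integral>z. ?\<Lambda>1 z \<partial>?V)"
    using exp1(1) unfolding Wt_def[symmetric] sp[of "%m. Wt N (i m) _"] by simp
  have f2: "(\<integral>x. U (fst x) * (\<Prod>m\<in>{1..q}. G m (z m) x) \<partial>(M \<Otimes>\<^sub>M M)) = ?\<Lambda>2 z" for z
  proof -
    have "(\<integral>x. U (fst x) * (\<Prod>m\<in>{1..q}. G m (z m) x) \<partial>(M \<Otimes>\<^sub>M M)) = (\<integral>x. (U (fst x) * ?a z (fst x)) * ?b z (snd x) \<partial>(M \<Otimes>\<^sub>M M))"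
      unfolding sp by (intro Bochner_Integration.integral_cong refl) (simp add: G_def mult.assoc)
    also have "... = ?\<Lambda>2 z" by (rule integral_pair_mult[where a = 1 and b = 1]) (use Ua prod_Ker_abs in auto)
    finally show ?thesis .
  qed
  have e2: "E (%w. U w * ?A w) * E ?B = (\<integral>z. ?\<Lambda>2 z \<partial>?V)"
  proof -
    have "E (%w. U w * ?A w) * E ?B = (\<integral>x. (U (fst x) * ?A (fst x)) * ?B (snd x) \<partial>(M \<Otimes>\<^sub>M M))"
      by (rule integral_pair_mult[OF _ _ UA prod_Wt_bounded, symmetric]) measurable
    also have "... = (\<integral>x. U (fst x) * (\<Prod>m\<in>{1..q}. \<integral>z. G m z x \<partial>signed_cut N) \<partial>(M \<Otimes>\<^sub>M M))"
      unfolding sp by (intro Bochner_Integration.integral_cong refl) (simp add: G_def Wt_def mult.assoc)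
    also have "... = (\<integral>z. ?\<Lambda>2 z \<partial>?V)" using exp2(1) unfolding f2 by simp
    finally show ?thesis .
  qed
  have ab: "E (%w. \<bar>\<Prod>m\<in>I. Ker (i m) (z m) w\<bar>) <= 1" for z I
  proof -
    have "integrable M (%w. \<bar>\<Prod>m\<in>I. Ker (i m) (z m) w\<bar>)" by (rule bounded_integrable[of _ 1]) (use prod_Ker_abs in auto)
    then have "E (%w. \<bar>\<Prod>m\<in>I. Ker (i m) (z m) w\<bar>) <= E (%w. 1)"
      using prod_Ker_abs by (intro integral_mono) auto
    then show ?thesis using prob_space by simp
  qed
  have Uab: "\<bar>E (%w. U w * (\<Prod>m\<in>I. Ker (i m) (z m) w))\<bar> <= E (%w. \<bar>\<Prod>m\<in>I. Ker (i m) (z m) w\<bar>)" for z I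
  proof -
    have ii: "integrable M (%w. \<Prod>m\<in>I. Ker (i m) (z m) w)" by (rule bounded_integrable[of _ 1]) (use prod_Ker_abs in auto)
    have "\<bar>E (%w. U w * (\<Prod>m\<in>I. Ker (i m) (z m) w))\<bar> <= E (%w. \<bar>U w * (\<Prod>m\<in>I. Ker (i m) (z m) w)\<bar>)"
      by (rule integral_abs_bound)
    also have "... <= E (%w. \<bar>\<Prod>m\<in>I. Ker (i m) (z m) w\<bar>)"
      using ii integrable_bounded_mult[OF ii UM U1] mult_left_le_one_le[OF abs_ge_zero abs_ge_zero U1]
      by (intro integral_mono integrable_abs) (simp_all add: abs_mult)
    finally show ?thesis .
  qed
  have bab: "\<bar>E (?b z)\<bar> <= E (%w. \<bar>?b z w\<bar>)" for z by (rule integral_abs_bound)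
  have \<Lambda>m: "?\<Lambda>1 \<in> borel_measurable ?V" "?\<Lambda>2 \<in> borel_measurable ?V"
    using exp1(2) exp2(2) unfolding f2 by simp_all
  have \<Lambda>2b: "\<bar>?\<Lambda>2 z\<bar> <= E (%w. \<bar>?a z w\<bar>) * E (%w. \<bar>?b z w\<bar>)" for z
    unfolding abs_mult by (rule mult_mono[OF Uab bab]) (auto intro: integral_nonneg_AE)
  have \<Lambda>i: "integrable ?V ?\<Lambda>1" "integrable ?V ?\<Lambda>2"
  proof -
    have 1: "\<bar>?\<Lambda>1 z\<bar> <= 1" for z by (rule order_trans[OF Uab ab])
    have 2: "\<bar>?\<Lambda>2 z\<bar> <= 1" for z
      by (rule order_trans[OF \<Lambda>2b]) (intro mult_le_one ab integral_nonneg_AE AE_I2 abs_ge_zero)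
    show "integrable ?V ?\<Lambda>1"
      by (rule PF.integrable_const_bound[OF AE_I2 \<Lambda>m(1)]) (unfold real_norm_def, rule 1)
    show "integrable ?V ?\<Lambda>2"
      by (rule PF.integrable_const_bound[OF AE_I2 \<Lambda>m(2)]) (unfold real_norm_def, rule 2)
  qed
  have eq: "(\<integral>w. U w * (?A w * (?B w - E ?B)) \<partial>M) = (\<integral>z. ?\<Lambda>1 z - ?\<Lambda>2 z \<partial>?V)"
  proof -
    have iUA: "integrable M (%w. U w * ?A w)" by (rule bounded_integrable) (use UA in auto)
    have iB: "\<bar>?B w\<bar> <= (\<Prod>m=Suc p..q. wb N)" for w by (rule prod_Wt_bounded)
    have "integrable M (%w. ?B w * (U w * ?A w))" by (rule integrable_bounded_mult[OF iUA _ iB]) measurable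
    then have iUAB: "integrable M (%w. U w * (?A w * ?B w))" by (simp add: mult_ac)
    have "(\<integral>w. U w * (?A w * (?B w - E ?B)) \<partial>M) = (\<integral>w. U w * (?A w * ?B w) - (U w * ?A w) * E ?B \<partial>M)"
      by (simp add: right_diff_distrib mult.assoc)
    also have "... = (\<integral>z. ?\<Lambda>1 z \<partial>?V) - (\<integral>z. ?\<Lambda>2 z \<partial>?V)"
      using iUA iUAB e1 e2 by simp
    also have "... = (\<integral>z. ?\<Lambda>1 z - ?\<Lambda>2 z \<partial>?V)" by (rule Bochner_Integration.integral_diff[OF \<Lambda>i, symmetric])
    finally show ?thesis .
  qed
  have "\<bar>\<integral>z. ?\<Lambda>1 z - ?\<Lambda>2 z \<partial>?V\<bar> <= 10 * 4 ^ card {1..q} * pr.H N (card {1..q}) j"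
  proof (rule kernel_bound[OF _ N])
    show "(%z. ?\<Lambda>1 z - ?\<Lambda>2 z) \<in> borel_measurable ?V" by (rule borel_measurable_diff[OF \<Lambda>m])
    show "\<bar>?\<Lambda>1 z - ?\<Lambda>2 z\<bar> <= 10 * \<alpha> j" for z
    proof -
      have aF: "(%w. U w * ?a z w) \<in> borel_measurable (sigma_at M T M0 (int (k p)))"
      proof (intro borel_measurable_times U borel_measurable_prod)
        fix m assume m: "m \<in> {1..p}"
        have "k a <= k n" if "a <= n" "n <= q" for a n
          using that
        proof (induction n rule: dec_induct)
          case (step n)
          then show ?case using k[rule_format, of n] by simp
        qed simp
        then have "k m <= k p" using m pq by simp
        from sigma_at_mono[OF this] Ker_F[OF h\<xi>_F, of "i m" "z m"]
        show "Ker (i m) (z m) \<in> borel_measurable (sigma_at M T M0 (int (k p)))"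
          unfolding i_def by (auto simp: measurable_def)
      qed
      have "cond_le M (sigma_at M T M0 (int (k p))) (%w. ?b z w - E (?b z)) (10 * \<alpha> j)"
        by (rule kernel_mixing) (use pq gap j k in \<open>auto simp: i_def\<close>)
      from cond_leD[OF this aF Ua]
      have c: "\<bar>\<integral>w. (U w * ?a z w) * (?b z w - E (?b z)) \<partial>M\<bar> <= 10 * \<alpha> j" .
      have iUa: "integrable M (%w. U w * ?a z w)" by (rule bounded_integrable[of _ 1]) (use Ua in auto)
      have "integrable M (%w. ?b z w * (U w * ?a z w))" by (rule integrable_bounded_mult[OF iUa _ prod_Ker_abs]) measurable
      then have iUab: "integrable M (%w. (U w * ?a z w) * ?b z w)" by (simp add: mult_ac)
      have "(\<integral>w. (U w * ?a z w) * (?b z w - E (?b z)) \<partial>M)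
          = (\<integral>w. (U w * ?a z w) * ?b z w - (U w * ?a z w) * E (?b z) \<partial>M)" by (simp only: right_diff_distrib)
      also have "... = (\<integral>w. (U w * ?a z w) * ?b z w \<partial>M) - ?\<Lambda>2 z" using iUa iUab by simp
      also have "(\<integral>w. (U w * ?a z w) * ?b z w \<partial>M) = ?\<Lambda>1 z" unfolding sp by (simp only: mult.assoc)
      finally show ?thesis using c by simp
    qed
    show "\<bar>?\<Lambda>1 z - ?\<Lambda>2 z\<bar> <= 10 * tail (fst (z m)) \<bar>snd (z m)\<bar>" if m: "m \<in> {1..q}" for z m
    proof -
      let ?t = "tail (fst (z m)) \<bar>snd (z m)\<bar>"
      have 1: "\<bar>?\<Lambda>1 z\<bar> <= 2 * ?t" by (rule order_trans[OF Uab prod_Ker_tail]) (use m in auto)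
      have t: "E (%w. \<bar>?a z w\<bar>) <= 2 * ?t" if "m <= p" by (rule prod_Ker_tail) (use that m in auto)
      have t': "E (%w. \<bar>?b z w\<bar>) <= 2 * ?t" if "\<not> m <= p" by (rule prod_Ker_tail) (use that m in auto)
      have n: "0 <= E (%w. \<bar>?a z w\<bar>)" "0 <= E (%w. \<bar>?b z w\<bar>)" by (auto intro: integral_nonneg_AE)
      have "E (%w. \<bar>?a z w\<bar>) * E (%w. \<bar>?b z w\<bar>) <= 2 * ?t"
      proof (cases "m <= p")
        case True
        have "E (%w. \<bar>?a z w\<bar>) * E (%w. \<bar>?b z w\<bar>) <= (2 * ?t) * 1"
          using t[OF True] ab n tail_nonneg by (intro mult_mono) auto
        then show ?thesis by simp
      next
        case False
        have "E (%w. \<bar>?a z w\<bar>) * E (%w. \<bar>?b z w\<bar>) <= 1 * (2 * ?t)"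
          using t'[OF False] ab n by (intro mult_mono) auto
        then show ?thesis by simp
      qed
      from order_trans[OF \<Lambda>2b this] 1 show ?thesis using tail_nonneg[of "fst (z m)" "\<bar>snd (z m)\<bar>"] by linarith
    qed
  qed simp
  then show "\<bar>\<integral>w. U w * ((\<Prod>m=1..p. Wt N (int (k m)) w) *
      ((\<Prod>m=Suc p..q. Wt N (int (k m)) w) - E (%w'. \<Prod>m=Suc p..q. Wt N (int (k m)) w'))) \<partial>M\<bar>
    <= 10 * 4 ^ q * pr.H N q j"
    using eq unfolding i_def by simp
qed

abbreviation "Xs \<equiv> shifted M T X0"

definition "ex N b w = max 0 (\<bar>h b (\<xi> w)\<bar> - N)"

lemma tq_le_Q: "0 < u ==> u < 1 ==> tq b u <= Q u"
  unfolding Q_def qr_def by (cases b) (auto simp: indicator_def)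

lemma quantile_ge: "0 < u ==> u < 1 ==> u < measure M {w\<in>space M. x <= \<bar>h b (\<xi> w)\<bar>} ==> x <= Q u"
  by (rule order_trans[OF tail_quantile_ge tq_le_Q]) auto

lemma ex_meas[measurable]: "ex N b \<in> borel_measurable M" unfolding ex_def[abs_def] by measurable

lemma ex_nonneg: "0 <= ex N b w" by (simp add: ex_def)

lemma ex_integrable:
  assumes N: "1 <= N"
  shows "integrable M (ex N b)" "integrable M (%w. ex N b w ^ 2)"
proof -
  have le: "ex N b w ^ 2 <= \<bar>h b (\<xi> w)\<bar> ^ 3" "ex N b w <= \<bar>h b (\<xi> w)\<bar> ^ 3" for w
  proof -
    let ?y = "\<bar>h b (\<xi> w)\<bar>"
    have "ex N b w ^ 2 <= ?y ^ 3 \<and> ex N b w <= ?y ^ 3"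
    proof (cases "?y <= N")
      case True
      then show ?thesis by (simp add: ex_def max_absorb1)
    next
      case False
      then have e: "0 <= ex N b w" "ex N b w <= ?y" "1 <= ?y" using N by (auto simp: ex_def)
      have "ex N b w ^ 2 <= ?y ^ 2" using e by (intro power_mono) auto
      also have "... <= ?y ^ 3" using e by (intro power_increasing) auto
      finally have "ex N b w ^ 2 <= ?y ^ 3" .
      moreover have "ex N b w <= ?y ^ 3" using e power_increasing[of 1 3 ?y] by simp
      ultimately show ?thesis by simp
    qed
    then show "ex N b w ^ 2 <= ?y ^ 3" "ex N b w <= ?y ^ 3" by auto
  qed
  show "integrable M (ex N b)"
    by (rule Bochner_Integration.integrable_bound[OF h_cube[of b]]) (use le ex_nonneg in auto)
  show "integrable M (%w. ex N b w ^ 2)"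
    by (rule Bochner_Integration.integrable_bound[OF h_cube[of b]]) (use le ex_nonneg in auto)
qed

lemma ex_mean:
  assumes N: "1 <= N" shows "E (ex N b) <= pr.R1 N"
proof -
  have N0: "0 <= N" using N by simp
  let ?v = "%x. indicator {N..} x :: ennreal"
  have "ennreal (E (ex N b)) = (\<integral>\<^sup>+w. ennreal (ex N b w) \<partial>M)"
    using ex_integrable[OF N] ex_nonneg by (intro nn_integral_eq_integral[symmetric]) auto
  also have "... = (\<integral>\<^sup>+w. (\<integral>\<^sup>+x. ?v x * indicator {0..\<bar>h b (\<xi> w)\<bar>} x \<partial>lborel) \<partial>M)"
    unfolding nn_integral_excess[OF N0] ex_def by (intro nn_integral_cong) (auto simp: max_def ennreal_neg)
  also have "... <= (\<integral>\<^sup>+u\<in>{0<..<1}. (\<integral>\<^sup>+x. ?v x * indicator {0..Q u} x \<partial>lborel) \<partial>lborel)"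
    by (rule layer_cake_le) (auto intro: quantile_ge)
  also have "... = ennreal (pr.R1 N)" unfolding nn_integral_excess[OF N0] by (rule pr.R1_eq[OF N0, symmetric])
  finally show ?thesis using pr.nonneg by (simp add: ennreal_le_iff)
qed

lemma ex_square_mean:
  assumes N: "1 <= N" shows "E (%w. ex N b w ^ 2) <= pr.R2 N"
proof -
  have N0: "0 <= N" using N by simp
  let ?v = "%x. ennreal (2 * (x - N)) * indicator {N..} x"
  have "ennreal (E (%w. ex N b w ^ 2)) = (\<integral>\<^sup>+w. ennreal (ex N b w ^ 2) \<partial>M)"
    using ex_integrable[OF N] by (intro nn_integral_eq_integral[symmetric]) auto
  also have "... = (\<integral>\<^sup>+w. (\<integral>\<^sup>+x. ?v x * indicator {0..\<bar>h b (\<xi> w)\<bar>} x \<partial>lborel) \<partial>M)"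
    unfolding nn_integral_excess_square[OF N0] ex_def ..
  also have "... <= (\<integral>\<^sup>+u\<in>{0<..<1}. (\<integral>\<^sup>+x. ?v x * indicator {0..Q u} x \<partial>lborel) \<partial>lborel)"
    by (rule layer_cake_le) (auto intro: quantile_ge)
  also have "... <= (\<integral>\<^sup>+u\<in>{0<..<1}. ennreal (of_bool (N < Q u) * Q u ^ 2) \<partial>lborel)"
    unfolding nn_integral_excess_square[OF N0]
  proof (rule nn_integral_mono)
    fix u
    have "max 0 (Q u - N) ^ 2 <= of_bool (N < Q u) * Q u ^ 2"
    proof (cases "N < Q u")
      case True
      then have "(Q u - N) ^ 2 <= Q u ^ 2" using N by (intro power_mono) auto
      then show ?thesis using True by simp
    qed (simp add: max_absorb1)
    then show "ennreal (max 0 (Q u - N) ^ 2) * indicator {0<..<1} u <= ennreal (of_bool (N < Q u) * Q u ^ 2) * indicator {0<..<1} u"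
      by (intro mult_right_mono ennreal_leI) auto
  qed
  also have "... = ennreal (pr.R2 N)" by (rule pr.R2_eq[symmetric])
  finally show ?thesis using pr.nonneg by (simp add: ennreal_le_iff)
qed

text \<open>Integrating indicators of half-lines over their thresholds amounts to clamping.\<close>

lemma Wt_clamp:
  assumes N: "0 <= N"
  shows "Wt N i w = clamp N (h True (\<xi>s i w)) - clamp N (h False (\<xi>s i w))
    - ((\<integral>x. df False x \<partial>cut N) - (\<integral>x. df True x \<partial>cut N))"
proof -
  interpret c: finite_measure "cut N" by (rule finite_cut)
  have iF: "integrable (cut N) (df b)" for b
    using df_bounds df_meas by (intro c.integrable_const_bound[of _ 1]) (auto simp: measurable_cong_sets[OF sets_cut refl])
  have iH: "integrable (cut N) (%x. of_bool (y <= x) :: real)" for y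
    by (intro c.integrable_const_bound[of _ 1]) (auto simp: measurable_cong_sets[OF sets_cut refl])
  have "Wt N i w = (\<integral>z. (%b x. Ker i (b, x) w) (fst z) (snd z) \<partial>signed_cut N)" unfolding Wt_def by simp
  also have "... = (\<integral>x. Ker i (True, x) w \<partial>cut N) + (\<integral>x. Ker i (False, x) w \<partial>cut N)"
  proof (rule integral_signed_cut)
    show "(%z. Ker i (fst z, snd z) w) \<in> borel_measurable (signed_cut N)"
    proof -
      have "(%z. Ker i z w) = (%z. if fst z then df True (snd z) - of_bool (h True (\<xi>s i w) <= snd z)
          else of_bool (h False (\<xi>s i w) <= snd z) - df False (snd z))"
        unfolding Ker_def by auto
      also have "... \<in> borel_measurable (signed_cut N)"
        unfolding measurable_cong_sets[OF sets_signed_cut refl] by measurable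
      finally show ?thesis by simp
    qed
  qed (rule Ker_abs)
  also have "(\<integral>x. Ker i (True, x) w \<partial>cut N) = (\<integral>x. df True x \<partial>cut N) - (N - clamp N (h True (\<xi>s i w)))"
    unfolding Ker_def using iF iH by (simp add: integral_cut_above[OF N])
  also have "(\<integral>x. Ker i (False, x) w \<partial>cut N) = (N - clamp N (h False (\<xi>s i w))) - (\<integral>x. df False x \<partial>cut N)"
    unfolding Ker_def using iF iH by (simp add: integral_cut_above[OF N])
  finally show ?thesis by simp
qed

lemma Wt_mean: "E (Wt N i) = 0"
proof -
  note exp = integral_prod_of_integrals[where G = "%m :: nat. Ker i" and I = "{0}" and N = M and V = "signed_cut N" and U = "%_. 1",
      OF finite_measure_axioms finite_signed_cut _ _ _ Ker_pair[OF h\<xi>_M] Ker_abs]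
  have "E (Wt N i) = E (%w. 1 * (\<Prod>m\<in>{0 :: nat}. \<integral>z. Ker i z w \<partial>signed_cut N))"
    by (simp add: Wt_def[abs_def])
  also have "... = (\<integral>z. E (%w. 1 * (\<Prod>m\<in>{0 :: nat}. Ker i (z m) w)) \<partial>PiM {0} (%_. signed_cut N))"
    by (rule exp(1)) auto
  also have "... = (\<integral>z. 0 \<partial>PiM {0 :: nat} (%_. signed_cut N))"
    by (intro Bochner_Integration.integral_cong refl) (simp add: Ker_mean)
  finally show ?thesis by simp
qed

definition "e N w = (h True (\<xi> w) - clamp N (h True (\<xi> w))) - (h False (\<xi> w) - clamp N (h False (\<xi> w)))"

definition "R N w = X0 w - Wt N 0 w"

context
  fixes N :: real
  assumes N: "1 <= N"
begin

lemma e_abs: "\<bar>e N w\<bar> <= ex N True w + ex N False w"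
  unfolding e_def ex_def using clamp_diff[of N "h True (\<xi> w)"] clamp_diff[of N "h False (\<xi> w)"] N by linarith

lemma e_meas[measurable]: "e N \<in> borel_measurable M" unfolding e_def[abs_def] clamp_def by measurable

lemma e_int: "integrable M (e N)"
proof (rule Bochner_Integration.integrable_bound)
  show "integrable M (%w. ex N True w + ex N False w)" using ex_integrable[OF N] by simp
  show "AE w in M. norm (e N w) <= norm (ex N True w + ex N False w)"
    using order_trans[OF e_abs abs_ge_self] by (intro AE_I2) simp
qed measurable

lemma e_square: "e N w ^ 2 <= 2 * ex N True w ^ 2 + 2 * ex N False w ^ 2"
proof -
  have "e N w ^ 2 <= (ex N True w + ex N False w) ^ 2"
    using e_abs[of w] by (metis abs_ge_zero power2_abs power_mono)
  also have "... <= 2 * ex N True w ^ 2 + 2 * ex N False w ^ 2"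
    using zero_le_power2[of "ex N True w - ex N False w"] by (simp add: power2_eq_square algebra_simps)
  finally show ?thesis .
qed

lemma e2_int: "integrable M (%w. e N w ^ 2)"
proof (rule Bochner_Integration.integrable_bound)
  show "integrable M (%w. 2 * ex N True w ^ 2 + 2 * ex N False w ^ 2)" using ex_integrable[OF N] by simp
  show "AE w in M. norm (e N w ^ 2) <= norm (2 * ex N True w ^ 2 + 2 * ex N False w ^ 2)"
    using order_trans[OF e_square abs_ge_self] by (intro AE_I2) simp
qed measurable

lemma Wt_int: "integrable M (Wt N i)"
  by (rule bounded_integrable[of _ "wb N"]) (use Wt_bounded in auto)

lemma R_eq: "AE w in M. R N w = e N w - E (e N)"
proof -
  define d where "d = (\<integral>x. df False x \<partial>cut N) - (\<integral>x. df True x \<partial>cut N)"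
  have W: "Wt N 0 w = clamp N (h True (\<xi> w)) - clamp N (h False (\<xi> w)) - d" for w
    using Wt_clamp[of N 0 w] N unfolding d_def shifted_0 by simp
  have ae: "AE w in M. R N w = e N w + d"
    using X0_eq by eventually_elim (simp add: R_def e_def W)
  have "E (R N) = E (%w. e N w + d)"
    using ae M0_M[OF X0] by (intro integral_cong_AE) (auto simp: R_def[abs_def])
  moreover have "E (R N) = 0"
    unfolding R_def[abs_def] using X0_int X0_mean Wt_int Wt_mean by simp
  ultimately have "d = - E (e N)" using e_int prob_space by simp
  then show ?thesis using ae by simp
qed

lemma R_meas[measurable]: "R N \<in> borel_measurable M" unfolding R_def[abs_def] using M0_M[OF X0] by measurable

lemma R_int: "integrable M (R N)" unfolding R_def[abs_def] using X0_int Wt_int by simp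

lemma R_mean: "E (%w. \<bar>R N w\<bar>) <= 4 * pr.R1 N"
proof -
  have Ee: "E (%w. \<bar>e N w\<bar>) <= 2 * pr.R1 N"
  proof -
    have "E (%w. \<bar>e N w\<bar>) <= E (%w. ex N True w + ex N False w)"
      using e_int ex_integrable[OF N] e_abs by (intro integral_mono) auto
    then show ?thesis using ex_integrable[OF N] ex_mean[OF N, of True] ex_mean[OF N, of False] by simp
  qed
  have "E (%w. \<bar>R N w\<bar>) = E (%w. \<bar>e N w - E (e N)\<bar>)"
    using R_eq by (intro integral_cong_AE) (auto elim: eventually_mono)
  also have "... <= E (%w. \<bar>e N w\<bar> + E (%w. \<bar>e N w\<bar>))"
  proof (rule integral_mono)
    fix w
    show "\<bar>e N w - E (e N)\<bar> <= \<bar>e N w\<bar> + E (%w. \<bar>e N w\<bar>)"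
      using integral_abs_bound[of M "e N"] abs_triangle_ineq4[of "e N w" "E (e N)"] by linarith
  qed (use e_int in auto)
  also have "... = 2 * E (%w. \<bar>e N w\<bar>)" using e_int prob_space by simp
  finally show ?thesis using Ee by simp
qed

lemma R2_int: "integrable M (%w. R N w ^ 2)"
proof -
  have "integrable M (%w. e N w ^ 2 - 2 * E (e N) * e N w + E (e N) ^ 2)"
    using e_int e2_int by simp
  then have "integrable M (%w. (e N w - E (e N)) ^ 2)"
    by (simp add: power2_diff algebra_simps)
  then show ?thesis
    by (rule integrable_cong_AE_imp) (use R_eq in \<open>auto elim!: eventually_mono\<close>)
qed

lemma R2_mean: "E (%w. R N w ^ 2) <= 4 * pr.R2 N"
proof -
  have "E (%w. R N w ^ 2) = E (%w. (e N w - E (e N)) ^ 2)"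
    using R_eq by (intro integral_cong_AE) (auto elim: eventually_mono)
  also have "... = E (%w. e N w ^ 2) - (E (e N)) ^ 2" by (rule variance_eq[OF e_int e2_int])
  also have "... <= E (%w. e N w ^ 2)" by simp
  also have "... <= E (%w. 2 * ex N True w ^ 2 + 2 * ex N False w ^ 2)"
    using e2_int ex_integrable[OF N] e_square by (intro integral_mono) auto
  also have "... <= 4 * pr.R2 N"
    using ex_integrable[OF N] ex_square_mean[OF N, of True] ex_square_mean[OF N, of False] by simp
  finally show ?thesis .
qed

lemma Wt_le: "\<bar>Wt N i w\<bar> <= 4 * N"
proof -
  define d where "d = (\<integral>x. df False x \<partial>cut N) - (\<integral>x. df True x \<partial>cut N)"
  have c: "\<bar>clamp N (h True (\<xi>s i w)) - clamp N (h False (\<xi>s i w))\<bar> <= 2 * N" for w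
    using clamp_bound[of N "h True (\<xi>s i w)"] clamp_bound[of N "h False (\<xi>s i w)"] N by linarith
  have W: "Wt N i w = clamp N (h True (\<xi>s i w)) - clamp N (h False (\<xi>s i w)) - d" for w
    using Wt_clamp[of N i w] N unfolding d_def by simp
  have dl: "- 2 * N - d <= Wt N i w" "Wt N i w <= 2 * N - d" for w using W[of w] c[of w] by linarith+
  have "E (%_. - 2 * N - d) <= E (Wt N i)" using Wt_int dl by (intro integral_mono) auto
  moreover have "E (Wt N i) <= E (%_. 2 * N - d)" using Wt_int dl by (intro integral_mono) auto
  ultimately have "\<bar>d\<bar> <= 2 * N" using Wt_mean prob_space by simp
  then show ?thesis using W[of w] c[of w] by linarith
qed

end

definition "\<gamma> N r = E (%w. Wt N 0 w * Wt N (int r) w)"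

definition "g r = E (%w. X0 w * Xs (int r) w)"

lemma R_shift: "Xs i w = Wt N i w + R N (\<tau> i w)"
  unfolding R_def Wt_shift[of N i] by (simp add: shifted_def)

lemma Xs_meas[measurable]: "Xs i \<in> borel_measurable M" by (rule shifted_M[OF M0_M[OF X0]])

text \<open>The bounded factors are at most \<open>4 N\<close>, and \<open>N\<close> times the mean of the part cut off is at most its
second moment.\<close>

lemma covariance_error:
  assumes N: "1 <= N" shows "\<bar>\<gamma> N r - g r\<bar> <= 36 * pr.R2 N"
proof -
  note Rm[measurable] = R_meas[OF N]
  let ?Rr = "%w. R N (\<tau> (int r) w)"
  have Rrm[measurable]: "?Rr \<in> borel_measurable M" by measurable
  have iR: "integrable M ?Rr" "integrable M (%w. ?Rr w ^ 2)"
    using integrable_\<tau>[OF R_int[OF N]] integrable_\<tau>[OF R2_int[OF N]] by auto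
  have mR: "E (%w. \<bar>?Rr w\<bar>) <= 4 * pr.R1 N" "E (%w. ?Rr w ^ 2) <= 4 * pr.R2 N"
    using expectation_\<tau>[of "%w. \<bar>R N w\<bar>" "int r"] expectation_\<tau>[of "%w. R N w ^ 2" "int r"] R_mean[OF N] R2_mean[OF N] by simp_all
  let ?B = "%w. 4 * N * \<bar>?Rr w\<bar> + 4 * N * \<bar>R N w\<bar> + (R N w ^ 2 + ?Rr w ^ 2) / 2"
  have iB: "integrable M ?B" using iR R_int[OF N] R2_int[OF N] by simp
  have iW: "integrable M (%w. Wt N 0 w * Wt N (int r) w)"
    by (rule integrable_bounded_mult[OF Wt_int[OF N] Wt_M Wt_bounded])
  have diff: "\<bar>X0 w * Xs (int r) w - Wt N 0 w * Wt N (int r) w\<bar> <= ?B w" for w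
  proof -
    have 1: "\<bar>Wt N 0 w * ?Rr w\<bar> <= 4 * N * \<bar>?Rr w\<bar>"
      unfolding abs_mult by (rule mult_right_mono[OF Wt_le[OF N]]) simp
    have 2: "\<bar>Wt N (int r) w * R N w\<bar> <= 4 * N * \<bar>R N w\<bar>"
      unfolding abs_mult by (rule mult_right_mono[OF Wt_le[OF N]]) simp
    have 3: "\<bar>R N w * ?Rr w\<bar> <= (R N w ^ 2 + ?Rr w ^ 2) / 2"
      using zero_le_power2[of "\<bar>R N w\<bar> - \<bar>?Rr w\<bar>"] by (simp add: power2_diff abs_mult)
    have "X0 w * Xs (int r) w - Wt N 0 w * Wt N (int r) w = Wt N 0 w * ?Rr w + Wt N (int r) w * R N w + R N w * ?Rr w"
    proof -
      have X: "X0 w = Wt N 0 w + R N w" by (simp add: R_def)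
      show ?thesis unfolding R_shift[of "int r" w N] X by (simp add: algebra_simps)
    qed
    then show ?thesis using 1 2 3 by linarith
  qed
  have iD: "integrable M (%w. X0 w * Xs (int r) w - Wt N 0 w * Wt N (int r) w)"
  proof (rule Bochner_Integration.integrable_bound[OF iB])
    show "(%w. X0 w * Xs (int r) w - Wt N 0 w * Wt N (int r) w) \<in> borel_measurable M"
      using M0_M[OF X0] by measurable
    show "AE w in M. norm (X0 w * Xs (int r) w - Wt N 0 w * Wt N (int r) w) <= norm (?B w)"
      using order_trans[OF diff abs_ge_self] by (intro AE_I2) simp
  qed
  have "integrable M (%w. (X0 w * Xs (int r) w - Wt N 0 w * Wt N (int r) w) + Wt N 0 w * Wt N (int r) w)"
    using iD iW by (rule Bochner_Integration.integrable_add)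
  then have iX: "integrable M (%w. X0 w * Xs (int r) w)" by simp
  have "\<bar>\<gamma> N r - g r\<bar> = \<bar>E (%w. X0 w * Xs (int r) w - Wt N 0 w * Wt N (int r) w)\<bar>"
    unfolding \<gamma>_def g_def using iW iX by simp
  also have "... <= E ?B"
    by (rule order_trans[OF integral_abs_bound integral_mono]) (use iD iB diff in auto)
  also have "... = 4 * N * E (%w. \<bar>?Rr w\<bar>) + 4 * N * E (%w. \<bar>R N w\<bar>)
      + (E (%w. R N w ^ 2) + E (%w. ?Rr w ^ 2)) / 2"
    using iR R_int[OF N] R2_int[OF N] by simp
  also have "... <= 4 * N * (4 * pr.R1 N) + 4 * N * (4 * pr.R1 N) + (4 * pr.R2 N + 4 * pr.R2 N) / 2"
    using mR R_mean[OF N] R2_mean[OF N] N by (intro add_mono divide_right_mono mult_left_mono) auto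
  also have "... <= 36 * pr.R2 N" using pr.R1_le_R2[OF N] by simp
  finally show ?thesis .
qed

lemma sequence:
  assumes N: "1 <= N"
  shows "mixing_seq M (%i. sigma_at M T M0 (int i)) (%i. Xs (int i)) (%i. Wt N (int i))
    (%q j. 2560 * pr.H N q j) (2560 * pr.R1 N) (2560 * N) (\<gamma> N)"
proof (intro mixing_seq.intro mixing_seq_axioms.intro)
  have H: "10 * 4 ^ q * pr.H N q j <= 2560 * pr.H N q j" if "q <= 4" for q j
  proof -
    have "(4 :: real) ^ q <= 4 ^ 4" using that by (intro power_increasing) auto
    then show ?thesis using pr.nonneg by (intro mult_right_mono) auto
  qed
  show "prob_space M" by (rule prob_space_axioms)
  show "subalgebra M (sigma_at M T M0 (int i))" for i by (rule sigma_at_sub)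
  show "sets (sigma_at M T M0 (int i)) \<subseteq> sets (sigma_at M T M0 (int j))" if "i <= j" for i j
    by (rule sigma_at_mono[OF that])
  show "Xs (int i) \<in> borel_measurable (sigma_at M T M0 (int i))" for i by (rule shifted_meas[OF X0])
  show "Wt N (int i) \<in> borel_measurable (sigma_at M T M0 (int i))" for i by (rule Wt_F_of[OF h\<xi>_F])
  show "integrable M (Xs (int i))" for i unfolding shifted_def by (rule integrable_\<tau>[OF X0_int])
  show "integrable M (%w. Wt N (int i) w ^ 4)" for i
  proof (rule bounded_integrable[of _ "wb N ^ 4"])
    show "\<forall>w. \<bar>Wt N (int i) w ^ 4\<bar> <= wb N ^ 4"
      unfolding power_abs using Wt_bounded by (intro allI power_mono) auto
  qed measurable
  show "E (Wt N (int i)) = 0" for i by (rule Wt_mean)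
  have "\<bar>Wt N (int i) w\<bar> <= 2560 * N" for i w using Wt_le[OF N, of "int i" w] N by linarith
  then show "(\<forall>i w. Xs (int i) w = Wt N (int i) w) \<or> (\<forall>i w. \<bar>Wt N (int i) w\<bar> <= 2560 * N)" by blast
  show "0 <= 2560 * N" using N by simp
  show "E (%w. \<bar>Xs (int i) w - Wt N (int i) w\<bar>) <= 2560 * pr.R1 N" for i
  proof -
    have "E (%w. \<bar>Xs (int i) w - Wt N (int i) w\<bar>) = E (%w. \<bar>R N (\<tau> (int i) w)\<bar>)"
      by (simp add: R_shift[of _ _ N])
    also have "... = E (%w. \<bar>R N w\<bar>)"
      by (rule expectation_\<tau>[of "%w. \<bar>R N w\<bar>", OF borel_measurable_abs[OF R_meas[OF N]]])
    finally show ?thesis using R_mean[OF N] pr.nonneg(3)[of N] by linarith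
  qed
  show "0 <= 2560 * pr.H N q j" for q j using pr.nonneg by simp
  show "E (%w. \<bar>Wt N (int i) w\<bar> ^ q) <= 2560 * pr.H N q 0" if q: "1 <= q" "q <= 4" for q i
    by (rule order_trans[OF moment_bound[OF N q(1)] H[OF q(2)]])
  show "E (%w. Wt N (int i) w * Wt N (int (i + r)) w) = \<gamma> N r" for i r
  proof -
    have "\<gamma> N r = E (%w. Wt N 0 (\<tau> (int i) w) * Wt N (int r) (\<tau> (int i) w))"
      unfolding \<gamma>_def by (rule expectation_\<tau>[symmetric]) measurable
    also have "... = E (%w. Wt N (int i) w * Wt N (int (i + r)) w)"
    proof (intro Bochner_Integration.integral_cong refl)
      fix w assume "w \<in> space M"
      from \<tau>_add[OF this, of "int r" "int i"]
      show "Wt N 0 (\<tau> (int i) w) * Wt N (int r) (\<tau> (int i) w) = Wt N (int i) w * Wt N (int (i + r)) w"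
        using Wt_shift[of N "int i" w] Wt_shift[of N "int r" "\<tau> (int i) w"] Wt_shift[of N "int (i + r)" w] by (simp add: add.commute)
    qed
    finally show ?thesis by simp
  qed
  show "cond_le M (sigma_at M T M0 (int (k p))) (%w. (\<Prod>m=1..p. Wt N (int (k m)) w) *
      ((\<Prod>m=Suc p..q. Wt N (int (k m)) w) - E (%w'. \<Prod>m=Suc p..q. Wt N (int (k m)) w'))) (2560 * pr.H N q j)"
    if "p < q" "q <= 4" "q <= p + 3" "\<forall>m<q. k m <= k (Suc m)" "k p + j <= k (Suc p)" "1 <= j" for p q k j
    by (rule cond_le_mono[OF mixing_bound[OF N] H]) (use that in auto)
qed

lemma H_le_H2: assumes "1 <= N" shows "pr.H N 2 j <= pr.H2 j"
proof -
  have "ennreal (pr.H N 2 j) <= ennreal (pr.H2 j)"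
    using assms unfolding pr.H2_eq by (subst pr.H_eq) (auto intro!: pr.set_nn_mono power_mono simp: Q_def)
  then show ?thesis using pr.nonneg by (simp add: ennreal_le_iff)
qed

lemma R2_le: assumes N: "1 <= N" shows "pr.R2 N <= pr.K / N"
proof -
  have "ennreal (pr.R2 N) <= (\<integral>\<^sup>+u. ennreal (1 / N) * (ennreal (Q u ^ 3) * indicator {0<..<1} u) \<partial>lborel)"
    unfolding pr.R2_eq
  proof (rule nn_integral_mono)
    fix u
    have "of_bool (N < Q u) * Q u ^ 2 <= 1 / N * Q u ^ 3"
    proof (cases "N < Q u")
      case True
      then have "N * Q u ^ 2 <= Q u * Q u ^ 2" by (intro mult_right_mono) auto
      then show ?thesis using True N by (simp add: field_simps power3_eq_cube power2_eq_square)
    qed (use N in \<open>simp add: Q_def\<close>)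
    then have "ennreal (of_bool (N < Q u) * Q u ^ 2) <= ennreal (1 / N * Q u ^ 3)" by (rule ennreal_leI)
    also have "... = ennreal (1 / N) * ennreal (Q u ^ 3)" using N by (intro ennreal_mult) (auto simp: Q_def)
    finally show "ennreal (of_bool (N < Q u) * Q u ^ 2) * indicator {0<..<1} u <= ennreal (1 / N) * (ennreal (Q u ^ 3) * indicator {0<..<1} u)"
      by (auto simp: indicator_def)
  qed
  also have "... = ennreal (1 / N) * (\<integral>\<^sup>+u\<in>{0<..<1}. ennreal (Q u ^ 3) \<partial>lborel)"
    by (rule nn_integral_cmult) measurable
  also have "... <= ennreal (1 / N) * ennreal pr.K" by (rule mult_left_mono[OF pr.integral_Q3_finite]) simp
  also have "... = ennreal (pr.K / N)" using N pr.K_nonneg by (simp add: ennreal_mult[symmetric])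
  finally show ?thesis using N pr.K_nonneg by (simp add: ennreal_le_iff)
qed

text \<open>Truncation is removed: the bound for the truncated covariances is uniform in \<open>N\<close>, and the error
vanishes as \<open>N\<close> grows.\<close>

lemma g_bound: "\<bar>g r\<bar> <= 2560 * pr.H2 r"
proof (rule field_le_epsilon)
  fix \<epsilon> :: real assume \<epsilon>: "0 < \<epsilon>"
  \<comment> \<open>The truncation error is at most \<open>36 * pr.K / N\<close>.\<close>
  define N where "N = 1 + 36 * pr.K / \<epsilon>"
  have N: "1 <= N" using \<epsilon> pr.K_nonneg by (simp add: N_def)
  interpret s: mixing_seq M "%i. sigma_at M T M0 (int i)" "%i. Xs (int i)" "%i. Wt N (int i)"
    "%q j. 2560 * pr.H N q j" "2560 * pr.R1 N" "2560 * N" "\<gamma> N" by (rule sequence[OF N])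
  have "\<bar>\<gamma> N r\<bar> <= 2560 * pr.H N 2 r" using s.\<gamma>_le[of r] s.\<gamma>0_le by (cases "r = 0") simp_all
  moreover have "36 * pr.R2 N <= \<epsilon>"
  proof -
    have "36 * pr.K / N <= \<epsilon>" using \<epsilon> N by (simp add: N_def field_simps)
    then show ?thesis using R2_le[OF N] by simp
  qed
  ultimately show "\<bar>g r\<bar> <= 2560 * pr.H2 r + \<epsilon>"
    using covariance_error[OF N, of r] H_le_H2[OF N, of r] by linarith
qed

lemma covariances_summable: "summable (%k. real (Suc k) * \<bar>g k\<bar>)"
  by (rule pr.profile_covariance_summable[OF g_bound])

lemma replacement:
  assumes "0 < \<sigma>" "\<sigma>\<^sup>2 = g 0 + 2 * (\<Sum>k. g (Suc k))"
  shows "\<exists>B. \<forall>n f. 1-lipschitz_on UNIV f \<longrightarrow>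
    \<bar>E (%w. f (\<Sum>i=1..n. Xs (int i) w)) - gsmooth (sqrt (real n) * \<sigma>) f 0\<bar> <= B"
proof (rule pr.profile_bound[where C = 2560 and g = g, OF sequence _ g_bound _ assms])
  show "\<bar>\<gamma> N r - g r\<bar> <= 2560 * pr.R2 N" if "1 <= N" for N r
    using covariance_error[OF that, of r] pr.nonneg(4)[of N] by linarith
qed simp_all

end

section \<open>Normal approximation in the Wasserstein distance\<close>

text \<open>Layer cake with the zero function in place of the quantile.\<close>

lemma (in prob_space) tail_quantile_zero_AE:
  fixes Z :: "'a => real"
  assumes Z[measurable]: "Z \<in> borel_measurable M" and Z0: "\<And>w. 0 <= Z w"
    and q: "\<And>u. 0 < u ==> u < 1 ==> tail_quantile M Z u <= 0"
  shows "AE w in M. Z w = 0"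
proof -
  have c: "(\<integral>\<^sup>+x. 1 * indicator {0..z} x \<partial>lborel) = ennreal z" for z :: real
    by (simp add: emeasure_lborel_Icc_eq ennreal_neg)
  have "(\<integral>\<^sup>+w. (\<integral>\<^sup>+x. 1 * indicator {0..Z w} x \<partial>lborel) \<partial>M)
      <= (\<integral>\<^sup>+u\<in>{0<..<1 :: real}. (\<integral>\<^sup>+x. 1 * indicator {0..(0 :: real)} x \<partial>lborel) \<partial>lborel)"
  proof (rule layer_cake_le[where v = "%_. 1" and q = "%_. 0"])
    show "x <= 0" if "0 < u" "u < 1" "u < measure M {w\<in>space M. x <= Z w}" for u x
      using order_trans[OF tail_quantile_ge[OF Z Z0 that] q[OF that(1,2)]] .
  qed measurable
  then have "(\<integral>\<^sup>+w. ennreal (Z w) \<partial>M) = 0" unfolding c by simp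
  then have "AE w in M. ennreal (Z w) = 0" by (subst (asm) nn_integral_0_iff_AE) auto
  then show ?thesis
  proof eventually_elim
    case (elim w)
    then show ?case using Z0[of w] by simp
  qed
qed

lemma wasserstein1_normal_le:
  assumes Y: "distributed N lborel Y std_normal_density"
    and B: "\<And>f. 1-lipschitz_on UNIV f ==> \<bar>(\<integral>w. f (U w) \<partial>M) - gsmooth s f 0\<bar> <= B"
  shows "wasserstein1 M U N (%w. s * Y w) <= ereal B"
  unfolding wasserstein1_def
proof (rule SUP_least)
  fix f :: "real => real" assume "f \<in> {f. 1-lipschitz_on UNIV f}"
  then have f: "1-lipschitz_on UNIV f" by simp
  have "f \<in> borel_measurable borel"
    by (intro borel_measurable_continuous_onI lipschitz_on_continuous_on[OF f])
  then have m: "(%y. f (s * y)) \<in> borel_measurable lborel" by measurable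
  have "(\<integral>w. f (s * Y w) \<partial>N) = (\<integral>y. std_normal_density y * f (s * y) \<partial>lborel)"
    by (rule distributed_integral[OF Y m, symmetric]) simp
  also have "... = gsmooth s f 0"
    unfolding gsmooth_def using m by (subst integral_density) auto
  finally show "ereal ((\<integral>w. f (U w) \<partial>M) - (\<integral>w. f (s * Y w) \<partial>N)) <= ereal B"
    using B[OF f] by simp
qed

theorem theorem3p1:
  fixes M M0 :: "'a measure" and T :: "'a \<Rightarrow> 'a" and X0 :: "'a \<Rightarrow> real"
    and N :: "'b measure" and Y :: "'b \<Rightarrow> real"
  assumes "prob_space M"
    and "mp_automorphism M T"
    and "subalgebra M M0"
    and "sets M0 \<subseteq> sets (sigma_at M T M0 1)"
    and "X0 \<in> borel_measurable M0"
    and "integrable M X0" and "(\<integral>\<omega>. X0 \<omega> \<partial>M) = 0"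
    and "prob_space N" and "distributed N lborel Y std_normal_density"
    and a_or_b:
      "(integrable M (\<lambda>\<omega>. X0 \<omega> ^ 4) \<and>
        (\<forall>p q :: nat. p < q \<and> q \<le> min (3 + p) 4 \<longrightarrow>
           (\<Sum>j. of_nat (Suc j) * theta_coeff M T M0 X0 p q (Suc j)) < \<infinity>))
       \<or>
       (\<exists>(\<xi>0 :: 'a \<Rightarrow> real) (f1 :: real \<Rightarrow> real) (f2 :: real \<Rightarrow> real).
          \<xi>0 \<in> borel_measurable M0 \<and> mono f1 \<and> mono f2 \<and>
          (AE \<omega> in M. X0 \<omega> = f1 (\<xi>0 \<omega>) - f2 (\<xi>0 \<omega>)) \<and>
          integrable M (\<lambda>\<omega>. \<bar>f1 (\<xi>0 \<omega>)\<bar> ^ 3) \<and>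
          integrable M (\<lambda>\<omega>. \<bar>f2 (\<xi>0 \<omega>)\<bar> ^ 3) \<and>
          (\<Sum>j. of_nat (Suc j) *
             (\<integral>\<^sup>+u\<in>{u. 0 < u \<and> ennreal u < alpha_coeff M T M0 \<xi>0 3 (Suc j)}.
                ennreal (max (tail_quantile M (\<lambda>\<omega>. \<bar>f1 (\<xi>0 \<omega>)\<bar>) u)
                             (tail_quantile M (\<lambda>\<omega>. \<bar>f2 (\<xi>0 \<omega>)\<bar>) u) ^ 3) \<partial>lborel)) < \<infinity>)"
  shows "summable (\<lambda>k. \<bar>\<integral>\<omega>. X0 \<omega> * shifted M T X0 (int (Suc k)) \<omega> \<partial>M\<bar>) \<and>
    (\<forall>\<sigma>>0. \<sigma>\<^sup>2 = (\<integral>\<omega>. (X0 \<omega>)\<^sup>2 \<partial>M)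
                 + 2 * (\<Sum>k. \<integral>\<omega>. X0 \<omega> * shifted M T X0 (int (Suc k)) \<omega> \<partial>M) \<longrightarrow>
       (\<exists>C :: real. \<forall>n\<ge>1.
          wasserstein1 M (partial_sum M T X0 n) N (\<lambda>\<omega>. sqrt (real n) * \<sigma> * Y \<omega>) \<le> ereal C))"
proof -
  interpret automorphism M T M0
    using assms(1-4) by (intro automorphism.intro automorphism_axioms.intro)
  define g where "g k = E (%w. X0 w * shifted M T X0 (int k) w)" for k
  have X0M[measurable]: "X0 \<in> borel_measurable M" by (rule M0_M[OF assms(5)])
  let ?rep = "%\<sigma>. \<exists>B. \<forall>n f. 1-lipschitz_on UNIV f \<longrightarrow>
    \<bar>E (%w. f (\<Sum>i=1..n. shifted M T X0 (int i) w)) - gsmooth (sqrt (real n) * \<sigma>) f 0\<bar> <= B"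
  have "summable (%k. real (Suc k) * \<bar>g k\<bar>) \<and> (\<forall>\<sigma>>0. \<sigma>\<^sup>2 = g 0 + 2 * (\<Sum>k. g (Suc k)) \<longrightarrow> ?rep \<sigma>)"
    using a_or_b
  proof (elim disjE exE conjE)
    assume a: "integrable M (%w. X0 w ^ 4)" "\<forall>p q :: nat. p < q \<and> q <= min (3 + p) 4 \<longrightarrow>
           (\<Sum>j. of_nat (Suc j) * theta_coeff M T M0 X0 p q (Suc j)) < \<infinity>"
    interpret fm: fourth_moment M T M0 X0
      by standard (use a assms(5,7) in auto)
    show ?thesis using fm.covariances_summable fm.replacement unfolding fm.g_def g_def by blast
  next
    fix \<xi>0 f1 f2
    assume b: "\<xi>0 \<in> borel_measurable M0" "mono f1" "mono f2"
      "AE w in M. X0 w = f1 (\<xi>0 w) - f2 (\<xi>0 w)"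
      "integrable M (%w. \<bar>f1 (\<xi>0 w)\<bar> ^ 3)" "integrable M (%w. \<bar>f2 (\<xi>0 w)\<bar> ^ 3)"
      and sum: "(\<Sum>j. of_nat (Suc j) *
             (\<integral>\<^sup>+u\<in>{u. 0 < u \<and> ennreal u < alpha_coeff M T M0 \<xi>0 3 (Suc j)}.
                ennreal (max (tail_quantile M (%w. \<bar>f1 (\<xi>0 w)\<bar>) u)
                             (tail_quantile M (%w. \<bar>f2 (\<xi>0 w)\<bar>) u) ^ 3) \<partial>lborel)) < \<infinity>"
    show ?thesis
    proof (cases "\<exists>u>0. u < 1 \<and> 0 < max (tail_quantile M (%w. \<bar>f1 (\<xi>0 w)\<bar>) u) (tail_quantile M (%w. \<bar>f2 (\<xi>0 w)\<bar>) u)")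
      case True
      define h where "h c = (if c then f1 else f2)" for c
      interpret md: monotone_difference M T M0 \<xi>0 h X0
        by standard (use b assms(5-7) sum True in \<open>auto simp: h_def\<close>)
      show ?thesis using md.covariances_summable md.replacement unfolding md.g_def g_def by blast
    next
      case False
      then have q0: "tail_quantile M (%w. \<bar>f1 (\<xi>0 w)\<bar>) u <= 0" "tail_quantile M (%w. \<bar>f2 (\<xi>0 w)\<bar>) u <= 0"
        if "0 < u" "u < 1" for u using that by (meson less_max_iff_disj not_le)+
      note [measurable] = borel_measurable_mono[OF b(2)] borel_measurable_mono[OF b(3)] M0_M[OF b(1)]
      have "AE w in M. \<bar>f1 (\<xi>0 w)\<bar> = 0" by (rule tail_quantile_zero_AE) (use q0 in auto)
      moreover have "AE w in M. \<bar>f2 (\<xi>0 w)\<bar> = 0" by (rule tail_quantile_zero_AE) (use q0 in auto)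
      ultimately have X: "AE w in M. X0 w = 0" using b(4) by eventually_elim simp
      have "g k = 0" for k
      proof -
        have "AE w in M. X0 w * shifted M T X0 (int k) w = 0" using X by eventually_elim simp
        then show ?thesis unfolding g_def by (rule integral_eq_zero_AE)
      qed
      then show ?thesis by simp
    qed
  qed
  then have gs: "summable (%k. real (Suc k) * \<bar>g k\<bar>)"
    and rep: "\<And>\<sigma>. 0 < \<sigma> ==> \<sigma>\<^sup>2 = g 0 + 2 * (\<Sum>k. g (Suc k)) ==> ?rep \<sigma>" by blast+
  show ?thesis
  proof (intro conjI allI impI)
    have "summable (%k. real (Suc (Suc k)) * \<bar>g (Suc k)\<bar>)" using gs by (subst (asm) summable_Suc_iff[symmetric])
    then have "summable (%k. \<bar>g (Suc k)\<bar>)"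
    proof (rule summable_comparison_test'[of _ 0])
      fix k :: nat
      have "1 * \<bar>g (Suc k)\<bar> <= real (Suc (Suc k)) * \<bar>g (Suc k)\<bar>" by (intro mult_right_mono) auto
      then show "norm \<bar>g (Suc k)\<bar> <= real (Suc (Suc k)) * \<bar>g (Suc k)\<bar>" by simp
    qed
    then show "summable (%k. \<bar>\<integral>w. X0 w * shifted M T X0 (int (Suc k)) w \<partial>M\<bar>)" unfolding g_def .
  next
    fix \<sigma> :: real
    assume \<sigma>: "0 < \<sigma>" "\<sigma>\<^sup>2 = (\<integral>w. (X0 w)\<^sup>2 \<partial>M)
                 + 2 * (\<Sum>k. \<integral>w. X0 w * shifted M T X0 (int (Suc k)) w \<partial>M)"
    have "\<sigma>\<^sup>2 = g 0 + 2 * (\<Sum>k. g (Suc k))" unfolding \<sigma>(2) g_def using shifted_0[of X0] by (simp add: power2_eq_square)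
    from rep[OF \<sigma>(1) this] obtain B where B: "\<And>n f. 1-lipschitz_on UNIV f ==>
      \<bar>E (%w. f (partial_sum M T X0 n w)) - gsmooth (sqrt (real n) * \<sigma>) f 0\<bar> <= B"
      unfolding partial_sum_def by blast
    have "wasserstein1 M (partial_sum M T X0 n) N (%w. sqrt (real n) * \<sigma> * Y w) <= ereal B" for n
      by (rule wasserstein1_normal_le[OF assms(9) B])
    then show "\<exists>C :: real. \<forall>n\<ge>1. wasserstein1 M (partial_sum M T X0 n) N (%w. sqrt (real n) * \<sigma> * Y w) <= ereal C" by blast
  qed
qed

end
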